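(* Let $\mathfrak d$ be a real vector space of dimension $n$, and let $\Delta\subset\mathfrak d^*$ be a simple convex polytope of dimension $n$ with $d$ facets. Choose inward-pointing normals $X_1,\ldots,X_d\in\mathfrak d$ to the facets of $\Delta$, so that $\Delta=\bigcap_{j=1}^d\{\mu\in\mathfrak d^*\mid\langle\mu,X_j\rangle\ge\lambda_j\}$ with $\lambda_j\in\mathbb R$, and let $Q\subset\mathfrak d$ be a quasilattice containing these vectors. Then the mapping $$\chi:\Psi^{-1}(0)/N\longrightarrow\mathbb C^d_\Delta/N_{\mathbb C},$$ which sends the $N$-orbit of a point of $\Psi^{-1}(0)\subset\mathbb C^d_\Delta$ to its $N_{\mathbb C}$-orbit, is an equivariant diffeomorphism of quasifolds (equivariant with respect to the actions of the quasitori $\mathfrak d/Q$ and $\mathfrak d_{\mathbb C}/Q$). Moreover the induced symplectic form on the complex quasifold $\mathbb C^d_\Delta/N_{\mathbb C}$ (the pullback via $\chi^{-1}$ of the symplectic form of $\Psi^{-1}(0)/N$) is Kähler.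
   Context: **Polytope data.** A polytope of dimension $n$ is simple if exactly $n$ edges stem from each vertex. A quasilattice in $\mathfrak d$ is the $\mathbb Z$-span of a set of vectors spanning $\mathfrak d$. Put $\mathfrak d_{\mathbb C}=\mathfrak d+i\mathfrak d$. The quotients $\mathfrak d/Q$ and $\mathfrak d_{\mathbb C}/Q$ are called a quasitorus and a complex quasitorus. Let $\pi:\mathbb R^d\to\mathfrak d$, $e_j\mapsto X_j$, with complexification $\pi_{\mathbb C}:\mathbb C^d\to\mathfrak d_{\mathbb C}$. These induce homomorphisms $\Pi:T^d=\mathbb R^d/\mathbb Z^d\to\mathfrak d/Q$ and $\Pi_{\mathbb C}:T^d_{\mathbb C}=\mathbb C^d/\mathbb Z^d\to\mathfrak d_{\mathbb C}/Q$, with kernels $N=\ker\Pi$ and $N_{\mathbb C}=\ker\Pi_{\mathbb C}$; let $\mathfrak n=\ker\pi$ (the Lie algebra of $N$) and $\iota:\mathfrak n\to\mathbb R^d$ the inclusion. $T^d_{\mathbb C}$ acts on $\mathbb C^d$ by $[Z]\cdot\underline z=(e^{2\pi iZ_1}z_1,\ldots,e^{2\pi iZ_d}z_d)$. For a nonempty face $F$ of $\Delta$ (including $\Delta$ itself), let $I_F$ be the set of indices $j$ with $\langle\mu,X_j\rangle=\lambda_j$ on $F$; $\mathbb C^d_F=\{\underline z\in\mathbb C^d\mid z_j=0\text{ iff }j\in I_F\}$ and $\mathbb C^d_\Delta=\bigcup_F\mathbb C^d_F$. Let $J:\mathbb C^d\to(\mathbb R^d)^*$, $J(\underline z)=\sum_{j=1}^d(|z_j|^2+\lambda_j)e_j^*$,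 and $\Psi=\iota^*\circ J:\mathbb C^d\to\mathfrak n^*$. One has $\Psi^{-1}(0)\subset\mathbb C^d_\Delta$. The group $\mathfrak d/Q\cong T^d/N$ acts on $\Psi^{-1}(0)/N$ and $\mathfrak d_{\mathbb C}/Q\cong T^d_{\mathbb C}/N_{\mathbb C}$ acts on $\mathbb C^d_\Delta/N_{\mathbb C}$, both induced by the standard action on $\mathbb C^d$; equivariance of $\chi$ means $\chi(t\cdot x)=t\cdot\chi(x)$ for $t\in\mathfrak d/Q\subset\mathfrak d_{\mathbb C}/Q$. **Models and quasifolds.** A (complex, resp. real) model is a triple $(\tilde V/\Gamma,p,\tilde V)$, with $\tilde V$ a connected, simply connected complex (resp. smooth) manifold, $\Gamma$ a discrete group acting holomorphically (resp. smoothly) on $\tilde V$ so that the set of points where the action is free is connected and dense, $\tilde V/\Gamma$ with the quotient topology, and $p$ the projection. If $\tilde V$ is not simply connected, one replaces it by its universal cover $\varpi:V^\#\to\tilde V$ and $\Gamma$ by $\Lambda=\{\lambda\in\mathrm{Diff}(V^\#)\mid\exists\gamma\in\Gamma\ \forall u:\varpi(\lambda(u))=\gamma\cdot\varpi(u)\}$, so $\tilde V/\Gamma=V^\#/\Lambda$. An open $W\subset\tilde V/\Gamma$ is a submodel if $(W,p,p^{-1}(W))$ is a model in this sense. A map of models is holomorphic (smooth) if it has a holomorphic (smooth) lift between the covering manifolds, commuting with the projections; it is a biholomorphism (diffeomorphism) of models if it is bijective and a lift is a biholomorphism (diffeomorphism). A complex (real) quasifold is a topological space $M$ with a maximal atlas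 of charts $(V_\alpha,\phi_\alpha,\tilde V_\alpha/\Gamma_\alpha)$, where the $V_\alpha$ are open and cover $M$, $\tilde V_\alpha/\Gamma_\alpha$ is a model with $\tilde V_\alpha$ open, connected and simply connected in $\mathbb C^k$ (resp. $\mathbb R^k$), $\phi_\alpha:\tilde V_\alpha/\Gamma_\alpha\to V_\alpha$ is a homeomorphism, and for $V_\alpha\cap V_\beta\neq\emptyset$ the sets $\phi_\alpha^{-1}(V_\alpha\cap V_\beta)$, $\phi_\beta^{-1}(V_\alpha\cap V_\beta)$ are submodels with $\phi_\beta^{-1}\circ\phi_\alpha$ a biholomorphism (diffeomorphism) of models. A complex quasifold of dimension $k$ is in particular a real quasifold of dimension $2k$. A continuous map $f:M\to M'$ of real quasifolds is smooth if around each $m\in M$ and around $f(m)$ there are charts $(V,\phi,\tilde V/\Gamma)$, $(W,\psi,\tilde W/\Delta')$ and a smooth map of models $f_m:\tilde V/\Gamma\to\tilde W/\Delta'$ with $\psi\circ f_m=f\circ\phi$; it is a diffeomorphism if it is bijective and each $f_m$ can be taken to be a diffeomorphism of models. **Forms.** A differential form on a model $\tilde V/\Gamma$ is a $\Gamma$-invariant differential form on $\tilde V$. A differential form on a quasifold is the assignment, for a family of charts covering it, of a form $\omega_\alpha$ on each model $\tilde V_\alpha/\Gamma_\alpha$, such that the changes of charts pull $\omega_\beta$ back to $\omega_\alpha$ (computed via lifts). It is symplectic if each form on $\tilde V_\alpha$ is symplectic and Kähler if each form on $\tilde V_\alpha$ is Kähler. Forms are pulled back under diffeomorphisms of quasifolds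 by pulling back via local lifts. Sign convention: a closed real $(1,1)$-form $\omega$ is Kähler if $\omega(\mathcal J\cdot,\cdot)$ is positive definite, $\mathcal J$ being the complex structure; with this convention the standard form $\omega_0=\frac1{2\pi i}\sum_j dz_j\wedge d\bar z_j$ on $\mathbb C^d$ is Kähler. **The two quasifold structures.** For a vertex $\mu$ of $\Delta$ let $I=I_\mu=\{r_1,\ldots,r_n\}$, let $\tilde V_\mu=\prod_{j\in I}\mathbb Ce_j\cong\mathbb C^n$, let $S^\mu_{\mathbb C}=\{[Z]\in T^d_{\mathbb C}\mid Z_j\in\mathbb Z\text{ for }j\notin I\}$, and let $\Gamma_\mu=N_{\mathbb C}\cap S^\mu_{\mathbb C}$ (a discrete group, equal to $N\cap S^\mu_{\mathbb C}$) act on $\tilde V_\mu$ by the standard action. Let $\hat V_\mu=\{\underline z\in\mathbb C^d\mid z_j\ne0\text{ for }j\notin I\}$ and $\underline z^\mu\in\mathbb C^d$ with $z^\mu_j=0$ for $j\in I$, $z^\mu_j=1$ for $j\notin I$. Complex structure: $\mathbb C^d_\Delta/N_{\mathbb C}$ is the complex quasifold of dimension $n$ whose atlas is generated by the charts $V_\mu=\hat V_\mu/N_{\mathbb C}$, $\phi_\mu:\tilde V_\mu/\Gamma_\mu\to V_\mu$, $[\underline z]\mapsto[\underline z^\mu+\underline z]$, with $\mu$ ranging over the vertices. Symplectic structure: write $X_h=\sum_{j=1}^na_{jh}X_{r_j}$ for $h=1,\dots,d$, and let $\tilde U_\mu=\{\underline w\in\tilde V_\mu\mid\sum_{j=1}^na_{jh}(|w_{r_j}|^2+\lambda_{r_j})-\lambda_h>0\text{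 for all }h\notin I\}$, which is $\Gamma_\mu$-invariant. For $\underline w\in\tilde U_\mu$ let $\underline w^\mu\in\mathbb C^d$ have components $w^\mu_h=0$ for $h\in I$ and $w^\mu_h=\sqrt{\sum_{j=1}^na_{jh}(|w_{r_j}|^2+\lambda_{r_j})-\lambda_h}$ for $h\notin I$. The quotient $\Psi^{-1}(0)/N$ is the real quasifold of dimension $2n$ whose atlas is generated by the charts $U_\mu=(\hat V_\mu\cap\Psi^{-1}(0))/N$, $\psi_\mu:\tilde U_\mu/\Gamma_\mu\to U_\mu$, $[\underline w]\mapsto[\underline w^\mu+\underline w]$, with $\mu$ ranging over the vertices. Its symplectic form is the one induced by $\omega_0$: its lift to $\tilde U_\mu$ is the pullback of $\omega_0$ under $\underline w\mapsto\underline w+\underline w^\mu$, i.e. $\frac1{2\pi i}\sum_{j\in I}dw_j\wedge d\bar w_j$. *)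

theory Defs
  imports
    "HOL-Analysis.Analysis"
    "HOL-Algebra.Bij"
    "HOL-Computational_Algebra.Group_Closure"
begin

section \<open>Smooth and holomorphic maps between open sets\<close>

fun Ck_on :: "nat \<Rightarrow> 'e::real_normed_vector set \<Rightarrow> ('e \<Rightarrow> 'f::real_normed_vector) \<Rightarrow> bool" where
  "Ck_on 0 S f \<longleftrightarrow> continuous_on S f"
| "Ck_on (Suc k) S f \<longleftrightarrow>
     (\<forall>x\<in>S. f differentiable (at x)) \<and>
     (\<forall>v. Ck_on k S (\<lambda>x. frechet_derivative f (at x) v))"

definition smooth_on :: "'e::real_normed_vector set \<Rightarrow> ('e \<Rightarrow> 'f::real_normed_vector) \<Rightarrow> bool" where
  "smooth_on S f \<longleftrightarrow> (\<forall>k. Ck_on k S f)"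

definition holomorphic_map_on :: "(complex^'n) set \<Rightarrow> (complex^'n \<Rightarrow> complex^'m) \<Rightarrow> bool" where
  "holomorphic_map_on S f \<longleftrightarrow>
     (\<forall>x\<in>S. \<exists>L. (f has_derivative L) (at x) \<and> (\<forall>c v. L (c *s v) = c *s L v))"


section \<open>Models\<close>

text \<open>
  The manifolds that occur are open subsets of a Euclidean space \<open>'e\<close> and covering spaces of
  such sets. Both are given as a set \<open>C\<close> with a local homeomorphism \<open>p\<close> from \<open>C\<close> into \<open>'e\<close>, which
  is the identity in the first case and the covering projection in the second; the smooth or
  complex structure of \<open>C\<close> is the one whose charts are the local restrictions of \<open>p\<close>.
  \<open>local_section C p x T s\<close> says that \<open>s\<close>, defined on the open set \<open>T\<close>, is the inverse of such a
  restriction near \<open>x\<close>.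
  The argument \<open>reg\<close> of the definitions below is \<open>smooth_on\<close> or \<open>holomorphic_map_on\<close>.
\<close>

definition local_section ::
    "'c::topological_space set \<Rightarrow> ('c \<Rightarrow> 'e::euclidean_space) \<Rightarrow> 'c \<Rightarrow> 'e set \<Rightarrow> ('e \<Rightarrow> 'c) \<Rightarrow> bool" where
  "local_section C p x T s \<longleftrightarrow>
     open T \<and> (\<exists>O'. openin (top_of_set C) O' \<and> x \<in> O' \<and> homeomorphism O' T p s)"

definition manifold_map ::
    "('e::euclidean_space set \<Rightarrow> ('e \<Rightarrow> 'f::euclidean_space) \<Rightarrow> bool) \<Rightarrow>
     'c::topological_space set \<Rightarrow> ('c \<Rightarrow> 'e) \<Rightarrow> 'b::topological_space set \<Rightarrow> ('b \<Rightarrow> 'f) \<Rightarrow>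
     ('c \<Rightarrow> 'b) \<Rightarrow> bool" where
  "manifold_map reg C p D q F \<longleftrightarrow>
     F ` C \<subseteq> D \<and> continuous_on C F \<and>
     (\<forall>x\<in>C. \<exists>T s. local_section C p x T s \<and> reg T (q \<circ> F \<circ> s))"

definition manifold_iso ::
    "('e::euclidean_space set \<Rightarrow> ('e \<Rightarrow> 'e) \<Rightarrow> bool) \<Rightarrow>
     'c::topological_space set \<Rightarrow> ('c \<Rightarrow> 'e) \<Rightarrow> 'b::topological_space set \<Rightarrow> ('b \<Rightarrow> 'e) \<Rightarrow>
     ('c \<Rightarrow> 'b) \<Rightarrow> bool" where
  "manifold_iso reg C p D q F \<longleftrightarrow>
     bij_betw F C D \<and> manifold_map reg C p D q F \<and> manifold_map reg D q C p (inv_into C F)"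

text \<open>
  An action with a free point is faithful, so the group of a model is given as a group of
  bijections of the manifold.
\<close>

definition group_orbit :: "('c \<Rightarrow> 'c) set \<Rightarrow> 'c \<Rightarrow> 'c set" where
  "group_orbit \<Gamma> x = (\<lambda>g. g x) ` \<Gamma>"

definition free_points :: "'c set \<Rightarrow> ('c \<Rightarrow> 'c) set \<Rightarrow> 'c set" where
  "free_points C \<Gamma> = {x \<in> C. \<forall>g\<in>\<Gamma>. g x = x \<longrightarrow> g = (\<lambda>y\<in>C. y)}"

definition is_model ::
    "('e::euclidean_space set \<Rightarrow> ('e \<Rightarrow> 'e) \<Rightarrow> bool) \<Rightarrow>
     'c::euclidean_space set \<Rightarrow> ('c \<Rightarrow> 'e) \<Rightarrow> ('c \<Rightarrow> 'c) set \<Rightarrow> bool" where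
  "is_model reg C p \<Gamma> \<longleftrightarrow>
     C \<noteq> {} \<and> connected C \<and> simply_connected C \<and>
     subgroup \<Gamma> (BijGroup C) \<and> (\<forall>g\<in>\<Gamma>. manifold_map reg C p C p g) \<and>
     connected (free_points C \<Gamma>) \<and> C \<subseteq> closure (free_points C \<Gamma>)"

definition quotient_topology :: "'c topology \<Rightarrow> ('c \<Rightarrow> 'q) \<Rightarrow> 'q topology" where
  "quotient_topology Y f =
     topology (\<lambda>W. W \<subseteq> f ` topspace Y \<and> openin Y {x \<in> topspace Y. f x \<in> W})"

text \<open>
  \<open>f\<close> is a diffeomorphism (biholomorphism) from the model with manifold \<open>(C, p)\<close> and projection
  \<open>a\<close> onto the model with manifold \<open>(D, q)\<close> and projection \<open>b\<close>, and \<open>F\<close> is a lift witnessing this.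
\<close>

definition model_iso_lift ::
    "('e::euclidean_space set \<Rightarrow> ('e \<Rightarrow> 'e) \<Rightarrow> bool) \<Rightarrow>
     'c::topological_space set \<Rightarrow> ('c \<Rightarrow> 'e) \<Rightarrow> ('c \<Rightarrow> 'q) \<Rightarrow>
     'b::topological_space set \<Rightarrow> ('b \<Rightarrow> 'e) \<Rightarrow> ('b \<Rightarrow> 'r) \<Rightarrow>
     ('q \<Rightarrow> 'r) \<Rightarrow> ('c \<Rightarrow> 'b) \<Rightarrow> bool" where
  "model_iso_lift reg C p a D q b f F \<longleftrightarrow>
     bij_betw f (a ` C) (b ` D) \<and> manifold_iso reg C p D q F \<and> (\<forall>x\<in>C. b (F x) = f (a x))"


section \<open>Quasifolds\<close>

record ('e, 'm) quasi_chart =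
  chart_dom :: "'e set"
  chart_group :: "('e \<Rightarrow> 'e) set"
  chart_map :: "'e set \<Rightarrow> 'm"

definition chart_orbits :: "('e, 'm) quasi_chart \<Rightarrow> 'e set set" where
  "chart_orbits c = group_orbit (chart_group c) ` chart_dom c"

definition chart_image :: "('e, 'm) quasi_chart \<Rightarrow> 'm set" where
  "chart_image c = chart_map c ` chart_orbits c"

definition chart_topology :: "('e::topological_space, 'm) quasi_chart \<Rightarrow> 'e set topology" where
  "chart_topology c = quotient_topology (top_of_set (chart_dom c)) (group_orbit (chart_group c))"

definition is_chart ::
    "('e::euclidean_space set \<Rightarrow> ('e \<Rightarrow> 'e) \<Rightarrow> bool) \<Rightarrow> 'm topology \<Rightarrow> ('e, 'm) quasi_chart \<Rightarrow> bool" where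
  "is_chart reg M c \<longleftrightarrow>
     openin M (chart_image c) \<and>
     open (chart_dom c) \<and> is_model reg (chart_dom c) id (chart_group c) \<and>
     homeomorphic_map (chart_topology c) (subtopology M (chart_image c)) (chart_map c)"

text \<open>The group \<open>\<Lambda>\<close> of all lifts of elements of \<open>\<Gamma>\<close> to the universal cover \<open>\<rho>\<close>.\<close>

definition cover_group ::
    "'c::topological_space set \<Rightarrow> ('c \<Rightarrow> 'e::euclidean_space) \<Rightarrow> ('e \<Rightarrow> 'e) set \<Rightarrow> ('c \<Rightarrow> 'c) set" where
  "cover_group C \<rho> \<Gamma> =
     {l \<in> Bij C. manifold_iso smooth_on C \<rho> C \<rho> l \<and> (\<exists>g\<in>\<Gamma>. \<forall>u\<in>C. \<rho> (l u) = g (\<rho> u))}"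

text \<open>
  The open set \<open>W\<close> of orbits is a submodel of the chart \<open>c\<close>, with universal cover \<open>\<rho> : C \<rightarrow> p\<^sup>-\<^sup>1(W)\<close>.
  The universal cover of a connected open subset of the \<open>k\<close>-dimensional space \<open>'e\<close> is a
  \<open>k\<close>-manifold, which embeds in \<open>2k\<close>-dimensional space by Whitney's theorem; hence taking \<open>C\<close> to be
  a subset of \<open>'e \<times> 'e\<close> is no restriction. If \<open>p\<^sup>-\<^sup>1(W)\<close> is simply connected then \<open>\<rho>\<close> is a
  homeomorphism and \<open>\<Lambda>\<close> is just \<open>\<Gamma>\<close>.
\<close>

definition submodel_cover ::
    "('e::euclidean_space set \<Rightarrow> ('e \<Rightarrow> 'e) \<Rightarrow> bool) \<Rightarrow> ('e, 'm) quasi_chart \<Rightarrow> 'e set set \<Rightarrow>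
     ('e \<times> 'e) set \<Rightarrow> ('e \<times> 'e \<Rightarrow> 'e) \<Rightarrow> bool" where
  "submodel_cover reg c W C \<rho> \<longleftrightarrow>
     openin (chart_topology c) W \<and>
     covering_space C \<rho> {x \<in> chart_dom c. group_orbit (chart_group c) x \<in> W} \<and>
     is_model reg C \<rho> (cover_group C \<rho> (chart_group c))"

definition chart_overlap :: "('e, 'm) quasi_chart \<Rightarrow> ('e, 'm) quasi_chart \<Rightarrow> 'e set set" where
  "chart_overlap c c' = {w \<in> chart_orbits c. chart_map c w \<in> chart_image c'}"

definition chart_change ::
    "('e, 'm) quasi_chart \<Rightarrow> ('e, 'm) quasi_chart \<Rightarrow> 'e set \<Rightarrow> 'e set" where
  "chart_change c c' = inv_into (chart_orbits c') (chart_map c') \<circ> chart_map c"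

definition chart_change_lift ::
    "('e::euclidean_space set \<Rightarrow> ('e \<Rightarrow> 'e) \<Rightarrow> bool) \<Rightarrow>
     ('e, 'm) quasi_chart \<Rightarrow> ('e \<times> 'e) set \<Rightarrow> ('e \<times> 'e \<Rightarrow> 'e) \<Rightarrow>
     ('e, 'm) quasi_chart \<Rightarrow> ('e \<times> 'e) set \<Rightarrow> ('e \<times> 'e \<Rightarrow> 'e) \<Rightarrow>
     ('e \<times> 'e \<Rightarrow> 'e \<times> 'e) \<Rightarrow> bool" where
  "chart_change_lift reg c C \<rho> c' C' \<rho>' F \<longleftrightarrow>
     submodel_cover reg c (chart_overlap c c') C \<rho> \<and>
     submodel_cover reg c' (chart_overlap c' c) C' \<rho>' \<and>
     model_iso_lift reg C \<rho> (group_orbit (chart_group c) \<circ> \<rho>)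
                        C' \<rho>' (group_orbit (chart_group c') \<circ> \<rho>') (chart_change c c') F"

definition charts_compatible ::
    "('e::euclidean_space set \<Rightarrow> ('e \<Rightarrow> 'e) \<Rightarrow> bool) \<Rightarrow>
     ('e, 'm) quasi_chart \<Rightarrow> ('e, 'm) quasi_chart \<Rightarrow> bool" where
  "charts_compatible reg c c' \<longleftrightarrow>
     (chart_image c \<inter> chart_image c' \<noteq> {} \<longrightarrow>
       (\<exists>C \<rho> C' \<rho>' F. chart_change_lift reg c C \<rho> c' C' \<rho>' F))"

definition quasifold_atlas ::
    "('e::euclidean_space set \<Rightarrow> ('e \<Rightarrow> 'e) \<Rightarrow> bool) \<Rightarrow> 'm topology \<Rightarrow>
     ('e, 'm) quasi_chart set \<Rightarrow> bool" where
  "quasifold_atlas reg M \<A> \<longleftrightarrow>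
     (\<forall>c\<in>\<A>. is_chart reg M c) \<and> (\<Union>c\<in>\<A>. chart_image c) = topspace M \<and>
     (\<forall>c\<in>\<A>. \<forall>c'\<in>\<A>. charts_compatible reg c c')"

definition quasifold ::
    "('e::euclidean_space set \<Rightarrow> ('e \<Rightarrow> 'e) \<Rightarrow> bool) \<Rightarrow> 'm topology \<Rightarrow>
     ('e, 'm) quasi_chart set \<Rightarrow> bool" where
  "quasifold reg M \<A> \<longleftrightarrow>
     quasifold_atlas reg M \<A> \<and> (\<forall>\<B>. quasifold_atlas reg M \<B> \<and> \<A> \<subseteq> \<B> \<longrightarrow> \<B> = \<A>)"

text \<open>\<open>F\<close> lifts a diffeomorphism \<open>h\<close> of the models of \<open>c\<close> and \<open>c'\<close> which represents \<open>f\<close>.\<close>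

definition diffeo_chart_lift ::
    "('e::euclidean_space, 'm) quasi_chart \<Rightarrow> ('e, 'k) quasi_chart \<Rightarrow> ('m \<Rightarrow> 'k) \<Rightarrow> ('e \<Rightarrow> 'e) \<Rightarrow> bool"
  where
  "diffeo_chart_lift c c' f F \<longleftrightarrow>
     (\<exists>h. model_iso_lift smooth_on
            (chart_dom c) id (group_orbit (chart_group c))
            (chart_dom c') id (group_orbit (chart_group c')) h F \<and>
          (\<forall>w\<in>chart_orbits c. chart_map c' (h w) = f (chart_map c w)))"

definition quasifold_diffeo ::
    "'m topology \<Rightarrow> ('e::euclidean_space, 'm) quasi_chart set \<Rightarrow>
     'k topology \<Rightarrow> ('e, 'k) quasi_chart set \<Rightarrow> ('m \<Rightarrow> 'k) \<Rightarrow> bool" where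
  "quasifold_diffeo M \<A> M' \<A>' f \<longleftrightarrow>
     quasifold smooth_on M \<A> \<and> quasifold smooth_on M' \<A>' \<and>
     continuous_map M M' f \<and> bij_betw f (topspace M) (topspace M') \<and>
     (\<forall>m\<in>topspace M. \<exists>c\<in>\<A>. \<exists>c'\<in>\<A>'. m \<in> chart_image c \<and> f m \<in> chart_image c' \<and>
        (\<exists>F. diffeo_chart_lift c c' f F))"


section \<open>Two-forms\<close>

type_synonym 'e two_form = "'e \<Rightarrow> 'e \<Rightarrow> 'e \<Rightarrow> real"

definition two_form_on :: "'e::euclidean_space set \<Rightarrow> 'e two_form \<Rightarrow> bool" where
  "two_form_on S \<omega> \<longleftrightarrow>
     (\<forall>x\<in>S. bilinear (\<omega> x) \<and> (\<forall>v. \<omega> x v v = 0)) \<and>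
     (\<forall>u v. smooth_on S (\<lambda>x. \<omega> x u v))"

definition closed_two_form_on :: "'e::euclidean_space set \<Rightarrow> 'e two_form \<Rightarrow> bool" where
  "closed_two_form_on S \<omega> \<longleftrightarrow>
     (\<forall>x\<in>S. \<forall>u v w.
        frechet_derivative (\<lambda>y. \<omega> y v w) (at x) u
        - frechet_derivative (\<lambda>y. \<omega> y u w) (at x) v
        + frechet_derivative (\<lambda>y. \<omega> y u v) (at x) w = 0)"

definition symplectic_on :: "'e::euclidean_space set \<Rightarrow> 'e two_form \<Rightarrow> bool" where
  "symplectic_on S \<omega> \<longleftrightarrow>
     two_form_on S \<omega> \<and> closed_two_form_on S \<omega> \<and>
     (\<forall>x\<in>S. \<forall>u. (\<forall>v. \<omega> x u v = 0) \<longrightarrow> u = 0)"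

definition kahler_on :: "(complex^'n) set \<Rightarrow> (complex^'n) two_form \<Rightarrow> bool" where
  "kahler_on S \<omega> \<longleftrightarrow>
     two_form_on S \<omega> \<and> closed_two_form_on S \<omega> \<and>
     (\<forall>x\<in>S. (\<forall>u v. \<omega> x (\<i> *s u) (\<i> *s v) = \<omega> x u v) \<and>
            (\<forall>u. u \<noteq> 0 \<longrightarrow> \<omega> x (\<i> *s u) u > 0))"

text \<open>
  The pullback of \<open>\<omega>'\<close> under \<open>F\<close> is \<open>\<omega>\<close>, where the forms on the manifolds \<open>(C, p)\<close> and \<open>(D, q)\<close> are
  those induced by the forms \<open>\<omega>\<close> and \<open>\<omega>'\<close> on \<open>p ` C\<close> and \<open>q ` D\<close>.
\<close>

definition pulls_back ::
    "'c::topological_space set \<Rightarrow> ('c \<Rightarrow> 'e::euclidean_space) \<Rightarrow>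
     ('b \<Rightarrow> 'e) \<Rightarrow> ('c \<Rightarrow> 'b) \<Rightarrow> 'e two_form \<Rightarrow> 'e two_form \<Rightarrow> bool" where
  "pulls_back C p q F \<omega>' \<omega> \<longleftrightarrow>
     (\<forall>x\<in>C. \<exists>T s. local_section C p x T s \<and>
        (\<forall>u v. \<omega> (p x) u v =
           \<omega>' (q (F x)) (frechet_derivative (q \<circ> F \<circ> s) (at (p x)) u)
                        (frechet_derivative (q \<circ> F \<circ> s) (at (p x)) v)))"

definition quasifold_two_form ::
    "('e::euclidean_space set \<Rightarrow> ('e \<Rightarrow> 'e) \<Rightarrow> bool) \<Rightarrow> 'm topology \<Rightarrow>
     ('e, 'm) quasi_chart set \<Rightarrow> (('e, 'm) quasi_chart \<Rightarrow> 'e two_form) \<Rightarrow> bool" where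
  "quasifold_two_form reg M \<C> \<omega> \<longleftrightarrow>
     quasifold_atlas reg M \<C> \<and>
     (\<forall>c\<in>\<C>. two_form_on (chart_dom c) (\<omega> c) \<and>
        (\<forall>g\<in>chart_group c. pulls_back (chart_dom c) id id g (\<omega> c) (\<omega> c))) \<and>
     (\<forall>c\<in>\<C>. \<forall>c'\<in>\<C>. chart_image c \<inter> chart_image c' \<noteq> {} \<longrightarrow>
        (\<exists>C \<rho> C' \<rho>' F. chart_change_lift reg c C \<rho> c' C' \<rho>' F \<and>
           pulls_back C \<rho> \<rho>' F (\<omega> c') (\<omega> c)))"

definition symplectic_form ::
    "'m topology \<Rightarrow> ('e::euclidean_space, 'm) quasi_chart set \<Rightarrow>
     (('e, 'm) quasi_chart \<Rightarrow> 'e two_form) \<Rightarrow> bool" where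
  "symplectic_form M \<C> \<omega> \<longleftrightarrow>
     quasifold_two_form smooth_on M \<C> \<omega> \<and> (\<forall>c\<in>\<C>. symplectic_on (chart_dom c) (\<omega> c))"

definition kahler_form ::
    "'m topology \<Rightarrow> (complex^'n, 'm) quasi_chart set \<Rightarrow>
     ((complex^'n, 'm) quasi_chart \<Rightarrow> (complex^'n) two_form) \<Rightarrow> bool" where
  "kahler_form M \<C> \<omega> \<longleftrightarrow>
     quasifold_two_form holomorphic_map_on M \<C> \<omega> \<and> (\<forall>c\<in>\<C>. kahler_on (chart_dom c) (\<omega> c))"

text \<open>\<open>(\<C>, \<omega>)\<close> is the pullback of the form \<open>(\<C>', \<omega>')\<close> under the diffeomorphism \<open>f\<close>.\<close>

definition is_pullback_form ::
    "('e::euclidean_space, 'm) quasi_chart set \<Rightarrow> (('e, 'm) quasi_chart \<Rightarrow> 'e two_form) \<Rightarrow>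
     ('e, 'k) quasi_chart set \<Rightarrow> (('e, 'k) quasi_chart \<Rightarrow> 'e two_form) \<Rightarrow> ('m \<Rightarrow> 'k) \<Rightarrow> bool" where
  "is_pullback_form \<C> \<omega> \<C>' \<omega>' f \<longleftrightarrow>
     (\<forall>c\<in>\<C>. \<forall>m\<in>chart_image c. \<exists>c'\<in>\<C>'. f m \<in> chart_image c' \<and>
        (\<exists>F. diffeo_chart_lift c c' f F \<and> pulls_back (chart_dom c) id id F (\<omega>' c') (\<omega> c)))"


section \<open>Polytope data\<close>

text \<open>
  The space \<open>\<dd>\<close> is a Euclidean space \<open>'a\<close>; its dual is identified with \<open>'a\<close> by the inner product,
  so that \<open>\<langle>\<mu>, Y\<rangle>\<close> is \<open>\<mu> \<bullet> Y\<close>. The complexification \<open>\<dd> + i\<dd>\<close> is \<open>'a \<times> 'a\<close>, with \<open>Q\<close> embedded in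
  the first factor.
\<close>

definition simple_polytope :: "'a::euclidean_space set \<Rightarrow> bool" where
  "simple_polytope P \<longleftrightarrow>
     polytope P \<and>
     (\<forall>v. v extreme_point_of P \<longrightarrow> int (card {E. E edge_of P \<and> v \<in> E}) = aff_dim P)"

definition quasilattice :: "'a::euclidean_space set \<Rightarrow> bool" where
  "quasilattice Q \<longleftrightarrow> (\<exists>B. span B = UNIV \<and> Q = group_closure B)"

definition face_index :: "('d \<Rightarrow> 'a::euclidean_space) \<Rightarrow> ('d \<Rightarrow> real) \<Rightarrow> 'a set \<Rightarrow> 'd set" where
  "face_index X lam F = {j. \<forall>\<mu>\<in>F. \<mu> \<bullet> X j = lam j}"

definition stratum :: "'d set \<Rightarrow> (complex^'d) set" where
  "stratum I = {z. \<forall>j. z $ j = 0 \<longleftrightarrow> j \<in> I}"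

definition C_Delta ::
    "'a::euclidean_space set \<Rightarrow> ('d::finite \<Rightarrow> 'a) \<Rightarrow> ('d \<Rightarrow> real) \<Rightarrow> (complex^'d) set" where
  "C_Delta \<Delta> X lam = (\<Union>F\<in>{F. F face_of \<Delta> \<and> F \<noteq> {}}. stratum (face_index X lam F))"

definition pi_map :: "('d::finite \<Rightarrow> 'a::euclidean_space) \<Rightarrow> real^'d \<Rightarrow> 'a" where
  "pi_map X x = (\<Sum>j\<in>UNIV. (x $ j) *\<^sub>R X j)"

definition piC_map :: "('d::finite \<Rightarrow> 'a::euclidean_space) \<Rightarrow> complex^'d \<Rightarrow> 'a \<times> 'a" where
  "piC_map X Z = (pi_map X (\<chi> j. Re (Z $ j)), pi_map X (\<chi> j. Im (Z $ j)))"

definition QC :: "'a::euclidean_space set \<Rightarrow> ('a \<times> 'a) set" where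
  "QC Q = (\<lambda>q. (q, 0)) ` Q"

definition complex_vec :: "real^'d \<Rightarrow> complex^'d" where
  "complex_vec x = (\<chi> j. complex_of_real (x $ j))"

text \<open>
  The class \<open>[Z]\<close> in the complex torus \<open>\<complex>\<^sup>d/\<int>\<^sup>d\<close>; the real torus is the set of classes of real vectors.
\<close>

definition torus_class :: "complex^'d \<Rightarrow> (complex^'d) set" where
  "torus_class Z = {Z'. \<forall>j. Z' $ j - Z $ j \<in> \<int>}"

definition N_group :: "('d::finite \<Rightarrow> 'a::euclidean_space) \<Rightarrow> 'a set \<Rightarrow> (complex^'d) set set" where
  "N_group X Q = {torus_class (complex_vec x) | x. pi_map X x \<in> Q}"

definition NC_group :: "('d::finite \<Rightarrow> 'a::euclidean_space) \<Rightarrow> 'a set \<Rightarrow> (complex^'d) set set" where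
  "NC_group X Q = {torus_class Z | Z. piC_map X Z \<in> QC Q}"

definition torus_act :: "complex^'d \<Rightarrow> complex^'d \<Rightarrow> complex^'d" where
  "torus_act Z z = (\<chi> j. exp (2 * complex_of_real pi * \<i> * Z $ j) * z $ j)"

definition torus_orbit :: "(complex^'d) set set \<Rightarrow> complex^'d \<Rightarrow> (complex^'d) set" where
  "torus_orbit H z = {torus_act Z z | Z. torus_class Z \<in> H}"

definition n_space :: "('d::finite \<Rightarrow> 'a::euclidean_space) \<Rightarrow> (real^'d) set" where
  "n_space X = {x. pi_map X x = 0}"

definition J_map :: "('d::finite \<Rightarrow> real) \<Rightarrow> complex^'d \<Rightarrow> real^'d \<Rightarrow> real" where
  "J_map lam z = (\<lambda>x. \<Sum>j\<in>UNIV. ((cmod (z $ j))\<^sup>2 + lam j) * x $ j)"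

text \<open>Elements of the dual of \<open>\<nn>\<close> are functions restricted to \<open>\<nn>\<close>, and \<open>\<iota>\<^sup>*\<close> is restriction.\<close>

definition Psi_map ::
    "('d::finite \<Rightarrow> 'a::euclidean_space) \<Rightarrow> ('d \<Rightarrow> real) \<Rightarrow> complex^'d \<Rightarrow> real^'d \<Rightarrow> real" where
  "Psi_map X lam z = restrict (J_map lam z) (n_space X)"

definition Psi_zero ::
    "('d::finite \<Rightarrow> 'a::euclidean_space) \<Rightarrow> ('d \<Rightarrow> real) \<Rightarrow> (complex^'d) set" where
  "Psi_zero X lam = {z. Psi_map X lam z = (\<lambda>x\<in>n_space X. 0)}"

definition symplectic_quotient ::
    "('d::finite \<Rightarrow> 'a::euclidean_space) \<Rightarrow> ('d \<Rightarrow> real) \<Rightarrow> 'a set \<Rightarrow> (complex^'d) set topology" where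
  "symplectic_quotient X lam Q =
     quotient_topology (top_of_set (Psi_zero X lam)) (torus_orbit (N_group X Q))"

definition complex_quotient ::
    "'a::euclidean_space set \<Rightarrow> ('d::finite \<Rightarrow> 'a) \<Rightarrow> ('d \<Rightarrow> real) \<Rightarrow> 'a set \<Rightarrow>
     (complex^'d) set topology" where
  "complex_quotient \<Delta> X lam Q =
     quotient_topology (top_of_set (C_Delta \<Delta> X lam)) (torus_orbit (NC_group X Q))"

definition chi_map ::
    "('d::finite \<Rightarrow> 'a::euclidean_space) \<Rightarrow> 'a set \<Rightarrow> (complex^'d) set \<Rightarrow> (complex^'d) set" where
  "chi_map X Q orb = the_elem (torus_orbit (NC_group X Q) ` orb)"


section \<open>The quasitorus actions\<close>

definition quasitorus :: "'a::euclidean_space set \<Rightarrow> 'a set set" where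
  "quasitorus Q = range (\<lambda>Y. (\<lambda>q. Y + q) ` Q)"

definition quasitorus_incl :: "'a::euclidean_space set \<Rightarrow> ('a \<times> 'a) set" where
  "quasitorus_incl t = (\<lambda>Y. (Y, 0)) ` t"

text \<open>
  The element \<open>t\<close> of \<open>\<dd>/Q\<close> corresponds to the coset of \<open>N\<close> formed by all \<open>[x]\<close> in the torus with
  \<open>\<Pi>([x]) = t\<close>, and it sends the orbit \<open>N \<cdot> z\<close> to the set of all \<open>[x] \<cdot> z'\<close> with \<open>[x]\<close> in that coset and
  \<open>z'\<close> in \<open>N \<cdot> z\<close>; similarly in the complex case.
\<close>

definition quasitorus_act ::
    "('d::finite \<Rightarrow> 'a::euclidean_space) \<Rightarrow> 'a set \<Rightarrow> (complex^'d) set \<Rightarrow> (complex^'d) set" where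
  "quasitorus_act X t orb = {torus_act (complex_vec x) z | x z. pi_map X x \<in> t \<and> z \<in> orb}"

definition complex_quasitorus_act ::
    "('d::finite \<Rightarrow> 'a::euclidean_space) \<Rightarrow> ('a \<times> 'a) set \<Rightarrow> (complex^'d) set \<Rightarrow> (complex^'d) set" where
  "complex_quasitorus_act X t orb = {torus_act Z z | Z z. piC_map X Z \<in> t \<and> z \<in> orb}"


section \<open>The charts\<close>

text \<open>
  An injective enumeration \<open>r\<close> of the index set \<open>I = range r\<close> of a vertex identifies \<open>\<complex>\<^sup>n\<close> with the
  coordinate subspace of \<open>\<complex>\<^sup>d\<close> given by the coordinates in \<open>I\<close>.
\<close>

definition embed_coords :: "('n::finite \<Rightarrow> 'd::finite) \<Rightarrow> complex^'n \<Rightarrow> complex^'d" where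
  "embed_coords r w = (\<chi> j. if j \<in> range r then w $ (inv_into UNIV r j) else 0)"

definition select_coords :: "('n::finite \<Rightarrow> 'd::finite) \<Rightarrow> complex^'d \<Rightarrow> complex^'n" where
  "select_coords r z = (\<chi> k. z $ r k)"

definition SC_group :: "'d set \<Rightarrow> (complex^'d) set set" where
  "SC_group I = {torus_class Z | Z. \<forall>j. j \<notin> I \<longrightarrow> Z $ j \<in> \<int>}"

definition Gamma_group ::
    "('d::finite \<Rightarrow> 'a::euclidean_space) \<Rightarrow> 'a set \<Rightarrow> ('n::finite \<Rightarrow> 'd) \<Rightarrow> (complex^'n) set \<Rightarrow>
     (complex^'n \<Rightarrow> complex^'n) set" where
  "Gamma_group X Q r V =
     {restrict (\<lambda>w. select_coords r (torus_act Z (embed_coords r w))) V | Z.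
        torus_class Z \<in> NC_group X Q \<inter> SC_group (range r)}"

definition vertex_enums ::
    "'a::euclidean_space set \<Rightarrow> ('d \<Rightarrow> 'a) \<Rightarrow> ('d \<Rightarrow> real) \<Rightarrow> ('n::finite \<Rightarrow> 'd) set" where
  "vertex_enums \<Delta> X lam =
     {r. \<exists>\<mu>. \<mu> extreme_point_of \<Delta> \<and> bij_betw r UNIV (face_index X lam {\<mu>})}"

definition z_vertex :: "'d set \<Rightarrow> complex^'d" where
  "z_vertex I = (\<chi> j. if j \<in> I then 0 else 1)"

definition complex_chart ::
    "('d::finite \<Rightarrow> 'a::euclidean_space) \<Rightarrow> 'a set \<Rightarrow> ('n::finite \<Rightarrow> 'd) \<Rightarrow>
     (complex^'n, (complex^'d) set) quasi_chart" where
  "complex_chart X Q r =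
     \<lparr>chart_dom = UNIV,
      chart_group = Gamma_group X Q r UNIV,
      chart_map = (\<lambda>orb. the_elem
        ((\<lambda>w. torus_orbit (NC_group X Q) (z_vertex (range r) + embed_coords r w)) ` orb))\<rparr>"

text \<open>
  The coefficient \<open>a\<^sub>j\<^sub>h\<close> of \<open>X\<^sub>j\<close> in the expansion of \<open>X\<^sub>h\<close> in the basis formed by the \<open>X\<^sub>i\<close>, \<open>i \<in> I\<close>, is
  \<open>representation (X ` I) (X h) (X j)\<close>.
\<close>

definition slack ::
    "('d::finite \<Rightarrow> 'a::euclidean_space) \<Rightarrow> ('d \<Rightarrow> real) \<Rightarrow> 'd set \<Rightarrow> complex^'d \<Rightarrow> 'd \<Rightarrow> real" where
  "slack X lam I w h =
     (\<Sum>j\<in>I. representation (X ` I) (X h) (X j) * ((cmod (w $ j))\<^sup>2 + lam j)) - lam h"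

definition w_vertex ::
    "('d::finite \<Rightarrow> 'a::euclidean_space) \<Rightarrow> ('d \<Rightarrow> real) \<Rightarrow> 'd set \<Rightarrow> complex^'d \<Rightarrow> complex^'d" where
  "w_vertex X lam I w = (\<chi> h. if h \<in> I then 0 else complex_of_real (sqrt (slack X lam I w h)))"

definition U_tilde ::
    "('d::finite \<Rightarrow> 'a::euclidean_space) \<Rightarrow> ('d \<Rightarrow> real) \<Rightarrow> ('n::finite \<Rightarrow> 'd) \<Rightarrow> (complex^'n) set" where
  "U_tilde X lam r = {w. \<forall>h. h \<notin> range r \<longrightarrow> slack X lam (range r) (embed_coords r w) h > 0}"

definition symplectic_chart ::
    "('d::finite \<Rightarrow> 'a::euclidean_space) \<Rightarrow> ('d \<Rightarrow> real) \<Rightarrow> 'a set \<Rightarrow> ('n::finite \<Rightarrow> 'd) \<Rightarrow>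
     (complex^'n, (complex^'d) set) quasi_chart" where
  "symplectic_chart X lam Q r =
     \<lparr>chart_dom = U_tilde X lam r,
      chart_group = Gamma_group X Q r (U_tilde X lam r),
      chart_map = (\<lambda>orb. the_elem
        ((\<lambda>w. torus_orbit (N_group X Q)
           (w_vertex X lam (range r) (embed_coords r w) + embed_coords r w)) ` orb))\<rparr>"

definition complex_charts ::
    "'a::euclidean_space set \<Rightarrow> ('d::finite \<Rightarrow> 'a) \<Rightarrow> ('d \<Rightarrow> real) \<Rightarrow> 'a set \<Rightarrow>
     (complex^'n::finite, (complex^'d) set) quasi_chart set" where
  "complex_charts \<Delta> X lam Q = complex_chart X Q ` vertex_enums \<Delta> X lam"

definition symplectic_charts ::
    "'a::euclidean_space set \<Rightarrow> ('d::finite \<Rightarrow> 'a) \<Rightarrow> ('d \<Rightarrow> real) \<Rightarrow> 'a set \<Rightarrow>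
     (complex^'n::finite, (complex^'d) set) quasi_chart set" where
  "symplectic_charts \<Delta> X lam Q = symplectic_chart X lam Q ` vertex_enums \<Delta> X lam"

text \<open>
  The form \<open>(1/2\<pi>i) \<Sum> dw\<^sub>k \<and> d\<bar>w\<^sub>k\<close>, evaluated with \<open>(\<alpha> \<and> \<beta>)(u, v) = \<alpha>(u) \<beta>(v) - \<alpha>(v) \<beta>(u)\<close>. The
  sum is purely imaginary, so taking the real part only changes the type.
\<close>

definition standard_form :: "(complex^'n) two_form" where
  "standard_form x u v =
     Re (1 / (2 * complex_of_real pi * \<i>) *
         (\<Sum>k\<in>UNIV. u $ k * cnj (v $ k) - v $ k * cnj (u $ k)))"

end

theory Submission
  imports Defs
begin

text \<open>
  Both quotients are glued from slices: over a vertex with index set \<open>I\<close> every orbit meets the set of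
  points whose coordinates outside \<open>I\<close> are normalised (equal to 1, respectively positive), and simplicity
  makes the normals \<open>X\<^sub>j\<close>, \<open>j \<in> I\<close>, a basis, so that an element of \<open>\<nn>\<close> is determined by its coordinates
  outside \<open>I\<close>. Passing to logarithms of the coordinates in \<open>I - I'\<close> gives the universal cover of an
  overlap and turns the chart changes into explicit formulas.

  An \<open>N\<^sub>\<complex>\<close>-orbit in \<open>\<complex>\<^sup>d\<^sub>\<Delta>\<close> meets the zero level of \<open>\<Psi>\<close> in one \<open>N\<close>-orbit, since the zero level consists of
  the critical points of a strictly convex and proper function along \<open>\<nn>\<close>. In the charts of a vertex \<open>\<chi>\<close>
  lifts to \<open>F\<^sub>k(w) = w\<^sub>k \<Prod>\<^sub>h slack\<^sub>h(w)\<^bsup>a\<^sub>k\<^sub>h/2\<^esup>\<close>, whose derivative is a complex diagonal matrix times \<open>1 + T\<close>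
  with \<open>T\<close> symmetric, positive semidefinite and \<open>T \<i> T = 0\<close>; this makes \<open>F\<close> a diffeomorphism and the
  transported form Kaehler.
\<close>

section \<open>Calculus of smooth maps\<close>

subsection \<open>Derivatives\<close>

lemma linear_sum_Basis:
  fixes L :: "'e::euclidean_space \<Rightarrow> 'f::real_vector"
  assumes "linear L"
  shows "L x = (\<Sum>b\<in>Basis. (x \<bullet> b) *\<^sub>R L b)"
proof -
  have "L x = L (\<Sum>b\<in>Basis. (x \<bullet> b) *\<^sub>R b)" by (simp add: euclidean_representation)
  then show ?thesis by (simp add: linear_sum[OF assms] linear_cmul[OF assms])
qed

lemma bounded_linear_axis: "bounded_linear (axis k :: 'f::euclidean_space \<Rightarrow> 'f^'n)"
  by (auto simp: linear_conv_bounded_linear[symmetric] axis_def vec_eq_iff intro!: linearI)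

lemma sum_axis_nth: "(\<Sum>k\<in>UNIV. axis k (x $ k)) = (x :: 'f::euclidean_space^'n)"
  by (simp add: vec_eq_iff axis_def)

lemma has_derivative_vec:
  fixes f :: "'e::real_normed_vector \<Rightarrow> 'f::euclidean_space^'m"
  assumes "\<And>k. ((\<lambda>x. f x $ k) has_derivative L k) F"
  shows "(f has_derivative (\<lambda>v. \<chi> k. L k v)) F"
proof -
  have "((\<lambda>x. \<Sum>k\<in>UNIV. axis k (f x $ k)) has_derivative (\<lambda>v. \<Sum>k\<in>UNIV. axis k ((\<chi> k. L k v) $ k))) F"
    using assms by (intro has_derivative_sum bounded_linear.has_derivative[OF bounded_linear_axis]) simp
  then show ?thesis unfolding sum_axis_nth .
qed

lemma has_derivative_vec_nth:
  "(f has_derivative D) F \<Longrightarrow> ((\<lambda>x. f x $ k) has_derivative (\<lambda>u. D u $ k)) F"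
  by (rule bounded_linear.has_derivative[OF bounded_linear_vec_nth])

lemma has_derivative_unique_open:
  assumes "(f has_derivative D) (at x)" "(g has_derivative E) (at x)"
    and "open T" "x \<in> T" "\<And>w. w \<in> T \<Longrightarrow> f w = g w"
  shows "D = E"
  using has_derivative_unique[OF has_derivative_transform_within_open[OF assms(1,3,4,5)] assms(2)] .

lemma has_derivative_frechet_derivative:
  "f differentiable (at x) \<Longrightarrow> (f has_derivative frechet_derivative f (at x)) (at x)"
  by (simp add: frechet_derivative_works)

lemma frechet_derivative_cong_open:
  assumes "open S" "x \<in> S" "\<And>x. x \<in> S \<Longrightarrow> f x = g x"
  shows "frechet_derivative f (at x) = frechet_derivative g (at x)"
proof -
  have "(f has_derivative D) (at x) \<longleftrightarrow> (g has_derivative D) (at x)" for D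
    using has_derivative_transform_within_open[of f D x UNIV S g]
      has_derivative_transform_within_open[of g D x UNIV S f] assms by auto
  then show ?thesis by (simp add: frechet_derivative_def)
qed

lemma frechet_derivative_inner_left:
  assumes "f differentiable (at x)"
  shows "frechet_derivative (\<lambda>y. f y \<bullet> b) (at x) u = frechet_derivative f (at x) u \<bullet> b"
proof -
  have "((\<lambda>y. f y \<bullet> b) has_derivative (\<lambda>u. frechet_derivative f (at x) u \<bullet> b)) (at x)"
    using has_derivative_frechet_derivative[OF assms] by (rule has_derivative_inner_left)
  then show ?thesis by (simp add: frechet_derivative_at[symmetric])
qed

lemma has_real_derivative_along_line:
  fixes f :: "'e::real_normed_vector \<Rightarrow> real"
  assumes "f differentiable (at (x + s *\<^sub>R u))"
  shows "((\<lambda>s. f (x + s *\<^sub>R u)) has_real_derivative frechet_derivative f (at (x + s *\<^sub>R u)) u) (at s)"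
proof -
  let ?D = "frechet_derivative f (at (x + s *\<^sub>R u))"
  have derivative: "(f has_derivative ?D) (at (x + s *\<^sub>R u))"
    by (rule has_derivative_frechet_derivative[OF assms])
  have "((\<lambda>s. x + s *\<^sub>R u) has_derivative (\<lambda>a. a *\<^sub>R u)) (at s)"
    by (auto intro!: derivative_eq_intros)
  from diff_chain_at[OF this derivative]
  have "((\<lambda>s. f (x + s *\<^sub>R u)) has_derivative (\<lambda>a. ?D (a *\<^sub>R u))) (at s)" by (simp add: o_def)
  moreover have "(\<lambda>a. ?D (a *\<^sub>R u)) = (*) (?D u)"
    using linear_cmul[OF has_derivative_linear[OF derivative]] by (simp add: fun_eq_iff)
  ultimately show ?thesis by (simp add: has_field_derivative_def)
qed

lemma has_derivative_exp_of_real: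
  assumes "(f has_derivative D) (at x)"
  shows "((\<lambda>x. exp (a * complex_of_real (f x))) has_derivative
     (\<lambda>u. exp (a * complex_of_real (f x)) * (a * complex_of_real (D u)))) (at x)"
proof -
  have "((\<lambda>x. a * complex_of_real (f x)) has_derivative (\<lambda>u. a * complex_of_real (D u))) (at x)"
    by (intro has_derivative_mult_right bounded_linear.has_derivative[OF bounded_linear_of_real] assms)
  from diff_chain_at[OF this DERIV_exp[unfolded has_field_derivative_def]] show ?thesis
    by (simp add: o_def)
qed

lemma has_derivative_cmod_squared:
  assumes "(z has_derivative D) (at x)"
  shows "((\<lambda>x. (cmod (z x))\<^sup>2) has_derivative (\<lambda>u. 2 * Re (cnj (z x) * D u))) (at x)"
proof -
  have Re: "((\<lambda>x. Re (z x)) has_derivative (\<lambda>u. Re (D u))) (at x)"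
    by (rule bounded_linear.has_derivative[OF bounded_linear_Re assms])
  have Im: "((\<lambda>x. Im (z x)) has_derivative (\<lambda>u. Im (D u))) (at x)"
    by (rule bounded_linear.has_derivative[OF bounded_linear_Im assms])
  have "((\<lambda>x. Re (z x) * Re (z x) + Im (z x) * Im (z x)) has_derivative
      (\<lambda>u. 2 * Re (cnj (z x) * D u))) (at x)"
    by (rule has_derivative_eq_rhs[OF has_derivative_add[OF
          has_derivative_mult[OF Re Re] has_derivative_mult[OF Im Im]]])
       (auto simp: algebra_simps)
  then show ?thesis unfolding cmod_power2 unfolding power2_eq_square .
qed

lemma has_derivative_scaleR_vanishing:
  fixes \<phi> :: "'e::real_normed_vector \<Rightarrow> real" and \<psi> :: "'e \<Rightarrow> 'f::real_normed_vector"
  assumes derivative: "(\<phi> has_derivative \<phi>') (at a)" and zero: "\<phi> a = 0" and cont: "continuous (at a) \<psi>"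
  shows "((\<lambda>x. \<phi> x *\<^sub>R \<psi> x) has_derivative (\<lambda>u. \<phi>' u *\<^sub>R \<psi> a)) (at a)"
proof -
  obtain K where K: "\<And>u. norm (\<phi>' u) \<le> norm u * K"
    using bounded_linear.bounded[OF has_derivative_bounded_linear[OF derivative]] by blast
  have \<psi>_lim: "((\<lambda>h. \<psi> (a + h) - \<psi> a) \<longlongrightarrow> 0) (at 0)"
    using cont by (simp add: continuous_at LIM_offset_zero_iff LIM_zero_iff)
  have remainder_lim: "((\<lambda>h. norm (\<phi> (a + h) - \<phi>' h) / norm h) \<longlongrightarrow> 0) (at 0)"
    using derivative zero by (simp add: has_derivative_at)
  have "((\<lambda>h. (norm (\<phi> (a + h) - \<phi>' h) / norm h + K) * norm (\<psi> (a + h) - \<psi> a)) \<longlongrightarrow> (0 + K) * norm (0::'f)) (at 0)"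
    by (intro tendsto_intros remainder_lim \<psi>_lim)
  then have bound_lim: "((\<lambda>h. (norm (\<phi> (a + h) - \<phi>' h) / norm h + K) * norm (\<psi> (a + h) - \<psi> a)) \<longlongrightarrow> 0) (at 0)"
    by simp
  have "norm (norm (\<phi> (a + h) *\<^sub>R (\<psi> (a + h) - \<psi> a)) / norm h) \<le>
      (norm (\<phi> (a + h) - \<phi>' h) / norm h + K) * norm (\<psi> (a + h) - \<psi> a)" if "h \<noteq> 0" for h
  proof -
    have "\<bar>\<phi> (a + h)\<bar> \<le> \<bar>\<phi> (a + h) - \<phi>' h\<bar> + norm h * K" using K[of h] by simp
    then have "\<bar>\<phi> (a + h)\<bar> / norm h \<le> \<bar>\<phi> (a + h) - \<phi>' h\<bar> / norm h + K"
      using that by (simp add: field_simps)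
    from mult_right_mono[OF this, of "norm (\<psi> (a + h) - \<psi> a)"] show ?thesis by simp
  qed
  then have "((\<lambda>h. norm (\<phi> (a + h) *\<^sub>R (\<psi> (a + h) - \<psi> a)) / norm h) \<longlongrightarrow> 0) (at 0)"
    by (intro Lim_null_comparison[OF _ bound_lim]) (simp add: eventually_at_filter)
  then have "((\<lambda>x. \<phi> x *\<^sub>R (\<psi> x - \<psi> a)) has_derivative (\<lambda>u. 0)) (at a)"
    using zero by (simp add: has_derivative_at)
  from has_derivative_add[OF this has_derivative_scaleR_left[OF derivative, of "\<psi> a"]]
  show ?thesis by (simp add: scaleR_diff_right)
qed

subsection \<open>The classes \<open>C\<^sup>k\<close>\<close>

lemma Ck_on_cong:
  assumes "open S" "\<And>x. x \<in> S \<Longrightarrow> f x = g x" "Ck_on k S f"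
  shows "Ck_on k S g"
  using assms(2,3)
proof (induction k arbitrary: f g)
  case 0
  then show ?case using continuous_on_cong by fastforce
next
  case (Suc k)
  have "g differentiable (at x)" if "x \<in> S" for x
    using Suc.prems that \<open>open S\<close> has_derivative_transform_within_open[of f _ x UNIV S g]
    by (fastforce simp: differentiable_def)
  moreover have "Ck_on k S (\<lambda>x. frechet_derivative g (at x) v)" for v
    by (rule Suc.IH[of "\<lambda>x. frechet_derivative f (at x) v"])
       (use Suc.prems frechet_derivative_cong_open[OF \<open>open S\<close>, of _ f g] in auto)
  ultimately show ?case by simp
qed

lemma Ck_on_Suc_derivativeI:
  assumes "\<And>x. x \<in> S \<Longrightarrow> (f has_derivative f' x) (at x)"
    and "\<And>v. Ck_on k S (\<lambda>x. f' x v)" and "open S"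
  shows "Ck_on (Suc k) S f"
proof -
  have "f' x = frechet_derivative f (at x)" if "x \<in> S" for x
    using assms(1)[OF that] by (rule frechet_derivative_at)
  then have "Ck_on k S (\<lambda>x. frechet_derivative f (at x) v)" for v
    by (intro Ck_on_cong[OF assms(3) _ assms(2)[of v]]) auto
  then show ?thesis using assms(1) by (auto simp: differentiable_def)
qed

lemma Ck_on_has_derivative:
  "Ck_on (Suc k) S f \<Longrightarrow> x \<in> S \<Longrightarrow> (f has_derivative frechet_derivative f (at x)) (at x)"
  by (simp add: has_derivative_frechet_derivative)

lemma Ck_on_SucD: "Ck_on (Suc k) S f \<Longrightarrow> Ck_on k S f"
proof (induction k arbitrary: f)
  case 0
  then show ?case
    by (auto intro!: differentiable_imp_continuous_on differentiable_at_imp_differentiable_on)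
qed auto

lemma Ck_on_imp_continuous_on: "Ck_on k S f \<Longrightarrow> continuous_on S f"
  by (induction k) (auto dest: Ck_on_SucD simp del: Ck_on.simps(2))

lemma Ck_on_subset: "Ck_on k S f \<Longrightarrow> T \<subseteq> S \<Longrightarrow> Ck_on k T f"
  by (induction k arbitrary: f) (auto intro: continuous_on_subset)

lemma Ck_on_const: "open S \<Longrightarrow> Ck_on k S (\<lambda>x. c)"
proof (induction k arbitrary: c)
  case (Suc k)
  show ?case by (rule Ck_on_Suc_derivativeI[where f'="\<lambda>x v. 0"]) (use Suc in auto)
qed auto

lemma Ck_on_bounded_linear: "open S \<Longrightarrow> bounded_linear L \<Longrightarrow> Ck_on k S L"
proof (cases k)
  case 0
  then show "bounded_linear L \<Longrightarrow> ?thesis" by (simp add: linear_continuous_on)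
next
  case (Suc m)
  show "open S \<Longrightarrow> bounded_linear L \<Longrightarrow> ?thesis" unfolding Suc
    by (rule Ck_on_Suc_derivativeI[where f'="\<lambda>x. L"])
      (auto intro: Ck_on_const bounded_linear_imp_has_derivative)
qed

lemma Ck_on_linear_comp:
  assumes "open S" "bounded_linear L" "Ck_on k S f"
  shows "Ck_on k S (\<lambda>x. L (f x))"
  using assms(3)
proof (induction k arbitrary: f)
  case 0
  then show ?case using assms(2) by (simp add: bounded_linear.continuous_on)
next
  case (Suc k)
  show ?case
  proof (rule Ck_on_Suc_derivativeI[where f'="\<lambda>x v. L (frechet_derivative f (at x) v)"])
    show "((\<lambda>x. L (f x)) has_derivative (\<lambda>v. L (frechet_derivative f (at x) v))) (at x)" if "x \<in> S" for x
      by (rule bounded_linear.has_derivative[OF assms(2) Ck_on_has_derivative[OF Suc.prems that]])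
    show "Ck_on k S (\<lambda>x. L (frechet_derivative f (at x) v))" for v
      using Suc.prems by (intro Suc.IH) simp
  qed (rule assms)
qed

lemma Ck_on_add:
  assumes "open S" "Ck_on k S f" "Ck_on k S g"
  shows "Ck_on k S (\<lambda>x. f x + g x)"
  using assms(2,3)
proof (induction k arbitrary: f g)
  case 0
  then show ?case by (simp add: continuous_on_add)
next
  case (Suc k)
  show ?case
  proof (rule Ck_on_Suc_derivativeI[where
          f'="\<lambda>x v. frechet_derivative f (at x) v + frechet_derivative g (at x) v"])
    show "((\<lambda>x. f x + g x) has_derivative
        (\<lambda>v. frechet_derivative f (at x) v + frechet_derivative g (at x) v)) (at x)" if "x \<in> S" for x
      using Suc.prems that by (intro has_derivative_add Ck_on_has_derivative)
    show "Ck_on k S (\<lambda>x. frechet_derivative f (at x) v + frechet_derivative g (at x) v)" for v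
      using Suc.prems by (intro Suc.IH) simp_all
  qed (rule assms)
qed

lemma Ck_on_sum:
  assumes "open S" "\<And>i. i \<in> I \<Longrightarrow> Ck_on k S (f i)"
  shows "Ck_on k S (\<lambda>x. \<Sum>i\<in>I. f i x)"
  using assms by (induction I rule: infinite_finite_induct) (auto intro: Ck_on_const Ck_on_add)

lemma Ck_on_bilinear:
  assumes "open S" "bounded_bilinear pr" "Ck_on k S f" "Ck_on k S g"
  shows "Ck_on k S (\<lambda>x. pr (f x) (g x))"
  using assms(3,4)
proof (induction k arbitrary: f g)
  case 0
  then show ?case using assms(2) by (simp add: bounded_bilinear.continuous_on)
next
  case (Suc k)
  let ?D = "\<lambda>x v. pr (f x) (frechet_derivative g (at x) v) + pr (frechet_derivative f (at x) v) (g x)"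
  show ?case
  proof (rule Ck_on_Suc_derivativeI[where f'="?D"])
    show "((\<lambda>x. pr (f x) (g x)) has_derivative ?D x) (at x)" if "x \<in> S" for x
      using that Suc.prems by (intro bounded_bilinear.FDERIV[OF assms(2)] Ck_on_has_derivative)
    show "Ck_on k S (\<lambda>x. ?D x v)" for v
      using Suc.prems Ck_on_SucD[OF Suc.prems(1)] Ck_on_SucD[OF Suc.prems(2)]
      by (intro Ck_on_add assms(1) Suc.IH) simp_all
  qed (rule assms)
qed

lemma Ck_on_compose:
  fixes f :: "'e::real_normed_vector \<Rightarrow> 'f::euclidean_space" and g :: "'f \<Rightarrow> 'g::real_normed_vector"
  assumes "open S" "open T" "f ` S \<subseteq> T" "Ck_on k S f" "Ck_on k T g"
  shows "Ck_on k S (\<lambda>x. g (f x))"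
  using assms(4,5)
proof (induction k arbitrary: g)
  case 0
  then show ?case using assms(3) by (auto intro: continuous_on_compose2)
next
  case (Suc k)
  let ?Df = "\<lambda>x. frechet_derivative f (at x)" and ?Dg = "\<lambda>y. frechet_derivative g (at y)"
  show ?case
  proof (rule Ck_on_Suc_derivativeI[where f'="\<lambda>x v. \<Sum>b\<in>Basis. (?Df x v \<bullet> b) *\<^sub>R ?Dg (f x) b"])
    fix x assume x: "x \<in> S"
    then have fx: "f x \<in> T" using assms(3) by auto
    note Df = Ck_on_has_derivative[OF Suc.prems(1) x] and Dg = Ck_on_has_derivative[OF Suc.prems(2) fx]
    have "((\<lambda>x. g (f x)) has_derivative (\<lambda>v. ?Dg (f x) (?Df x v))) (at x)"
      using diff_chain_at[OF Df Dg] by (simp add: o_def)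
    then show "((\<lambda>x. g (f x)) has_derivative (\<lambda>v. \<Sum>b\<in>Basis. (?Df x v \<bullet> b) *\<^sub>R ?Dg (f x) b)) (at x)"
      by (rule has_derivative_eq_rhs) (intro ext linear_sum_Basis has_derivative_linear[OF Dg])
  next
    show "Ck_on k S (\<lambda>x. \<Sum>b\<in>Basis. (?Df x v \<bullet> b) *\<^sub>R ?Dg (f x) b)" for v
      using Suc.prems Ck_on_SucD[OF Suc.prems(1)] assms(1)
      by (intro Ck_on_sum Ck_on_bilinear[OF _ bounded_bilinear_scaleR]
          Ck_on_linear_comp[OF _ bounded_linear_inner_left] Suc.IH) auto
  qed (use assms in auto)
qed

lemma Ck_on_exp: "Ck_on k UNIV (exp :: 'f::{real_normed_field,banach} \<Rightarrow> 'f)"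
proof (induction k)
  case (Suc k)
  show ?case
  proof (rule Ck_on_Suc_derivativeI[where f'="\<lambda>x v. exp x * v"])
    show "(exp has_derivative (*) (exp x)) (at x)" for x :: 'f
      using DERIV_exp[of x] by (simp add: has_field_derivative_def)
    show "Ck_on k UNIV (\<lambda>x::'f. exp x * v)" for v
      by (rule Ck_on_bilinear[OF _ bounded_bilinear_mult Suc Ck_on_const]) auto
  qed auto
qed (auto intro!: continuous_intros)

lemma Ck_on_inverse: "Ck_on k (- {0}) (inverse :: 'f::real_normed_field \<Rightarrow> 'f)"
proof (induction k)
  case (Suc k)
  show ?case
  proof (rule Ck_on_Suc_derivativeI[where f'="\<lambda>x v. (inverse x * inverse x) * (- v)"])
    show "(inverse has_derivative (\<lambda>v. (inverse x * inverse x) * (- v))) (at x)" if "x \<in> - {0}" for x :: 'f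
      using that by (auto intro!: derivative_eq_intros simp: fun_eq_iff)
    show "Ck_on k (- {0}) (\<lambda>x::'f. (inverse x * inverse x) * (- v))" for v
      by (intro Ck_on_bilinear[OF _ bounded_bilinear_mult] Suc Ck_on_const) auto
  qed auto
qed (auto intro!: continuous_intros)

subsection \<open>Smooth maps\<close>

lemma smooth_onI: "(\<And>k. Ck_on k S f) \<Longrightarrow> smooth_on S f"
  by (simp add: smooth_on_def)

lemma smooth_onD: "smooth_on S f \<Longrightarrow> Ck_on k S f"
  by (simp add: smooth_on_def)

lemma smooth_on_cong:
  "open S \<Longrightarrow> (\<And>x. x \<in> S \<Longrightarrow> f x = g x) \<Longrightarrow> smooth_on S f \<Longrightarrow> smooth_on S g"
  by (auto simp: smooth_on_def intro: Ck_on_cong)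

lemma smooth_on_imp_differentiable: "smooth_on S f \<Longrightarrow> x \<in> S \<Longrightarrow> f differentiable (at x)"
  using smooth_onD[of S f 1] by simp

lemma smooth_on_has_derivative:
  "smooth_on S f \<Longrightarrow> x \<in> S \<Longrightarrow> (f has_derivative frechet_derivative f (at x)) (at x)"
  by (intro has_derivative_frechet_derivative smooth_on_imp_differentiable)

lemma smooth_on_imp_continuous_on: "smooth_on S f \<Longrightarrow> continuous_on S f"
  using smooth_onD[of S f 0] by simp

lemma smooth_on_frechet_derivative:
  "smooth_on S f \<Longrightarrow> smooth_on S (\<lambda>x. frechet_derivative f (at x) v)"
  using smooth_onD[of S f "Suc _"] by (intro smooth_onI) auto

lemma smooth_on_subset: "smooth_on S f \<Longrightarrow> T \<subseteq> S \<Longrightarrow> smooth_on T f"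
  by (auto simp: smooth_on_def intro: Ck_on_subset)

lemma smooth_on_const: "open S \<Longrightarrow> smooth_on S (\<lambda>x. c)"
  by (simp add: smooth_on_def Ck_on_const)

lemma smooth_on_bounded_linear: "open S \<Longrightarrow> bounded_linear L \<Longrightarrow> smooth_on S L"
  by (simp add: smooth_on_def Ck_on_bounded_linear)

lemma smooth_on_linear_comp:
  "open S \<Longrightarrow> bounded_linear L \<Longrightarrow> smooth_on S f \<Longrightarrow> smooth_on S (\<lambda>x. L (f x))"
  by (simp add: smooth_on_def Ck_on_linear_comp)

lemma smooth_on_add:
  "open S \<Longrightarrow> smooth_on S f \<Longrightarrow> smooth_on S g \<Longrightarrow> smooth_on S (\<lambda>x. f x + g x)"
  by (simp add: smooth_on_def Ck_on_add)

lemma smooth_on_sum: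
  "open S \<Longrightarrow> (\<And>i. i \<in> I \<Longrightarrow> smooth_on S (f i)) \<Longrightarrow> smooth_on S (\<lambda>x. \<Sum>i\<in>I. f i x)"
  by (simp add: smooth_on_def Ck_on_sum)

lemma smooth_on_bilinear:
  "open S \<Longrightarrow> bounded_bilinear pr \<Longrightarrow> smooth_on S f \<Longrightarrow> smooth_on S g \<Longrightarrow>
   smooth_on S (\<lambda>x. pr (f x) (g x))"
  by (simp add: smooth_on_def Ck_on_bilinear)

lemma smooth_on_mult:
  fixes f g :: "'e::real_normed_vector \<Rightarrow> 'f::real_normed_algebra"
  shows "open S \<Longrightarrow> smooth_on S f \<Longrightarrow> smooth_on S g \<Longrightarrow> smooth_on S (\<lambda>x. f x * g x)"
  by (rule smooth_on_bilinear[OF _ bounded_bilinear_mult])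

lemma smooth_on_compose:
  fixes f :: "'e::real_normed_vector \<Rightarrow> 'f::euclidean_space"
  shows "open S \<Longrightarrow> open T \<Longrightarrow> f ` S \<subseteq> T \<Longrightarrow> smooth_on S f \<Longrightarrow> smooth_on T g \<Longrightarrow>
   smooth_on S (\<lambda>x. g (f x))"
  using Ck_on_compose[of S T f _ g] by (simp add: smooth_on_def)

lemma smooth_on_vec:
  fixes f :: "'e::real_normed_vector \<Rightarrow> 'f::euclidean_space^'n"
  assumes "open S" "\<And>k. smooth_on S (\<lambda>x. f x $ k)"
  shows "smooth_on S f"
proof -
  have "smooth_on S (\<lambda>x. \<Sum>k\<in>UNIV. axis k (f x $ k))"
    using assms by (intro smooth_on_sum smooth_on_linear_comp[OF _ bounded_linear_axis])
  then show ?thesis by (simp add: sum_axis_nth)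
qed

lemma smooth_on_exp:
  fixes f :: "'e::real_normed_vector \<Rightarrow> 'f::{real_normed_field,banach,euclidean_space}"
  shows "open S \<Longrightarrow> smooth_on S f \<Longrightarrow> smooth_on S (\<lambda>x. exp (f x))"
  by (rule smooth_on_compose[of S UNIV f exp]) (auto intro: smooth_onI Ck_on_exp)

lemma smooth_on_antiderivative_inverse:
  fixes f :: "'f::real_normed_field \<Rightarrow> 'f"
  assumes "open S" "0 \<notin> S" "\<And>x. x \<in> S \<Longrightarrow> (f has_field_derivative inverse x) (at x)"
  shows "smooth_on S f"
proof (rule smooth_onI)
  fix k
  have "Ck_on (Suc k) S f"
  proof (rule Ck_on_Suc_derivativeI[where f'="\<lambda>x v. inverse x * v"])
    show "(f has_derivative (*) (inverse x)) (at x)" if "x \<in> S" for x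
      using assms(3)[OF that] by (simp add: has_field_derivative_def)
    have "Ck_on k S (inverse :: 'f \<Rightarrow> 'f)"
      by (rule Ck_on_subset[OF Ck_on_inverse]) (use assms in auto)
    then show "Ck_on k S (\<lambda>x. inverse x * v)" for v
      by (intro Ck_on_bilinear[OF _ bounded_bilinear_mult] Ck_on_const) (use assms in auto)
  qed (use assms in auto)
  then show "Ck_on k S f" by (rule Ck_on_SucD)
qed

lemma smooth_on_ln:
  fixes f :: "'e::real_normed_vector \<Rightarrow> real"
  assumes "open S" "smooth_on S f" "\<And>x. x \<in> S \<Longrightarrow> f x > 0"
  shows "smooth_on S (\<lambda>x. ln (f x))"
  by (rule smooth_on_compose[of S "{0<..}" f ln])
     (use assms in \<open>auto intro!: smooth_on_antiderivative_inverse derivative_eq_intros simp: field_simps\<close>)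

lemma smooth_on_Ln:
  fixes f :: "'e::real_normed_vector \<Rightarrow> complex"
  assumes "open S" "smooth_on S f" "\<And>x. x \<in> S \<Longrightarrow> f x \<notin> \<real>\<^sub>\<le>\<^sub>0"
  shows "smooth_on S (\<lambda>x. Ln (f x))"
  by (rule smooth_on_compose[of S "- \<real>\<^sub>\<le>\<^sub>0" f Ln])
     (use assms in \<open>auto intro!: smooth_on_antiderivative_inverse has_field_derivative_Ln simp: open_Compl\<close>)

lemma smooth_on_sqrt:
  fixes f :: "'e::real_normed_vector \<Rightarrow> real"
  assumes "open S" "smooth_on S f" "\<And>x. x \<in> S \<Longrightarrow> f x > 0"
  shows "smooth_on S (\<lambda>x. sqrt (f x))"
proof (rule smooth_on_cong[OF assms(1)])
  show "smooth_on S (\<lambda>x. exp ((1/2) *\<^sub>R ln (f x)))"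
    using assms
    by (intro smooth_on_exp smooth_on_linear_comp[OF _ bounded_linear_scaleR_right] smooth_on_ln) auto
  fix x assume "x \<in> S"
  then have "f x > 0" by (rule assms(3))
  then show "exp ((1/2) *\<^sub>R ln (f x)) = sqrt (f x)"
    using exp_ln[of "sqrt (f x)"] by (simp add: ln_sqrt)
qed

subsection \<open>Smoothness of inverse maps\<close>

lemma norm_linear_diff_le:
  fixes f g :: "'e::euclidean_space \<Rightarrow> 'f::real_normed_vector"
  assumes "linear f" "linear g"
  shows "norm (f u - g u) \<le> norm u * (\<Sum>b\<in>Basis. norm (f b - g b))"
proof -
  have "f u - g u = (\<Sum>b\<in>Basis. (u \<bullet> b) *\<^sub>R (f b - g b))"
    by (rule linear_sum_Basis[OF linear_compose_sub[OF assms]])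
  also have "norm \<dots> \<le> (\<Sum>b\<in>Basis. norm u * norm (f b - g b))"
    by (rule sum_norm_le) (auto intro!: mult_right_mono Basis_le_norm)
  finally show ?thesis by (simp add: sum_distrib_left)
qed

lemma linear_bounded_below_perturbation:
  fixes f g :: "'e::euclidean_space \<Rightarrow> 'f::real_normed_vector"
  assumes "linear f" "linear g" and below: "m * norm u \<le> norm (g u)"
    and close: "(\<Sum>b\<in>Basis. norm (f b - g b)) \<le> m / 2"
  shows "m / 2 * norm u \<le> norm (f u)"
proof -
  have "norm (f u - g u) \<le> norm u * (\<Sum>b\<in>Basis. norm (f b - g b))"
    by (rule norm_linear_diff_le[OF assms(1,2)])
  also have "\<dots> \<le> norm u * (m / 2)" using close by (rule mult_left_mono) simp
  finally have "norm (f u - g u) \<le> m / 2 * norm u" by (simp add: mult.commute)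
  moreover have "norm (g u) \<le> norm (f u) + norm (f u - g u)"
    using norm_triangle_sub[of "g u" "f u"] by (simp add: norm_minus_commute)
  ultimately show ?thesis using below by linarith
qed

lemma continuous_on_inverse_family:
  fixes A h :: "'p::real_normed_vector \<Rightarrow> 'e::euclidean_space \<Rightarrow> 'e"
  assumes "open S" and linear_A: "\<And>y. y \<in> S \<Longrightarrow> linear (A y)"
    and right_inv: "\<And>y v. y \<in> S \<Longrightarrow> A y (h y v) = v" and left_inv: "\<And>y v. y \<in> S \<Longrightarrow> h y (A y v) = v"
    and continuous_A: "\<And>u. continuous_on S (\<lambda>y. A y u)"
  shows "continuous_on S (\<lambda>y. h y v)"
proof -
  have "((\<lambda>y. h y v) \<longlongrightarrow> h y\<^sub>0 v) (at y\<^sub>0)" if y\<^sub>0: "y\<^sub>0 \<in> S" for y\<^sub>0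
  proof -
    have lim_A: "((\<lambda>y. A y u) \<longlongrightarrow> A y\<^sub>0 u) (at y\<^sub>0)" for u
      using continuous_A[of u] y\<^sub>0 \<open>open S\<close> by (simp add: continuous_on_eq_continuous_at continuous_at)
    obtain m where m: "m > 0" "\<And>u. m * norm u \<le> norm (A y\<^sub>0 u)"
      using linear_inj_bounded_below_pos[OF linear_A[OF y\<^sub>0]] left_inv[OF y\<^sub>0] by (metis injI mult.commute)
    have "((\<lambda>y. \<Sum>b\<in>Basis. norm (A y b - A y\<^sub>0 b)) \<longlongrightarrow> (\<Sum>b\<in>Basis. norm (A y\<^sub>0 b - A y\<^sub>0 b))) (at y\<^sub>0)"
      by (intro tendsto_intros lim_A)
    then have "\<forall>\<^sub>F y in at y\<^sub>0. (\<Sum>b\<in>Basis. norm (A y b - A y\<^sub>0 b)) < m / 2"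
      using m by (intro order_tendstoD(2)[of _ 0]) simp_all
    then have bound: "\<forall>\<^sub>F y in at y\<^sub>0. norm (h y v - h y\<^sub>0 v) \<le> 2 / m * norm (v - A y (h y\<^sub>0 v))"
      using eventually_at_in_open'[OF \<open>open S\<close> y\<^sub>0]
    proof eventually_elim
      case (elim y)
      have "m / 2 * norm (h y v - h y\<^sub>0 v) \<le> norm (A y (h y v - h y\<^sub>0 v))"
        by (rule linear_bounded_below_perturbation[OF linear_A linear_A m(2)]) (use elim y\<^sub>0 in auto)
      also have "A y (h y v - h y\<^sub>0 v) = v - A y (h y\<^sub>0 v)"
        using linear_diff[OF linear_A] right_inv elim by simp
      finally show ?case using m(1) by (simp add: field_simps)
    qed
    have "((\<lambda>y. 2 / m * norm (v - A y (h y\<^sub>0 v))) \<longlongrightarrow> 2 / m * norm (v - A y\<^sub>0 (h y\<^sub>0 v))) (at y\<^sub>0)"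
      by (intro tendsto_intros lim_A)
    then have "((\<lambda>y. 2 / m * norm (v - A y (h y\<^sub>0 v))) \<longlongrightarrow> 0) (at y\<^sub>0)" using right_inv y\<^sub>0 by simp
    from Lim_null_comparison[OF bound this] show ?thesis by (rule LIM_zero_cancel)
  qed
  then show ?thesis
    using \<open>open S\<close> by (simp add: continuous_on_eq_continuous_at continuous_at)
qed

text \<open>On \<open>S\<close> one has \<open>h\<^sub>z v = w - h\<^sub>z (A\<^sub>z w - v)\<close> for the fixed vector \<open>w = h\<^sub>y v\<close>, and \<open>A\<^sub>z w - v\<close> vanishes
  at \<open>z = y\<close>; hence continuity of \<open>h\<close> suffices.\<close>

lemma has_derivative_inverse_family:
  fixes A h :: "'p::real_normed_vector \<Rightarrow> 'e::euclidean_space \<Rightarrow> 'e"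
  assumes "open S" "y \<in> S" and linear_h: "\<And>z. z \<in> S \<Longrightarrow> linear (h z)"
    and right_inv: "\<And>z v. z \<in> S \<Longrightarrow> A z (h z v) = v" and left_inv: "\<And>z v. z \<in> S \<Longrightarrow> h z (A z v) = v"
    and continuous_h: "\<And>b. continuous (at y) (\<lambda>z. h z b)"
    and derivative_A: "((\<lambda>z. A z (h y v)) has_derivative D) (at y)"
  shows "((\<lambda>z. h z v) has_derivative (\<lambda>u. - h y (D u))) (at y)"
proof -
  define w where "w = h y v"
  have "((\<lambda>z. ((A z w - v) \<bullet> b) *\<^sub>R h z b) has_derivative (\<lambda>u. (D u \<bullet> b) *\<^sub>R h y b)) (at y)" for b
    by (rule has_derivative_scaleR_vanishing[OF _ _ continuous_h])
       (use right_inv[OF \<open>y \<in> S\<close>] derivative_A in \<open>auto simp: w_def intro!: derivative_eq_intros\<close>)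
  then have "((\<lambda>z. w - (\<Sum>b\<in>Basis. ((A z w - v) \<bullet> b) *\<^sub>R h z b)) has_derivative
      (\<lambda>u. 0 - (\<Sum>b\<in>Basis. (D u \<bullet> b) *\<^sub>R h y b))) (at y)"
    by (intro has_derivative_diff has_derivative_sum has_derivative_const)
  then have "((\<lambda>z. w - (\<Sum>b\<in>Basis. ((A z w - v) \<bullet> b) *\<^sub>R h z b)) has_derivative (\<lambda>u. - h y (D u))) (at y)"
    by (simp add: linear_sum_Basis[OF linear_h[OF \<open>y \<in> S\<close>], of "D _"])
  then show ?thesis
  proof (rule has_derivative_transform_within_open[OF _ \<open>open S\<close> \<open>y \<in> S\<close>])
    fix z assume z: "z \<in> S"
    have "(\<Sum>b\<in>Basis. ((A z w - v) \<bullet> b) *\<^sub>R h z b) = h z (A z w - v)"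
      by (rule linear_sum_Basis[OF linear_h[OF z], symmetric])
    also have "\<dots> = w - h z v" using linear_diff[OF linear_h[OF z]] left_inv[OF z] by simp
    finally show "w - (\<Sum>b\<in>Basis. ((A z w - v) \<bullet> b) *\<^sub>R h z b) = h z v" by simp
  qed
qed

lemma Ck_on_inverse_family:
  fixes A h :: "'p::real_normed_vector \<Rightarrow> 'e::euclidean_space \<Rightarrow> 'e"
  assumes "open S" and linear_A: "\<And>y. y \<in> S \<Longrightarrow> linear (A y)" and linear_h: "\<And>y. y \<in> S \<Longrightarrow> linear (h y)"
    and right_inv: "\<And>y v. y \<in> S \<Longrightarrow> A y (h y v) = v" and left_inv: "\<And>y v. y \<in> S \<Longrightarrow> h y (A y v) = v"
    and Ck_A: "\<And>u. Ck_on k S (\<lambda>y. A y u)"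
  shows "Ck_on k S (\<lambda>y. h y v)"
  using Ck_A
proof (induction k arbitrary: v)
  case 0
  then show ?case using continuous_on_inverse_family[of S A h v] assms(1-5) by simp
next
  case (Suc k)
  have Ck_h: "Ck_on k S (\<lambda>y. h y v)" for v
    by (rule Suc.IH) (rule Ck_on_SucD[OF Suc.prems])
  define D where "D c y u = frechet_derivative (\<lambda>y. A y c) (at y) u" for c y u
  have derivative_A: "((\<lambda>z. A z c) has_derivative D c y) (at y)" if "y \<in> S" for y c
    using Ck_on_has_derivative[OF Suc.prems that] unfolding D_def .
  let ?A' = "\<lambda>y u. \<Sum>c\<in>Basis. (h y v \<bullet> c) *\<^sub>R D c y u"
  have derivative_h: "((\<lambda>y. h y v) has_derivative (\<lambda>u. - h y (?A' y u))) (at y)" if y: "y \<in> S" for y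
  proof (rule has_derivative_inverse_family[OF \<open>open S\<close> y linear_h right_inv left_inv])
    show "continuous (at y) (\<lambda>z. h z b)" for b
      using Ck_on_imp_continuous_on[OF Ck_h] y \<open>open S\<close> by (simp add: continuous_on_eq_continuous_at)
    have "((\<lambda>z. \<Sum>c\<in>Basis. (h y v \<bullet> c) *\<^sub>R A z c) has_derivative ?A' y) (at y)"
      by (intro has_derivative_sum has_derivative_scaleR_right derivative_A[OF y])
    then show "((\<lambda>z. A z (h y v)) has_derivative ?A' y) (at y)"
      by (rule has_derivative_transform_within_open[OF _ \<open>open S\<close> y])
         (rule linear_sum_Basis[OF linear_A, symmetric])
  qed
  have "((\<lambda>y. h y v) has_derivative (\<lambda>u. - (\<Sum>b\<in>Basis. (?A' y u \<bullet> b) *\<^sub>R h y b))) (at y)"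
    if "y \<in> S" for y
    by (rule has_derivative_eq_rhs[OF derivative_h[OF that]])
       (intro ext arg_cong[of _ _ uminus] linear_sum_Basis linear_h that)
  then show ?case
  proof (rule Ck_on_Suc_derivativeI[OF _ _ \<open>open S\<close>])
    show "Ck_on k S (\<lambda>y. - (\<Sum>b\<in>Basis. (?A' y u \<bullet> b) *\<^sub>R h y b))" for u
      using Suc.prems
      by (intro Ck_on_linear_comp[OF \<open>open S\<close> bounded_linear_minus[OF bounded_linear_ident]]
          Ck_on_sum Ck_on_bilinear[OF _ bounded_bilinear_scaleR]
          Ck_on_linear_comp[OF _ bounded_linear_inner_left] Ck_h \<open>open S\<close>) (simp add: D_def)
  qed
qed

lemma smooth_on_inverse_function:
  fixes f g :: "'e::euclidean_space \<Rightarrow> 'e"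
  assumes "open S" "open T" and smooth: "smooth_on S f" and "f ` S \<subseteq> T" and gT: "g ` T \<subseteq> S"
    and gf: "\<And>x. x \<in> S \<Longrightarrow> g (f x) = x" and fg: "\<And>y. y \<in> T \<Longrightarrow> f (g y) = y"
    and inj: "\<And>x u. x \<in> S \<Longrightarrow> frechet_derivative f (at x) u = 0 \<Longrightarrow> u = 0"
  shows "smooth_on T g"
proof -
  define A where "A y = frechet_derivative f (at (g y))" for y
  have derivf: "(f has_derivative A y) (at (g y))" if "y \<in> T" for y
    unfolding A_def using smooth gT that by (intro smooth_on_has_derivative) auto
  have linear_A: "linear (A y)" if "y \<in> T" for y
    using derivf[OF that] by (rule has_derivative_linear)
  have "\<exists>B. linear B \<and> (\<forall>v. A y (B v) = v) \<and> (\<forall>v. B (A y v) = v)" if y: "y \<in> T" for y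
  proof -
    have "inj (A y)" unfolding linear_injective_0[OF linear_A[OF y]] using inj gT y by (auto simp: A_def)
    from linear_injective_isomorphism[OF linear_A[OF y] this] show ?thesis by blast
  qed
  then obtain h where h: "\<And>y. y \<in> T \<Longrightarrow> linear (h y)" "\<And>y v. y \<in> T \<Longrightarrow> A y (h y v) = v"
    "\<And>y v. y \<in> T \<Longrightarrow> h y (A y v) = v"
    by metis
  have derivg: "(g has_derivative h y) (at y)" if y: "y \<in> T" for y
  proof (rule has_derivative_inverse_strong_x[OF \<open>open S\<close> _ smooth_on_imp_continuous_on[OF smooth] gf derivf[OF y]])
    show "A y \<circ> h y = id" using h(2)[OF y] by auto
  qed (use y gT fg in auto)
  have "Ck_on k T g" for k
  proof (induction k)
    case 0
    show ?case
      using derivg \<open>open T\<close> by (auto simp: continuous_on_eq_continuous_at intro: has_derivative_continuous)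
  next
    case (Suc k)
    have "Ck_on k T (\<lambda>y. A y u)" for u
      unfolding A_def
      by (rule Ck_on_compose[OF \<open>open T\<close> \<open>open S\<close> gT Suc])
         (rule smooth_onD[OF smooth_on_frechet_derivative[OF smooth]])
    then have "Ck_on k T (\<lambda>y. h y v)" for v by (intro Ck_on_inverse_family[OF \<open>open T\<close> linear_A h])
    then show ?case by (intro Ck_on_Suc_derivativeI[OF derivg _ \<open>open T\<close>])
  qed
  then show ?thesis by (rule smooth_onI)
qed

subsection \<open>Symmetry of second derivatives\<close>

lemma dist_parallelogram_less:
  fixes u v x :: "'e::real_normed_vector"
  assumes "h * (norm u + norm v) < r" "0 \<le> s" "s \<le> h" "0 \<le> t" "t \<le> h"
  shows "dist (x + t *\<^sub>R v + s *\<^sub>R u) x < r"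
proof -
  have "dist (x + t *\<^sub>R v + s *\<^sub>R u) x \<le> s * norm u + t * norm v"
    using assms norm_triangle_ineq[of "s *\<^sub>R u" "t *\<^sub>R v"] by (simp add: dist_norm add_ac)
  also have "\<dots> \<le> h * norm u + h * norm v" using assms by (intro add_mono mult_right_mono) auto
  finally show ?thesis using assms(1) by (simp add: algebra_simps)
qed

lemma mixed_difference_mean_value:
  fixes f :: "'e::real_normed_vector \<Rightarrow> real"
  assumes ball: "ball x r \<subseteq> S" and small: "0 < h" "h * (norm u + norm v) < r"
    and diff: "\<And>y. y \<in> S \<Longrightarrow> f differentiable (at y)"
    and diff2: "\<And>y. y \<in> S \<Longrightarrow> (\<lambda>z. frechet_derivative f (at z) u) differentiable (at y)"
  shows "\<exists>p. dist p x < r \<and> f (x + h *\<^sub>R u + h *\<^sub>R v) - f (x + h *\<^sub>R u) - f (x + h *\<^sub>R v) + f x =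
           h * h * frechet_derivative (\<lambda>z. frechet_derivative f (at z) u) (at p) v"
proof -
  define Du where "Du y = frechet_derivative f (at y) u" for y
  note near = dist_parallelogram_less[OF small(2)]
  have in_S: "x + t *\<^sub>R v + s *\<^sub>R u \<in> S" if "0 \<le> s" "s \<le> h" "0 \<le> t" "t \<le> h" for s t
    using near[OF that] ball by (auto simp: dist_commute)
  define \<phi> where "\<phi> s = f (x + h *\<^sub>R v + s *\<^sub>R u) - f (x + 0 *\<^sub>R v + s *\<^sub>R u)" for s
  have "\<exists>s. 0 < s \<and> s < h \<and> \<phi> h - \<phi> 0 = (h - 0) * (Du (x + h *\<^sub>R v + s *\<^sub>R u) - Du (x + 0 *\<^sub>R v + s *\<^sub>R u))"
  proof (rule MVT2)
    show "(\<phi> has_real_derivative Du (x + h *\<^sub>R v + s *\<^sub>R u) - Du (x + 0 *\<^sub>R v + s *\<^sub>R u)) (at s)"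
      if "0 \<le> s" "s \<le> h" for s
      unfolding \<phi>_def Du_def using that small
      by (intro DERIV_diff has_real_derivative_along_line diff in_S) auto
  qed (use small in auto)
  then obtain s where s: "0 < s" "s < h"
    "\<phi> h - \<phi> 0 = h * (Du (x + s *\<^sub>R u + h *\<^sub>R v) - Du (x + s *\<^sub>R u + 0 *\<^sub>R v))"
    by (auto simp: add_ac)
  have "\<exists>t. 0 < t \<and> t < h \<and> Du (x + s *\<^sub>R u + h *\<^sub>R v) - Du (x + s *\<^sub>R u + 0 *\<^sub>R v) =
      (h - 0) * frechet_derivative Du (at (x + s *\<^sub>R u + t *\<^sub>R v)) v"
  proof (rule MVT2)
    fix t assume "0 \<le> t" "t \<le> h"
    then have "x + s *\<^sub>R u + t *\<^sub>R v \<in> S" using in_S[of s t] s by (simp add: add_ac)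
    then have "Du differentiable (at (x + s *\<^sub>R u + t *\<^sub>R v))" using diff2 by (simp add: Du_def[abs_def])
    then show "((\<lambda>t. Du (x + s *\<^sub>R u + t *\<^sub>R v)) has_real_derivative
        frechet_derivative Du (at (x + s *\<^sub>R u + t *\<^sub>R v)) v) (at t)"
      by (rule has_real_derivative_along_line)
  qed (use small in auto)
  then obtain t where t: "0 < t" "t < h" "Du (x + s *\<^sub>R u + h *\<^sub>R v) - Du (x + s *\<^sub>R u + 0 *\<^sub>R v) =
      h * frechet_derivative Du (at (x + s *\<^sub>R u + t *\<^sub>R v)) v" by auto
  have "f (x + h *\<^sub>R u + h *\<^sub>R v) - f (x + h *\<^sub>R u) - f (x + h *\<^sub>R v) + f x = \<phi> h - \<phi> 0"
    by (simp add: \<phi>_def add_ac)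
  also have "\<dots> = h * h * frechet_derivative Du (at (x + s *\<^sub>R u + t *\<^sub>R v)) v"
    using s(3) t(3) by simp
  finally show ?thesis
    using near[of s t] s t unfolding Du_def
    by (intro exI[of _ "x + s *\<^sub>R u + t *\<^sub>R v"]) (auto simp: add_ac)
qed

lemma continuous_at_eq_if_nearby_values_agree:
  fixes f g :: "'a::metric_space \<Rightarrow> 'b::t2_space"
  assumes "continuous (at x) f" "continuous (at x) g"
    and nearby: "\<And>r. r > 0 \<Longrightarrow> \<exists>p q. dist p x < r \<and> dist q x < r \<and> f p = g q"
  shows "f x = g x"
proof (rule ccontr)
  assume "f x \<noteq> g x"
  then obtain U V where UV: "open U" "open V" "f x \<in> U" "g x \<in> V" "U \<inter> V = {}"
    using hausdorff[OF \<open>f x \<noteq> g x\<close>] by blast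
  have lim: "(f \<longlongrightarrow> f x) (nhds x)" "(g \<longlongrightarrow> g x) (nhds x)"
    using assms(1,2) unfolding continuous_at tendsto_at_iff_tendsto_nhds by this+
  obtain d where d: "d > 0" "\<And>y. dist y x < d \<Longrightarrow> f y \<in> U"
    using topological_tendstoD[OF lim(1) UV(1,3)] unfolding eventually_nhds_metric by blast
  obtain e where e: "e > 0" "\<And>y. dist y x < e \<Longrightarrow> g y \<in> V"
    using topological_tendstoD[OF lim(2) UV(2,4)] unfolding eventually_nhds_metric by blast
  have "min d e > 0" using d(1) e(1) by simp
  from nearby[OF this] obtain p q where "dist p x < min d e" "dist q x < min d e" "f p = g q"
    by blast
  then have "f p \<in> U" "f p \<in> V" using d(2)[of p] e(2)[of q] by simp_all
  then show False using UV(5) by blast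
qed

lemma mixed_second_derivatives_agree_nearby:
  fixes f :: "'e::real_normed_vector \<Rightarrow> real"
  assumes "open S" "x \<in> S" and smooth: "smooth_on S f" and "r > 0"
  shows "\<exists>p q. dist p x < r \<and> dist q x < r \<and>
    frechet_derivative (\<lambda>y. frechet_derivative f (at y) v) (at p) u =
    frechet_derivative (\<lambda>y. frechet_derivative f (at y) u) (at q) v"
proof -
  let ?D2 = "\<lambda>u v x. frechet_derivative (\<lambda>y. frechet_derivative f (at y) v) (at x) u"
  obtain r' where "r' > 0" "ball x r' \<subseteq> S" using assms(1,2) by (meson openE)
  define \<rho> where "\<rho> = min r r'"
  have \<rho>: "\<rho> > 0" "ball x \<rho> \<subseteq> S" "\<rho> \<le> r" using \<open>r > 0\<close> \<open>r' > 0\<close> \<open>ball x r' \<subseteq> S\<close> by (auto simp: \<rho>_def)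
  define h where "h = \<rho> / (2 * (norm u + norm v + 1))"
  have denominator_pos: "norm u + norm v + 1 > 0" by (simp add: add_nonneg_pos)
  then have h: "h > 0" using \<rho> by (simp add: h_def)
  then have "h * (norm u + norm v) < h * (2 * (norm u + norm v + 1))"
    by (intro mult_strict_left_mono) (auto simp: add_nonneg_pos)
  also have "\<dots> = \<rho>" using denominator_pos by (simp add: h_def)
  finally have small: "h * (norm u + norm v) < \<rho>" "h * (norm v + norm u) < \<rho>" by (auto simp: add.commute)
  have diff: "f differentiable (at y)" "(\<lambda>z. frechet_derivative f (at z) w) differentiable (at y)"
    if "y \<in> S" for y w
    using smooth_on_imp_differentiable that smooth smooth_on_frechet_derivative[OF smooth] by blast+
  obtain p where p: "dist p x < \<rho>"
    "f (x + h *\<^sub>R u + h *\<^sub>R v) - f (x + h *\<^sub>R u) - f (x + h *\<^sub>R v) + f x = h * h * ?D2 v u p"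
    using mixed_difference_mean_value[OF \<rho>(2) h small(1) diff] by blast
  obtain q where q: "dist q x < \<rho>"
    "f (x + h *\<^sub>R v + h *\<^sub>R u) - f (x + h *\<^sub>R v) - f (x + h *\<^sub>R u) + f x = h * h * ?D2 u v q"
    using mixed_difference_mean_value[OF \<rho>(2) h small(2) diff] by blast
  have "x + h *\<^sub>R v + h *\<^sub>R u = x + h *\<^sub>R u + h *\<^sub>R v" by (simp add: add_ac)
  from q(2)[unfolded this] p(2) have "h * h * ?D2 v u p = h * h * ?D2 u v q" by linarith
  then have "?D2 u v q = ?D2 v u p" using h by simp
  then show ?thesis using p(1) q(1) \<rho>(3) by (intro exI[of _ q] exI[of _ p]) auto
qed

lemma second_derivative_symmetric_real:
  fixes f :: "'e::real_normed_vector \<Rightarrow> real"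
  assumes "open S" "x \<in> S" and smooth: "smooth_on S f"
  shows "frechet_derivative (\<lambda>y. frechet_derivative f (at y) v) (at x) u =
         frechet_derivative (\<lambda>y. frechet_derivative f (at y) u) (at x) v"
proof -
  let ?D2 = "\<lambda>u v x. frechet_derivative (\<lambda>y. frechet_derivative f (at y) v) (at x) u"
  have "continuous (at x) (?D2 u v)" for u v
    using smooth_on_imp_continuous_on[OF smooth_on_frechet_derivative[OF smooth_on_frechet_derivative[OF smooth]]]
      assms(1,2) by (auto simp: continuous_on_eq_continuous_at)
  from continuous_at_eq_if_nearby_values_agree[OF this this mixed_second_derivatives_agree_nearby[OF assms]]
  show ?thesis .
qed

lemma second_derivative_symmetric:
  fixes f :: "'e::real_normed_vector \<Rightarrow> 'f::euclidean_space"
  assumes "open S" "x \<in> S" and smooth: "smooth_on S f"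
  shows "frechet_derivative (\<lambda>y. frechet_derivative f (at y) v) (at x) u =
         frechet_derivative (\<lambda>y. frechet_derivative f (at y) u) (at x) v"
proof (rule euclidean_eqI)
  fix b :: 'f
  have "frechet_derivative (\<lambda>y. frechet_derivative f (at y) v) (at x) u \<bullet> b =
      frechet_derivative (\<lambda>y. frechet_derivative (\<lambda>y. f y \<bullet> b) (at y) v) (at x) u" for u v
  proof -
    have "frechet_derivative (\<lambda>y. frechet_derivative (\<lambda>y. f y \<bullet> b) (at y) v) (at x) =
        frechet_derivative (\<lambda>y. frechet_derivative f (at y) v \<bullet> b) (at x)"
      by (rule frechet_derivative_cong_open[OF assms(1,2)])
         (simp add: frechet_derivative_inner_left smooth_on_imp_differentiable[OF smooth])
    then show ?thesis
      by (simp add: frechet_derivative_inner_left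
          smooth_on_imp_differentiable[OF smooth_on_frechet_derivative[OF smooth] assms(2)])
  qed
  moreover have "smooth_on S (\<lambda>y. f y \<bullet> b)"
    by (rule smooth_on_linear_comp[OF assms(1) bounded_linear_inner_left smooth])
  ultimately show "frechet_derivative (\<lambda>y. frechet_derivative f (at y) v) (at x) u \<bullet> b =
      frechet_derivative (\<lambda>y. frechet_derivative f (at y) u) (at x) v \<bullet> b"
    using second_derivative_symmetric_real[OF assms(1,2)] by simp
qed

lemma closed_pullback_constant_form:
  fixes G :: "'e::euclidean_space \<Rightarrow> 'f::euclidean_space" and \<omega> :: "'f \<Rightarrow> 'f \<Rightarrow> real"
  assumes "open S" and smooth: "smooth_on S G" and bilinear: "bounded_bilinear \<omega>"
    and alternating: "\<And>u v. \<omega> u v = - \<omega> v u"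
  shows "closed_two_form_on S
    (\<lambda>y u v. \<omega> (frechet_derivative G (at y) u) (frechet_derivative G (at y) v))"
  unfolding closed_two_form_on_def
proof (intro ballI allI)
  fix x u v w assume x: "x \<in> S"
  let ?D = "\<lambda>v y. frechet_derivative G (at y) v"
  let ?D2 = "\<lambda>u v. frechet_derivative (?D v) (at x) u"
  have "((\<lambda>y. \<omega> (?D v y) (?D w y)) has_derivative (\<lambda>u. \<omega> (?D v x) (?D2 u w) + \<omega> (?D2 u v) (?D w x))) (at x)" for v w
    by (intro bounded_bilinear.FDERIV[OF bilinear]
        smooth_on_has_derivative[OF smooth_on_frechet_derivative[OF smooth] x])
  from frechet_derivative_at[OF this]
  have product_rule: "frechet_derivative (\<lambda>y. \<omega> (?D v y) (?D w y)) (at x) u =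
      \<omega> (?D v x) (?D2 u w) + \<omega> (?D2 u v) (?D w x)" for u v w
    by (rule fun_cong[OF sym])
  have symmetric: "?D2 a b = ?D2 b a" for a b by (rule second_derivative_symmetric[OF assms(1) x smooth])
  show "frechet_derivative (\<lambda>y. \<omega> (?D v y) (?D w y)) (at x) u
     - frechet_derivative (\<lambda>y. \<omega> (?D u y) (?D w y)) (at x) v
     + frechet_derivative (\<lambda>y. \<omega> (?D u y) (?D v y)) (at x) w = 0"
    unfolding product_rule
    using symmetric[of u v] symmetric[of u w] symmetric[of v w] alternating[of "?D2 u w" "?D v x"] by simp
qed

section \<open>Holomorphic maps\<close>

lemma holomorphic_map_on_cong:
  assumes "open S" "\<And>x. x \<in> S \<Longrightarrow> f x = g x" "holomorphic_map_on S f"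
  shows "holomorphic_map_on S g"
  unfolding holomorphic_map_on_def
proof
  fix x assume x: "x \<in> S"
  then obtain L where L: "(f has_derivative L) (at x)" "\<And>c v. L (c *s v) = c *s L v"
    using assms(3) by (auto simp: holomorphic_map_on_def)
  have "(g has_derivative L) (at x)"
    by (rule has_derivative_transform_within_open[OF L(1) assms(1) x assms(2)])
  then show "\<exists>L. (g has_derivative L) (at x) \<and> (\<forall>c v. L (c *s v) = c *s L v)" using L by blast
qed

definition complex_differentiable_at :: "(complex^'n \<Rightarrow> complex) \<Rightarrow> complex^'n \<Rightarrow> bool" where
  "complex_differentiable_at f x \<longleftrightarrow> (\<exists>L. (f has_derivative L) (at x) \<and> (\<forall>c v. L (c *s v) = c * L v))"

lemma complex_differentiable_at_compose:
  assumes "complex_differentiable_at f x" and "(g has_field_derivative g') (at (f x))"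
  shows "complex_differentiable_at (\<lambda>x. g (f x)) x"
proof -
  obtain L where L: "(f has_derivative L) (at x)" "\<And>c v. L (c *s v) = c * L v"
    using assms(1) by (auto simp: complex_differentiable_at_def)
  have "((\<lambda>x. g (f x)) has_derivative (\<lambda>v. g' * L v)) (at x)"
    using diff_chain_at[OF L(1) assms(2)[unfolded has_field_derivative_def]] by (simp add: o_def)
  then show ?thesis
    unfolding complex_differentiable_at_def using L(2) by (intro exI[of _ "\<lambda>v. g' * L v"]) auto
qed

lemma complex_differentiable_at_mult:
  assumes "complex_differentiable_at f x" "complex_differentiable_at g x"
  shows "complex_differentiable_at (\<lambda>x. f x * g x) x"
proof -
  obtain L L' where L: "(f has_derivative L) (at x)" "\<And>c v. L (c *s v) = c * L v"
    and L': "(g has_derivative L') (at x)" "\<And>c v. L' (c *s v) = c * L' v"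
    using assms by (auto simp: complex_differentiable_at_def)
  show ?thesis
    unfolding complex_differentiable_at_def using has_derivative_mult[OF L(1) L'(1)] L(2) L'(2)
    by (intro exI[of _ "\<lambda>h. f x * L' h + L h * g x"]) (auto simp: algebra_simps)
qed

lemma complex_differentiable_at_sum:
  assumes "\<And>i. i \<in> I \<Longrightarrow> complex_differentiable_at (f i) x"
  shows "complex_differentiable_at (\<lambda>x. \<Sum>i\<in>I. f i x) x"
proof -
  have "\<exists>L. \<forall>i\<in>I. (f i has_derivative L i) (at x) \<and> (\<forall>c v. L i (c *s v) = c * L i v)"
    using assms unfolding complex_differentiable_at_def by (intro bchoice) blast
  then obtain L where L: "\<And>i. i \<in> I \<Longrightarrow> (f i has_derivative L i) (at x)"
    "\<And>i c v. i \<in> I \<Longrightarrow> L i (c *s v) = c * L i v" by blast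
  show ?thesis
    unfolding complex_differentiable_at_def using has_derivative_sum[of I f L, OF L(1)] L(2)
    by (intro exI[of _ "\<lambda>v. \<Sum>i\<in>I. L i v"]) (auto simp: sum_distrib_left)
qed

lemma complex_differentiable_at_nth: "complex_differentiable_at (\<lambda>x. x $ k) x"
  unfolding complex_differentiable_at_def
  by (intro exI[of _ "\<lambda>v. v $ k"]) (auto intro!: bounded_linear_imp_has_derivative bounded_linear_vec_nth)

lemma complex_differentiable_at_const: "complex_differentiable_at (\<lambda>x. a) x"
  unfolding complex_differentiable_at_def by (intro exI[of _ "\<lambda>v. 0"]) auto

lemma holomorphic_map_on_vec:
  fixes f :: "complex^'n \<Rightarrow> complex^'m"
  assumes "\<And>x k. x \<in> S \<Longrightarrow> complex_differentiable_at (\<lambda>x. f x $ k) x"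
  shows "holomorphic_map_on S f"
  unfolding holomorphic_map_on_def
proof
  fix x assume "x \<in> S"
  then obtain L where L: "\<And>k. ((\<lambda>x. f x $ k) has_derivative L k) (at x)" "\<And>k c v. L k (c *s v) = c * L k v"
    using assms unfolding complex_differentiable_at_def by metis
  from has_derivative_vec[OF L(1)] have "(f has_derivative (\<lambda>v. \<chi> k. L k v)) (at x)" .
  then show "\<exists>L. (f has_derivative L) (at x) \<and> (\<forall>c v. L (c *s v) = c *s L v)"
    using L(2) by (intro exI[of _ "\<lambda>v. \<chi> k. L k v"]) (auto simp: vec_eq_iff)
qed

definition regularity :: "((complex^'n::finite) set \<Rightarrow> (complex^'n \<Rightarrow> complex^'n) \<Rightarrow> bool) \<Rightarrow> bool" where
  "regularity reg \<longleftrightarrow> reg = smooth_on \<or> reg = holomorphic_map_on"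

lemma regularity_cong:
  "regularity reg \<Longrightarrow> open S \<Longrightarrow> (\<And>x. x \<in> S \<Longrightarrow> f x = g x) \<Longrightarrow> reg S f \<Longrightarrow> reg S g"
  using smooth_on_cong[of S f g] holomorphic_map_on_cong[of S f g] by (auto simp: regularity_def)

lemma regularity_complex_linear:
  fixes L :: "complex^'n \<Rightarrow> complex^'n"
  assumes "regularity reg" "open S" "linear L" "\<And>c v. L (c *s v) = c *s L v"
  shows "reg S L"
proof -
  have bounded: "bounded_linear L" using assms(3) by (simp add: linear_conv_bounded_linear)
  then show ?thesis
    using assms(1,2,4) smooth_on_bounded_linear[OF assms(2) bounded] bounded_linear_imp_has_derivative[OF bounded]
    unfolding regularity_def holomorphic_map_on_def by blast
qed

section \<open>Quotient topologies\<close>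

lemma openin_quotient_topology:
  "openin (quotient_topology Y f) W \<longleftrightarrow> W \<subseteq> f ` topspace Y \<and> openin Y {x \<in> topspace Y. f x \<in> W}"
proof -
  have "istopology (\<lambda>W. W \<subseteq> f ` topspace Y \<and> openin Y {x \<in> topspace Y. f x \<in> W})"
    unfolding istopology_def
  proof (intro conjI allI impI)
    fix S T
    assume S: "S \<subseteq> f ` topspace Y \<and> openin Y {x \<in> topspace Y. f x \<in> S}"
      and T: "T \<subseteq> f ` topspace Y \<and> openin Y {x \<in> topspace Y. f x \<in> T}"
    have "{x \<in> topspace Y. f x \<in> S \<inter> T} = {x \<in> topspace Y. f x \<in> S} \<inter> {x \<in> topspace Y. f x \<in> T}" by auto
    then show "openin Y {x \<in> topspace Y. f x \<in> S \<inter> T}" using S T by auto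
  next
    fix \<K> assume \<K>: "\<forall>W\<in>\<K>. W \<subseteq> f ` topspace Y \<and> openin Y {x \<in> topspace Y. f x \<in> W}"
    have "{x \<in> topspace Y. f x \<in> \<Union>\<K>} = (\<Union>W\<in>\<K>. {x \<in> topspace Y. f x \<in> W})" by auto
    then show "openin Y {x \<in> topspace Y. f x \<in> \<Union>\<K>}" using \<K> by auto
  qed auto
  then show ?thesis unfolding quotient_topology_def by (simp add: topology_inverse')
qed

lemma topspace_quotient_topology: "topspace (quotient_topology Y f) = f ` topspace Y"
proof -
  have "{x \<in> topspace Y. f x \<in> f ` topspace Y} = topspace Y" by auto
  then have "openin (quotient_topology Y f) (f ` topspace Y)"
    by (simp add: openin_quotient_topology)
  from openin_subset[OF this] show ?thesis
    using openin_topspace[of "quotient_topology Y f"] unfolding openin_quotient_topology by blast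
qed

lemma quotient_map_quotient_topology: "quotient_map Y (quotient_topology Y f) f"
  by (simp add: quotient_map_def topspace_quotient_topology openin_quotient_topology)

lemma continuous_map_quotient_topology:
  assumes "\<And>x. x \<in> topspace Y \<Longrightarrow> h (a x) = g x" "continuous_map Y Z g"
  shows "continuous_map (quotient_topology Y a) Z h"
  by (rule continuous_compose_quotient_map[OF quotient_map_quotient_topology])
     (rule continuous_map_eq[OF assms(2)], simp add: assms(1))

lemma open_map_quotient_topology:
  assumes h: "\<And>x. x \<in> topspace Y \<Longrightarrow> h (a x) = b (\<sigma> x)"
    and cont: "continuous_map Y Z \<sigma>"
    and saturated: "\<And>V. openin Y V \<Longrightarrow> openin Z {z \<in> topspace Z. b z \<in> b ` \<sigma> ` V}"
  shows "open_map (quotient_topology Y a) (quotient_topology Z b) h"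
  unfolding open_map_def
proof (intro allI impI)
  fix W assume W: "openin (quotient_topology Y a) W"
  let ?V = "{x \<in> topspace Y. a x \<in> W}"
  have V: "openin Y ?V" "W = a ` ?V" using W by (auto simp: openin_quotient_topology)
  have "h ` W = h ` a ` ?V" by (rule arg_cong[OF V(2)])
  also have "\<dots> = b ` \<sigma> ` ?V" unfolding image_image by (rule image_cong) (auto simp: h)
  finally have "h ` W = b ` \<sigma> ` ?V" .
  moreover have "b ` \<sigma> ` ?V \<subseteq> b ` topspace Z"
    using continuous_map_image_subset_topspace[OF cont] by blast
  ultimately show "openin (quotient_topology Z b) (h ` W)"
    using saturated[OF V(1)] by (simp add: openin_quotient_topology)
qed

lemma embedding_map_quotient_topology:
  assumes h: "\<And>x. x \<in> topspace Y \<Longrightarrow> h (a x) = b (\<sigma> x)"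
    and cont: "continuous_map Y Z \<sigma>"
    and saturated: "\<And>V. openin Y V \<Longrightarrow> openin Z {z \<in> topspace Z. b z \<in> b ` \<sigma> ` V}"
    and inj: "inj_on h (a ` topspace Y)"
  shows "embedding_map (quotient_topology Y a) (quotient_topology Z b) h"
proof (rule injective_open_imp_embedding_map)
  show "continuous_map (quotient_topology Y a) (quotient_topology Z b) h"
  proof (rule continuous_map_quotient_topology[where g="b \<circ> \<sigma>"])
    show "continuous_map Y (quotient_topology Z b) (b \<circ> \<sigma>)"
      by (rule continuous_map_compose[OF cont quotient_imp_continuous_map[OF quotient_map_quotient_topology]])
  qed (simp add: h)
  show "open_map (quotient_topology Y a) (quotient_topology Z b) h"
    by (rule open_map_quotient_topology[where a=a and b=b and \<sigma>=\<sigma>, OF h cont saturated])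
qed (use inj in \<open>simp add: topspace_quotient_topology\<close>)

section \<open>Models from group actions\<close>

lemma bij_betw_induced_on_images:
  assumes F: "bij_betw F C D" and comm: "\<And>x. x \<in> C \<Longrightarrow> b (F x) = f (a x)" and inj: "inj_on f (a ` C)"
  shows "bij_betw f (a ` C) (b ` D)"
proof (rule bij_betw_imageI[OF inj])
  have "f ` a ` C = b ` F ` C" unfolding image_image by (rule image_cong) (simp_all add: comm)
  then show "f ` a ` C = b ` D" using bij_betw_imp_surj_on[OF F] by simp
qed

lemma local_section_open_id: "open C \<Longrightarrow> x \<in> C \<Longrightarrow> local_section C id x C id"
  unfolding local_section_def
  by (intro conjI exI[of _ C]) (auto simp: homeomorphism_def)

lemma manifold_map_open_id:
  assumes "open C" "F ` C \<subseteq> D" "continuous_on C F" "reg C F"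
  shows "manifold_map reg C id D id F"
  unfolding manifold_map_def
  using assms local_section_open_id[OF assms(1)] by (intro conjI ballI exI[of _ C] exI[of _ id]) auto

definition transformations :: "'g set \<Rightarrow> ('g \<Rightarrow> 'c \<Rightarrow> 'c) \<Rightarrow> 'c set \<Rightarrow> ('c \<Rightarrow> 'c) set" where
  "transformations S \<tau> C = (\<lambda>\<alpha>. restrict (\<tau> \<alpha>) C) ` S"

locale abelian_action =
  fixes S :: "'g::ab_group_add set" and \<tau> :: "'g \<Rightarrow> 'c \<Rightarrow> 'c" and C :: "'c set"
  assumes zero: "0 \<in> S" and add: "\<alpha> \<in> S \<Longrightarrow> \<beta> \<in> S \<Longrightarrow> \<alpha> + \<beta> \<in> S" and minus: "\<alpha> \<in> S \<Longrightarrow> - \<alpha> \<in> S"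
    and act_closed: "\<alpha> \<in> S \<Longrightarrow> x \<in> C \<Longrightarrow> \<tau> \<alpha> x \<in> C"
    and act_zero: "x \<in> C \<Longrightarrow> \<tau> 0 x = x"
    and act_add: "x \<in> C \<Longrightarrow> \<tau> (\<alpha> + \<beta>) x = \<tau> \<alpha> (\<tau> \<beta> x)"
begin

lemma act_inverse: "x \<in> C \<Longrightarrow> \<tau> (- \<alpha>) (\<tau> \<alpha> x) = x" "x \<in> C \<Longrightarrow> \<tau> \<alpha> (\<tau> (- \<alpha>) x) = x"
  using act_add[of x "- \<alpha>" \<alpha>] act_add[of x \<alpha> "- \<alpha>"] act_zero by auto

lemma bij_betw_act: "\<alpha> \<in> S \<Longrightarrow> bij_betw (\<tau> \<alpha>) C C"
  by (rule bij_betwI[where g="\<tau> (- \<alpha>)"]) (auto simp: act_inverse intro: act_closed minus)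

lemma group_orbit_transformations:
  "x \<in> C \<Longrightarrow> group_orbit (transformations S \<tau> C) x = (\<lambda>\<alpha>. \<tau> \<alpha> x) ` S"
  by (auto simp: group_orbit_def transformations_def image_image)

lemma group_orbit_act:
  assumes "\<alpha> \<in> S" "x \<in> C"
  shows "group_orbit (transformations S \<tau> C) (\<tau> \<alpha> x) = group_orbit (transformations S \<tau> C) x"
proof -
  have subset: "(\<lambda>\<beta>. \<tau> \<beta> (\<tau> \<alpha> y)) ` S \<subseteq> (\<lambda>\<beta>. \<tau> \<beta> y) ` S" if "\<alpha> \<in> S" "y \<in> C" for \<alpha> y
    using act_add[OF that(2), symmetric] add[OF _ that(1)] by auto
  have "(\<lambda>\<beta>. \<tau> \<beta> x) ` S \<subseteq> (\<lambda>\<beta>. \<tau> \<beta> (\<tau> \<alpha> x)) ` S"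
    using subset[OF minus[OF assms(1)] act_closed[OF assms]] by (simp add: act_inverse assms)
  then show ?thesis
    using subset[OF assms] assms by (simp add: group_orbit_transformations act_closed subset_antisym)
qed

lemma act_in_Bij: "\<alpha> \<in> S \<Longrightarrow> restrict (\<tau> \<alpha>) C \<in> Bij C"
  using bij_betw_act by (auto simp: Bij_def cong: bij_betw_cong)

lemma BijGroup_mult_act:
  assumes "\<alpha> \<in> S" "\<beta> \<in> S"
  shows "restrict (\<tau> \<alpha>) C \<otimes>\<^bsub>BijGroup C\<^esub> restrict (\<tau> \<beta>) C = restrict (\<tau> (\<alpha> + \<beta>)) C"
  using act_in_Bij[OF assms(1)] act_in_Bij[OF assms(2)] act_add act_closed[OF assms(2)]
  by (auto simp: BijGroup_def compose_def fun_eq_iff)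

lemma subgroup_transformations: "subgroup (transformations S \<tau> C) (BijGroup C)"
proof (rule group.subgroupI[OF group_BijGroup])
  show "transformations S \<tau> C \<subseteq> carrier (BijGroup C)"
    using act_in_Bij by (auto simp: transformations_def BijGroup_def)
  show "transformations S \<tau> C \<noteq> {}" using zero by (auto simp: transformations_def)
  show "inv\<^bsub>BijGroup C\<^esub> g \<in> transformations S \<tau> C" if g: "g \<in> transformations S \<tau> C" for g
  proof -
    obtain \<alpha> where \<alpha>: "\<alpha> \<in> S" "g = restrict (\<tau> \<alpha>) C" using g by (auto simp: transformations_def)
    have "restrict (\<tau> (- \<alpha>)) C \<otimes>\<^bsub>BijGroup C\<^esub> g = \<one>\<^bsub>BijGroup C\<^esub>"
      unfolding \<alpha>(2) BijGroup_mult_act[OF minus[OF \<alpha>(1)] \<alpha>(1)] by (auto simp: BijGroup_def act_zero)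
    then have "inv\<^bsub>BijGroup C\<^esub> g = restrict (\<tau> (- \<alpha>)) C"
      using act_in_Bij \<alpha> minus[OF \<alpha>(1)]
      by (intro group.inv_equality[OF group_BijGroup]) (auto simp: BijGroup_def)
    then show ?thesis using minus[OF \<alpha>(1)] by (simp add: transformations_def)
  qed
  show "g \<otimes>\<^bsub>BijGroup C\<^esub> h \<in> transformations S \<tau> C" if "g \<in> transformations S \<tau> C" "h \<in> transformations S \<tau> C" for g h
    using that BijGroup_mult_act add by (auto simp: transformations_def)
qed

end

lemma is_model_transformations:
  fixes \<tau> :: "'g::ab_group_add \<Rightarrow> 'c::euclidean_space \<Rightarrow> 'c" and p :: "'c \<Rightarrow> 'e::euclidean_space"
  assumes "abelian_action S \<tau> C" and "C \<noteq> {}" "contractible C"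
    and regular: "\<And>\<alpha>. \<alpha> \<in> S \<Longrightarrow> manifold_map reg C p C p (restrict (\<tau> \<alpha>) C)"
    and dense: "F \<subseteq> C" "connected F" "C \<subseteq> closure F"
    and free: "\<And>\<alpha> x y. \<alpha> \<in> S \<Longrightarrow> x \<in> F \<Longrightarrow> \<tau> \<alpha> x = x \<Longrightarrow> y \<in> C \<Longrightarrow> \<tau> \<alpha> y = y"
  shows "is_model reg C p (transformations S \<tau> C)"
proof -
  interpret abelian_action S \<tau> C by fact
  show ?thesis unfolding is_model_def
  proof (intro conjI ballI subgroup_transformations \<open>C \<noteq> {}\<close>)
    show "connected C" "simply_connected C"
      using contractible_imp_connected contractible_imp_simply_connected \<open>contractible C\<close> by auto
    show "manifold_map reg C p C p g" if "g \<in> transformations S \<tau> C" for g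
      using that regular by (auto simp: transformations_def)
    have F_free: "F \<subseteq> free_points C (transformations S \<tau> C)"
      using dense(1) free by (force simp: free_points_def transformations_def fun_eq_iff)
    moreover have "free_points C (transformations S \<tau> C) \<subseteq> C" by (auto simp: free_points_def)
    ultimately show "connected (free_points C (transformations S \<tau> C))"
      using connected_intermediate_closure[OF dense(2)] dense(3) by blast
    show "C \<subseteq> closure (free_points C (transformations S \<tau> C))"
      using closure_mono[OF F_free] dense(3) by blast
  qed
qed

section \<open>Reinhardt domains and their universal covers\<close>

subsection \<open>Logarithmic coordinates\<close>

definition sq_moduli :: "complex^'n::finite \<Rightarrow> real^'n" where
  "sq_moduli w = (\<chi> k. (cmod (w $ k))\<^sup>2)"

definition reinhardt :: "(real^'n::finite) set \<Rightarrow> (complex^'n) set" where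
  "reinhardt A = {w. sq_moduli w \<in> A}"

definition partial_exp :: "'n set \<Rightarrow> complex^'n::finite \<Rightarrow> complex^'n" where
  "partial_exp K x = (\<chi> k. if k \<in> K then exp (x $ k) else x $ k)"

definition log_domain :: "(real^'n::finite) set \<Rightarrow> 'n set \<Rightarrow> (complex^'n) set" where
  "log_domain A K = {x. partial_exp K x \<in> reinhardt A}"

definition nonvanishing :: "(real^'n::finite) set \<Rightarrow> 'n set \<Rightarrow> (complex^'n) set" where
  "nonvanishing A K = {w \<in> reinhardt A. \<forall>k\<in>K. w $ k \<noteq> 0}"

definition phase :: "real^'n::finite \<Rightarrow> complex^'n \<Rightarrow> complex^'n" where
  "phase \<alpha> w = (\<chi> k. exp (\<i> * complex_of_real (\<alpha> $ k)) * w $ k)"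

definition log_phase :: "'n set \<Rightarrow> real^'n::finite \<Rightarrow> complex^'n \<Rightarrow> complex^'n" where
  "log_phase K \<alpha> x = (\<chi> k. if k \<in> K then x $ k + \<i> * complex_of_real (\<alpha> $ k)
     else exp (\<i> * complex_of_real (\<alpha> $ k)) * x $ k)"

lemma continuous_on_sq_moduli: "continuous_on S sq_moduli"
  unfolding sq_moduli_def by (intro continuous_intros)

lemma continuous_on_partial_exp: "continuous_on S (partial_exp K)"
  unfolding partial_exp_def
proof (rule continuous_on_vec_lambda)
  show "continuous_on S (\<lambda>x. if i \<in> K then exp (x $ i) else x $ i)" for i
    by (cases "i \<in> K") (auto intro!: continuous_intros)
qed

lemma continuous_on_log_phase: "continuous_on S (log_phase K \<alpha>)"
  unfolding log_phase_def
proof (rule continuous_on_vec_lambda)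
  show "continuous_on S (\<lambda>x. if i \<in> K then x $ i + \<i> * complex_of_real (\<alpha> $ i)
     else exp (\<i> * complex_of_real (\<alpha> $ i)) * x $ i)" for i
    by (cases "i \<in> K") (auto intro!: continuous_intros)
qed

lemma open_reinhardt: "open A \<Longrightarrow> open (reinhardt A)"
  using open_vimage[OF _ continuous_on_sq_moduli[of UNIV]] by (simp add: reinhardt_def vimage_def)

lemma open_log_domain: "open A \<Longrightarrow> open (log_domain A K)"
  using open_vimage[OF open_reinhardt continuous_on_partial_exp[of UNIV K]]
  by (simp add: log_domain_def vimage_def)

lemma open_nonvanishing:
  assumes "open A"
  shows "open (nonvanishing A K)"
proof -
  have "nonvanishing A K = reinhardt A \<inter> (\<Inter>k\<in>K. {w. w $ k \<noteq> 0})"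
    by (auto simp: nonvanishing_def)
  also have "open \<dots>"
    using assms by (intro open_Int open_reinhardt open_INT) (auto intro!: open_Collect_neq continuous_intros)
  finally show ?thesis .
qed

lemma reinhardt_UNIV [simp]: "reinhardt UNIV = UNIV"
  by (simp add: reinhardt_def)

lemma log_domain_empty [simp]: "log_domain A {} = reinhardt A"
  by (simp add: log_domain_def partial_exp_def)

lemma log_phase_empty [simp]: "log_phase {} \<alpha> = phase \<alpha>"
  by (auto simp: log_phase_def phase_def fun_eq_iff)

lemma sq_moduli_phase [simp]: "sq_moduli (phase \<alpha> w) = sq_moduli w"
  by (simp add: sq_moduli_def phase_def norm_mult norm_exp_i_times)

lemma phase_in_reinhardt_iff: "phase \<alpha> w \<in> reinhardt A \<longleftrightarrow> w \<in> reinhardt A"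
  by (simp add: reinhardt_def)

lemma partial_exp_log_phase: "partial_exp K (log_phase K \<alpha> x) = phase \<alpha> (partial_exp K x)"
  by (auto simp: partial_exp_def log_phase_def phase_def vec_eq_iff exp_add)

lemma log_phase_add: "log_phase K (\<alpha> + \<beta>) x = log_phase K \<alpha> (log_phase K \<beta> x)"
  by (auto simp: log_phase_def vec_eq_iff exp_add algebra_simps)

lemma log_phase_zero [simp]: "log_phase K 0 x = x"
  by (auto simp: log_phase_def vec_eq_iff)

lemma log_phase_in_log_domain_iff: "log_phase K \<alpha> x \<in> log_domain A K \<longleftrightarrow> x \<in> log_domain A K"
  by (simp add: log_domain_def partial_exp_log_phase phase_in_reinhardt_iff)

lemma phase_add: "phase (\<alpha> + \<beta>) w = phase \<alpha> (phase \<beta> w)"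
  using log_phase_add[of "{}"] by simp

lemma phase_zero [simp]: "phase 0 w = w"
  using log_phase_zero[of "{}"] by simp

lemma bounded_linear_phase: "bounded_linear (phase \<alpha>)"
  by (auto simp: linear_conv_bounded_linear[symmetric] phase_def vec_eq_iff algebra_simps intro!: linearI)

lemma phase_vector_smult: "phase \<alpha> (c *s v) = c *s phase \<alpha> v"
  by (auto simp: phase_def vec_eq_iff)

lemma phase_periodic:
  assumes "\<And>k. \<exists>m::int. \<alpha> $ k - \<beta> $ k = 2 * pi * of_int m"
  shows "phase \<alpha> = phase \<beta>"
proof -
  have "exp (\<i> * complex_of_real (\<alpha> $ k)) = exp (\<i> * complex_of_real (\<beta> $ k))" for k
  proof -
    obtain m :: int where "\<alpha> $ k = \<beta> $ k + 2 * pi * of_int m" using assms[of k] by (auto simp: algebra_simps)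
    then show ?thesis unfolding exp_eq by (intro exI[of _ m]) (simp add: algebra_simps)
  qed
  then show ?thesis by (simp add: phase_def fun_eq_iff)
qed

lemma partial_exp_image_log_domain: "partial_exp K ` log_domain A K = nonvanishing A K"
proof
  show "partial_exp K ` log_domain A K \<subseteq> nonvanishing A K"
    by (auto simp: log_domain_def nonvanishing_def) (simp add: partial_exp_def)
  show "nonvanishing A K \<subseteq> partial_exp K ` log_domain A K"
  proof
    fix w assume w: "w \<in> nonvanishing A K"
    let ?x = "\<chi> k. if k \<in> K then Ln (w $ k) else w $ k"
    have "partial_exp K ?x = w" using w by (auto simp: nonvanishing_def partial_exp_def vec_eq_iff)
    then show "w \<in> partial_exp K ` log_domain A K"
      using w by (intro image_eqI[of _ _ ?x]) (auto simp: log_domain_def nonvanishing_def)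
  qed
qed

lemma log_domain_nonempty:
  assumes "s \<in> A" and s: "\<And>k. if k \<in> K then s $ k > 0 else s $ k = 0"
  shows "log_domain A K \<noteq> {}"
proof -
  let ?w = "\<chi> k. complex_of_real (sqrt (s $ k))"
  have "s $ k \<ge> 0" for k using s[of k] by (auto split: if_splits)
  then have "sq_moduli ?w = s" by (simp add: sq_moduli_def vec_eq_iff)
  moreover have "?w $ k \<noteq> 0" if "k \<in> K" for k using s[of k] that by simp
  ultimately have "?w \<in> nonvanishing A K" using \<open>s \<in> A\<close> by (auto simp: nonvanishing_def reinhardt_def)
  then show ?thesis by (auto simp flip: partial_exp_image_log_domain)
qed

subsection \<open>Contractibility\<close>

definition modulus_homotopy :: "'n set \<Rightarrow> real^'n::finite \<Rightarrow> real \<times> (complex^'n) \<Rightarrow> complex^'n" where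
  "modulus_homotopy K s = (\<lambda>(t, x). \<chi> k. if k \<in> K
     then Complex (ln ((1 - t) * exp (2 * Re (x $ k)) + t * s $ k) / 2) ((1 - t) * Im (x $ k))
     else complex_of_real (sqrt (1 - t)) * x $ k)"

lemma convex_combination_exp_pos:
  assumes "s > 0" "t \<in> {0..1}"
  shows "(1 - t) * exp r + t * s > (0::real)"
proof (cases "t = 1")
  case False
  then have "(1 - t) * exp r > 0" "t * s \<ge> 0" using assms by auto
  then show ?thesis by linarith
qed (use assms in simp)

lemma continuous_on_modulus_homotopy:
  assumes s: "\<And>k. k \<in> K \<Longrightarrow> s $ k > 0"
  shows "continuous_on ({0..1} \<times> D) (modulus_homotopy K s)"
  unfolding modulus_homotopy_def case_prod_unfold
proof (rule continuous_on_vec_lambda)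
  fix k
  show "continuous_on ({0..1} \<times> D) (\<lambda>p. if k \<in> K
     then Complex (ln ((1 - fst p) * exp (2 * Re (snd p $ k)) + fst p * s $ k) / 2) ((1 - fst p) * Im (snd p $ k))
     else complex_of_real (sqrt (1 - fst p)) * snd p $ k)"
  proof (cases "k \<in> K")
    case True
    show ?thesis unfolding if_P[OF True] Complex_eq
      by (intro continuous_intros) (use convex_combination_exp_pos[OF s[OF True]] in \<open>force simp: less_le\<close>)+
  next
    case False
    show ?thesis unfolding if_not_P[OF False] by (intro continuous_intros)
  qed
qed

lemma sq_moduli_modulus_homotopy:
  assumes s: "\<And>k. if k \<in> K then s $ k > 0 else s $ k = 0" and t: "t \<in> {0..1}"
  shows "sq_moduli (partial_exp K (modulus_homotopy K s (t, x))) =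
    (1 - t) *\<^sub>R sq_moduli (partial_exp K x) + t *\<^sub>R s"
proof (rule vec_eq_iff[THEN iffD2], rule allI)
  fix k
  show "sq_moduli (partial_exp K (modulus_homotopy K s (t, x))) $ k =
      ((1 - t) *\<^sub>R sq_moduli (partial_exp K x) + t *\<^sub>R s) $ k"
  proof (cases "k \<in> K")
    case True
    have exp_squared: "(exp a)\<^sup>2 = exp (2 * a)" for a :: real by (simp add: exp_double)
    have "s $ k > 0" using s[of k] True by simp
    then show ?thesis
      using True convex_combination_exp_pos[OF _ t]
      by (simp add: sq_moduli_def partial_exp_def modulus_homotopy_def norm_exp_eq_Re exp_squared)
  next
    case False
    then show ?thesis using s[of k] t
      by (simp add: sq_moduli_def partial_exp_def modulus_homotopy_def norm_mult power_mult_distrib)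
  qed
qed

text \<open>The squared moduli interpolate linearly along the homotopy, so that the convexity of \<open>A\<close> keeps it
  inside the domain.\<close>

lemma contractible_log_domain:
  fixes A :: "(real^'n::finite) set"
  assumes "convex A" "s \<in> A" and s: "\<And>k. if k \<in> K then s $ k > 0 else s $ k = 0"
  shows "contractible (log_domain A K)"
proof -
  let ?D = "log_domain A K" and ?H = "modulus_homotopy K s"
  let ?c = "\<chi> k. if k \<in> K then Complex (ln (s $ k) / 2) 0 else 0"
  have cont: "continuous_on ({0..1} \<times> ?D) ?H"
    using s by (intro continuous_on_modulus_homotopy) (metis (full_types))
  have image: "?H ` ({0..1} \<times> ?D) \<subseteq> ?D"
  proof clarify
    fix t :: real and x :: "complex^'n" assume t: "t \<in> {0..1}" and x: "x \<in> ?D"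
    have "(1 - t) *\<^sub>R sq_moduli (partial_exp K x) + t *\<^sub>R s \<in> A"
      using \<open>convex A\<close> x \<open>s \<in> A\<close> t by (auto simp: convex_alt log_domain_def reinhardt_def)
    then show "?H (t, x) \<in> ?D"
      by (simp add: log_domain_def reinhardt_def sq_moduli_modulus_homotopy[OF s t])
  qed
  have "?H (0, x) = id x" "?H (1, x) = ?c" for x
    by (auto simp: modulus_homotopy_def vec_eq_iff complex_eq_iff)
  then have "homotopic_with_canon (\<lambda>x. True) ?D ?D id (\<lambda>x. ?c)"
    unfolding homotopic_with_def using cont image by (intro exI[of _ ?H]) (auto simp: image_subset_iff)
  then show ?thesis unfolding contractible_def by blast
qed

subsection \<open>The covering by logarithms\<close>

definition log_section :: "'n set \<Rightarrow> complex^'n::finite \<Rightarrow> complex^'n \<Rightarrow> complex^'n" where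
  "log_section K x\<^sub>0 w = (\<chi> k. if k \<in> K then x\<^sub>0 $ k + Ln (w $ k / exp (x\<^sub>0 $ k)) else w $ k)"

definition slit_domain :: "(real^'n::finite) set \<Rightarrow> 'n set \<Rightarrow> complex^'n \<Rightarrow> (complex^'n) set" where
  "slit_domain A K w\<^sub>0 = {w \<in> reinhardt A. \<forall>k\<in>K. w $ k / w\<^sub>0 $ k \<notin> \<real>\<^sub>\<le>\<^sub>0}"

definition sheet :: "(real^'n::finite) set \<Rightarrow> 'n set \<Rightarrow> complex^'n \<Rightarrow> (complex^'n) set" where
  "sheet A K x\<^sub>0 = {x \<in> log_domain A K. \<forall>k\<in>K. \<bar>Im (x $ k - x\<^sub>0 $ k)\<bar> < pi}"

lemma exp_notin_nonpos_Reals: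
  assumes "\<bar>Im y\<bar> < pi"
  shows "exp y \<notin> \<real>\<^sub>\<le>\<^sub>0"
proof
  assume "exp y \<in> \<real>\<^sub>\<le>\<^sub>0"
  then have "Re (exp y) < 0" "Im (exp y) = 0"
    using exp_not_eq_zero[of y] by (auto simp: complex_nonpos_Reals_iff complex_eq_iff less_le simp del: exp_not_eq_zero)
  then have "Im (Ln (exp y)) = pi" by (simp add: Im_Ln_eq_pi)
  then show False using assms by (simp add: abs_less_iff)
qed

lemma abs_Im_Ln_less_pi:
  assumes "z \<notin> \<real>\<^sub>\<le>\<^sub>0"
  shows "\<bar>Im (Ln z)\<bar> < pi"
proof -
  have "z \<noteq> 0" using assms by auto
  then show ?thesis using mpi_less_Im_Ln[of z] Im_Ln_less_pi[OF assms] by (simp add: abs_less_iff)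
qed

lemma open_slit_domain:
  fixes A :: "(real^'n::finite) set"
  assumes "open A" "\<And>k. k \<in> K \<Longrightarrow> w\<^sub>0 $ k \<noteq> 0"
  shows "open (slit_domain A K w\<^sub>0)"
proof -
  have "slit_domain A K w\<^sub>0 = reinhardt A \<inter> (\<Inter>k\<in>K. (\<lambda>w. w $ k / w\<^sub>0 $ k) -` (- \<real>\<^sub>\<le>\<^sub>0))"
    by (auto simp: slit_domain_def)
  also have "open \<dots>"
    using assms
    by (intro open_Int open_reinhardt open_INT ballI finite open_vimage)
       (auto intro!: continuous_intros)
  finally show ?thesis .
qed

lemma open_sheet:
  fixes A :: "(real^'n::finite) set"
  assumes "open A"
  shows "open (sheet A K x\<^sub>0)"
proof -
  have "sheet A K x\<^sub>0 = log_domain A K \<inter> (\<Inter>k\<in>K. {x. \<bar>Im (x $ k - x\<^sub>0 $ k)\<bar> < pi})"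
    by (auto simp: sheet_def)
  also have "open \<dots>"
    using assms
    by (intro open_Int open_log_domain open_INT ballI finite open_Collect_less)
       (auto intro!: continuous_intros)
  finally show ?thesis .
qed

lemma partial_exp_in_slit_domain:
  "x\<^sub>0 \<in> log_domain A K \<Longrightarrow> partial_exp K x\<^sub>0 \<in> slit_domain A K (partial_exp K x\<^sub>0)"
  by (auto simp: slit_domain_def log_domain_def) (simp add: partial_exp_def)

lemma partial_exp_log_section:
  assumes "w \<in> slit_domain A K w\<^sub>0"
  shows "partial_exp K (log_section K x\<^sub>0 w) = w"
proof -
  have "w $ k \<noteq> 0" if "k \<in> K" for k using assms that by (auto simp: slit_domain_def)
  then show ?thesis by (auto simp: partial_exp_def log_section_def vec_eq_iff exp_add)
qed

lemma log_section_partial_exp: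
  assumes "x \<in> sheet A K x\<^sub>0"
  shows "log_section K x\<^sub>0 (partial_exp K x) = x"
proof -
  have "x\<^sub>0 $ k + Ln (exp (x $ k) / exp (x\<^sub>0 $ k)) = x $ k" if "k \<in> K" for k
    using assms that by (auto simp: sheet_def abs_less_iff simp flip: exp_diff)
  then show ?thesis by (auto simp: partial_exp_def log_section_def vec_eq_iff)
qed

lemma continuous_on_log_section: "continuous_on (slit_domain A K (partial_exp K x\<^sub>0)) (log_section K x\<^sub>0)"
  unfolding log_section_def
proof (rule continuous_on_vec_lambda)
  show "continuous_on (slit_domain A K (partial_exp K x\<^sub>0))
      (\<lambda>w. if k \<in> K then x\<^sub>0 $ k + Ln (w $ k / exp (x\<^sub>0 $ k)) else w $ k)" for k
    by (cases "k \<in> K") (auto intro!: continuous_intros simp: slit_domain_def partial_exp_def)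
qed

lemma log_section_in_sheet:
  assumes "w \<in> slit_domain A K (partial_exp K x\<^sub>0)"
  shows "log_section K x\<^sub>0 w \<in> sheet A K x\<^sub>0"
proof -
  have "\<bar>Im (Ln (w $ k / exp (x\<^sub>0 $ k)))\<bar> < pi" if "k \<in> K" for k
    using assms that by (intro abs_Im_Ln_less_pi) (auto simp: slit_domain_def partial_exp_def)
  then show ?thesis
    using assms partial_exp_log_section[OF assms]
    by (auto simp: sheet_def log_domain_def slit_domain_def log_section_def)
qed

lemma partial_exp_sheet_in_slit_domain:
  assumes "x \<in> sheet A K x\<^sub>0"
  shows "partial_exp K x \<in> slit_domain A K (partial_exp K x\<^sub>0)"
proof -
  have "partial_exp K x $ k / partial_exp K x\<^sub>0 $ k \<notin> \<real>\<^sub>\<le>\<^sub>0" if "k \<in> K" for k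
    using exp_notin_nonpos_Reals[of "x $ k - x\<^sub>0 $ k"] assms that
    by (auto simp: sheet_def partial_exp_def exp_diff)
  then show ?thesis using assms by (auto simp: slit_domain_def sheet_def log_domain_def)
qed

lemma homeomorphism_sheet:
  "homeomorphism (sheet A K x\<^sub>0) (slit_domain A K (partial_exp K x\<^sub>0)) (partial_exp K) (log_section K x\<^sub>0)"
  by (intro homeomorphismI continuous_on_partial_exp continuous_on_log_section)
     (auto simp: partial_exp_log_section log_section_partial_exp log_section_in_sheet
        partial_exp_sheet_in_slit_domain)

abbreviation log_cover :: "(real^'n::finite) set \<Rightarrow> 'n set \<Rightarrow> ((complex^'n) \<times> (complex^'n)) set" where
  "log_cover A K \<equiv> log_domain A K \<times> {0}"

definition cover_proj :: "'n set \<Rightarrow> (complex^'n::finite) \<times> (complex^'n) \<Rightarrow> complex^'n" where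
  "cover_proj K = partial_exp K \<circ> fst"

lemma continuous_on_cover_proj: "continuous_on S (cover_proj K)"
  unfolding cover_proj_def
  by (intro continuous_on_compose continuous_on_fst continuous_on_partial_exp continuous_on_id)

lemma homeomorphism_Times_zero:
  fixes p :: "'a::topological_space \<Rightarrow> 'b::topological_space"
  assumes "homeomorphism U T p s"
  shows "homeomorphism (U \<times> {0::'c::{zero,topological_space}}) T (p \<circ> fst) (\<lambda>w. (s w, 0))"
proof
  have "continuous_on U p" "continuous_on T s" using assms by (auto simp: homeomorphism_def)
  then show "continuous_on (U \<times> {0::'c}) (p \<circ> fst)" "continuous_on T (\<lambda>w. (s w, 0::'c))"
    unfolding o_def by (auto intro!: continuous_intros intro: continuous_on_compose2[of U p _ fst])
qed (use assms in \<open>auto simp: homeomorphism_def\<close>)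

lemma openin_sheet:
  fixes A :: "(real^'n::finite) set"
  assumes "open A"
  shows "openin (top_of_set (log_cover A K)) (sheet A K x\<^sub>0 \<times> {0})"
proof -
  have "sheet A K x\<^sub>0 \<subseteq> log_domain A K" by (auto simp: sheet_def)
  then have "openin (top_of_set (log_domain A K)) (sheet A K x\<^sub>0)"
    using open_sheet[OF assms] by (auto simp: openin_open)
  then show ?thesis by (intro openin_Times) auto
qed

lemma local_section_log_cover:
  fixes A :: "(real^'n::finite) set"
  assumes "open A" "x\<^sub>0 \<in> log_domain A K"
  shows "local_section (log_cover A K) (cover_proj K) (x\<^sub>0, 0)
     (slit_domain A K (partial_exp K x\<^sub>0)) (\<lambda>w. (log_section K x\<^sub>0 w, 0))"
  unfolding local_section_def cover_proj_def
proof (intro conjI exI[of _ "sheet A K x\<^sub>0 \<times> {0}"])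
  show "open (slit_domain A K (partial_exp K x\<^sub>0))"
    by (rule open_slit_domain[OF assms(1)]) (simp add: partial_exp_def)
  show "openin (top_of_set (log_cover A K)) (sheet A K x\<^sub>0 \<times> {0})"
    by (rule openin_sheet[OF assms(1)])
  show "(x\<^sub>0, 0) \<in> sheet A K x\<^sub>0 \<times> {0}" using assms(2) by (simp add: sheet_def)
qed (rule homeomorphism_Times_zero[OF homeomorphism_sheet])

lemma in_sheet_over_point:
  assumes w\<^sub>0: "w\<^sub>0 \<in> nonvanishing A K" and x: "x \<in> log_domain A K" "partial_exp K x \<in> slit_domain A K w\<^sub>0"
  obtains x\<^sub>0 where "partial_exp K x\<^sub>0 = w\<^sub>0" "x \<in> sheet A K x\<^sub>0"
proof
  let ?x\<^sub>0 = "\<chi> k. if k \<in> K then x $ k - Ln (exp (x $ k) / w\<^sub>0 $ k) else w\<^sub>0 $ k"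
  show "partial_exp K ?x\<^sub>0 = w\<^sub>0"
    using w\<^sub>0 by (auto simp: nonvanishing_def partial_exp_def vec_eq_iff exp_diff)
  have "\<bar>Im (Ln (exp (x $ k) / w\<^sub>0 $ k))\<bar> < pi" if "k \<in> K" for k
    using x(2) that by (intro abs_Im_Ln_less_pi) (auto simp: slit_domain_def partial_exp_def)
  then show "x \<in> sheet A K ?x\<^sub>0" using x(1) by (auto simp: sheet_def)
qed

lemma sheet_unique:
  assumes x: "x \<in> sheet A K y" "x \<in> sheet A K y'" and eq: "partial_exp K y = partial_exp K y'"
  shows "y = y'"
proof -
  have coord: "(if k \<in> K then exp (y $ k) else y $ k) = (if k \<in> K then exp (y' $ k) else y' $ k)" for k
    using arg_cong[OF eq, of "\<lambda>v. v $ k"] by (simp add: partial_exp_def)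
  have "y $ k = y' $ k" for k
  proof (cases "k \<in> K")
    case True
    have "\<bar>Im (x $ k - y $ k)\<bar> < pi" "\<bar>Im (x $ k - y' $ k)\<bar> < pi" using x True by (auto simp: sheet_def)
    then have "\<bar>Im (y $ k) - Im (y' $ k)\<bar> < 2 * pi" by (simp add: abs_less_iff)
    moreover have "exp (y $ k) = exp (y' $ k)" using coord[of k] True by simp
    ultimately show ?thesis by (rule exp_complex_eqI)
  next
    case False
    then show ?thesis using coord[of k] by simp
  qed
  then show ?thesis by (simp add: vec_eq_iff)
qed

lemma Union_sheets:
  assumes "w\<^sub>0 \<in> nonvanishing A K"
  shows "\<Union>{sheet A K x\<^sub>0 \<times> {0} | x\<^sub>0. partial_exp K x\<^sub>0 = w\<^sub>0} =
    log_cover A K \<inter> cover_proj K -` slit_domain A K w\<^sub>0" (is "\<Union>?sheets = ?preimage")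
proof (intro equalityI subsetI)
  fix p assume "p \<in> \<Union>?sheets"
  then obtain x x\<^sub>0 where "p = (x, 0)" "x \<in> sheet A K x\<^sub>0" "partial_exp K x\<^sub>0 = w\<^sub>0" by blast
  then show "p \<in> ?preimage"
    using partial_exp_sheet_in_slit_domain[of x A K x\<^sub>0] by (auto simp: cover_proj_def sheet_def)
next
  fix p assume "p \<in> ?preimage"
  then obtain x where x: "p = (x, 0)" "x \<in> log_domain A K" "partial_exp K x \<in> slit_domain A K w\<^sub>0"
    by (auto simp: cover_proj_def)
  from in_sheet_over_point[OF assms x(2,3)] obtain x\<^sub>0 where "partial_exp K x\<^sub>0 = w\<^sub>0" "x \<in> sheet A K x\<^sub>0" .
  then show "p \<in> \<Union>?sheets" using x(1) by blast
qed

lemma pairwise_disjnt_sheets: "pairwise disjnt {sheet A K x\<^sub>0 \<times> {0} | x\<^sub>0. partial_exp K x\<^sub>0 = w\<^sub>0}"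
proof (rule pairwiseI)
  let ?sheets = "{sheet A K x\<^sub>0 \<times> {0} | x\<^sub>0. partial_exp K x\<^sub>0 = w\<^sub>0}"
  fix u u' assume "u \<in> ?sheets" "u' \<in> ?sheets" "u \<noteq> u'"
  then obtain y y' where y: "u = sheet A K y \<times> {0}" "partial_exp K y = w\<^sub>0"
    and y': "u' = sheet A K y' \<times> {0}" "partial_exp K y' = w\<^sub>0" by blast
  then have "y \<noteq> y'" using \<open>u \<noteq> u'\<close> by auto
  then have "sheet A K y \<inter> sheet A K y' = {}" using sheet_unique[of _ A K y y'] y(2) y'(2) by auto
  then show "disjnt u u'" unfolding y(1) y'(1) disjnt_def by auto
qed

lemma covering_space_log_cover:
  fixes A :: "(real^'n::finite) set"
  assumes "open A"
  shows "covering_space (log_cover A K) (cover_proj K) (nonvanishing A K)"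
proof
  show "continuous_on (log_cover A K) (cover_proj K)" by (rule continuous_on_cover_proj)
  show "cover_proj K ` log_cover A K = nonvanishing A K"
    unfolding partial_exp_image_log_domain[symmetric] by (force simp: cover_proj_def)
next
  fix w\<^sub>0 assume w\<^sub>0: "w\<^sub>0 \<in> nonvanishing A K"
  let ?T = "slit_domain A K w\<^sub>0" and ?sheets = "{sheet A K x\<^sub>0 \<times> {0::complex^'n} | x\<^sub>0. partial_exp K x\<^sub>0 = w\<^sub>0}"
  have "open ?T" using w\<^sub>0 by (intro open_slit_domain assms) (auto simp: nonvanishing_def)
  moreover have "?T \<subseteq> nonvanishing A K" by (auto simp: slit_domain_def nonvanishing_def)
  ultimately have "openin (top_of_set (nonvanishing A K)) ?T" by (auto simp: openin_open)
  moreover have "w\<^sub>0 \<in> ?T" using w\<^sub>0 by (auto simp: slit_domain_def nonvanishing_def)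
  moreover have "\<Union>?sheets = log_cover A K \<inter> cover_proj K -` ?T" by (rule Union_sheets[OF w\<^sub>0])
  moreover have "\<forall>u\<in>?sheets. openin (top_of_set (log_cover A K)) u"
    using openin_sheet[OF assms] by blast
  moreover have "pairwise disjnt ?sheets" by (rule pairwise_disjnt_sheets)
  moreover have "\<forall>u\<in>?sheets. \<exists>q. homeomorphism u ?T (cover_proj K) q"
    using homeomorphism_Times_zero[OF homeomorphism_sheet] unfolding cover_proj_def by blast
  ultimately show "\<exists>T. w\<^sub>0 \<in> T \<and> openin (top_of_set (nonvanishing A K)) T \<and>
     (\<exists>v. \<Union>v = log_cover A K \<inter> cover_proj K -` T \<and>
        (\<forall>u\<in>v. openin (top_of_set (log_cover A K)) u) \<and> pairwise disjnt v \<and>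
        (\<forall>u\<in>v. \<exists>q. homeomorphism u T (cover_proj K) q))"
    by blast
qed

subsection \<open>The points with nonzero coordinates\<close>

lemma closure_nonzero_coordinates: "closure {x :: complex^'n::finite. \<forall>k. x $ k \<noteq> 0} = UNIV"
proof -
  have "x \<in> closure {x. \<forall>k. x $ k \<noteq> 0}" for x :: "complex^'n"
    unfolding closure_sequential
  proof (intro exI conjI allI)
    let ?y = "\<lambda>n. \<chi> k. if x $ k = 0 then complex_of_real (inverse (real (Suc n))) else x $ k"
    show "?y n \<in> {x. \<forall>k. x $ k \<noteq> 0}" for n by (auto simp del: of_nat_Suc)
    show "?y \<longlonglongrightarrow> x"
    proof (rule vec_tendstoI)
      fix k
      have "(\<lambda>n. complex_of_real (inverse (real (Suc n)))) \<longlonglongrightarrow> of_real 0"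
        by (intro tendsto_of_real LIMSEQ_inverse_real_of_nat)
      then show "(\<lambda>n. ?y n $ k) \<longlonglongrightarrow> x $ k"
        by (cases "x $ k = 0") (simp_all del: of_nat_Suc of_real_inverse)
    qed
  qed
  then show ?thesis by blast
qed

definition log_domain_nonzero :: "(real^'n::finite) set \<Rightarrow> 'n set \<Rightarrow> (complex^'n) set" where
  "log_domain_nonzero A K = {x \<in> log_domain A K. \<forall>k. k \<notin> K \<longrightarrow> x $ k \<noteq> 0}"

lemma log_domain_subset_closure_nonzero:
  assumes "open A"
  shows "log_domain A K \<subseteq> closure (log_domain_nonzero A K)"
proof -
  have "log_domain A K \<subseteq> closure (log_domain A K \<inter> {x. \<forall>k. x $ k \<noteq> 0})"
    using open_Int_closure_subset[OF open_log_domain[OF assms], of K "{x. \<forall>k. x $ k \<noteq> 0}"]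
    by (simp add: closure_nonzero_coordinates)
  also have "\<dots> \<subseteq> closure (log_domain_nonzero A K)"
    by (rule closure_mono) (auto simp: log_domain_nonzero_def)
  finally show ?thesis .
qed

lemma log_domain_nonzero_eq: "log_domain_nonzero A K = partial_exp (- K) ` log_domain A UNIV"
proof (intro equalityI subsetI)
  fix x assume x: "x \<in> log_domain_nonzero A K"
  let ?y = "\<chi> k. if k \<in> K then x $ k else Ln (x $ k)"
  have "partial_exp (- K) ?y = x" "partial_exp UNIV ?y = partial_exp K x"
    using x by (auto simp: log_domain_nonzero_def partial_exp_def vec_eq_iff)
  then show "x \<in> partial_exp (- K) ` log_domain A UNIV"
    using x by (intro image_eqI[of _ _ ?y]) (auto simp: log_domain_nonzero_def log_domain_def)
next
  fix x assume "x \<in> partial_exp (- K) ` log_domain A UNIV"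
  then obtain y where y: "x = partial_exp (- K) y" "y \<in> log_domain A UNIV" by blast
  have "partial_exp K x = partial_exp UNIV y" by (auto simp: y partial_exp_def vec_eq_iff)
  then show "x \<in> log_domain_nonzero A K"
    using y by (auto simp: log_domain_nonzero_def log_domain_def) (simp add: partial_exp_def)
qed

lemma connected_log_domain_nonzero:
  fixes A :: "(real^'n::finite) set"
  assumes "open A" "convex A" "0 \<in> A"
  shows "connected (log_domain_nonzero A K)"
proof -
  have "((\<lambda>t. t *\<^sub>R (1 :: real^'n)) \<longlongrightarrow> 0 *\<^sub>R 1) (at_right 0)" by (intro tendsto_intros)
  then have "\<forall>\<^sub>F t in at_right 0. t *\<^sub>R (1 :: real^'n) \<in> A"
    using topological_tendstoD[OF _ \<open>open A\<close>] \<open>0 \<in> A\<close> by simp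
  then have "\<forall>\<^sub>F t in at_right (0::real). t > 0 \<and> t *\<^sub>R (1 :: real^'n) \<in> A"
    using eventually_at_right_less by eventually_elim simp
  then obtain t :: real where t: "t > 0" "t *\<^sub>R (1 :: real^'n) \<in> A"
    using eventually_happens[of _ "at_right (0::real)"] by (auto simp: trivial_limit_at_right_real)
  have "contractible (log_domain A UNIV)"
    by (rule contractible_log_domain[OF \<open>convex A\<close> t(2)]) (simp add: t(1))
  then show ?thesis
    unfolding log_domain_nonzero_eq
    by (intro connected_continuous_image[OF continuous_on_partial_exp] contractible_imp_connected)
qed

subsection \<open>Groups of phases\<close>

lemma log_phase_over_phase:
  fixes x y :: "complex^'n::finite"
  assumes "partial_exp K y = phase \<beta> (partial_exp K x)"
  shows "\<exists>\<alpha>. (\<forall>k. \<exists>m::int. \<alpha> $ k - \<beta> $ k = 2 * pi * of_int m) \<and> y = log_phase K \<alpha> x"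
proof -
  have coord: "(if k \<in> K then exp (y $ k) else y $ k) =
      exp (\<i> * complex_of_real (\<beta> $ k)) * (if k \<in> K then exp (x $ k) else x $ k)" for k
    using arg_cong[OF assms, of "\<lambda>v. v $ k"] by (simp add: partial_exp_def phase_def)
  have "\<exists>m::int. y $ k = x $ k + \<i> * complex_of_real (\<beta> $ k) + (of_int (2 * m) * pi) * \<i>" if "k \<in> K" for k
  proof -
    have "exp (y $ k) = exp (x $ k + \<i> * complex_of_real (\<beta> $ k))"
      using coord[of k] that by (simp add: exp_add)
    then show ?thesis unfolding exp_eq by simp
  qed
  then obtain m :: "'n \<Rightarrow> int" where
    m: "\<And>k. k \<in> K \<Longrightarrow> y $ k = x $ k + \<i> * complex_of_real (\<beta> $ k) + (of_int (2 * m k) * pi) * \<i>"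
    by metis
  let ?\<alpha> = "\<chi> k. \<beta> $ k + (if k \<in> K then 2 * pi * of_int (m k) else 0)"
  have "\<exists>n::int. ?\<alpha> $ k - \<beta> $ k = 2 * pi * of_int n" for k
    by (auto intro: exI[of _ 0])
  moreover have "y $ k = log_phase K ?\<alpha> x $ k" for k
    using m[of k] coord[of k] by (cases "k \<in> K") (simp_all add: log_phase_def algebra_simps)
  then have "y = log_phase K ?\<alpha> x" by (simp add: vec_eq_iff)
  ultimately show ?thesis by blast
qed

definition deck_act :: "'n set \<Rightarrow> real^'n::finite \<Rightarrow> (complex^'n) \<times> (complex^'n) \<Rightarrow> (complex^'n) \<times> (complex^'n)" where
  "deck_act K \<alpha> p = (log_phase K \<alpha> (fst p), 0)"

lemma cover_proj_deck_act: "cover_proj K (deck_act K \<alpha> p) = phase \<alpha> (cover_proj K p)"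
  by (simp add: cover_proj_def deck_act_def partial_exp_log_phase)

lemma deck_act_in_log_cover: "p \<in> log_cover A K \<Longrightarrow> deck_act K \<alpha> p \<in> log_cover A K"
  by (auto simp: deck_act_def log_phase_in_log_domain_iff)

lemma continuous_on_deck_act: "continuous_on C (deck_act K \<alpha>)"
  unfolding deck_act_def[abs_def]
  by (intro continuous_intros continuous_on_compose2[OF continuous_on_log_phase[of UNIV]]) auto

locale phase_group =
  fixes A :: "(real^'n::finite) set" and S :: "(real^'n) set"
  assumes open_A: "open A" and convex_A: "convex A" and zero_in_A: "0 \<in> A"
    and S_zero: "0 \<in> S" and S_diff: "\<And>\<alpha> \<beta>. \<alpha> \<in> S \<Longrightarrow> \<beta> \<in> S \<Longrightarrow> \<alpha> - \<beta> \<in> S"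
    and S_period: "\<And>\<alpha> \<beta>. \<alpha> \<in> S \<Longrightarrow> (\<And>k. \<exists>m::int. \<beta> $ k - \<alpha> $ k = 2 * pi * of_int m) \<Longrightarrow> \<beta> \<in> S"
begin

lemma S_minus: "\<alpha> \<in> S \<Longrightarrow> - \<alpha> \<in> S"
  using S_diff[OF S_zero] by force

lemma S_add: "\<alpha> \<in> S \<Longrightarrow> \<beta> \<in> S \<Longrightarrow> \<alpha> + \<beta> \<in> S"
  using S_diff[of \<alpha> "- \<beta>"] S_minus by force

lemma abelian_action_phase: "abelian_action S phase (reinhardt A)"
  by unfold_locales (auto simp: S_zero S_add S_minus phase_in_reinhardt_iff phase_add)

lemma is_model_reinhardt:
  assumes "regularity reg"
  shows "is_model reg (reinhardt A) id (transformations S phase (reinhardt A))"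
proof (rule is_model_transformations[OF abelian_action_phase])
  show "contractible (reinhardt A)"
    using contractible_log_domain[OF convex_A zero_in_A, of "{}"] by simp
  show "reinhardt A \<noteq> {}" using log_domain_nonempty[OF zero_in_A, of "{}"] by simp
  show "log_domain_nonzero A {} \<subseteq> reinhardt A" by (auto simp: log_domain_nonzero_def)
  show "connected (log_domain_nonzero A {})"
    by (rule connected_log_domain_nonzero[OF open_A convex_A zero_in_A])
  show "reinhardt A \<subseteq> closure (log_domain_nonzero A {})"
    using log_domain_subset_closure_nonzero[OF open_A, of "{}"] by simp
  show "manifold_map reg (reinhardt A) id (reinhardt A) id (restrict (phase \<alpha>) (reinhardt A))" for \<alpha>
  proof (rule manifold_map_open_id[OF open_reinhardt[OF open_A]])
    have "reg (reinhardt A) (phase \<alpha>)"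
      by (rule regularity_complex_linear[OF assms open_reinhardt[OF open_A]
            bounded_linear.linear[OF bounded_linear_phase] phase_vector_smult])
    then show "reg (reinhardt A) (restrict (phase \<alpha>) (reinhardt A))"
      by (rule regularity_cong[OF assms open_reinhardt[OF open_A], rotated]) simp
    show "continuous_on (reinhardt A) (restrict (phase \<alpha>) (reinhardt A))"
      by (simp add: linear_continuous_on bounded_linear_phase cong: continuous_on_cong)
  qed (auto simp: phase_in_reinhardt_iff)
  show "phase \<alpha> y = y" if "x \<in> log_domain_nonzero A {}" "phase \<alpha> x = x" for \<alpha> x y
  proof -
    have "exp (\<i> * complex_of_real (\<alpha> $ k)) = 1" for k
      using that by (simp add: log_domain_nonzero_def phase_def vec_eq_iff)
    then show ?thesis by (simp add: phase_def vec_eq_iff)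
  qed
qed

lemma abelian_action_deck_act: "abelian_action S (deck_act K) (log_cover A K)"
  by unfold_locales
     (auto simp: S_zero S_add S_minus deck_act_def log_phase_in_log_domain_iff log_phase_add)

lemma manifold_map_deck_act:
  assumes reg: "regularity reg" and l: "\<And>p. p \<in> log_cover A K \<Longrightarrow> l p = deck_act K \<alpha> p"
  shows "manifold_map reg (log_cover A K) (cover_proj K) (log_cover A K) (cover_proj K) l"
  unfolding manifold_map_def
proof (intro conjI ballI)
  show "l ` log_cover A K \<subseteq> log_cover A K" using l by (auto simp: deck_act_def log_phase_in_log_domain_iff)
  show "continuous_on (log_cover A K) l"
    by (rule continuous_on_eq[OF continuous_on_deck_act]) (simp add: l)
  fix p assume "p \<in> log_cover A K"
  then obtain x\<^sub>0 where x\<^sub>0: "p = (x\<^sub>0, 0)" "x\<^sub>0 \<in> log_domain A K" by auto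
  let ?T = "slit_domain A K (partial_exp K x\<^sub>0)" and ?s = "\<lambda>w. (log_section K x\<^sub>0 w, 0::complex^'n)"
  have local_sec: "local_section (log_cover A K) (cover_proj K) p ?T ?s"
    unfolding x\<^sub>0(1) by (rule local_section_log_cover[OF open_A x\<^sub>0(2)])
  then have "open ?T" by (simp add: local_section_def)
  then have "reg ?T (phase \<alpha>)"
    by (rule regularity_complex_linear[OF reg _ bounded_linear.linear[OF bounded_linear_phase] phase_vector_smult])
  then have "reg ?T (cover_proj K \<circ> l \<circ> ?s)"
  proof (rule regularity_cong[OF reg \<open>open ?T\<close>, rotated])
    fix w assume w: "w \<in> ?T"
    have "?s w \<in> log_cover A K" "cover_proj K (?s w) = w"
      using log_section_in_sheet[OF w] partial_exp_log_section[OF w] by (auto simp: sheet_def cover_proj_def)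
    then show "phase \<alpha> w = (cover_proj K \<circ> l \<circ> ?s) w" by (simp add: l cover_proj_deck_act)
  qed
  then show "\<exists>T s. local_section (log_cover A K) (cover_proj K) p T s \<and> reg T (cover_proj K \<circ> l \<circ> s)"
    using local_sec by blast
qed

lemma lift_of_phase_is_deck_act:
  assumes conn: "connected (log_cover A K)" and nonempty: "log_domain A K \<noteq> {}" and "\<beta> \<in> S"
    and l: "continuous_on (log_cover A K) l" "l ` log_cover A K \<subseteq> log_cover A K"
    and lifts: "\<And>p. p \<in> log_cover A K \<Longrightarrow> cover_proj K (l p) = phase \<beta> (cover_proj K p)"
  obtains \<alpha> where "\<alpha> \<in> S" "\<And>p. p \<in> log_cover A K \<Longrightarrow> l p = deck_act K \<alpha> p"
proof -
  obtain x\<^sub>0 where x\<^sub>0: "x\<^sub>0 \<in> log_domain A K" using nonempty by blast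
  then obtain y where y: "l (x\<^sub>0, 0) = (y, 0)" using l(2) by blast
  have "partial_exp K y = phase \<beta> (partial_exp K x\<^sub>0)"
    using lifts[of "(x\<^sub>0, 0)"] x\<^sub>0 y by (simp add: cover_proj_def)
  from log_phase_over_phase[OF this] obtain \<alpha>
    where \<alpha>: "\<And>k. \<exists>m::int. \<alpha> $ k - \<beta> $ k = 2 * pi * of_int m" "y = log_phase K \<alpha> x\<^sub>0" by blast
  show ?thesis
  proof
    show "\<alpha> \<in> S" by (rule S_period[OF \<open>\<beta> \<in> S\<close> \<alpha>(1)])
    fix p assume p: "p \<in> log_cover A K"
    show "l p = deck_act K \<alpha> p"
    proof (rule covering_space_lift_unique[OF covering_space_log_cover[OF open_A], of l "(x\<^sub>0, 0)"
          "deck_act K \<alpha>" "log_cover A K" "\<lambda>p. phase \<beta> (cover_proj K p)" K])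
      show "l (x\<^sub>0, 0) = deck_act K \<alpha> (x\<^sub>0, 0)" by (simp add: y \<alpha>(2) deck_act_def)
      show "continuous_on (log_cover A K) (\<lambda>p. phase \<beta> (cover_proj K p))"
        by (rule continuous_on_compose2[OF linear_continuous_on[OF bounded_linear_phase, of UNIV]
              continuous_on_cover_proj]) simp
      show "(\<lambda>p. phase \<beta> (cover_proj K p)) \<in> log_cover A K \<rightarrow> nonvanishing A K"
        by (auto simp: cover_proj_def nonvanishing_def log_domain_def phase_in_reinhardt_iff)
           (simp add: phase_def partial_exp_def)
      show "phase \<beta> (cover_proj K p) = cover_proj K (deck_act K \<alpha> p)" for p
        by (simp add: cover_proj_deck_act phase_periodic[OF \<alpha>(1)])
    qed (use l lifts conn x\<^sub>0 p in \<open>auto simp: continuous_on_deck_act deck_act_in_log_cover\<close>)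
  qed
qed

lemma deck_act_in_cover_group:
  assumes "\<alpha> \<in> S"
  shows "restrict (deck_act K \<alpha>) (log_cover A K) \<in>
    cover_group (log_cover A K) (cover_proj K) (transformations S phase (reinhardt A))"
proof -
  interpret abelian_action S "deck_act K" "log_cover A K" by (rule abelian_action_deck_act)
  let ?C = "log_cover A K" and ?l = "restrict (deck_act K \<alpha>) (log_cover A K)"
  have bij: "bij_betw ?l ?C ?C" using bij_betw_act[OF assms] by (simp cong: bij_betw_cong)
  have "inv_into ?C ?l p = deck_act K (- \<alpha>) p" if p: "p \<in> ?C" for p
    by (rule inv_into_f_eq[OF bij_betw_imp_inj_on[OF bij]])
       (use p act_closed[OF minus[OF assms] p] act_inverse(2)[OF p] in \<open>auto simp del: mem_Sigma_iff\<close>)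
  then have "manifold_iso smooth_on ?C (cover_proj K) ?C (cover_proj K) ?l"
    unfolding manifold_iso_def using bij
    by (intro conjI manifold_map_deck_act[where \<alpha>=\<alpha>] manifold_map_deck_act[where \<alpha>="- \<alpha>"])
       (auto simp: regularity_def)
  moreover have "cover_proj K (?l u) = restrict (phase \<alpha>) (reinhardt A) (cover_proj K u)" if "u \<in> ?C" for u
    using that by (auto simp: cover_proj_deck_act) (auto simp: cover_proj_def log_domain_def)
  ultimately show ?thesis
    using act_in_Bij[OF assms] assms unfolding cover_group_def transformations_def by blast
qed

lemma cover_group_eq:
  assumes "s \<in> A" and s: "\<And>k. if k \<in> K then s $ k > 0 else s $ k = 0"
  shows "cover_group (log_cover A K) (cover_proj K) (transformations S phase (reinhardt A)) =
    transformations S (deck_act K) (log_cover A K)"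
proof (intro equalityI subsetI)
  let ?C = "log_cover A K"
  fix l assume "l \<in> cover_group ?C (cover_proj K) (transformations S phase (reinhardt A))"
  then obtain \<beta> where l: "l \<in> Bij ?C" "manifold_iso smooth_on ?C (cover_proj K) ?C (cover_proj K) l" "\<beta> \<in> S"
    and lifts: "\<And>u. u \<in> ?C \<Longrightarrow> cover_proj K (l u) = restrict (phase \<beta>) (reinhardt A) (cover_proj K u)"
    by (auto simp: cover_group_def transformations_def)
  have "connected ?C"
    using contractible_imp_connected[OF contractible_log_domain[OF convex_A assms]]
    by (intro connected_Times) auto
  moreover have "log_domain A K \<noteq> {}" by (rule log_domain_nonempty[OF assms])
  moreover have "continuous_on ?C l" "l ` ?C \<subseteq> ?C"
    using l(2) by (auto simp: manifold_iso_def manifold_map_def)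
  moreover have "cover_proj K (l u) = phase \<beta> (cover_proj K u)" if "u \<in> ?C" for u
    using lifts[OF that] that by (auto simp: cover_proj_def log_domain_def)
  ultimately obtain \<alpha> where \<alpha>: "\<alpha> \<in> S" "\<And>p. p \<in> ?C \<Longrightarrow> l p = deck_act K \<alpha> p"
    using lift_of_phase_is_deck_act[OF _ _ l(3)] by blast
  then have "l = restrict (deck_act K \<alpha>) ?C"
    using l(1) by (auto simp: Bij_def extensional_def fun_eq_iff)
  then show "l \<in> transformations S (deck_act K) ?C" using \<alpha>(1) by (auto simp: transformations_def)
qed (auto simp: transformations_def[of S "deck_act K"] deck_act_in_cover_group)

lemma is_model_log_cover:
  assumes reg: "regularity reg" and "s \<in> A" and s: "\<And>k. if k \<in> K then s $ k > 0 else s $ k = 0"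
  shows "is_model reg (log_cover A K) (cover_proj K)
    (cover_group (log_cover A K) (cover_proj K) (transformations S phase (reinhardt A)))"
  unfolding cover_group_eq[OF \<open>s \<in> A\<close> s]
proof (rule is_model_transformations[OF abelian_action_deck_act])
  let ?F = "log_domain_nonzero A K \<times> {0::complex^'n}"
  show "contractible (log_cover A K)"
    using contractible_log_domain[OF convex_A \<open>s \<in> A\<close> s] by (intro contractible_Times) auto
  show "log_cover A K \<noteq> {}" using log_domain_nonempty[OF \<open>s \<in> A\<close> s] by auto
  show "?F \<subseteq> log_cover A K" by (auto simp: log_domain_nonzero_def)
  show "connected ?F"
    using connected_log_domain_nonzero[OF open_A convex_A zero_in_A] by (intro connected_Times) auto
  show "log_cover A K \<subseteq> closure ?F"
    using log_domain_subset_closure_nonzero[OF open_A] by (auto simp: closure_Times)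
  show "manifold_map reg (log_cover A K) (cover_proj K) (log_cover A K) (cover_proj K)
      (restrict (deck_act K \<alpha>) (log_cover A K))" for \<alpha>
    by (rule manifold_map_deck_act[OF reg]) simp
  show "deck_act K \<alpha> q = q" if p: "p \<in> ?F" and "deck_act K \<alpha> p = p" "q \<in> log_cover A K" for \<alpha> p q
  proof -
    obtain x where x: "p = (x, 0)" "x \<in> log_domain_nonzero A K" using p by blast
    then have "log_phase K \<alpha> x = x" using that(2) by (simp add: deck_act_def)
    with x(2) have "log_phase K \<alpha> y $ k = y $ k" for y k
      by (cases "k \<in> K") (auto simp: log_domain_nonzero_def log_phase_def vec_eq_iff split: if_splits)
    then show ?thesis using that(3) by (auto simp: deck_act_def vec_eq_iff)
  qed
qed

end

section \<open>Quasifold atlases from slices\<close>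

subsection \<open>The exponential action\<close>

text \<open>For \<open>\<kappa> = 1\<close> this is the identity and for \<open>\<kappa> = 0\<close> the projection to the imaginary axis; this
  distinguishes the complexified group \<open>N\<^sub>\<complex>\<close> from the compact one.\<close>

definition im_proj :: "real \<Rightarrow> complex \<Rightarrow> complex" where
  "im_proj \<kappa> x = Complex (\<kappa> * Re x) (Im x)"

definition exp_act :: "complex^'d::finite \<Rightarrow> complex^'d \<Rightarrow> complex^'d" where
  "exp_act \<zeta> z = (\<chi> j. exp (\<zeta> $ j) * z $ j)"

definition exp_group :: "('d::finite \<Rightarrow> 'a::euclidean_space) \<Rightarrow> 'a set \<Rightarrow> real \<Rightarrow> (complex^'d) set" where
  "exp_group X Q \<kappa> = {\<zeta>. (\<forall>j. im_proj \<kappa> (\<zeta> $ j) = \<zeta> $ j) \<and>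
     (\<Sum>j\<in>UNIV. Re (\<zeta> $ j) *\<^sub>R X j) = 0 \<and> (\<Sum>j\<in>UNIV. (Im (\<zeta> $ j) / (2 * pi)) *\<^sub>R X j) \<in> Q}"

definition exp_orbit ::
    "('d::finite \<Rightarrow> 'a::euclidean_space) \<Rightarrow> 'a set \<Rightarrow> real \<Rightarrow> complex^'d \<Rightarrow> (complex^'d) set" where
  "exp_orbit X Q \<kappa> z = (\<lambda>\<zeta>. exp_act \<zeta> z) ` exp_group X Q \<kappa>"

lemma exp_act_zero [simp]: "exp_act 0 z = z"
  by (simp add: exp_act_def vec_eq_iff)

lemma exp_act_add: "exp_act (\<zeta> + \<zeta>') z = exp_act \<zeta> (exp_act \<zeta>' z)"
  by (simp add: exp_act_def vec_eq_iff exp_add)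

lemma exp_act_minus [simp]: "exp_act (- \<zeta>) (exp_act \<zeta> z) = z" "exp_act \<zeta> (exp_act (- \<zeta>) z) = z"
  by (simp_all flip: exp_act_add)

lemma continuous_on_exp_act: "continuous_on S (exp_act \<zeta>)"
  unfolding exp_act_def by (intro continuous_intros)

lemma linear_im_proj: "linear (im_proj \<kappa>)"
  by (rule linearI) (auto simp: im_proj_def complex_eq_iff algebra_simps)

lemma bounded_linear_im_proj: "bounded_linear (im_proj \<kappa>)"
  using linear_im_proj by (simp add: linear_conv_bounded_linear)

lemma im_proj_0 [simp]: "im_proj \<kappa> 0 = 0"
  by (rule linear_0[OF linear_im_proj])

lemma im_proj_minus [simp]: "im_proj \<kappa> (- x) = - im_proj \<kappa> x"
  by (rule linear_neg[OF linear_im_proj])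

lemma im_proj_scale: "im_proj \<kappa> (complex_of_real a * z) = complex_of_real a * im_proj \<kappa> z"
  using linear_cmul[OF linear_im_proj, of \<kappa> a z] by (simp add: scaleR_conv_of_real)

lemma im_proj_one [simp]: "im_proj 1 = id"
  by (auto simp: im_proj_def fun_eq_iff complex_eq_iff)

lemma exp_minus_im_proj: "exp (x - im_proj \<kappa> x) = complex_of_real (exp ((1 - \<kappa>) * Re x))"
proof -
  have "x - im_proj \<kappa> x = complex_of_real ((1 - \<kappa>) * Re x)"
    by (simp add: im_proj_def complex_eq_iff algebra_simps)
  then show ?thesis by (simp only: exp_of_real)
qed

subsection \<open>Frames of normals\<close>

definition frame_coeff ::
    "('d::finite \<Rightarrow> 'a::euclidean_space) \<Rightarrow> ('n::finite \<Rightarrow> 'd) \<Rightarrow> 'd \<Rightarrow> 'n \<Rightarrow> real" where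
  "frame_coeff X r h k = representation (X ` range r) (X h) (X (r k))"

text \<open>The element of the complexification of \<open>\<nn>\<close> with prescribed coordinates outside \<open>range r\<close>.\<close>

definition kernel_extend ::
    "('d::finite \<Rightarrow> 'a::euclidean_space) \<Rightarrow> ('n::finite \<Rightarrow> 'd) \<Rightarrow> ('d \<Rightarrow> complex) \<Rightarrow> complex^'d" where
  "kernel_extend X r f = (\<chi> j. if j \<in> range r
     then - (\<Sum>h\<in>- range r. complex_of_real (frame_coeff X r h (inv_into UNIV r j)) * f h) else f j)"

definition admissible_angles ::
    "('d::finite \<Rightarrow> 'a::euclidean_space) \<Rightarrow> 'a set \<Rightarrow> ('n::finite \<Rightarrow> 'd) \<Rightarrow> (real^'n) set" where
  "admissible_angles X Q r = {\<alpha>. (\<Sum>k\<in>UNIV. (\<alpha> $ k / (2 * pi)) *\<^sub>R X (r k)) \<in> Q}"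

definition angle_vec :: "('n::finite \<Rightarrow> 'd::finite) \<Rightarrow> real^'n \<Rightarrow> complex^'d" where
  "angle_vec r \<alpha> = (\<chi> j. if j \<in> range r then \<i> * complex_of_real (\<alpha> $ inv_into UNIV r j) else 0)"

lemma sum_UNIV_split_range:
  fixes g :: "'d::finite \<Rightarrow> 'b::comm_monoid_add"
  assumes "inj (r :: 'n::finite \<Rightarrow> 'd)"
  shows "(\<Sum>j\<in>UNIV. g j) = (\<Sum>k\<in>UNIV. g (r k)) + (\<Sum>h\<in>- range r. g h)"
proof -
  have "(\<Sum>j\<in>UNIV. g j) = (\<Sum>j\<in>range r \<union> - range r. g j)" by simp
  also have "\<dots> = (\<Sum>j\<in>range r. g j) + (\<Sum>h\<in>- range r. g h)"
    by (rule sum.union_disjoint) auto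
  also have "(\<Sum>j\<in>range r. g j) = (\<Sum>k\<in>UNIV. g (r k))"
    using sum.reindex[OF assms, of g] by simp
  finally show ?thesis .
qed

lemma kernel_extend_outside: "h \<notin> range r \<Longrightarrow> kernel_extend X r f $ h = f h"
  by (simp add: kernel_extend_def)

lemma kernel_extend_range:
  "inj r \<Longrightarrow> kernel_extend X r f $ r k = - (\<Sum>h\<in>- range r. complex_of_real (frame_coeff X r h k) * f h)"
  by (simp add: kernel_extend_def)

lemma kernel_extend_im_proj:
  assumes "\<And>h. im_proj \<kappa> (f h) = f h"
  shows "im_proj \<kappa> (kernel_extend X r f $ j) = kernel_extend X r f $ j"
  using assms by (simp add: kernel_extend_def linear_sum[OF linear_im_proj] im_proj_scale)

locale normal_frames =
  fixes X :: "'d::finite \<Rightarrow> 'a::euclidean_space" and Q :: "'a set" and R :: "('n::finite \<Rightarrow> 'd) set"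
  assumes Q_zero: "0 \<in> Q" and Q_diff: "\<And>x y. x \<in> Q \<Longrightarrow> y \<in> Q \<Longrightarrow> x - y \<in> Q" and X_in_Q: "\<And>j. X j \<in> Q"
    and inj_frame: "\<And>r. r \<in> R \<Longrightarrow> inj r"
    and indep_frame: "\<And>r t k. r \<in> R \<Longrightarrow> (\<Sum>k\<in>UNIV. t k *\<^sub>R X (r k)) = 0 \<Longrightarrow> t k = 0"
    and frame_expansion: "\<And>r h. r \<in> R \<Longrightarrow> X h = (\<Sum>k\<in>UNIV. frame_coeff X r h k *\<^sub>R X (r k))"
begin

lemma Q_minus: "x \<in> Q \<Longrightarrow> - x \<in> Q"
  using Q_diff[OF Q_zero] by force

lemma Q_add: "x \<in> Q \<Longrightarrow> y \<in> Q \<Longrightarrow> x + y \<in> Q"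
  using Q_diff[of x "- y"] Q_minus by force

lemma Q_sum: "(\<And>i. i \<in> I \<Longrightarrow> f i \<in> Q) \<Longrightarrow> sum f I \<in> Q"
  by (induction I rule: infinite_finite_induct) (auto intro: Q_zero Q_add)

lemma Q_of_int:
  assumes "x \<in> Q"
  shows "of_int m *\<^sub>R x \<in> Q"
proof -
  have "of_nat n *\<^sub>R x \<in> Q" for n
    by (induction n) (auto simp: algebra_simps intro: Q_zero Q_add assms)
  then show ?thesis
    using Q_minus by (cases m) (auto simp: scaleR_minus_left simp del: of_nat_Suc)
qed

lemma Q_sum_of_int: "(\<Sum>h\<in>I. of_int (m h) *\<^sub>R X h) \<in> Q"
  by (intro Q_sum Q_of_int X_in_Q)

lemma exp_group_zero: "0 \<in> exp_group X Q \<kappa>"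
  by (auto simp: exp_group_def Q_zero)

lemma exp_group_add: "\<zeta> \<in> exp_group X Q \<kappa> \<Longrightarrow> \<zeta>' \<in> exp_group X Q \<kappa> \<Longrightarrow> \<zeta> + \<zeta>' \<in> exp_group X Q \<kappa>"
  by (auto simp: exp_group_def linear_add[OF linear_im_proj] scaleR_add_left sum.distrib
      add_divide_distrib Q_add)

lemma exp_group_minus: "\<zeta> \<in> exp_group X Q \<kappa> \<Longrightarrow> - \<zeta> \<in> exp_group X Q \<kappa>"
  by (auto simp: exp_group_def sum_negf Q_minus)

lemma in_exp_orbit: "z \<in> exp_orbit X Q \<kappa> z"
  using exp_group_zero by (force simp: exp_orbit_def)

lemma exp_orbit_act:
  assumes "\<zeta> \<in> exp_group X Q \<kappa>"
  shows "exp_orbit X Q \<kappa> (exp_act \<zeta> z) = exp_orbit X Q \<kappa> z"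
proof -
  have subset: "exp_orbit X Q \<kappa> (exp_act \<zeta> z) \<subseteq> exp_orbit X Q \<kappa> z" if "\<zeta> \<in> exp_group X Q \<kappa>" for \<zeta> z
    using exp_group_add that by (force simp: exp_orbit_def simp flip: exp_act_add)
  from subset[OF exp_group_minus[OF assms], of "exp_act \<zeta> z"] subset[OF assms, of z] show ?thesis
    by (simp add: subset_antisym)
qed

lemma exp_orbit_eq_iff:
  "exp_orbit X Q \<kappa> z = exp_orbit X Q \<kappa> z' \<longleftrightarrow> (\<exists>\<zeta>\<in>exp_group X Q \<kappa>. z' = exp_act \<zeta> z)"
proof
  assume "exp_orbit X Q \<kappa> z = exp_orbit X Q \<kappa> z'"
  then have "z' \<in> exp_orbit X Q \<kappa> z" using in_exp_orbit by simp
  then show "\<exists>\<zeta>\<in>exp_group X Q \<kappa>. z' = exp_act \<zeta> z" by (auto simp: exp_orbit_def)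
qed (auto simp: exp_orbit_act)

lemma exp_orbit_coset:
  "{exp_act \<xi> y | \<xi> y. \<xi> - \<zeta> \<in> exp_group X Q \<kappa> \<and> y \<in> exp_orbit X Q \<kappa> z} = exp_orbit X Q \<kappa> (exp_act \<zeta> z)"
proof (intro equalityI subsetI)
  fix p assume "p \<in> {exp_act \<xi> y | \<xi> y. \<xi> - \<zeta> \<in> exp_group X Q \<kappa> \<and> y \<in> exp_orbit X Q \<kappa> z}"
  then obtain \<xi> \<zeta>' where \<xi>: "\<xi> - \<zeta> \<in> exp_group X Q \<kappa>" "\<zeta>' \<in> exp_group X Q \<kappa>" "p = exp_act (\<xi> + \<zeta>') z"
    by (auto simp: exp_orbit_def exp_act_add)
  then have "p = exp_act ((\<xi> - \<zeta>) + \<zeta>') (exp_act \<zeta> z)" by (simp flip: exp_act_add add: algebra_simps)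
  then show "p \<in> exp_orbit X Q \<kappa> (exp_act \<zeta> z)"
    unfolding exp_orbit_def using exp_group_add[OF \<xi>(1,2)] by (rule image_eqI)
next
  fix p assume "p \<in> exp_orbit X Q \<kappa> (exp_act \<zeta> z)"
  then obtain \<zeta>' where "\<zeta>' \<in> exp_group X Q \<kappa>" "p = exp_act (\<zeta>' + \<zeta>) z"
    by (auto simp: exp_orbit_def exp_act_add)
  then show "p \<in> {exp_act \<xi> y | \<xi> y. \<xi> - \<zeta> \<in> exp_group X Q \<kappa> \<and> y \<in> exp_orbit X Q \<kappa> z}"
    using in_exp_orbit by (intro CollectI exI[of _ "\<zeta>' + \<zeta>"] exI[of _ z]) simp
qed

lemma sum_linear_kernel_extend:
  assumes r: "r \<in> R" and P: "linear P"
  shows "(\<Sum>j\<in>UNIV. (P (kernel_extend X r f $ j) :: real) *\<^sub>R X j) = 0"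
proof -
  have P_scale: "P (complex_of_real a * z) = a * P z" for a z
    using linear_cmul[OF P, of a z] by (simp add: scaleR_conv_of_real)
  have "(\<Sum>k\<in>UNIV. P (kernel_extend X r f $ r k) *\<^sub>R X (r k)) =
      - (\<Sum>k\<in>UNIV. \<Sum>h\<in>- range r. (P (f h) * frame_coeff X r h k) *\<^sub>R X (r k))"
    by (simp add: kernel_extend_range[OF inj_frame[OF r]] linear_neg[OF P] linear_sum[OF P] P_scale
        scaleR_sum_left sum_negf mult.commute[of "P _"])
  also have "\<dots> = - (\<Sum>h\<in>- range r. P (f h) *\<^sub>R (\<Sum>k\<in>UNIV. frame_coeff X r h k *\<^sub>R X (r k)))"
    by (subst sum.swap) (simp add: scaleR_sum_right)
  also have "\<dots> = - (\<Sum>h\<in>- range r. P (f h) *\<^sub>R X h)"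
    by (simp only: frame_expansion[OF r, symmetric])
  finally show ?thesis
    by (simp add: sum_UNIV_split_range[OF inj_frame[OF r]] kernel_extend_outside)
qed

lemma sum_Re_kernel_extend: "r \<in> R \<Longrightarrow> (\<Sum>j\<in>UNIV. Re (kernel_extend X r f $ j) *\<^sub>R X j) = 0"
  by (rule sum_linear_kernel_extend) (auto intro!: linearI)

lemma sum_Im_kernel_extend: "r \<in> R \<Longrightarrow> (\<Sum>j\<in>UNIV. Im (kernel_extend X r f $ j) *\<^sub>R X j) = 0"
  by (rule sum_linear_kernel_extend) (auto intro!: linearI)

lemma kernel_extend_in_exp_group:
  assumes r: "r \<in> R" and "\<And>h. im_proj \<kappa> (f h) = f h"
  shows "kernel_extend X r f \<in> exp_group X Q \<kappa>"
proof -
  have "(\<Sum>j\<in>UNIV. (Im (kernel_extend X r f $ j) / (2 * pi)) *\<^sub>R X j) =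
      (1 / (2 * pi)) *\<^sub>R (\<Sum>j\<in>UNIV. Im (kernel_extend X r f $ j) *\<^sub>R X j)"
    by (simp add: scaleR_sum_right)
  then show ?thesis
    using sum_Re_kernel_extend[OF r] sum_Im_kernel_extend[OF r] kernel_extend_im_proj[of \<kappa> f X r] assms(2) Q_zero
    by (auto simp: exp_group_def)
qed

lemma kernel_vec_eq_0:
  assumes r: "r \<in> R" and "(\<Sum>j\<in>UNIV. Re (\<zeta> $ j) *\<^sub>R X j) = 0" "(\<Sum>j\<in>UNIV. Im (\<zeta> $ j) *\<^sub>R X j) = 0"
    and outside: "\<And>h. h \<notin> range r \<Longrightarrow> \<zeta> $ h = 0"
  shows "\<zeta> = 0"
proof -
  have "(\<Sum>k\<in>UNIV. Re (\<zeta> $ r k) *\<^sub>R X (r k)) = 0" "(\<Sum>k\<in>UNIV. Im (\<zeta> $ r k) *\<^sub>R X (r k)) = 0"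
    using assms(2,3) outside by (auto simp: sum_UNIV_split_range[OF inj_frame[OF r]])
  from indep_frame[OF r this(1)] indep_frame[OF r this(2)] have "\<zeta> $ r k = 0" for k
    by (simp add: complex_eq_iff)
  then have "\<zeta> $ j = 0" for j using outside by (cases "j \<in> range r") auto
  then show ?thesis by (simp add: vec_eq_iff)
qed

lemma phase_group_admissible_angles:
  assumes "open A" "convex A" "0 \<in> A"
  shows "phase_group A (admissible_angles X Q r)"
proof
  show "0 \<in> admissible_angles X Q r" by (simp add: admissible_angles_def Q_zero)
  show "\<alpha> - \<beta> \<in> admissible_angles X Q r" if "\<alpha> \<in> admissible_angles X Q r" "\<beta> \<in> admissible_angles X Q r" for \<alpha> \<beta>
    using that Q_diff by (simp add: admissible_angles_def diff_divide_distrib scaleR_diff_left sum_subtractf)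
  show "\<beta> \<in> admissible_angles X Q r"
    if \<alpha>: "\<alpha> \<in> admissible_angles X Q r" and period: "\<And>k. \<exists>m::int. \<beta> $ k - \<alpha> $ k = 2 * pi * of_int m" for \<alpha> \<beta>
  proof -
    obtain m where m: "\<And>k. \<beta> $ k - \<alpha> $ k = 2 * pi * of_int (m k)" using period by metis
    have "\<beta> $ k / (2 * pi) = \<alpha> $ k / (2 * pi) + of_int (m k)" for k
      using m[of k] by (simp add: field_simps)
    then have "(\<Sum>k\<in>UNIV. (\<beta> $ k / (2 * pi)) *\<^sub>R X (r k)) =
        (\<Sum>k\<in>UNIV. (\<alpha> $ k / (2 * pi)) *\<^sub>R X (r k)) + (\<Sum>k\<in>UNIV. of_int (m k) *\<^sub>R X (r k))"
      by (simp add: scaleR_add_left sum.distrib)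
    then show ?thesis using \<alpha> by (auto simp: admissible_angles_def intro!: Q_add Q_sum Q_of_int X_in_Q)
  qed
qed (use assms in auto)

lemma angle_vec_in_exp_group:
  assumes r: "r \<in> R" and \<alpha>: "\<alpha> \<in> admissible_angles X Q r"
  shows "angle_vec r \<alpha> \<in> exp_group X Q \<kappa>"
proof -
  have "(\<Sum>j\<in>UNIV. (Im (angle_vec r \<alpha> $ j) / (2 * pi)) *\<^sub>R X j) = (\<Sum>k\<in>UNIV. (\<alpha> $ k / (2 * pi)) *\<^sub>R X (r k))"
    using inj_frame[OF r] by (simp add: sum_UNIV_split_range[OF inj_frame[OF r]] angle_vec_def)
  moreover have "Re (angle_vec r \<alpha> $ j) = 0" for j by (simp add: angle_vec_def)
  ultimately show ?thesis
    using \<alpha> by (auto simp: exp_group_def admissible_angles_def im_proj_def complex_eq_iff)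
qed

lemma exp_group_integral_outside_frame:
  assumes r: "r \<in> R" and \<zeta>: "\<zeta> \<in> exp_group X Q \<kappa>"
    and integral: "\<And>h. h \<notin> range r \<Longrightarrow> \<exists>m::int. \<zeta> $ h = 2 * complex_of_real pi * \<i> * of_int m"
  shows "\<exists>\<alpha>\<in>admissible_angles X Q r. \<forall>k. \<zeta> $ r k = \<i> * complex_of_real (\<alpha> $ k)"
proof (intro bexI allI)
  let ?\<alpha> = "\<chi> k. Im (\<zeta> $ r k)"
  obtain m :: "'d \<Rightarrow> int" where m: "\<And>h. h \<notin> range r \<Longrightarrow> \<zeta> $ h = 2 * complex_of_real pi * \<i> * of_int (m h)"
    using integral by metis
  have "(\<Sum>k\<in>UNIV. Re (\<zeta> $ r k) *\<^sub>R X (r k)) = 0"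
    using \<zeta> m by (simp add: exp_group_def sum_UNIV_split_range[OF inj_frame[OF r]])
  then have "Re (\<zeta> $ r k) = 0" for k by (rule indep_frame[OF r])
  then show "\<zeta> $ r k = \<i> * complex_of_real (?\<alpha> $ k)" for k by (simp add: complex_eq_iff)
  have "(\<Sum>k\<in>UNIV. (?\<alpha> $ k / (2 * pi)) *\<^sub>R X (r k)) =
      (\<Sum>j\<in>UNIV. (Im (\<zeta> $ j) / (2 * pi)) *\<^sub>R X j) - (\<Sum>h\<in>- range r. of_int (m h) *\<^sub>R X h)"
    using m by (simp add: sum_UNIV_split_range[OF inj_frame[OF r]])
  then show "?\<alpha> \<in> admissible_angles X Q r"
    using \<zeta> by (auto simp: admissible_angles_def exp_group_def intro!: Q_diff Q_sum_of_int)
qed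

end

subsection \<open>Slices and their charts\<close>

definition slice_point :: "('n::finite \<Rightarrow> 'd::finite) \<Rightarrow> real^'d \<Rightarrow> complex^'n \<Rightarrow> complex^'d" where
  "slice_point r a w = (\<chi> j. if j \<in> range r then w $ inv_into UNIV r j else complex_of_real (a $ j))"

lemma slice_point_range [simp]: "inj r \<Longrightarrow> slice_point r a w $ r k = w $ k"
  by (simp add: slice_point_def)

lemma slice_point_outside [simp]: "h \<notin> range r \<Longrightarrow> slice_point r a w $ h = complex_of_real (a $ h)"
  by (simp add: slice_point_def)

lemma select_slice_point [simp]: "inj r \<Longrightarrow> select_coords r (slice_point r a w) = w"
  by (simp add: select_coords_def vec_eq_iff)

locale quasi_slice = normal_frames X Q R
  for X :: "'d::finite \<Rightarrow> 'a::euclidean_space" and Q and R :: "('n::finite \<Rightarrow> 'd) set" +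
  fixes \<kappa> :: real and level :: "(complex^'d) set" and moduli :: "('n \<Rightarrow> 'd) \<Rightarrow> (real^'n) set"
    and height :: "('n \<Rightarrow> 'd) \<Rightarrow> complex^'n \<Rightarrow> real^'d"
    and reg :: "(complex^'n) set \<Rightarrow> (complex^'n \<Rightarrow> complex^'n) \<Rightarrow> bool"
  assumes kappa: "\<kappa> = 0 \<or> \<kappa> = 1"
    and level_invariant: "\<And>z \<zeta>. z \<in> level \<Longrightarrow> \<zeta> \<in> exp_group X Q \<kappa> \<Longrightarrow> exp_act \<zeta> z \<in> level"
    and slice_in_level: "\<And>r w. r \<in> R \<Longrightarrow> w \<in> reinhardt (moduli r) \<Longrightarrow> slice_point r (height r w) w \<in> level"
    and height_pos: "\<And>r w h. r \<in> R \<Longrightarrow> w \<in> reinhardt (moduli r) \<Longrightarrow> h \<notin> range r \<Longrightarrow> height r w $ h > 0"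
    and height_one: "\<And>r w h. \<kappa> = 1 \<Longrightarrow> height r w $ h = 1"
    and normalized_in_slice: "\<And>r z. r \<in> R \<Longrightarrow> z \<in> level \<Longrightarrow>
       (\<And>h. h \<notin> range r \<Longrightarrow> \<exists>t>0. z $ h = complex_of_real t \<and> (\<kappa> = 1 \<longrightarrow> t = 1)) \<Longrightarrow>
       select_coords r z \<in> reinhardt (moduli r) \<and>
       slice_point r (height r (select_coords r z)) (select_coords r z) = z"
    and open_moduli: "\<And>r. r \<in> R \<Longrightarrow> open (moduli r)" and convex_moduli: "\<And>r. r \<in> R \<Longrightarrow> convex (moduli r)"
    and zero_in_moduli: "\<And>r. r \<in> R \<Longrightarrow> 0 \<in> moduli r"
    and moduli_overlap: "\<And>r r'. r \<in> R \<Longrightarrow> r' \<in> R \<Longrightarrow>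
       \<exists>s\<in>moduli r. \<forall>k. if r k \<notin> range r' then s $ k > 0 else s $ k = 0"
    and level_cover: "\<And>z. z \<in> level \<Longrightarrow> \<exists>r\<in>R. \<forall>h. h \<notin> range r \<longrightarrow> z $ h \<noteq> 0"
    and height_smooth: "\<And>r h. r \<in> R \<Longrightarrow> smooth_on (reinhardt (moduli r)) (\<lambda>w. height r w $ h)"
    and reg_cases: "reg = smooth_on \<or> reg = holomorphic_map_on \<and> \<kappa> = 1"
begin

abbreviation "slice_dom r \<equiv> reinhardt (moduli r)"
abbreviation "slice r w \<equiv> slice_point r (height r w) w"
abbreviation "orbit \<equiv> exp_orbit X Q \<kappa>"
abbreviation "\<Gamma> r \<equiv> transformations (admissible_angles X Q r) phase (slice_dom r)"
abbreviation "orbit_space \<equiv> quotient_topology (top_of_set level) orbit"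

definition slice_chart :: "('n \<Rightarrow> 'd) \<Rightarrow> (complex^'n, (complex^'d) set) quasi_chart" where
  "slice_chart r =
     \<lparr>chart_dom = slice_dom r, chart_group = \<Gamma> r, chart_map = (\<lambda>S. the_elem ((\<lambda>w. orbit (slice r w)) ` S))\<rparr>"

lemma regularity_reg: "regularity reg"
  using reg_cases by (auto simp: regularity_def)

lemma phase_group_moduli: "r \<in> R \<Longrightarrow> phase_group (moduli r) (admissible_angles X Q r)"
  by (intro phase_group_admissible_angles open_moduli convex_moduli zero_in_moduli)

lemma abelian_action_slice_dom: "r \<in> R \<Longrightarrow> abelian_action (admissible_angles X Q r) phase (slice_dom r)"
  by (rule phase_group.abelian_action_phase[OF phase_group_moduli])

lemma open_slice_dom: "r \<in> R \<Longrightarrow> open (slice_dom r)"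
  by (simp add: open_reinhardt open_moduli)

lemma topspace_orbit_space: "topspace orbit_space = orbit ` level"
  by (simp add: topspace_quotient_topology)

lemma chart_dom_slice_chart [simp]: "chart_dom (slice_chart r) = slice_dom r"
  by (simp add: slice_chart_def)

lemma chart_group_slice_chart [simp]: "chart_group (slice_chart r) = \<Gamma> r"
  by (simp add: slice_chart_def)

lemma im_proj_idem: "im_proj \<kappa> (im_proj \<kappa> x) = im_proj \<kappa> x"
  using kappa by (auto simp: im_proj_def)

lemma im_proj_ln_height: "im_proj \<kappa> (complex_of_real (ln (height r w $ h))) = 0"
  using kappa height_one by (auto simp: im_proj_def complex_eq_iff)

lemma slice_phase:
  assumes r: "r \<in> R" and w: "w \<in> slice_dom r" and \<alpha>: "\<alpha> \<in> admissible_angles X Q r"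
  shows "slice r (phase \<alpha> w) = exp_act (angle_vec r \<alpha>) (slice r w)"
proof -
  let ?z = "exp_act (angle_vec r \<alpha>) (slice r w)"
  have select: "select_coords r ?z = phase \<alpha> w"
    using inj_frame[OF r] by (simp add: select_coords_def exp_act_def angle_vec_def phase_def vec_eq_iff)
  have "?z \<in> level" using level_invariant[OF slice_in_level[OF r w] angle_vec_in_exp_group[OF r \<alpha>]] .
  then have "slice r (select_coords r ?z) = ?z"
    by (rule normalized_in_slice[OF r, THEN conjunct2])
       (use height_pos[OF r w] height_one[of r w] in \<open>auto simp: exp_act_def angle_vec_def\<close>)
  then show ?thesis unfolding select by simp
qed

lemma orbit_slice_phase:
  assumes "r \<in> R" "w \<in> slice_dom r" "\<alpha> \<in> admissible_angles X Q r"
  shows "orbit (slice r (phase \<alpha> w)) = orbit (slice r w)"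
  unfolding slice_phase[OF assms] by (rule exp_orbit_act[OF angle_vec_in_exp_group[OF assms(1,3)]])

lemma chart_map_slice_chart:
  assumes "r \<in> R" "w \<in> slice_dom r"
  shows "chart_map (slice_chart r) (group_orbit (\<Gamma> r) w) = orbit (slice r w)"
proof -
  interpret abelian_action "admissible_angles X Q r" phase "slice_dom r"
    by (rule abelian_action_slice_dom[OF assms(1)])
  have "(\<lambda>w. orbit (slice r w)) ` group_orbit (\<Gamma> r) w = {orbit (slice r w)}"
    using orbit_slice_phase[OF assms] zero by (auto simp: group_orbit_transformations[OF assms(2)] image_image)
  then show ?thesis by (simp add: slice_chart_def)
qed

lemma integral_outside_frame:
  assumes r: "r \<in> R" and w: "w \<in> slice_dom r" "w' \<in> slice_dom r" and \<zeta>: "\<zeta> \<in> exp_group X Q \<kappa>"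
    and eq: "slice r w' = exp_act \<zeta> (slice r w)" and h: "h \<notin> range r"
  shows "\<exists>m::int. \<zeta> $ h = 2 * complex_of_real pi * \<i> * of_int m"
proof -
  have coord: "complex_of_real (height r w' $ h) = exp (\<zeta> $ h) * complex_of_real (height r w $ h)"
    using arg_cong[OF eq, of "\<lambda>z. z $ h"] h by (simp add: exp_act_def)
  have pos: "height r w $ h > 0" "height r w' $ h > 0" using height_pos[OF r _ h] w by auto
  have "height r w $ h = height r w' $ h"
  proof (cases "\<kappa> = 1")
    case False
    then have "Re (\<zeta> $ h) = 0" using \<zeta> kappa by (auto simp: exp_group_def im_proj_def complex_eq_iff)
    then have "cmod (exp (\<zeta> $ h)) = 1" by (simp add: norm_exp_eq_Re)
    then show ?thesis using arg_cong[OF coord, of cmod] pos by (simp add: norm_mult)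
  qed (simp add: height_one)
  then have "exp (\<zeta> $ h) = 1" using coord pos by simp
  then obtain m :: int where "Re (\<zeta> $ h) = 0" "Im (\<zeta> $ h) = of_int (2 * m) * pi" unfolding exp_eq_1 by blast
  then show ?thesis by (intro exI[of _ m]) (simp add: complex_eq_iff mult_ac)
qed

lemma group_orbit_eq_if_orbit_slice_eq:
  assumes r: "r \<in> R" and w: "w \<in> slice_dom r" "w' \<in> slice_dom r" and eq: "orbit (slice r w) = orbit (slice r w')"
  shows "group_orbit (\<Gamma> r) w = group_orbit (\<Gamma> r) w'"
proof -
  interpret abelian_action "admissible_angles X Q r" phase "slice_dom r"
    by (rule abelian_action_slice_dom[OF r])
  obtain \<zeta> where \<zeta>: "\<zeta> \<in> exp_group X Q \<kappa>" "slice r w' = exp_act \<zeta> (slice r w)"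
    using eq unfolding exp_orbit_eq_iff by blast
  obtain \<alpha> where \<alpha>: "\<alpha> \<in> admissible_angles X Q r" "\<And>k. \<zeta> $ r k = \<i> * complex_of_real (\<alpha> $ k)"
    using exp_group_integral_outside_frame[OF r \<zeta>(1) integral_outside_frame[OF r w \<zeta>]] by blast
  have "w' $ k = phase \<alpha> w $ k" for k
    using arg_cong[OF \<zeta>(2), of "\<lambda>z. z $ r k"] inj_frame[OF r] by (simp add: exp_act_def phase_def \<alpha>(2))
  then have "w' = phase \<alpha> w" by (simp add: vec_eq_iff)
  then show ?thesis using group_orbit_act[OF \<alpha>(1) w(1)] by simp
qed

definition normalizing_vec :: "('n \<Rightarrow> 'd) \<Rightarrow> complex^'d \<Rightarrow> complex^'d" where
  "normalizing_vec r z = kernel_extend X r (\<lambda>h. - im_proj \<kappa> (Ln (z $ h)))"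

definition slice_coords :: "('n \<Rightarrow> 'd) \<Rightarrow> complex^'d \<Rightarrow> complex^'n" where
  "slice_coords r z = select_coords r (exp_act (normalizing_vec r z) z)"

lemma normalizing_vec_in_exp_group: "r \<in> R \<Longrightarrow> normalizing_vec r z \<in> exp_group X Q \<kappa>"
  unfolding normalizing_vec_def by (rule kernel_extend_in_exp_group) (auto simp: im_proj_idem)

lemma slice_coords:
  assumes r: "r \<in> R" and z: "z \<in> level" and nonzero: "\<And>h. h \<notin> range r \<Longrightarrow> z $ h \<noteq> 0"
  shows "slice_coords r z \<in> slice_dom r" "orbit (slice r (slice_coords r z)) = orbit z"
proof -
  let ?z = "exp_act (normalizing_vec r z) z"
  have "\<exists>t>0. ?z $ h = complex_of_real t \<and> (\<kappa> = 1 \<longrightarrow> t = 1)" if h: "h \<notin> range r" for h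
  proof -
    have "?z $ h = exp (Ln (z $ h) - im_proj \<kappa> (Ln (z $ h)))"
      using nonzero[OF h] h
      by (simp add: exp_act_def normalizing_vec_def kernel_extend_outside exp_diff exp_minus field_simps)
    also have "\<dots> = complex_of_real (exp ((1 - \<kappa>) * Re (Ln (z $ h))))" by (rule exp_minus_im_proj)
    finally show ?thesis by (intro exI[of _ "exp ((1 - \<kappa>) * Re (Ln (z $ h)))"]) auto
  qed
  from normalized_in_slice[OF r level_invariant[OF z normalizing_vec_in_exp_group[OF r]] this]
  have "slice_coords r z \<in> slice_dom r" "slice r (slice_coords r z) = ?z" by (auto simp: slice_coords_def)
  then show "slice_coords r z \<in> slice_dom r" "orbit (slice r (slice_coords r z)) = orbit z"
    using exp_orbit_act[OF normalizing_vec_in_exp_group[OF r]] by simp_all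
qed

lemma slice_coords_slice:
  assumes r: "r \<in> R" and w: "w \<in> slice_dom r"
  shows "slice_coords r (slice r w) = w"
proof -
  have "im_proj \<kappa> (Ln (slice r w $ h)) = 0" if h: "h \<notin> range r" for h
    using h height_pos[OF r w h] im_proj_ln_height by (simp add: Ln_of_real)
  then have "normalizing_vec r (slice r w) = 0"
    unfolding normalizing_vec_def kernel_extend_def by (auto simp: vec_eq_iff intro!: sum.neutral)
  then show ?thesis by (simp add: slice_coords_def inj_frame[OF r])
qed

lemma continuous_on_slice: "r \<in> R \<Longrightarrow> continuous_on (slice_dom r) (slice r)"
  unfolding slice_point_def
proof (rule continuous_on_vec_lambda)
  fix j assume r: "r \<in> R"
  show "continuous_on (slice_dom r)
      (\<lambda>w. if j \<in> range r then w $ inv_into UNIV r j else complex_of_real (height r w $ j))"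
    using smooth_on_imp_continuous_on[OF height_smooth[OF r, of j]]
    by (cases "j \<in> range r") (auto intro!: continuous_intros)
qed

definition slit_points :: "('n \<Rightarrow> 'd) \<Rightarrow> (complex^'d) set" where
  "slit_points r = {z. \<forall>h. h \<notin> range r \<longrightarrow> z $ h \<notin> \<real>\<^sub>\<le>\<^sub>0}"

lemma open_slit_points: "open (slit_points r)"
proof -
  have "slit_points r = (\<Inter>h\<in>- range r. (\<lambda>z. z $ h) -` (- \<real>\<^sub>\<le>\<^sub>0))" by (auto simp: slit_points_def)
  also have "open \<dots>" by (intro open_INT ballI finite open_vimage) (auto intro!: continuous_intros)
  finally show ?thesis .
qed

lemma slice_in_slit_points: "r \<in> R \<Longrightarrow> w \<in> slice_dom r \<Longrightarrow> slice r w \<in> slit_points r"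
  using height_pos[of r w] by (simp add: slit_points_def not_le)

lemma continuous_on_slice_coords: "continuous_on (slit_points r) (slice_coords r)"
proof -
  have "continuous_on (slit_points r) (\<lambda>z. normalizing_vec r z $ j)" for j
    unfolding normalizing_vec_def kernel_extend_def slit_points_def
    by (cases "j \<in> range r")
       (auto intro!: continuous_intros bounded_linear.continuous_on[OF bounded_linear_im_proj])
  then have "continuous_on (slit_points r) (\<lambda>z. \<chi> j. normalizing_vec r z $ j)"
    by (rule continuous_on_vec_lambda)
  then show ?thesis
    unfolding slice_coords_def[abs_def] select_coords_def exp_act_def by (auto intro!: continuous_intros)
qed

lemma orbit_in_orbits_of_slice_iff:
  assumes r: "r \<in> R" and V: "V \<subseteq> slice_dom r" and z: "z \<in> level"
  shows "orbit z \<in> orbit ` slice r ` V \<longleftrightarrow>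
    (\<exists>\<zeta>\<in>exp_group X Q \<kappa>. exp_act \<zeta> z \<in> slit_points r \<inter> slice_coords r -` V)"
proof
  assume "orbit z \<in> orbit ` slice r ` V"
  then obtain w where w: "w \<in> V" "orbit z = orbit (slice r w)" by blast
  then obtain \<zeta> where \<zeta>: "\<zeta> \<in> exp_group X Q \<kappa>" "slice r w = exp_act \<zeta> z" unfolding exp_orbit_eq_iff by blast
  have "w \<in> slice_dom r" using w(1) V by blast
  then have "exp_act \<zeta> z \<in> slit_points r \<inter> slice_coords r -` V"
    unfolding \<zeta>(2)[symmetric] using slice_in_slit_points[OF r] slice_coords_slice[OF r] w(1) by simp
  then show "\<exists>\<zeta>\<in>exp_group X Q \<kappa>. exp_act \<zeta> z \<in> slit_points r \<inter> slice_coords r -` V" using \<zeta>(1) by blast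
next
  assume "\<exists>\<zeta>\<in>exp_group X Q \<kappa>. exp_act \<zeta> z \<in> slit_points r \<inter> slice_coords r -` V"
  then obtain \<zeta> where \<zeta>: "\<zeta> \<in> exp_group X Q \<kappa>" "exp_act \<zeta> z \<in> slit_points r" "slice_coords r (exp_act \<zeta> z) \<in> V"
    by blast
  have "orbit z = orbit (exp_act \<zeta> z)" by (rule exp_orbit_act[OF \<zeta>(1), symmetric])
  also have "\<dots> = orbit (slice r (slice_coords r (exp_act \<zeta> z)))"
    by (rule slice_coords(2)[OF r level_invariant[OF z \<zeta>(1)], symmetric])
       (use \<zeta>(2) in \<open>auto simp: slit_points_def\<close>)
  finally show "orbit z \<in> orbit ` slice r ` V" using \<zeta>(3) by blast
qed

lemma openin_saturation_of_slice:
  assumes r: "r \<in> R" and V: "openin (top_of_set (slice_dom r)) V"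
  shows "openin (top_of_set level) {z \<in> level. orbit z \<in> orbit ` slice r ` V}"
proof -
  have "open V" "V \<subseteq> slice_dom r" using V open_slice_dom[OF r] by (auto simp: openin_open_eq)
  have "open (slit_points r \<inter> slice_coords r -` V)"
    using continuous_open_preimage[OF continuous_on_slice_coords open_slit_points \<open>open V\<close>] .
  then have "open (\<Union>\<zeta>\<in>exp_group X Q \<kappa>. exp_act \<zeta> -` (slit_points r \<inter> slice_coords r -` V))"
    by (intro open_UN ballI open_vimage continuous_on_exp_act)
  moreover have "{z \<in> level. orbit z \<in> orbit ` slice r ` V} =
      level \<inter> (\<Union>\<zeta>\<in>exp_group X Q \<kappa>. exp_act \<zeta> -` (slit_points r \<inter> slice_coords r -` V))"
    by (simp add: orbit_in_orbits_of_slice_iff[OF r \<open>V \<subseteq> slice_dom r\<close>] Collect_conj_eq set_eq_iff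
        cong: conj_cong)
  ultimately show ?thesis by (auto simp: openin_open)
qed

lemma chart_orbits_slice_chart: "chart_orbits (slice_chart r) = group_orbit (\<Gamma> r) ` slice_dom r"
  by (simp add: chart_orbits_def)

lemma chart_image_slice_chart: "r \<in> R \<Longrightarrow> chart_image (slice_chart r) = orbit ` slice r ` slice_dom r"
  using chart_map_slice_chart by (force simp: chart_image_def chart_orbits_slice_chart image_image)

lemma inj_on_chart_map: "r \<in> R \<Longrightarrow> inj_on (chart_map (slice_chart r)) (chart_orbits (slice_chart r))"
  unfolding chart_orbits_slice_chart
proof (rule inj_onI, elim imageE)
  fix p q w w' assume r: "r \<in> R" and eq: "chart_map (slice_chart r) p = chart_map (slice_chart r) q"
    and w: "p = group_orbit (\<Gamma> r) w" "w \<in> slice_dom r" "q = group_orbit (\<Gamma> r) w'" "w' \<in> slice_dom r"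
  have "orbit (slice r w) = orbit (slice r w')" using eq chart_map_slice_chart[OF r] w by simp
  then show "p = q" using group_orbit_eq_if_orbit_slice_eq[OF r w(2,4)] w(1,3) by simp
qed

lemma orbit_in_chart_image_iff:
  assumes r: "r \<in> R" and z: "z \<in> level"
  shows "orbit z \<in> chart_image (slice_chart r) \<longleftrightarrow> (\<forall>h. h \<notin> range r \<longrightarrow> z $ h \<noteq> 0)"
proof
  assume "orbit z \<in> chart_image (slice_chart r)"
  then obtain w where w: "w \<in> slice_dom r" "orbit (slice r w) = orbit z"
    by (auto simp: chart_image_slice_chart[OF r])
  then obtain \<zeta> where "z = exp_act \<zeta> (slice r w)" unfolding exp_orbit_eq_iff by blast
  then show "\<forall>h. h \<notin> range r \<longrightarrow> z $ h \<noteq> 0" using height_pos[OF r w(1)] by (force simp: exp_act_def)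
next
  assume "\<forall>h. h \<notin> range r \<longrightarrow> z $ h \<noteq> 0"
  then have "slice_coords r z \<in> slice_dom r" "orbit z = orbit (slice r (slice_coords r z))"
    using slice_coords[OF r z] by simp_all
  then show "orbit z \<in> chart_image (slice_chart r)" unfolding chart_image_slice_chart[OF r] by simp
qed

lemma is_chart_slice_chart:
  assumes r: "r \<in> R"
  shows "is_chart reg orbit_space (slice_chart r)"
proof -
  let ?Y = "quotient_topology (top_of_set (slice_dom r)) (group_orbit (\<Gamma> r))"
  have comm: "chart_map (slice_chart r) (group_orbit (\<Gamma> r) w) = orbit (slice r w)"
    if "w \<in> topspace (top_of_set (slice_dom r))" for w
    using chart_map_slice_chart[OF r] that by simp
  have cont: "continuous_map (top_of_set (slice_dom r)) (top_of_set level) (slice r)"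
    using continuous_on_slice[OF r] slice_in_level[OF r] by (auto simp: continuous_map_in_subtopology)
  have saturated: "openin (top_of_set level) {z \<in> topspace (top_of_set level). orbit z \<in> orbit ` slice r ` V}"
    if "openin (top_of_set (slice_dom r)) V" for V
    using openin_saturation_of_slice[OF r that] by simp
  have inj: "inj_on (chart_map (slice_chart r)) (group_orbit (\<Gamma> r) ` topspace (top_of_set (slice_dom r)))"
    using inj_on_chart_map[OF r] by (simp add: chart_orbits_slice_chart)
  have image: "chart_map (slice_chart r) ` topspace ?Y = chart_image (slice_chart r)"
    by (simp add: chart_image_def chart_orbits_slice_chart topspace_quotient_topology)
  have "open_map ?Y orbit_space (chart_map (slice_chart r))"
    by (rule open_map_quotient_topology[where a="group_orbit (\<Gamma> r)" and b=orbit and \<sigma>="slice r",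
          OF comm cont saturated])
  then have "openin orbit_space (chart_image (slice_chart r))"
    unfolding open_map_def image[symmetric] by blast
  moreover have "embedding_map ?Y orbit_space (chart_map (slice_chart r))"
    by (rule embedding_map_quotient_topology[where a="group_orbit (\<Gamma> r)" and b=orbit and \<sigma>="slice r",
          OF comm cont saturated inj])
  moreover have "is_model reg (slice_dom r) id (\<Gamma> r)"
    by (rule phase_group.is_model_reinhardt[OF phase_group_moduli[OF r] regularity_reg])
  ultimately show ?thesis
    using open_slice_dom[OF r] unfolding is_chart_def embedding_map_def image chart_topology_def by simp
qed

lemma chart_image_subset_topspace: "r \<in> R \<Longrightarrow> chart_image (slice_chart r) \<subseteq> topspace orbit_space"
  using slice_in_level by (auto simp: chart_image_slice_chart topspace_orbit_space)

lemma chart_images_cover: "(\<Union>r\<in>R. chart_image (slice_chart r)) = topspace orbit_space"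
proof (intro equalityI UN_least chart_image_subset_topspace subsetI)
  fix p assume "p \<in> topspace orbit_space"
  then obtain z where "z \<in> level" "p = orbit z" unfolding topspace_orbit_space by blast
  then show "p \<in> (\<Union>r\<in>R. chart_image (slice_chart r))"
    using level_cover orbit_in_chart_image_iff by blast
qed

end

subsection \<open>Changes of charts\<close>

lemma continuous_on_kernel_extend:
  assumes "\<And>h. h \<notin> range r \<Longrightarrow> continuous_on S (\<lambda>x. f x h)"
  shows "continuous_on S (\<lambda>x. kernel_extend X r (f x) $ j)"
  using assms unfolding kernel_extend_def by (cases "j \<in> range r") (auto intro!: continuous_intros)

lemma smooth_on_kernel_extend:
  assumes "open S" "\<And>h. h \<notin> range r \<Longrightarrow> smooth_on S (\<lambda>x. f x h)"
  shows "smooth_on S (\<lambda>x. kernel_extend X r (f x) $ j)"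
proof (cases "j \<in> range r")
  case True
  have "smooth_on S (\<lambda>x. - (\<Sum>h\<in>- range r. complex_of_real (frame_coeff X r h (inv_into UNIV r j)) * f x h))"
    using assms
    by (intro smooth_on_linear_comp[OF _ bounded_linear_minus[OF bounded_linear_ident]] smooth_on_sum
        smooth_on_linear_comp[OF _ bounded_linear_mult_right]) auto
  then show ?thesis using True by (simp add: kernel_extend_def)
qed (use assms in \<open>simp add: kernel_extend_def\<close>)

lemma complex_differentiable_at_minus:
  "complex_differentiable_at f x \<Longrightarrow> complex_differentiable_at (\<lambda>x. - f x) x"
  by (rule complex_differentiable_at_compose[where g=uminus and g'="-1"]) (auto intro!: derivative_eq_intros)

lemma complex_differentiable_at_kernel_extend:
  assumes "\<And>h. h \<notin> range r \<Longrightarrow> complex_differentiable_at (\<lambda>x. f x h) x"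
  shows "complex_differentiable_at (\<lambda>x. kernel_extend X r (f x) $ j) x"
proof (cases "j \<in> range r")
  case True
  have "complex_differentiable_at
      (\<lambda>x. - (\<Sum>h\<in>- range r. complex_of_real (frame_coeff X r h (inv_into UNIV r j)) * f x h)) x"
    using assms
    by (intro complex_differentiable_at_minus complex_differentiable_at_sum complex_differentiable_at_mult
        complex_differentiable_at_const) auto
  then show ?thesis using True by (simp add: kernel_extend_def)
qed (use assms in \<open>simp add: kernel_extend_def\<close>)

context quasi_slice
begin

definition new_index :: "('n \<Rightarrow> 'd) \<Rightarrow> ('n \<Rightarrow> 'd) \<Rightarrow> 'n set" where
  "new_index r r' = {k. r k \<notin> range r'}"

abbreviation "overlap_logs r r' \<equiv> log_domain (moduli r) (new_index r r')"
abbreviation "overlap_cover r r' \<equiv> log_cover (moduli r) (new_index r r')"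
abbreviation "overlap_proj r r' \<equiv> cover_proj (new_index r r')"
abbreviation "overlap_exp r r' \<equiv> partial_exp (new_index r r')"
abbreviation "overlap_slit r r' x\<^sub>0 \<equiv> slit_domain (moduli r) (new_index r r') (overlap_exp r r' x\<^sub>0)"
abbreviation "overlap_log r r' x\<^sub>0 \<equiv> log_section (new_index r r') x\<^sub>0"

lemma inv_frame_in_new_index: "r \<in> R \<Longrightarrow> h \<in> range r \<Longrightarrow> h \<notin> range r' \<Longrightarrow> inv_into UNIV r h \<in> new_index r r'"
  by (auto simp: new_index_def inj_frame)

lemma slice_nonzero_iff:
  assumes r: "r \<in> R" and x: "x \<in> slice_dom r"
  shows "(\<forall>h. h \<notin> range r' \<longrightarrow> slice r x $ h \<noteq> 0) \<longleftrightarrow> (\<forall>k\<in>new_index r r'. x $ k \<noteq> 0)"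
proof
  assume "\<forall>h. h \<notin> range r' \<longrightarrow> slice r x $ h \<noteq> 0"
  then show "\<forall>k\<in>new_index r r'. x $ k \<noteq> 0"
    using slice_point_range[OF inj_frame[OF r]] by (metis mem_Collect_eq new_index_def)
next
  assume nonzero: "\<forall>k\<in>new_index r r'. x $ k \<noteq> 0"
  show "\<forall>h. h \<notin> range r' \<longrightarrow> slice r x $ h \<noteq> 0"
  proof (intro allI impI)
    fix h assume h: "h \<notin> range r'"
    show "slice r x $ h \<noteq> 0"
    proof (cases "h \<in> range r")
      case True
      then show ?thesis using nonzero inv_frame_in_new_index[OF r True h] by (simp add: slice_point_def)
    next
      case False
      then show ?thesis using height_pos[OF r x False] by simp
    qed
  qed
qed

lemma overlap_preimage:
  assumes r: "r \<in> R" and r': "r' \<in> R"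
  shows "{x \<in> slice_dom r. group_orbit (\<Gamma> r) x \<in> chart_overlap (slice_chart r) (slice_chart r')} =
    nonvanishing (moduli r) (new_index r r')"
proof -
  have "group_orbit (\<Gamma> r) x \<in> chart_overlap (slice_chart r) (slice_chart r') \<longleftrightarrow> (\<forall>k\<in>new_index r r'. x $ k \<noteq> 0)"
    if x: "x \<in> slice_dom r" for x
    using x chart_map_slice_chart[OF r x] orbit_in_chart_image_iff[OF r' slice_in_level[OF r x]]
      slice_nonzero_iff[OF r x]
    by (simp add: chart_overlap_def chart_orbits_slice_chart)
  then show ?thesis by (auto simp: nonvanishing_def)
qed

lemma submodel_cover_slice_chart:
  assumes r: "r \<in> R" and r': "r' \<in> R"
  shows "submodel_cover reg (slice_chart r) (chart_overlap (slice_chart r) (slice_chart r'))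
    (overlap_cover r r') (overlap_proj r r')"
  unfolding submodel_cover_def chart_dom_slice_chart chart_group_slice_chart overlap_preimage[OF r r']
proof (intro conjI)
  show "covering_space (overlap_cover r r') (overlap_proj r r') (nonvanishing (moduli r) (new_index r r'))"
    by (rule covering_space_log_cover[OF open_moduli[OF r]])
  have "nonvanishing (moduli r) (new_index r r') \<subseteq> slice_dom r" by (auto simp: nonvanishing_def)
  moreover have "open (nonvanishing (moduli r) (new_index r r'))" by (rule open_nonvanishing[OF open_moduli[OF r]])
  ultimately have "openin (top_of_set (slice_dom r)) (nonvanishing (moduli r) (new_index r r'))"
    by (auto simp: openin_open)
  moreover have "chart_overlap (slice_chart r) (slice_chart r') \<subseteq> group_orbit (\<Gamma> r) ` slice_dom r"
    by (auto simp: chart_overlap_def chart_orbits_slice_chart)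
  ultimately show "openin (chart_topology (slice_chart r)) (chart_overlap (slice_chart r) (slice_chart r'))"
    using overlap_preimage[OF r r'] by (simp add: openin_quotient_topology chart_topology_def)
  obtain s where "s \<in> moduli r" "\<And>k. if k \<in> new_index r r' then s $ k > 0 else s $ k = 0"
    using moduli_overlap[OF r r'] by (auto simp: new_index_def)
  then show "is_model reg (overlap_cover r r') (overlap_proj r r')
      (cover_group (overlap_cover r r') (overlap_proj r r') (\<Gamma> r))"
    by (rule phase_group.is_model_log_cover[OF phase_group_moduli[OF r] regularity_reg])
qed

definition change_vec :: "('n \<Rightarrow> 'd) \<Rightarrow> ('n \<Rightarrow> 'd) \<Rightarrow> complex^'n \<Rightarrow> complex^'d" where
  "change_vec r r' x =
     kernel_extend X r' (\<lambda>h. if h \<in> range r then - im_proj \<kappa> (x $ inv_into UNIV r h) else 0)"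

definition changed_point :: "('n \<Rightarrow> 'd) \<Rightarrow> ('n \<Rightarrow> 'd) \<Rightarrow> complex^'n \<Rightarrow> complex^'d" where
  "changed_point r r' x = exp_act (change_vec r r' x) (slice r (overlap_exp r r' x))"

definition change_lift :: "('n \<Rightarrow> 'd) \<Rightarrow> ('n \<Rightarrow> 'd) \<Rightarrow> complex^'n \<Rightarrow> complex^'n" where
  "change_lift r r' x = (\<chi> k. if r' k \<in> range r then changed_point r r' x $ r' k
     else change_vec r r' x $ r' k + complex_of_real (ln (height r (overlap_exp r r' x) $ r' k)))"

lemma change_vec_outside:
  "h \<notin> range r' \<Longrightarrow> change_vec r r' x $ h = (if h \<in> range r then - im_proj \<kappa> (x $ inv_into UNIV r h) else 0)"
  by (simp add: change_vec_def kernel_extend_outside)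

lemma im_proj_change_vec: "im_proj \<kappa> (change_vec r r' x $ j) = change_vec r r' x $ j"
  unfolding change_vec_def by (rule kernel_extend_im_proj) (auto simp: im_proj_idem)

lemma change_vec_in_exp_group: "r' \<in> R \<Longrightarrow> change_vec r r' x \<in> exp_group X Q \<kappa>"
  unfolding change_vec_def by (rule kernel_extend_in_exp_group) (auto simp: im_proj_idem)

lemma sum_Im_change_vec: "r' \<in> R \<Longrightarrow> (\<Sum>j\<in>UNIV. Im (change_vec r r' x $ j) *\<^sub>R X j) = 0"
  unfolding change_vec_def by (rule sum_Im_kernel_extend)

lemma overlap_exp_in_slice_dom: "x \<in> overlap_logs r r' \<Longrightarrow> overlap_exp r r' x \<in> slice_dom r"
  by (simp add: log_domain_def)

lemma changed_point_old_coord: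
  assumes r: "r \<in> R" and h: "h \<in> range r" "h \<notin> range r'"
  shows "changed_point r r' x $ h = complex_of_real (exp ((1 - \<kappa>) * Re (x $ inv_into UNIV r h)))"
proof -
  have "changed_point r r' x $ h = exp (- im_proj \<kappa> (x $ inv_into UNIV r h)) * exp (x $ inv_into UNIV r h)"
    using h inv_frame_in_new_index[OF r h]
    by (simp add: changed_point_def exp_act_def change_vec_outside partial_exp_def slice_point_def)
  also have "\<dots> = exp (x $ inv_into UNIV r h - im_proj \<kappa> (x $ inv_into UNIV r h))" by (simp flip: exp_add)
  finally show ?thesis by (simp only: exp_minus_im_proj)
qed

lemma changed_point_in_slice:
  assumes r: "r \<in> R" and r': "r' \<in> R" and x: "x \<in> overlap_logs r r'"
  shows "select_coords r' (changed_point r r' x) \<in> slice_dom r'"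
    and "slice r' (select_coords r' (changed_point r r' x)) = changed_point r r' x"
proof -
  note w = overlap_exp_in_slice_dom[OF x]
  have "\<exists>t>0. changed_point r r' x $ h = complex_of_real t \<and> (\<kappa> = 1 \<longrightarrow> t = 1)" if h: "h \<notin> range r'" for h
  proof (cases "h \<in> range r")
    case True
    then show ?thesis
      using changed_point_old_coord[OF r True h]
      by (intro exI[of _ "exp ((1 - \<kappa>) * Re (x $ inv_into UNIV r h))"]) auto
  next
    case False
    then have "changed_point r r' x $ h = complex_of_real (height r (overlap_exp r r' x) $ h)"
      using h by (simp add: changed_point_def exp_act_def change_vec_outside)
    then show ?thesis using height_pos[OF r w False] height_one by blast
  qed
  moreover have "changed_point r r' x \<in> level"
    unfolding changed_point_def by (rule level_invariant[OF slice_in_level[OF r w] change_vec_in_exp_group[OF r']])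
  ultimately show "select_coords r' (changed_point r r' x) \<in> slice_dom r'"
    and "slice r' (select_coords r' (changed_point r r' x)) = changed_point r r' x"
    using normalized_in_slice[OF r'] by blast+
qed

lemma overlap_exp_change_lift:
  assumes r: "r \<in> R" and x: "x \<in> overlap_logs r r'"
  shows "overlap_exp r' r (change_lift r r' x) = select_coords r' (changed_point r r' x)"
proof -
  have "overlap_exp r' r (change_lift r r' x) $ k = changed_point r r' x $ r' k" for k
  proof (cases "r' k \<in> range r")
    case True
    then show ?thesis by (simp add: partial_exp_def new_index_def change_lift_def)
  next
    case False
    then have "height r (overlap_exp r r' x) $ r' k > 0"
      by (rule height_pos[OF r overlap_exp_in_slice_dom[OF x]])
    then show ?thesis using False
      by (simp add: partial_exp_def new_index_def change_lift_def changed_point_def exp_act_def exp_add exp_of_real)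
  qed
  then show ?thesis by (simp add: select_coords_def vec_eq_iff)
qed

lemma change_lift_in_overlap_logs:
  assumes "r \<in> R" "r' \<in> R" "x \<in> overlap_logs r r'"
  shows "change_lift r r' x \<in> overlap_logs r' r"
  using overlap_exp_change_lift[OF assms(1,3)] changed_point_in_slice(1)[OF assms] by (simp add: log_domain_def)

lemma slice_change_lift:
  assumes "r \<in> R" "r' \<in> R" "x \<in> overlap_logs r r'"
  shows "slice r' (overlap_exp r' r (change_lift r r' x)) = changed_point r r' x"
  using overlap_exp_change_lift[OF assms(1,3)] changed_point_in_slice(2)[OF assms] by simp

lemma orbit_slice_change_lift:
  assumes "r \<in> R" "r' \<in> R" "x \<in> overlap_logs r r'"
  shows "orbit (slice r' (overlap_exp r' r (change_lift r r' x))) = orbit (slice r (overlap_exp r r' x))"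
  unfolding slice_change_lift[OF assms] changed_point_def
  by (rule exp_orbit_act[OF change_vec_in_exp_group[OF assms(2)]])

lemma change_vec_change_lift:
  assumes r: "r \<in> R" and r': "r' \<in> R"
  shows "change_vec r' r (change_lift r r' x) = - change_vec r r' x"
proof -
  let ?y = "change_lift r r' x"
  have "change_vec r' r ?y + change_vec r r' x = 0"
  proof (rule kernel_vec_eq_0[OF r])
    show "(\<Sum>j\<in>UNIV. Re ((change_vec r' r ?y + change_vec r r' x) $ j) *\<^sub>R X j) = 0"
      "(\<Sum>j\<in>UNIV. Im ((change_vec r' r ?y + change_vec r r' x) $ j) *\<^sub>R X j) = 0"
      using sum_Re_kernel_extend[OF r] sum_Im_kernel_extend[OF r] sum_Re_kernel_extend[OF r']
        sum_Im_kernel_extend[OF r']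
      by (auto simp: change_vec_def scaleR_add_left sum.distrib)
    fix h assume h: "h \<notin> range r"
    show "(change_vec r' r ?y + change_vec r r' x) $ h = 0"
    proof (cases "h \<in> range r'")
      case True
      then obtain k where k: "h = r' k" by blast
      then have "im_proj \<kappa> (?y $ k) = change_vec r r' x $ h"
        using h by (simp add: change_lift_def linear_add[OF linear_im_proj] im_proj_change_vec im_proj_ln_height)
      then show ?thesis using h k inj_frame[OF r'] by (simp add: change_vec_outside)
    next
      case False
      then show ?thesis using h by (simp add: change_vec_outside)
    qed
  qed
  then show ?thesis by (simp add: eq_neg_iff_add_eq_0)
qed

lemma changed_point_change_lift:
  assumes "r \<in> R" "r' \<in> R" "x \<in> overlap_logs r r'"
  shows "changed_point r' r (change_lift r r' x) = slice r (overlap_exp r r' x)"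
  unfolding changed_point_def[of r' r] slice_change_lift[OF assms] change_vec_change_lift[OF assms(1,2)]
  by (simp add: changed_point_def)

lemma change_lift_change_lift:
  assumes r: "r \<in> R" and r': "r' \<in> R" and x: "x \<in> overlap_logs r r'"
  shows "change_lift r' r (change_lift r r' x) = x"
proof -
  let ?y = "change_lift r r' x"
  have "change_lift r' r ?y $ k = x $ k" for k
  proof (cases "r k \<in> range r'")
    case True
    then show ?thesis
      using inj_frame[OF r] changed_point_change_lift[OF assms]
      by (simp add: change_lift_def[of r' r] partial_exp_def new_index_def)
  next
    case False
    have "complex_of_real (height r' (overlap_exp r' r ?y) $ r k) = slice r' (overlap_exp r' r ?y) $ r k"
      using False by simp
    also have "\<dots> = complex_of_real (exp ((1 - \<kappa>) * Re (x $ k)))"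
      using slice_change_lift[OF assms] changed_point_old_coord[OF r _ False] inj_frame[OF r] by simp
    finally have height: "height r' (overlap_exp r' r ?y) $ r k = exp ((1 - \<kappa>) * Re (x $ k))"
      by (simp only: of_real_eq_iff)
    have "change_vec r' r ?y $ r k = im_proj \<kappa> (x $ k)"
      using change_vec_change_lift[OF r r'] False inj_frame[OF r] by (simp add: change_vec_outside)
    then have "change_lift r' r ?y $ k = im_proj \<kappa> (x $ k) + complex_of_real ((1 - \<kappa>) * Re (x $ k))"
      using False by (simp add: change_lift_def[of r' r] height)
    also have "\<dots> = x $ k" by (simp add: im_proj_def complex_eq_iff algebra_simps)
    finally show ?thesis .
  qed
  then show ?thesis by (simp add: vec_eq_iff)
qed

lemma continuous_on_change_vec: "continuous_on S (\<lambda>x. change_vec r r' x $ j)"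
  unfolding change_vec_def
proof (rule continuous_on_kernel_extend)
  fix h
  have "continuous_on S (\<lambda>x. - im_proj \<kappa> (x $ inv_into UNIV r h))"
    by (intro continuous_intros bounded_linear.continuous_on[OF bounded_linear_im_proj])
  then show "continuous_on S (\<lambda>x. if h \<in> range r then - im_proj \<kappa> (x $ inv_into UNIV r h) else 0)"
    by (cases "h \<in> range r") simp_all
qed

lemma continuous_on_change_lift:
  assumes r: "r \<in> R"
  shows "continuous_on (overlap_logs r r') (change_lift r r')"
  unfolding change_lift_def
proof (rule continuous_on_vec_lambda)
  fix k
  have exp_image: "overlap_exp r r' ` overlap_logs r r' \<subseteq> slice_dom r" by (auto simp: log_domain_def)
  have cont_slice: "continuous_on (overlap_logs r r') (\<lambda>x. slice r (overlap_exp r r' x) $ j)" for j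
    using continuous_on_compose2[OF continuous_on_slice[OF r] continuous_on_partial_exp exp_image]
    by (intro continuous_intros)
  have cont_height: "continuous_on (overlap_logs r r') (\<lambda>x. height r (overlap_exp r r' x) $ j)" for j
    by (rule continuous_on_compose2[OF smooth_on_imp_continuous_on[OF height_smooth[OF r]]
          continuous_on_partial_exp exp_image])
  show "continuous_on (overlap_logs r r') (\<lambda>x. if r' k \<in> range r then changed_point r r' x $ r' k
     else change_vec r r' x $ r' k + complex_of_real (ln (height r (overlap_exp r r' x) $ r' k)))"
  proof (cases "r' k \<in> range r")
    case True
    then show ?thesis
      by (auto simp: changed_point_def exp_act_def intro!: continuous_intros continuous_on_change_vec cont_slice)
  next
    case False
    have "height r (overlap_exp r r' x) $ r' k \<noteq> 0" if "x \<in> overlap_logs r r'" for x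
      using height_pos[OF r overlap_exp_in_slice_dom[OF that] False] by simp
    then show ?thesis using False
      by (auto intro!: continuous_intros continuous_on_change_vec cont_height)
  qed
qed

definition local_change :: "('n \<Rightarrow> 'd) \<Rightarrow> ('n \<Rightarrow> 'd) \<Rightarrow> complex^'n \<Rightarrow> complex^'n \<Rightarrow> complex^'n" where
  "local_change r r' x\<^sub>0 w = select_coords r' (exp_act (change_vec r r' (overlap_log r r' x\<^sub>0 w)) (slice r w))"

lemma overlap_log:
  assumes "w \<in> overlap_slit r r' x\<^sub>0"
  shows "overlap_log r r' x\<^sub>0 w \<in> overlap_logs r r'" "overlap_exp r r' (overlap_log r r' x\<^sub>0 w) = w"
  using log_section_in_sheet[OF assms] partial_exp_log_section[OF assms] by (auto simp: sheet_def)

lemma overlap_slit_subset_slice_dom: "overlap_slit r r' x\<^sub>0 \<subseteq> slice_dom r"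
  by (auto simp: slit_domain_def)

lemma open_overlap_slit: "r \<in> R \<Longrightarrow> open (overlap_slit r r' x\<^sub>0)"
  by (rule open_slit_domain[OF open_moduli]) (auto simp: partial_exp_def)

lemma overlap_log_nth:
  "k \<in> new_index r r' \<Longrightarrow> overlap_log r r' x\<^sub>0 w $ k = x\<^sub>0 $ k + Ln (inverse (exp (x\<^sub>0 $ k)) * w $ k)"
  by (simp add: log_section_def divide_inverse mult.commute)

lemma inverse_exp_mult_notin_nonpos_Reals:
  "k \<in> new_index r r' \<Longrightarrow> w \<in> overlap_slit r r' x\<^sub>0 \<Longrightarrow> inverse (exp (x\<^sub>0 $ k)) * w $ k \<notin> \<real>\<^sub>\<le>\<^sub>0"
  by (auto simp: slit_domain_def partial_exp_def divide_inverse mult.commute)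

lemma smooth_on_change_vec:
  assumes r: "r \<in> R"
  shows "smooth_on (overlap_slit r r' x\<^sub>0) (\<lambda>w. change_vec r r' (overlap_log r r' x\<^sub>0 w) $ j)"
  unfolding change_vec_def
proof (rule smooth_on_kernel_extend[OF open_overlap_slit[OF r]])
  fix h assume h: "h \<notin> range r'"
  note opn = open_overlap_slit[OF r]
  show "smooth_on (overlap_slit r r' x\<^sub>0)
      (\<lambda>w. if h \<in> range r then - im_proj \<kappa> (overlap_log r r' x\<^sub>0 w $ inv_into UNIV r h) else 0)"
  proof (cases "h \<in> range r")
    case True
    then have k: "inv_into UNIV r h \<in> new_index r r'" by (rule inv_frame_in_new_index[OF r _ h])
    have "smooth_on (overlap_slit r r' x\<^sub>0) (\<lambda>w. overlap_log r r' x\<^sub>0 w $ inv_into UNIV r h)"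
      unfolding overlap_log_nth[OF k]
      by (intro smooth_on_add smooth_on_const smooth_on_Ln smooth_on_linear_comp[OF _ bounded_linear_mult_right]
          smooth_on_bounded_linear bounded_linear_vec_nth opn inverse_exp_mult_notin_nonpos_Reals[OF k])
    then show ?thesis
      unfolding if_P[OF True]
      by (intro smooth_on_linear_comp[OF opn bounded_linear_minus[OF bounded_linear_im_proj]])
  qed (simp add: smooth_on_const opn)
qed

lemma complex_differentiable_at_change_vec:
  assumes r: "r \<in> R" and "\<kappa> = 1" and x: "x \<in> overlap_slit r r' x\<^sub>0"
  shows "complex_differentiable_at (\<lambda>w. change_vec r r' (overlap_log r r' x\<^sub>0 w) $ j) x"
  unfolding change_vec_def unfolding \<open>\<kappa> = 1\<close> im_proj_one id_apply
proof (rule complex_differentiable_at_kernel_extend)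
  fix h assume h: "h \<notin> range r'"
  show "complex_differentiable_at
      (\<lambda>w. if h \<in> range r then - (overlap_log r r' x\<^sub>0 w $ inv_into UNIV r h) else 0) x"
  proof (cases "h \<in> range r")
    case True
    let ?k = "inv_into UNIV r h"
    have k: "?k \<in> new_index r r'" by (rule inv_frame_in_new_index[OF r True h])
    have "complex_differentiable_at (\<lambda>w. (\<lambda>y. x\<^sub>0 $ ?k + Ln (inverse (exp (x\<^sub>0 $ ?k)) * y)) (w $ ?k)) x"
      by (rule complex_differentiable_at_compose[OF complex_differentiable_at_nth])
         (use inverse_exp_mult_notin_nonpos_Reals[OF k x] in \<open>auto intro!: derivative_eq_intros\<close>)
    then show ?thesis
      unfolding if_P[OF True] overlap_log_nth[OF k] by (rule complex_differentiable_at_minus)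
  qed (simp add: complex_differentiable_at_const)
qed

lemma smooth_on_slice_nth:
  assumes r: "r \<in> R"
  shows "smooth_on (slice_dom r) (\<lambda>w. slice r w $ j)"
proof (cases "j \<in> range r")
  case True
  then show ?thesis
    by (auto simp: slice_point_def intro!: smooth_on_bounded_linear open_slice_dom[OF r] bounded_linear_vec_nth)
next
  case False
  then show ?thesis
    by (auto intro!: smooth_on_linear_comp[OF _ bounded_linear_of_real] height_smooth open_slice_dom r)
qed

lemma smooth_on_slice: "r \<in> R \<Longrightarrow> smooth_on (slice_dom r) (slice r)"
  by (rule smooth_on_vec[OF open_slice_dom smooth_on_slice_nth])

lemma smooth_on_local_change:
  assumes r: "r \<in> R"
  shows "smooth_on (overlap_slit r r' x\<^sub>0) (local_change r r' x\<^sub>0)"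
proof (rule smooth_on_vec[OF open_overlap_slit[OF r]])
  show "smooth_on (overlap_slit r r' x\<^sub>0) (\<lambda>w. local_change r r' x\<^sub>0 w $ k)" for k
    unfolding local_change_def select_coords_def exp_act_def
    using smooth_on_subset[OF smooth_on_slice_nth[OF r] overlap_slit_subset_slice_dom] smooth_on_change_vec[OF r]
    by (auto intro!: smooth_on_mult smooth_on_exp open_overlap_slit[OF r])
qed

lemma holomorphic_local_change:
  assumes r: "r \<in> R" and "\<kappa> = 1"
  shows "holomorphic_map_on (overlap_slit r r' x\<^sub>0) (local_change r r' x\<^sub>0)"
proof (rule holomorphic_map_on_vec)
  fix x k assume x: "x \<in> overlap_slit r r' x\<^sub>0"
  have "complex_differentiable_at (\<lambda>w. slice r w $ r' k) x"
    using complex_differentiable_at_nth complex_differentiable_at_const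
    by (cases "r' k \<in> range r") (simp_all add: slice_point_def height_one[OF \<open>\<kappa> = 1\<close>])
  then show "complex_differentiable_at (\<lambda>w. local_change r r' x\<^sub>0 w $ k) x"
    unfolding local_change_def select_coords_def exp_act_def vec_lambda_beta
    by (intro complex_differentiable_at_mult complex_differentiable_at_compose[OF _ DERIV_exp]
        complex_differentiable_at_change_vec assms x)
qed

lemma regular_local_change: "r \<in> R \<Longrightarrow> reg (overlap_slit r r' x\<^sub>0) (local_change r r' x\<^sub>0)"
  using reg_cases smooth_on_local_change holomorphic_local_change by auto

lemma local_change:
  assumes r: "r \<in> R" and r': "r' \<in> R" and w: "w \<in> overlap_slit r r' x\<^sub>0"
  shows "overlap_exp r' r (change_lift r r' (overlap_log r r' x\<^sub>0 w)) = local_change r r' x\<^sub>0 w"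
    and "slice r' (local_change r r' x\<^sub>0 w) = exp_act (change_vec r r' (overlap_log r r' x\<^sub>0 w)) (slice r w)"
    and "local_change r r' x\<^sub>0 w \<in> slice_dom r'"
  using overlap_exp_change_lift[OF r overlap_log(1)[OF w]] changed_point_in_slice[OF r r' overlap_log(1)[OF w]]
  by (auto simp: changed_point_def local_change_def overlap_log(2)[OF w])

definition cover_change ::
    "('n \<Rightarrow> 'd) \<Rightarrow> ('n \<Rightarrow> 'd) \<Rightarrow> (complex^'n) \<times> (complex^'n) \<Rightarrow> (complex^'n) \<times> (complex^'n)" where
  "cover_change r r' p = (change_lift r r' (fst p), 0)"

lemma cover_proj_cover_change:
  assumes "r \<in> R" "r' \<in> R" "w \<in> overlap_slit r r' x\<^sub>0"
  shows "overlap_proj r' r (cover_change r r' (overlap_log r r' x\<^sub>0 w, 0)) = local_change r r' x\<^sub>0 w"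
  by (simp add: cover_proj_def cover_change_def local_change(1)[OF assms])

lemma bij_betw_cover_change:
  assumes r: "r \<in> R" and r': "r' \<in> R"
  shows "bij_betw (cover_change r r') (overlap_cover r r') (overlap_cover r' r)"
  by (rule bij_betwI[where g="cover_change r' r"])
     (auto simp: cover_change_def change_lift_in_overlap_logs r r' change_lift_change_lift)

lemma manifold_map_cover_change:
  assumes r: "r \<in> R" and r': "r' \<in> R" and l: "\<And>p. p \<in> overlap_cover r r' \<Longrightarrow> l p = cover_change r r' p"
  shows "manifold_map reg (overlap_cover r r') (overlap_proj r r') (overlap_cover r' r) (overlap_proj r' r) l"
  unfolding manifold_map_def
proof (intro conjI ballI)
  show "l ` overlap_cover r r' \<subseteq> overlap_cover r' r"
    using change_lift_in_overlap_logs[OF r r'] by (force simp: l cover_change_def)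
  have "continuous_on (overlap_cover r r') (\<lambda>p. change_lift r r' (fst p))"
    by (rule continuous_on_compose2[OF continuous_on_change_lift[OF r] continuous_on_fst[OF continuous_on_id]]) simp
  then have "continuous_on (overlap_cover r r') (cover_change r r')"
    unfolding cover_change_def[abs_def] by (rule continuous_on_Pair[OF _ continuous_on_const])
  then show "continuous_on (overlap_cover r r') l" by (rule continuous_on_eq) (simp add: l)
  fix p assume "p \<in> overlap_cover r r'"
  then obtain x\<^sub>0 where x\<^sub>0: "p = (x\<^sub>0, 0)" "x\<^sub>0 \<in> overlap_logs r r'" by auto
  let ?s = "\<lambda>w. (overlap_log r r' x\<^sub>0 w, 0::complex^'n)"
  have local_sec: "local_section (overlap_cover r r') (overlap_proj r r') p (overlap_slit r r' x\<^sub>0) ?s"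
    unfolding x\<^sub>0(1) by (rule local_section_log_cover[OF open_moduli[OF r] x\<^sub>0(2)])
  have lift_eq: "local_change r r' x\<^sub>0 w = (overlap_proj r' r \<circ> l \<circ> ?s) w" if "w \<in> overlap_slit r r' x\<^sub>0" for w
    using l overlap_log(1)[OF that] cover_proj_cover_change[OF r r' that] by simp
  have "reg (overlap_slit r r' x\<^sub>0) (overlap_proj r' r \<circ> l \<circ> ?s)"
    by (rule regularity_cong[where f="local_change r r' x\<^sub>0", OF regularity_reg open_overlap_slit[OF r]])
       (simp_all add: lift_eq regular_local_change[OF r])
  with local_sec
  show "\<exists>T s. local_section (overlap_cover r r') (overlap_proj r r') p T s \<and> reg T (overlap_proj r' r \<circ> l \<circ> s)"
    by (intro exI conjI)
qed

lemma manifold_iso_cover_change: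
  assumes r: "r \<in> R" and r': "r' \<in> R"
  shows "manifold_iso reg (overlap_cover r r') (overlap_proj r r') (overlap_cover r' r) (overlap_proj r' r)
    (cover_change r r')"
proof -
  have "inv_into (overlap_cover r r') (cover_change r r') p = cover_change r' r p" if "p \<in> overlap_cover r' r" for p
    by (rule inv_into_f_eq[OF bij_betw_imp_inj_on[OF bij_betw_cover_change[OF r r']]])
       (use that in \<open>auto simp: cover_change_def change_lift_in_overlap_logs r r' change_lift_change_lift\<close>)
  then show ?thesis
    unfolding manifold_iso_def
    using bij_betw_cover_change manifold_map_cover_change r r' by blast
qed

lemma chart_change_group_orbit:
  assumes r: "r \<in> R" and r': "r' \<in> R" and x: "x \<in> overlap_logs r r'"
  shows "chart_change (slice_chart r) (slice_chart r') (group_orbit (\<Gamma> r) (overlap_exp r r' x)) =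
    group_orbit (\<Gamma> r') (overlap_exp r' r (change_lift r r' x))"
proof -
  note w = overlap_exp_in_slice_dom[OF x] overlap_exp_in_slice_dom[OF change_lift_in_overlap_logs[OF r r' x]]
  have "chart_map (slice_chart r) (group_orbit (\<Gamma> r) (overlap_exp r r' x)) =
      chart_map (slice_chart r') (group_orbit (\<Gamma> r') (overlap_exp r' r (change_lift r r' x)))"
    using chart_map_slice_chart[OF r w(1)] chart_map_slice_chart[OF r' w(2)] orbit_slice_change_lift[OF r r' x]
    by simp
  then show ?thesis
    using inj_on_chart_map[OF r'] w(2) by (simp add: chart_change_def chart_orbits_slice_chart)
qed

lemma inj_on_chart_change:
  assumes r: "r \<in> R"
  shows "inj_on (chart_change (slice_chart r) (slice_chart r')) (chart_overlap (slice_chart r) (slice_chart r'))"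
proof (rule inj_onI)
  fix p q assume pq: "p \<in> chart_overlap (slice_chart r) (slice_chart r')"
    "q \<in> chart_overlap (slice_chart r) (slice_chart r')"
    and eq: "chart_change (slice_chart r) (slice_chart r') p = chart_change (slice_chart r) (slice_chart r') q"
  have "chart_map (slice_chart r) p = chart_map (slice_chart r) q"
    using eq pq inv_into_injective[of "chart_orbits (slice_chart r')" "chart_map (slice_chart r')"]
    by (auto simp: chart_change_def chart_overlap_def chart_image_def)
  then show "p = q" using inj_on_chart_map[OF r] pq by (auto simp: chart_overlap_def inj_on_def)
qed

lemma chart_change_lift_slice_chart:
  assumes r: "r \<in> R" and r': "r' \<in> R"
  shows "chart_change_lift reg (slice_chart r) (overlap_cover r r') (overlap_proj r r')
    (slice_chart r') (overlap_cover r' r) (overlap_proj r' r) (cover_change r r')"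
  unfolding chart_change_lift_def model_iso_lift_def
proof (intro conjI ballI submodel_cover_slice_chart manifold_iso_cover_change r r')
  let ?a = "group_orbit (chart_group (slice_chart r)) \<circ> overlap_proj r r'"
  let ?b = "group_orbit (chart_group (slice_chart r')) \<circ> overlap_proj r' r"
  show comm: "?b (cover_change r r' p) = chart_change (slice_chart r) (slice_chart r') (?a p)"
    if "p \<in> overlap_cover r r'" for p
    using that chart_change_group_orbit[OF r r'] by (auto simp: cover_change_def cover_proj_def)
  have "?a ` overlap_cover r r' \<subseteq> chart_overlap (slice_chart r) (slice_chart r')"
    using overlap_preimage[OF r r'] partial_exp_image_log_domain[of "new_index r r'" "moduli r"]
    by (auto simp: cover_proj_def)
  then have "inj_on (chart_change (slice_chart r) (slice_chart r')) (?a ` overlap_cover r r')"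
    by (rule inj_on_subset[OF inj_on_chart_change[OF r]])
  then show "bij_betw (chart_change (slice_chart r) (slice_chart r'))
      (?a ` overlap_cover r r') (?b ` overlap_cover r' r)"
    by (intro bij_betw_induced_on_images[OF bij_betw_cover_change[OF r r']] comm)
qed

theorem quasifold_atlas_slice_charts: "quasifold_atlas reg orbit_space (slice_chart ` R)"
  unfolding quasifold_atlas_def
proof (intro conjI ballI)
  show "is_chart reg orbit_space c" if "c \<in> slice_chart ` R" for c using that is_chart_slice_chart by blast
  show "(\<Union>c\<in>slice_chart ` R. chart_image c) = topspace orbit_space" using chart_images_cover by simp
  fix c c' assume "c \<in> slice_chart ` R" "c' \<in> slice_chart ` R"
  then obtain r r' where "c = slice_chart r" "c' = slice_chart r'" "r \<in> R" "r' \<in> R" by blast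
  then have "chart_change_lift reg c (overlap_cover r r') (overlap_proj r r')
      c' (overlap_cover r' r) (overlap_proj r' r) (cover_change r r')"
    by (simp only: chart_change_lift_slice_chart)
  then show "charts_compatible reg c c'" unfolding charts_compatible_def by (intro impI exI)
qed

lemma pulls_back_cover_change:
  assumes r: "r \<in> R" and r': "r' \<in> R"
    and local_pullback: "\<And>x\<^sub>0 u v. x\<^sub>0 \<in> overlap_logs r r' \<Longrightarrow> \<omega> (overlap_exp r r' x\<^sub>0) u v =
      \<omega>' (local_change r r' x\<^sub>0 (overlap_exp r r' x\<^sub>0))
        (frechet_derivative (local_change r r' x\<^sub>0) (at (overlap_exp r r' x\<^sub>0)) u)
        (frechet_derivative (local_change r r' x\<^sub>0) (at (overlap_exp r r' x\<^sub>0)) v)"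
  shows "pulls_back (overlap_cover r r') (overlap_proj r r') (overlap_proj r' r) (cover_change r r') \<omega>' \<omega>"
  unfolding pulls_back_def
proof
  fix p assume "p \<in> overlap_cover r r'"
  then obtain x\<^sub>0 where x\<^sub>0: "p = (x\<^sub>0, 0)" "x\<^sub>0 \<in> overlap_logs r r'" by auto
  let ?w = "overlap_exp r r' x\<^sub>0" and ?s = "\<lambda>w. (overlap_log r r' x\<^sub>0 w, 0::complex^'n)"
  let ?lift = "overlap_proj r' r \<circ> cover_change r r' \<circ> ?s"
  have local_sec: "local_section (overlap_cover r r') (overlap_proj r r') p (overlap_slit r r' x\<^sub>0) ?s"
    unfolding x\<^sub>0(1) by (rule local_section_log_cover[OF open_moduli[OF r] x\<^sub>0(2)])
  have lift_eq: "?lift w = local_change r r' x\<^sub>0 w" if "w \<in> overlap_slit r r' x\<^sub>0" for w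
    using cover_proj_cover_change[OF r r' that] by simp
  have w: "?w \<in> overlap_slit r r' x\<^sub>0" by (rule partial_exp_in_slit_domain[OF x\<^sub>0(2)])
  have "?s ?w = p" by (auto simp: x\<^sub>0(1) log_section_def partial_exp_def vec_eq_iff)
  then have point: "overlap_proj r' r (cover_change r r' p) = local_change r r' x\<^sub>0 ?w"
    using lift_eq[OF w] by simp
  have deriv: "frechet_derivative ?lift (at ?w) = frechet_derivative (local_change r r' x\<^sub>0) (at ?w)"
    by (rule frechet_derivative_cong_open[OF open_overlap_slit[OF r] w lift_eq])
  have proj: "overlap_proj r r' p = ?w" by (simp add: x\<^sub>0(1) cover_proj_def)
  show "\<exists>T s. local_section (overlap_cover r r') (overlap_proj r r') p T s \<and> (\<forall>u v. \<omega> (overlap_proj r r' p) u v =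
     \<omega>' (overlap_proj r' r (cover_change r r' p))
        (frechet_derivative (overlap_proj r' r \<circ> cover_change r r' \<circ> s) (at (overlap_proj r r' p)) u)
        (frechet_derivative (overlap_proj r' r \<circ> cover_change r r' \<circ> s) (at (overlap_proj r r' p)) v))"
    by (intro exI conjI, rule local_sec) (simp only: proj point deriv local_pullback[OF x\<^sub>0(2)], simp)
qed

end

section \<open>Simple polytopes near a vertex\<close>

lemma not_extreme_point_if_two_sided:
  fixes u :: "'a::real_vector"
  assumes "u \<noteq> 0" "\<forall>\<^sub>F t in at_right (0::real). x + t *\<^sub>R u \<in> S" "\<forall>\<^sub>F t in at_right (0::real). x - t *\<^sub>R u \<in> S"
  shows "\<not> x extreme_point_of S"
proof
  assume extreme: "x extreme_point_of S"
  have "\<forall>\<^sub>F t in at_right (0::real). False"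
    using assms(2,3) eventually_at_right_less[of "0::real"]
  proof eventually_elim
    case (elim t)
    have "(2 * t) *\<^sub>R u \<noteq> 0" using elim(3) \<open>u \<noteq> 0\<close> by simp
    then have "x - t *\<^sub>R u \<noteq> x + t *\<^sub>R u" by (simp add: algebra_simps flip: scaleR_add_left)
    moreover have "midpoint (x - t *\<^sub>R u) (x + t *\<^sub>R u) = x" by (simp add: midpoint_def flip: scaleR_2)
    ultimately have "x \<in> open_segment (x - t *\<^sub>R u) (x + t *\<^sub>R u)"
      by (metis midpoint_in_open_segment)
    then show ?case using extreme elim by (auto simp: extreme_point_of_def)
  qed
  then show False by simp
qed

lemma edge_eq_closed_segment:
  fixes P :: "'a::euclidean_space set"
  assumes P: "compact P" "convex P" and v: "v extreme_point_of P" and E: "E edge_of P" "v \<in> E"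
  obtains w where "E = closed_segment v w"
proof -
  have face: "E face_of P" and "aff_dim E = 1" using E by (auto simp: edge_of_def)
  then obtain a b where ab: "E = closed_segment a b"
    using compact_convex_collinear_segment[of E] E(2) face_of_imp_compact[OF P(2,1)] face_of_imp_convex
    by (metis collinear_aff_dim empty_iff order_refl)
  have "v extreme_point_of E" using v E(2) extreme_point_of_face[OF face] by blast
  then have "v = a \<or> v = b" by (simp add: ab extreme_point_of_segment)
  then show ?thesis using that ab closed_segment_commute by metis
qed

lemma aff_dim_le_dim_if_diff_in_span:
  fixes S :: "'a::euclidean_space set"
  assumes "v \<in> S" "\<And>x. x \<in> S \<Longrightarrow> x - v \<in> span T"
  shows "aff_dim S \<le> int (dim T)"
proof -
  have "aff_dim S = int (dim ((+) (- v) ` S))" using assms(1) by (intro aff_dim_eq_dim hull_inc)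
  moreover have "(+) (- v) ` S \<subseteq> span T" using assms(2) by auto
  ultimately show ?thesis using dim_mono[of "(+) (- v) ` S" T] by simp
qed

lemma convex_cone_hull_Int_hyperplane_subset_span:
  fixes U :: "'a::real_inner set"
  assumes nonneg: "\<And>u. u \<in> U \<Longrightarrow> u \<bullet> a \<ge> 0" and x: "x \<in> convex_cone hull U" "x \<bullet> a = 0"
  shows "x \<in> span {u \<in> U. u \<bullet> a = 0}"
proof -
  let ?C = "{x. x \<bullet> a \<ge> 0 \<and> (x \<bullet> a = 0 \<longrightarrow> x \<in> span {u \<in> U. u \<bullet> a = 0})}"
  have "convex_cone hull U \<subseteq> ?C"
  proof (rule hull_minimal)
    show "U \<subseteq> ?C" using nonneg by (auto intro: span_base)
    show "convex_cone ?C"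
      unfolding convex_cone_iff
      by (auto simp: inner_add_left span_zero span_scale add_nonneg_eq_0_iff intro: span_add)
  qed
  then show ?thesis using x by blast
qed

definition edge_vectors :: "'a::euclidean_space set \<Rightarrow> 'a \<Rightarrow> 'a set" where
  "edge_vectors P v = {u. closed_segment v (v + u) edge_of P}"

lemma edge_vectors_card_le:
  fixes P :: "'a::euclidean_space set"
  assumes P: "polytope P"
  shows "finite (edge_vectors P v)" "card (edge_vectors P v) \<le> card {E. E edge_of P \<and> v \<in> E}"
proof -
  let ?edge = "\<lambda>u. closed_segment v (v + u)"
  have "inj_on ?edge (edge_vectors P v)" by (rule inj_onI) (auto simp: doubleton_eq_iff)
  moreover have "?edge ` edge_vectors P v \<subseteq> {E. E edge_of P \<and> v \<in> E}" by (auto simp: edge_vectors_def)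
  moreover have "finite {E. E edge_of P \<and> v \<in> E}"
    by (rule finite_subset[OF _ finite_polytope_faces[OF P]]) (auto simp: edge_of_def)
  ultimately show "finite (edge_vectors P v)" "card (edge_vectors P v) \<le> card {E. E edge_of P \<and> v \<in> E}"
    by (auto intro: inj_on_finite card_inj_on_le)
qed

locale polytope_data =
  fixes \<Delta> :: "'a::euclidean_space set" and X :: "'d::finite \<Rightarrow> 'a" and lam :: "'d \<Rightarrow> real"
  assumes simple: "simple_polytope \<Delta>" and full_dim: "aff_dim \<Delta> = int DIM('a)"
    and Delta_eq: "\<Delta> = (\<Inter>j. {\<mu>. \<mu> \<bullet> X j \<ge> lam j})"
    and facets: "bij_betw (\<lambda>j. {\<mu> \<in> \<Delta>. \<mu> \<bullet> X j = lam j}) UNIV {F. F facet_of \<Delta>}"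
begin

abbreviation active :: "'a \<Rightarrow> 'd set" where
  "active \<nu> \<equiv> face_index X lam {\<nu>}"

definition facet_intersection :: "'d set \<Rightarrow> 'a set" where
  "facet_intersection J = {\<nu> \<in> \<Delta>. \<forall>j\<in>J. \<nu> \<bullet> X j = lam j}"

lemma mem_Delta: "\<nu> \<in> \<Delta> \<longleftrightarrow> (\<forall>j. \<nu> \<bullet> X j \<ge> lam j)"
  using Delta_eq by blast

lemma mem_active: "j \<in> active \<nu> \<longleftrightarrow> \<nu> \<bullet> X j = lam j"
  by (simp add: face_index_def)

lemma polytope_Delta: "polytope \<Delta>"
  using simple by (simp add: simple_polytope_def)

lemma compact_Delta: "compact \<Delta>"
  by (rule polytope_imp_compact[OF polytope_Delta])

lemma convex_Delta: "convex \<Delta>"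
  by (rule polytope_imp_convex[OF polytope_Delta])

lemma feasible_direction:
  assumes \<nu>: "\<nu> \<in> \<Delta>" and u: "\<And>j. j \<in> active \<nu> \<Longrightarrow> u \<bullet> X j \<ge> 0"
  shows "\<forall>\<^sub>F t in at_right (0::real). \<nu> + t *\<^sub>R u \<in> \<Delta> \<and> (\<forall>j. j \<notin> active \<nu> \<longrightarrow> (\<nu> + t *\<^sub>R u) \<bullet> X j > lam j)"
proof -
  have "\<forall>\<^sub>F t in at_right (0::real). j \<notin> active \<nu> \<longrightarrow> (\<nu> + t *\<^sub>R u) \<bullet> X j > lam j" for j
  proof (cases "j \<in> active \<nu>")
    case False
    then have slack: "lam j < (\<nu> + 0 *\<^sub>R u) \<bullet> X j"
      using \<nu> by (auto simp: mem_Delta mem_active less_le)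
    have "((\<lambda>t. (\<nu> + t *\<^sub>R u) \<bullet> X j) \<longlongrightarrow> (\<nu> + 0 *\<^sub>R u) \<bullet> X j) (at_right 0)"
      by (intro tendsto_intros)
    from order_tendstoD(1)[OF this slack] show ?thesis by (rule eventually_mono) simp
  qed simp
  then have "\<forall>\<^sub>F t in at_right (0::real). \<forall>j. j \<notin> active \<nu> \<longrightarrow> (\<nu> + t *\<^sub>R u) \<bullet> X j > lam j"
    by (rule eventually_all_finite)
  moreover have "\<forall>\<^sub>F t in at_right (0::real). t > 0" by (rule eventually_at_right_less)
  ultimately show ?thesis
  proof eventually_elim
    case (elim t)
    have "(\<nu> + t *\<^sub>R u) \<bullet> X j \<ge> lam j" for j
    proof (cases "j \<in> active \<nu>")
      case True
      then show ?thesis using elim(2) u[OF True] by (simp add: mem_active inner_add_left)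
    qed (use elim in \<open>auto intro: less_imp_le\<close>)
    then show ?case using elim by (simp add: mem_Delta)
  qed
qed

lemma facet_intersection_face_of: "facet_intersection J face_of \<Delta>"
proof (cases "J = {}")
  case True
  then show ?thesis by (simp add: facet_intersection_def face_of_refl convex_Delta)
next
  case False
  have "{\<nu> \<in> \<Delta>. \<nu> \<bullet> X j = lam j} face_of \<Delta>" for j
    using face_of_Int_supporting_hyperplane_ge[OF convex_Delta, of "lam j" "X j"]
    by (simp add: mem_Delta inner_commute Int_def)
  then have "(\<Inter>j\<in>J. {\<nu> \<in> \<Delta>. \<nu> \<bullet> X j = lam j}) face_of \<Delta>" using False by (intro face_of_Inter) auto
  moreover have "(\<Inter>j\<in>J. {\<nu> \<in> \<Delta>. \<nu> \<bullet> X j = lam j}) = facet_intersection J"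
    using False by (auto simp: facet_intersection_def)
  ultimately show ?thesis by simp
qed

lemma mem_facet_intersection_active: "\<nu> \<in> \<Delta> \<Longrightarrow> \<nu> \<in> facet_intersection (active \<nu>)"
  by (simp add: facet_intersection_def mem_active)

lemma slice_extreme_point_rigid:
  assumes q: "q extreme_point_of (\<Delta> \<inter> {x. a \<bullet> x = b})"
    and u: "\<And>j. j \<in> active q \<Longrightarrow> u \<bullet> X j = 0" "a \<bullet> u = 0"
  shows "u = 0"
proof (rule ccontr)
  assume "u \<noteq> 0"
  have q_mem: "q \<in> \<Delta>" "a \<bullet> q = b" using q by (auto simp: extreme_point_of_def)
  have "\<not> q extreme_point_of (\<Delta> \<inter> {x. a \<bullet> x = b})"
  proof (rule not_extreme_point_if_two_sided[OF \<open>u \<noteq> 0\<close>])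
    show "\<forall>\<^sub>F t in at_right 0. q + t *\<^sub>R u \<in> \<Delta> \<inter> {x. a \<bullet> x = b}"
      using feasible_direction[OF q_mem(1), of u] u q_mem(2)
      by (auto elim!: eventually_mono simp: inner_add_right)
    show "\<forall>\<^sub>F t in at_right 0. q - t *\<^sub>R u \<in> \<Delta> \<inter> {x. a \<bullet> x = b}"
      using feasible_direction[OF q_mem(1), of "- u"] u q_mem(2)
      by (auto elim!: eventually_mono simp: inner_diff_right)
  qed
  then show False using q by simp
qed

lemma vertex_normals_span:
  assumes v: "v extreme_point_of \<Delta>"
  shows "span (X ` active v) = UNIV"
proof (rule ccontr)
  assume "span (X ` active v) \<noteq> UNIV"
  then obtain u where u: "u \<noteq> 0" "\<forall>x\<in>span (X ` active v). u \<bullet> x = 0"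
    using span_not_UNIV_orthogonal by blast
  then have "u \<bullet> X j = 0" if "j \<in> active v" for j using that by (simp add: span_base)
  then have "u = 0" using v by (intro slice_extreme_point_rigid[of v 0 0]) auto
  then show False using u(1) by simp
qed

lemma slice_extreme_point_on_edge:
  assumes q: "q extreme_point_of (\<Delta> \<inter> {x. a \<bullet> x = b})" and not_vertex: "\<not> q extreme_point_of \<Delta>"
  shows "facet_intersection (active q) edge_of \<Delta>"
proof -
  let ?F = "facet_intersection (active q)"
  have "q \<in> \<Delta>" using q by (auto simp: extreme_point_of_def)
  then have q_mem: "q \<in> ?F" by (rule mem_facet_intersection_active)
  have tangent: "(x - q) \<bullet> X j = 0" if "x \<in> ?F" "j \<in> active q" for x j
    using that by (simp add: facet_intersection_def mem_active inner_diff_left)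
  have "?F \<noteq> {q}" using facet_intersection_face_of[of "active q"] not_vertex by (metis face_of_singleton)
  then obtain p where p: "p \<in> ?F" "p \<noteq> q" using q_mem by blast
  have a_p: "a \<bullet> (p - q) \<noteq> 0" using slice_extreme_point_rigid[OF q tangent[OF p(1)]] p(2) by auto
  have "x - q \<in> span {p - q}" if x: "x \<in> ?F" for x
  proof -
    define t where "t = (a \<bullet> (x - q)) / (a \<bullet> (p - q))"
    have "(x - q) - t *\<^sub>R (p - q) = 0"
    proof (rule slice_extreme_point_rigid[OF q])
      show "(x - q - t *\<^sub>R (p - q)) \<bullet> X j = 0" if "j \<in> active q" for j
        using tangent[OF x that] tangent[OF p(1) that] by (simp add: inner_diff_left)
      show "a \<bullet> (x - q - t *\<^sub>R (p - q)) = 0" using a_p by (simp add: inner_diff_right t_def)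
    qed
    then show ?thesis by (auto simp: span_singleton)
  qed
  then have "aff_dim ?F \<le> int (dim {p - q})" by (intro aff_dim_le_dim_if_diff_in_span[OF q_mem])
  also have "\<dots> \<le> 1" by (simp add: dim_singleton)
  finally have "aff_dim ?F \<le> 1" .
  moreover have "aff_dim {q, p} \<le> aff_dim ?F" using p q_mem by (intro aff_dim_subset) auto
  ultimately show ?thesis using facet_intersection_face_of p(2) by (simp add: edge_of_def aff_dim_2)
qed

lemma separated_vertex_in_face:
  assumes F: "F face_of \<Delta>" and x: "x \<in> F" "a \<bullet> x \<le> b"
    and separated: "\<And>w. w extreme_point_of \<Delta> \<Longrightarrow> w \<noteq> v \<Longrightarrow> a \<bullet> w > b"
  shows "v \<in> F"
proof (rule ccontr)
  assume "v \<notin> F"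
  have "compact F" "convex F"
    using F face_of_imp_compact[OF convex_Delta compact_Delta] face_of_imp_convex by auto
  then have "F = convex hull {x. x extreme_point_of F}" by (rule Krein_Milman_Minkowski)
  also have "\<dots> \<subseteq> {x. a \<bullet> x > b}"
  proof (rule hull_minimal)
    show "{x. x extreme_point_of F} \<subseteq> {x. a \<bullet> x > b}"
      using extreme_point_of_face[OF F] separated \<open>v \<notin> F\<close> by blast
  qed (rule convex_halfspace_gt)
  finally show False using x by auto
qed

lemma vertex_figure:
  assumes v: "a \<bullet> v < b" and separated: "\<And>w. w extreme_point_of \<Delta> \<Longrightarrow> w \<noteq> v \<Longrightarrow> a \<bullet> w > b"
    and q: "q extreme_point_of (\<Delta> \<inter> {x. a \<bullet> x = b})"
  obtains E where "E edge_of \<Delta>" "v \<in> E" "q \<in> E"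
proof -
  have q_mem: "q \<in> \<Delta>" "a \<bullet> q = b" using q by (auto simp: extreme_point_of_def)
  have "\<not> q extreme_point_of \<Delta>" using v separated[of q] q_mem(2) by (cases "q = v") auto
  then have "facet_intersection (active q) edge_of \<Delta>" by (rule slice_extreme_point_on_edge[OF q])
  moreover have q_face: "q \<in> facet_intersection (active q)" by (rule mem_facet_intersection_active[OF q_mem(1)])
  moreover have "v \<in> facet_intersection (active q)"
    by (rule separated_vertex_in_face[OF facet_intersection_face_of q_face _ separated]) (simp_all add: q_mem(2))
  ultimately show ?thesis using that by blast
qed

lemma vertex_separating_hyperplane:
  assumes v: "v extreme_point_of \<Delta>"
  obtains a b where "a \<bullet> v < b" "\<And>w. w extreme_point_of \<Delta> \<Longrightarrow> w \<noteq> v \<Longrightarrow> a \<bullet> w > b"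
proof -
  define W where "W = {w. w extreme_point_of \<Delta> \<and> w \<noteq> v}"
  have "finite {w. w extreme_point_of \<Delta>}"
    using polytope_Delta by (simp add: finite_polyhedron_extreme_points polytope_imp_polyhedron)
  then have "finite W" by (simp add: W_def)
  then have "closed (convex hull W)" by (simp add: finite_imp_compact_convex_hull compact_imp_closed)
  moreover have "v \<notin> convex hull W"
  proof
    assume "v \<in> convex hull W"
    moreover have "convex hull W \<subseteq> \<Delta>"
      by (rule hull_minimal) (auto simp: W_def extreme_point_of_def convex_Delta)
    ultimately have "v extreme_point_of (convex hull W)" using v by (auto simp: extreme_point_of_def)
    then have "v \<in> W" by (rule extreme_point_of_convex_hull)
    then show False by (simp add: W_def)
  qed
  ultimately obtain a b where "a \<bullet> v < b" "\<forall>x\<in>convex hull W. a \<bullet> x > b"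
    using separating_hyperplane_closed_point[of "convex hull W" v] by blast
  then show ?thesis using that hull_inc[of _ W convex] by (auto simp: W_def)
qed

lemma edge_subset_edge_cone:
  assumes v: "v extreme_point_of \<Delta>" and E: "E edge_of \<Delta>" "v \<in> E" and x: "x \<in> E"
  shows "x - v \<in> convex_cone hull (edge_vectors \<Delta> v)"
proof -
  obtain w where w: "E = closed_segment v w" using edge_eq_closed_segment[OF compact_Delta convex_Delta v E] .
  then have "w - v \<in> edge_vectors \<Delta> v" using E(1) by (simp add: edge_vectors_def)
  moreover obtain t where "t \<ge> 0" "x - v = t *\<^sub>R (w - v)"
    using x w by (auto simp: in_segment algebra_simps)
  ultimately show ?thesis by (simp add: convex_cone_hull_mul hull_inc)
qed

lemma edge_cone:
  assumes v: "v extreme_point_of \<Delta>" and x: "x \<in> \<Delta>"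
  shows "x - v \<in> convex_cone hull (edge_vectors \<Delta> v)"
proof -
  define K where "K = (+) v ` (convex_cone hull (edge_vectors \<Delta> v))"
  have mem_K: "y \<in> K \<longleftrightarrow> y - v \<in> convex_cone hull (edge_vectors \<Delta> v)" for y
    unfolding K_def by (auto simp: image_iff algebra_simps intro: bexI[of _ "y - v"])
  have "convex K" unfolding K_def by (intro convex_translation convex_convex_cone_hull)
  obtain a b where v_below: "a \<bullet> v < b" and above: "\<And>w. w extreme_point_of \<Delta> \<Longrightarrow> w \<noteq> v \<Longrightarrow> a \<bullet> w > b"
    using vertex_separating_hyperplane[OF v] by blast
  let ?S = "\<Delta> \<inter> {x. a \<bullet> x = b}"
  have "?S = convex hull {x. x extreme_point_of ?S}"
    using compact_Delta convex_Delta
    by (intro Krein_Milman_Minkowski compact_Int_closed closed_hyperplane convex_Int convex_hyperplane)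
  also have "\<dots> \<subseteq> K"
  proof (rule hull_minimal)
    have "q \<in> K" if "q extreme_point_of ?S" for q
      using vertex_figure[OF v_below above that] edge_subset_edge_cone[OF v] mem_K by metis
    then show "{x. x extreme_point_of ?S} \<subseteq> K" by blast
  qed (rule \<open>convex K\<close>)
  finally have "?S \<subseteq> K" .
  have "w \<in> K" if w: "w extreme_point_of \<Delta>" for w
  proof (cases "w = v")
    case False
    define t where "t = (b - a \<bullet> v) / (a \<bullet> w - a \<bullet> v)"
    have t: "0 < t" "t \<le> 1" using v_below above[OF w False] by (auto simp: t_def field_simps)
    have "v \<in> \<Delta>" "w \<in> \<Delta>" using v w by (auto simp: extreme_point_of_def)
    then have "(1 - t) *\<^sub>R v + t *\<^sub>R w \<in> \<Delta>" using convex_Delta t by (auto simp: convex_alt)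
    moreover have "a \<bullet> ((1 - t) *\<^sub>R v + t *\<^sub>R w) = a \<bullet> v + t * (a \<bullet> w - a \<bullet> v)"
      by (simp add: inner_add_right algebra_simps)
    then have "a \<bullet> ((1 - t) *\<^sub>R v + t *\<^sub>R w) = b" using v_below above[OF w False] by (simp add: t_def)
    ultimately have "(1 - t) *\<^sub>R v + t *\<^sub>R w \<in> K" using \<open>?S \<subseteq> K\<close> by blast
    then have "t *\<^sub>R (w - v) \<in> convex_cone hull (edge_vectors \<Delta> v)" by (simp add: mem_K algebra_simps)
    then have "(1 / t) *\<^sub>R t *\<^sub>R (w - v) \<in> convex_cone hull (edge_vectors \<Delta> v)"
      using t by (intro convex_cone_hull_mul[of "t *\<^sub>R (w - v)"]) auto
    then show ?thesis using t by (simp add: mem_K)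
  qed (simp add: mem_K convex_cone_hull_contains_0)
  then have "convex hull {w. w extreme_point_of \<Delta>} \<subseteq> K" using \<open>convex K\<close> by (intro hull_minimal) auto
  then show ?thesis using Krein_Milman_Minkowski[OF compact_Delta convex_Delta] x mem_K by blast
qed

lemma edge_vector_nonneg:
  assumes u: "u \<in> edge_vectors \<Delta> v" and j: "j \<in> active v"
  shows "u \<bullet> X j \<ge> 0"
proof -
  have "v + u \<in> \<Delta>" using u edge_of_imp_subset by (fastforce simp: edge_vectors_def)
  then have "(v + u) \<bullet> X j \<ge> lam j" by (simp add: mem_Delta)
  then show ?thesis using j by (simp add: mem_active inner_add_left)
qed

lemma edge_vectors_basis:
  assumes v: "v extreme_point_of \<Delta>"
  shows "span (edge_vectors \<Delta> v) = UNIV" "card (edge_vectors \<Delta> v) = DIM('a)"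
proof -
  let ?U = "edge_vectors \<Delta> v"
  have "v \<in> \<Delta>" using v by (simp add: extreme_point_of_def)
  moreover have "x - v \<in> span ?U" if "x \<in> \<Delta>" for x
    using edge_cone[OF v that] hull_minimal[of ?U "span ?U" convex_cone] span_superset convex_cone_span by blast
  ultimately have "int DIM('a) \<le> int (dim ?U)" using aff_dim_le_dim_if_diff_in_span full_dim by metis
  then have dim: "dim ?U = DIM('a)" using dim_subset_UNIV[of ?U] by linarith
  then show "span ?U = UNIV" by (simp add: dim_eq_full)
  have "card ?U \<le> DIM('a)"
    using edge_vectors_card_le(2)[OF polytope_Delta, of v] simple v full_dim by (simp add: simple_polytope_def)
  moreover have "dim ?U \<le> card ?U" by (rule dim_le_card'[OF edge_vectors_card_le(1)[OF polytope_Delta]])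
  ultimately show "card ?U = DIM('a)" using dim by simp
qed

lemma orthogonal_to_edge_vectors:
  assumes v: "v extreme_point_of \<Delta>" and x: "\<And>u. u \<in> edge_vectors \<Delta> v \<Longrightarrow> u \<bullet> x = 0"
  shows "x = 0"
proof -
  have "orthogonal x x"
    using edge_vectors_basis(1)[OF v] x
    by (intro orthogonal_to_span[of x "edge_vectors \<Delta> v"]) (auto simp: orthogonal_def inner_commute[of x])
  then show ?thesis by (simp add: orthogonal_def)
qed

lemma facet_of_index: "{\<mu> \<in> \<Delta>. \<mu> \<bullet> X j = lam j} facet_of \<Delta>"
  using facets by (auto simp: bij_betw_def)

lemma facet_normal_nonzero: "X j \<noteq> 0"
proof
  assume "X j = 0"
  moreover obtain \<nu> where "\<nu> \<in> \<Delta>" "\<nu> \<bullet> X j = lam j" using facet_of_index[of j] by (auto simp: facet_of_def)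
  ultimately have "{\<mu> \<in> \<Delta>. \<mu> \<bullet> X j = lam j} = \<Delta>" by auto
  then show False using facet_of_index[of j] by (auto simp: facet_of_def)
qed

lemma unique_transversal_edge:
  assumes v: "v extreme_point_of \<Delta>" and j: "j \<in> active v"
  shows "\<exists>!u. u \<in> edge_vectors \<Delta> v \<and> u \<bullet> X j \<noteq> 0"
proof -
  let ?U = "edge_vectors \<Delta> v" and ?F = "{\<mu> \<in> \<Delta>. \<mu> \<bullet> X j = lam j}"
  let ?T = "{u \<in> ?U. u \<bullet> X j = 0}" and ?N = "{u \<in> ?U. u \<bullet> X j \<noteq> 0}"
  have fin: "finite ?U" by (rule edge_vectors_card_le(1)[OF polytope_Delta])
  have "v \<in> ?F" using v j by (auto simp: extreme_point_of_def mem_active)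
  moreover have "x - v \<in> span ?T" if x: "x \<in> ?F" for x
  proof (rule convex_cone_hull_Int_hyperplane_subset_span)
    show "x - v \<in> convex_cone hull ?U" using edge_cone[OF v] x by simp
    show "(x - v) \<bullet> X j = 0" using x j by (simp add: mem_active inner_diff_left)
  qed (rule edge_vector_nonneg[OF _ j])
  ultimately have "aff_dim ?F \<le> int (dim ?T)" by (rule aff_dim_le_dim_if_diff_in_span)
  moreover have "dim ?T \<le> card ?T" using fin by (intro dim_le_card') auto
  ultimately have "DIM('a) \<le> card ?T + 1" using facet_of_index[of j] full_dim by (simp add: facet_of_def)
  moreover have "?U = ?T \<union> ?N" by blast
  then have "card ?U = card ?T + card ?N" using card_Un_disjoint[of ?T ?N] fin by (auto simp: disjoint_iff)
  ultimately have "card ?N \<le> 1" using edge_vectors_basis(2)[OF v] by simp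
  moreover have "?N \<noteq> {}" using orthogonal_to_edge_vectors[OF v, of "X j"] facet_normal_nonzero by auto
  ultimately have "card ?N = 1" using fin by (simp add: card_gt_0_iff Suc_leI order_antisym)
  then obtain u where "?N = {u}" by (rule card_1_singletonE)
  then show ?thesis unfolding set_eq_iff by auto
qed

lemma facet_normals_not_parallel:
  assumes "j \<in> active v" "i \<in> active v" and X: "X j = s *\<^sub>R X i"
  shows "i = j"
proof -
  have "s \<noteq> 0" using X facet_normal_nonzero[of j] by auto
  have "lam j = s * lam i" using assms by (simp add: mem_active)
  then have "{\<mu> \<in> \<Delta>. \<mu> \<bullet> X i = lam i} = {\<mu> \<in> \<Delta>. \<mu> \<bullet> X j = lam j}" using \<open>s \<noteq> 0\<close> by (auto simp: X)
  then show ?thesis using facets by (auto simp: bij_betw_def inj_on_def)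
qed

lemma vertex_dual_basis:
  assumes v: "v extreme_point_of \<Delta>"
  shows "\<exists>y. \<forall>i\<in>active v. \<forall>j\<in>active v. y i \<bullet> X j = (if i = j then 1 else 0)"
proof -
  obtain e where e: "\<And>j. j \<in> active v \<Longrightarrow> e j \<in> edge_vectors \<Delta> v \<and> e j \<bullet> X j \<noteq> 0"
    and unique: "\<And>j u. j \<in> active v \<Longrightarrow> u \<in> edge_vectors \<Delta> v \<Longrightarrow> u \<bullet> X j \<noteq> 0 \<Longrightarrow> u = e j"
    using unique_transversal_edge[OF v] by metis
  have inj: "i = j" if i: "i \<in> active v" and j: "j \<in> active v" and eq: "e i = e j" for i j
  proof (rule facet_normals_not_parallel[OF j i])
    define s where "s = (e j \<bullet> X j) / (e i \<bullet> X i)"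
    have "u \<bullet> (X j - s *\<^sub>R X i) = 0" if u: "u \<in> edge_vectors \<Delta> v" for u
    proof (cases "u = e i")
      case True
      then show ?thesis using e[OF i] by (simp add: inner_diff_right s_def eq)
    next
      case False
      then have "u \<bullet> X i = 0" "u \<bullet> X j = 0" using unique[OF i u] unique[OF j u] eq by metis+
      then show ?thesis by (simp add: inner_diff_right)
    qed
    then have "X j - s *\<^sub>R X i = 0" by (rule orthogonal_to_edge_vectors[OF v])
    then show "X j = s *\<^sub>R X i" by simp
  qed
  show ?thesis
  proof (intro exI[of _ "\<lambda>i. (1 / (e i \<bullet> X i)) *\<^sub>R e i"] ballI)
    fix i j assume "i \<in> active v" "j \<in> active v"
    then show "((1 / (e i \<bullet> X i)) *\<^sub>R e i) \<bullet> X j = (if i = j then 1 else 0)"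
      using e[of i] unique[of j "e i"] inj[of i j] by auto
  qed
qed

lemma vertex_normals:
  assumes v: "v extreme_point_of \<Delta>"
  shows "inj_on X (active v)" "independent (X ` active v)" "card (active v) = DIM('a)"
proof -
  obtain y where y: "\<And>i j. i \<in> active v \<Longrightarrow> j \<in> active v \<Longrightarrow> y i \<bullet> X j = (if i = j then 1 else 0)"
    using vertex_dual_basis[OF v] by blast
  show inj: "inj_on X (active v)"
    by (rule inj_onI) (use y in \<open>metis one_neq_zero\<close>)
  show indep: "independent (X ` active v)"
  proof (rule independent_if_scalars_zero)
    fix f x assume sum: "(\<Sum>x\<in>X ` active v. f x *\<^sub>R x) = 0" and "x \<in> X ` active v"
    then obtain i where i: "i \<in> active v" "x = X i" by blast
    have "0 = y i \<bullet> (\<Sum>x\<in>X ` active v. f x *\<^sub>R x)" by (simp add: sum)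
    also have "\<dots> = (\<Sum>j\<in>active v. f (X j) * (y i \<bullet> X j))"
      by (simp add: sum.reindex[OF inj] inner_sum_right)
    also have "\<dots> = (\<Sum>j\<in>active v. if i = j then f (X j) else 0)"
      by (rule sum.cong) (use y[OF i(1)] in auto)
    also have "\<dots> = f x" using i by simp
    finally show "f x = 0" by simp
  qed simp
  show "card (active v) = DIM('a)"
    using dim_span_eq_card_independent[OF indep] vertex_normals_span[OF v] card_image[OF inj] by simp
qed

lemma face_contains_vertex:
  assumes F: "F face_of \<Delta>" "F \<noteq> {}"
  obtains v where "v \<in> F" "v extreme_point_of \<Delta>"
proof -
  have "compact F" "convex F"
    using F face_of_imp_compact[OF convex_Delta compact_Delta] face_of_imp_convex by auto
  then obtain v where "v extreme_point_of F" using extreme_point_exists_convex F(2) by blast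
  then show ?thesis using that extreme_point_of_face[OF F(1)] by blast
qed

lemma point_with_active_set:
  assumes v: "v extreme_point_of \<Delta>" and J: "J \<subseteq> active v"
  obtains \<nu> where "\<nu> \<in> \<Delta>" "active \<nu> = J"
proof -
  obtain y where y: "\<And>i j. i \<in> active v \<Longrightarrow> j \<in> active v \<Longrightarrow> y i \<bullet> X j = (if i = j then 1 else 0)"
    using vertex_dual_basis[OF v] by blast
  have v_mem: "v \<in> \<Delta>" using v by (simp add: extreme_point_of_def)
  define u where "u = (\<Sum>i\<in>active v - J. y i)"
  have u: "u \<bullet> X j = (if j \<in> J then 0 else 1)" if j: "j \<in> active v" for j
  proof -
    have "u \<bullet> X j = (\<Sum>i\<in>active v - J. if i = j then 1 else 0)"
      unfolding u_def inner_sum_left by (rule sum.cong) (use y j in auto)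
    then show ?thesis using j by simp
  qed
  have "\<forall>\<^sub>F t in at_right (0::real). t > 0 \<and> v + t *\<^sub>R u \<in> \<Delta> \<and> (\<forall>j. j \<notin> active v \<longrightarrow> (v + t *\<^sub>R u) \<bullet> X j > lam j)"
    by (intro eventually_conj eventually_at_right_less feasible_direction[OF v_mem]) (simp add: u)
  then have "\<exists>t>0. v + t *\<^sub>R u \<in> \<Delta> \<and> (\<forall>j. j \<notin> active v \<longrightarrow> (v + t *\<^sub>R u) \<bullet> X j > lam j)"
    by (rule eventually_happens'[OF trivial_limit_at_right_real])
  then obtain t where t: "t > 0" "v + t *\<^sub>R u \<in> \<Delta>" "\<And>j. j \<notin> active v \<Longrightarrow> (v + t *\<^sub>R u) \<bullet> X j > lam j"
    by blast
  have eq_iff: "(v + t *\<^sub>R u) \<bullet> X j = lam j \<longleftrightarrow> j \<in> J" for j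
  proof (cases "j \<in> active v")
    case True
    then show ?thesis using u[OF True] t(1) by (simp add: inner_add_left mem_active)
  next
    case False
    then show ?thesis using t(3)[OF False] J by auto
  qed
  have "active (v + t *\<^sub>R u) = J" by (rule Set.set_eqI) (simp only: mem_active eq_iff)
  then show ?thesis using that t(2) by blast
qed

lemma face_with_index:
  assumes v: "v extreme_point_of \<Delta>" and J: "J \<subseteq> active v"
  obtains F where "F face_of \<Delta>" "F \<noteq> {}" "face_index X lam F = J"
proof -
  obtain \<nu> where \<nu>: "\<nu> \<in> \<Delta>" "active \<nu> = J" using point_with_active_set[OF v J] .
  have mem: "\<nu> \<in> facet_intersection J" using mem_facet_intersection_active[OF \<nu>(1)] \<nu>(2) by simp
  then have "face_index X lam (facet_intersection J) = J"
    using \<nu>(2) by (auto simp: face_index_def facet_intersection_def)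
  then show ?thesis using that[OF facet_intersection_face_of] mem by blast
qed

end

section \<open>The two quasifolds of a simple polytope\<close>

subsection \<open>The torus action as an exponential action\<close>

definition torus_exponent :: "complex^'d \<Rightarrow> complex^'d" where
  "torus_exponent Z = (\<chi> j. 2 * complex_of_real pi * \<i> * Z $ j)"

lemma torus_act_eq_exp_act: "torus_act Z z = exp_act (torus_exponent Z) z"
  by (simp add: torus_act_def exp_act_def torus_exponent_def)

lemma torus_exponent_add: "torus_exponent (Z + Z') = torus_exponent Z + torus_exponent Z'"
  by (simp add: torus_exponent_def vec_eq_iff algebra_simps)

lemma torus_exponent_diff: "torus_exponent (Z - Z') = torus_exponent Z - torus_exponent Z'"
  by (simp add: torus_exponent_def vec_eq_iff algebra_simps)

lemma torus_exponent_surj: "\<exists>Z. torus_exponent Z = \<zeta>"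
  by (rule exI[of _ "\<chi> j. \<zeta> $ j / (2 * complex_of_real pi * \<i>)"]) (simp add: torus_exponent_def vec_eq_iff)

lemma torus_class_eq_iff: "torus_class Z = torus_class Z' \<longleftrightarrow> (\<forall>j. Z $ j - Z' $ j \<in> \<int>)"
proof
  assume "torus_class Z = torus_class Z'"
  moreover have "Z \<in> torus_class Z" by (simp add: torus_class_def)
  ultimately show "\<forall>j. Z $ j - Z' $ j \<in> \<int>" by (simp add: torus_class_def)
next
  assume Z: "\<forall>j. Z $ j - Z' $ j \<in> \<int>"
  have "Y $ j - Z $ j \<in> \<int> \<longleftrightarrow> Y $ j - Z' $ j \<in> \<int>" for Y j
    using Ints_add[of "Y $ j - Z $ j" "Z $ j - Z' $ j"] Ints_diff[of "Y $ j - Z' $ j" "Z $ j - Z' $ j"] Z by auto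
  then show "torus_class Z = torus_class Z'" by (simp add: torus_class_def)
qed

lemma torus_class_in_SC_group_iff: "torus_class Z \<in> SC_group I \<longleftrightarrow> (\<forall>j. j \<notin> I \<longrightarrow> Z $ j \<in> \<int>)"
proof
  assume "torus_class Z \<in> SC_group I"
  then obtain Z' where Z': "torus_class Z = torus_class Z'" "\<forall>j. j \<notin> I \<longrightarrow> Z' $ j \<in> \<int>" by (auto simp: SC_group_def)
  then have "Z $ j - Z' $ j \<in> \<int>" for j by (simp add: torus_class_eq_iff)
  then show "\<forall>j. j \<notin> I \<longrightarrow> Z $ j \<in> \<int>" using Z'(2) Ints_add by (metis diff_add_cancel)
qed (auto simp: SC_group_def)

lemma linear_pi_map: "linear (pi_map X)"
  by (rule linearI) (auto simp: pi_map_def scaleR_add_left sum.distrib scaleR_sum_right)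

lemma complex_vec_diff: "complex_vec (x - y) = complex_vec x - complex_vec y"
  by (simp add: complex_vec_def vec_eq_iff)

lemma torus_exponent_complex_vec_in_exp_group_iff:
  "torus_exponent (complex_vec x) \<in> exp_group X Q 0 \<longleftrightarrow> pi_map X x \<in> Q"
  by (auto simp: exp_group_def torus_exponent_def complex_vec_def pi_map_def im_proj_def complex_eq_iff)

lemma torus_exponent_in_exp_group_iff: "torus_exponent Z \<in> exp_group X Q 1 \<longleftrightarrow> piC_map X Z \<in> QC Q"
proof -
  have "(\<Sum>j\<in>UNIV. Re (torus_exponent Z $ j) *\<^sub>R X j) = (- 2 * pi) *\<^sub>R pi_map X (\<chi> j. Im (Z $ j))"
    by (simp add: torus_exponent_def pi_map_def scaleR_sum_right sum_negf)
  then show ?thesis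
    by (auto simp: piC_map_def QC_def exp_group_def pi_map_def torus_exponent_def)
qed

lemma real_torus_exponent:
  assumes "torus_exponent Z \<in> exp_group X Q 0"
  shows "complex_vec (\<chi> j. Re (Z $ j)) = Z"
proof -
  have "Im (Z $ j) = 0" for j
    using assms by (auto simp: exp_group_def torus_exponent_def im_proj_def complex_eq_iff)
  then show ?thesis by (simp add: complex_vec_def vec_eq_iff complex_eq_iff)
qed

context normal_frames
begin

lemma torus_exponent_in_exp_group_if_integral:
  assumes "\<And>j. Z $ j \<in> \<int>"
  shows "torus_exponent Z \<in> exp_group X Q \<kappa>"
proof -
  have "\<exists>m::int. Z $ j = of_int m" for j using assms[of j] by (auto elim: Ints_cases)
  then obtain m where m: "\<And>j. Z $ j = of_int (m j)" by metis
  show ?thesis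
    using Q_sum_of_int[of m UNIV]
    by (auto simp: exp_group_def torus_exponent_def m im_proj_def complex_eq_iff)
qed

lemma torus_exponent_in_exp_group_cong:
  assumes "torus_class Z = torus_class Z'" "torus_exponent Z' \<in> exp_group X Q \<kappa>"
  shows "torus_exponent Z \<in> exp_group X Q \<kappa>"
proof -
  have "torus_exponent (Z - Z') \<in> exp_group X Q \<kappa>"
    by (rule torus_exponent_in_exp_group_if_integral) (use assms(1) in \<open>simp add: torus_class_eq_iff\<close>)
  then show ?thesis
    using exp_group_add[of "torus_exponent (Z - Z')" \<kappa> "torus_exponent Z'"] assms(2)
    by (simp flip: torus_exponent_add)
qed

lemma torus_class_in_NC_group_iff: "torus_class Z \<in> NC_group X Q \<longleftrightarrow> torus_exponent Z \<in> exp_group X Q 1"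
  using torus_exponent_in_exp_group_cong[of Z _ 1]
  by (auto simp: NC_group_def simp flip: torus_exponent_in_exp_group_iff)

lemma torus_class_in_N_group_iff: "torus_class Z \<in> N_group X Q \<longleftrightarrow> torus_exponent Z \<in> exp_group X Q 0"
proof
  assume "torus_class Z \<in> N_group X Q"
  then obtain x where "torus_class Z = torus_class (complex_vec x)" "pi_map X x \<in> Q"
    by (auto simp: N_group_def)
  then show "torus_exponent Z \<in> exp_group X Q 0"
    using torus_exponent_in_exp_group_cong by (simp add: torus_exponent_complex_vec_in_exp_group_iff)
next
  assume Z: "torus_exponent Z \<in> exp_group X Q 0"
  then have "pi_map X (\<chi> j. Re (Z $ j)) \<in> Q"
    using real_torus_exponent[OF Z] torus_exponent_complex_vec_in_exp_group_iff by metis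
  then show "torus_class Z \<in> N_group X Q"
    unfolding N_group_def using real_torus_exponent[OF Z] by (intro CollectI exI[of _ "\<chi> j. Re (Z $ j)"]) simp
qed

lemma torus_orbit_eq_exp_orbit:
  assumes "\<And>Z. torus_class Z \<in> G \<longleftrightarrow> torus_exponent Z \<in> exp_group X Q \<kappa>"
  shows "torus_orbit G = exp_orbit X Q \<kappa>"
proof
  fix z
  have "torus_orbit G z = {exp_act (torus_exponent Z) z | Z. torus_exponent Z \<in> exp_group X Q \<kappa>}"
    by (simp add: torus_orbit_def assms torus_act_eq_exp_act)
  also have "\<dots> = exp_orbit X Q \<kappa> z"
    unfolding exp_orbit_def by (auto simp: image_iff) (metis torus_exponent_surj)
  finally show "torus_orbit G z = exp_orbit X Q \<kappa> z" .
qed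

lemma torus_orbit_NC_group: "torus_orbit (NC_group X Q) = exp_orbit X Q 1"
  by (rule torus_orbit_eq_exp_orbit[OF torus_class_in_NC_group_iff])

lemma torus_orbit_N_group: "torus_orbit (N_group X Q) = exp_orbit X Q 0"
  by (rule torus_orbit_eq_exp_orbit[OF torus_class_in_N_group_iff])

lemma select_torus_act_embed:
  "inj r \<Longrightarrow> select_coords r (torus_act Z (embed_coords r w)) = (\<chi> k. exp (torus_exponent Z $ r k) * w $ k)"
  by (simp add: select_coords_def torus_act_def torus_exponent_def embed_coords_def vec_eq_iff)

lemma Gamma_group_eq_transformations:
  assumes r: "r \<in> R"
  shows "Gamma_group X Q r V = transformations (admissible_angles X Q r) phase V"
proof (intro equalityI subsetI)
  fix g assume "g \<in> Gamma_group X Q r V"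
  then obtain Z where g: "g = restrict (\<lambda>w. select_coords r (torus_act Z (embed_coords r w))) V"
    and Z: "torus_exponent Z \<in> exp_group X Q 1" "\<And>j. j \<notin> range r \<Longrightarrow> Z $ j \<in> \<int>"
    by (auto simp: Gamma_group_def torus_class_in_NC_group_iff torus_class_in_SC_group_iff)
  have "\<exists>m::int. torus_exponent Z $ h = 2 * complex_of_real pi * \<i> * of_int m" if "h \<notin> range r" for h
    using Z(2)[OF that] by (auto simp: torus_exponent_def elim: Ints_cases)
  from exp_group_integral_outside_frame[OF r Z(1) this]
  obtain \<alpha> where \<alpha>: "\<alpha> \<in> admissible_angles X Q r" "\<And>k. torus_exponent Z $ r k = \<i> * complex_of_real (\<alpha> $ k)"
    by blast
  then have "g = restrict (phase \<alpha>) V" unfolding g select_torus_act_embed[OF inj_frame[OF r]] phase_def by simp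
  then show "g \<in> transformations (admissible_angles X Q r) phase V" using \<alpha>(1) by (simp add: transformations_def)
next
  fix g assume "g \<in> transformations (admissible_angles X Q r) phase V"
  then obtain \<alpha> where \<alpha>: "\<alpha> \<in> admissible_angles X Q r" "g = restrict (phase \<alpha>) V"
    by (auto simp: transformations_def)
  obtain Z where Z: "torus_exponent Z = angle_vec r \<alpha>" using torus_exponent_surj by blast
  have "Z $ h = 0" if "h \<notin> range r" for h
    using arg_cong[OF Z, of "\<lambda>\<zeta>. \<zeta> $ h"] that by (simp add: torus_exponent_def angle_vec_def)
  then have "torus_class Z \<in> NC_group X Q \<inter> SC_group (range r)"
    using angle_vec_in_exp_group[OF r \<alpha>(1), of 1]
    by (simp add: torus_class_in_NC_group_iff torus_class_in_SC_group_iff Z)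
  moreover have "g = restrict (\<lambda>w. select_coords r (torus_act Z (embed_coords r w))) V"
    using inj_frame[OF r] by (simp add: \<alpha>(2) select_torus_act_embed Z angle_vec_def phase_def[abs_def])
  ultimately show "g \<in> Gamma_group X Q r V" unfolding Gamma_group_def by blast
qed

end

subsection \<open>The zero level\<close>

lemma adjoint_pi_map: "adjoint (pi_map X) = (\<lambda>\<nu>. \<chi> j. \<nu> \<bullet> X j)"
  by (rule adjoint_unique) (simp add: pi_map_def inner_vec_def inner_sum_left inner_commute[of _ "X _"])

lemma mem_Psi_zero_iff_J_map: "z \<in> Psi_zero X lam \<longleftrightarrow> (\<forall>x\<in>n_space X. J_map lam z x = 0)"
  by (auto simp: Psi_zero_def Psi_map_def fun_eq_iff restrict_def)

text \<open>The annihilator of \<open>\<nn> = ker \<pi>\<close> is the image of the adjoint of \<open>\<pi>\<close>.\<close>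

lemma mem_Psi_zero: "z \<in> Psi_zero X lam \<longleftrightarrow> (\<exists>\<nu>. \<forall>j. \<nu> \<bullet> X j - lam j = (cmod (z $ j))\<^sup>2)"
proof -
  let ?J = "\<chi> j. (cmod (z $ j))\<^sup>2 + lam j" and ?A = "range (adjoint (pi_map X))"
  have "z \<in> Psi_zero X lam \<longleftrightarrow> ?J \<in> orthogonal_comp (n_space X)"
    by (auto simp: mem_Psi_zero_iff_J_map orthogonal_comp_def orthogonal_def J_map_def inner_vec_def mult.commute)
  moreover have "n_space X = orthogonal_comp ?A"
    using ker_orthogonal_comp_adjoint[OF linear_pi_map, of X] by (auto simp: n_space_def)
  moreover have "subspace ?A" by (intro linear_subspace_image adjoint_linear linear_pi_map subspace_UNIV)
  then have "orthogonal_comp (orthogonal_comp ?A) = ?A" by (rule orthogonal_comp_self)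
  ultimately have "z \<in> Psi_zero X lam \<longleftrightarrow> ?J \<in> ?A" by (simp only:)
  also have "\<dots> \<longleftrightarrow> (\<exists>\<nu>. \<forall>j. (cmod (z $ j))\<^sup>2 + lam j = \<nu> \<bullet> X j)"
    by (auto simp: adjoint_pi_map vec_eq_iff image_iff)
  finally show ?thesis by (simp add: diff_eq_eq eq_commute)
qed

lemma exp_act_in_Psi_zero:
  assumes z: "z \<in> Psi_zero X lam" and \<zeta>: "\<zeta> \<in> exp_group X Q 0"
  shows "exp_act \<zeta> z \<in> Psi_zero X lam"
proof -
  have "Re (\<zeta> $ j) = 0" for j using \<zeta> by (auto simp: exp_group_def im_proj_def complex_eq_iff)
  then have "cmod (exp_act \<zeta> z $ j) = cmod (z $ j)" for j
    by (simp add: exp_act_def norm_mult norm_exp_eq_Re)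
  then show ?thesis using z by (simp add: mem_Psi_zero)
qed

subsection \<open>Vertex frames\<close>

locale toric = polytope_data \<Delta> X lam
  for \<Delta> :: "'a::euclidean_space set" and X :: "'d::finite \<Rightarrow> 'a" and lam +
  fixes Q :: "'a set" and R :: "('n::finite \<Rightarrow> 'd) set"
  assumes card_n: "CARD('n) = DIM('a)" and lattice: "quasilattice Q" and normals_in_Q: "range X \<subseteq> Q"
    and R_def: "R = vertex_enums \<Delta> X lam"
begin

lemma frame_vertex:
  assumes "r \<in> R"
  obtains v where "v extreme_point_of \<Delta>" "range r = active v" "inj r"
  using assms by (auto simp: R_def vertex_enums_def bij_betw_def)

lemma vertex_frame:
  assumes v: "v extreme_point_of \<Delta>"
  obtains r where "r \<in> R" "range r = active v"
proof -
  have "card (UNIV :: 'n set) = card (active v)" using vertex_normals(3)[OF v] card_n by simp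
  then obtain r where "bij_betw r (UNIV :: 'n set) (active v)"
    using finite_same_card_bij[of "UNIV :: 'n set" "active v"] by auto
  then show ?thesis using that[of r] v by (auto simp: R_def vertex_enums_def bij_betw_def)
qed

lemma frame_basis:
  assumes r: "r \<in> R"
  shows "inj (\<lambda>k. X (r k))" "independent (X ` range r)" "span (X ` range r) = UNIV"
proof -
  obtain v where v: "v extreme_point_of \<Delta>" "range r = active v" "inj r" using frame_vertex[OF r] .
  show "inj (\<lambda>k. X (r k))" using comp_inj_on[OF v(3), of X] vertex_normals(1)[OF v(1)] v(2) by (simp add: comp_def)
  show "independent (X ` range r)" "span (X ` range r) = UNIV"
    using vertex_normals(2)[OF v(1)] vertex_normals_span[OF v(1)] v(2) by simp_all
qed

lemma sum_frame:
  assumes "r \<in> R"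
  shows "(\<Sum>x\<in>X ` range r. g x) = (\<Sum>k\<in>UNIV. g (X (r k)))"
  using sum.reindex[OF frame_basis(1)[OF assms], of g] by (simp add: image_image)

sublocale normal_frames X Q R
proof
  obtain B where B: "Q = group_closure B" using lattice by (auto simp: quasilattice_def)
  show "0 \<in> Q" by (simp add: B)
  show "x - y \<in> Q" if "x \<in> Q" "y \<in> Q" for x y using that by (simp add: B group_closure.diff)
  show "X j \<in> Q" for j using normals_in_Q by auto
  show "inj r" if "r \<in> R" for r using frame_vertex[OF that] by blast
  show "X h = (\<Sum>k\<in>UNIV. frame_coeff X r h k *\<^sub>R X (r k))" if r: "r \<in> R" for r h
    using real_vector.sum_representation_eq[OF frame_basis(2)[OF r], of "X h" "X ` range r"] frame_basis(3)[OF r]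
    by (simp add: sum_frame[OF r] frame_coeff_def)
  show "t k = 0" if r: "r \<in> R" and t: "(\<Sum>k\<in>UNIV. t k *\<^sub>R X (r k)) = 0" for r t k
  proof -
    let ?u = "\<lambda>x. t (inv_into UNIV (\<lambda>k. X (r k)) x)"
    have u: "?u (X (r k)) = t k" for k using inv_into_f_f[OF frame_basis(1)[OF r], of k] by simp
    have "(\<Sum>x\<in>X ` range r. ?u x *\<^sub>R x) = 0" unfolding sum_frame[OF r] u by (rule t)
    then have "?u (X (r k)) = 0" by (intro independentD[OF frame_basis(2)[OF r]]) auto
    then show ?thesis unfolding u .
  qed
qed

definition frame_slack :: "('n \<Rightarrow> 'd) \<Rightarrow> real^'n \<Rightarrow> 'd \<Rightarrow> real" where
  "frame_slack r s h = (\<Sum>k\<in>UNIV. frame_coeff X r h k * (s $ k + lam (r k))) - lam h"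

definition slack_region :: "('n \<Rightarrow> 'd) \<Rightarrow> (real^'n) set" where
  "slack_region r = {s. \<forall>h. h \<notin> range r \<longrightarrow> frame_slack r s h > 0}"

definition slack_heights :: "('n \<Rightarrow> 'd) \<Rightarrow> complex^'n \<Rightarrow> real^'d" where
  "slack_heights r w = (\<chi> h. if h \<in> range r then 1 else sqrt (frame_slack r (sq_moduli w) h))"

lemma frame_slack_point:
  assumes r: "r \<in> R" and \<nu>: "\<And>k. \<nu> \<bullet> X (r k) - lam (r k) = s $ k"
  shows "frame_slack r s h = \<nu> \<bullet> X h - lam h"
proof -
  have "\<nu> \<bullet> X h = \<nu> \<bullet> (\<Sum>k\<in>UNIV. frame_coeff X r h k *\<^sub>R X (r k))"
    by (rule arg_cong[OF frame_expansion[OF r]])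
  also have "\<dots> = (\<Sum>k\<in>UNIV. frame_coeff X r h k * (s $ k + lam (r k)))"
    unfolding inner_sum_right by (rule sum.cong) (use \<nu> in \<open>auto simp: algebra_simps\<close>)
  finally show ?thesis by (simp add: frame_slack_def)
qed

lemma point_with_frame_slack:
  assumes r: "r \<in> R"
  obtains \<nu> where "\<And>k. \<nu> \<bullet> X (r k) - lam (r k) = s $ k" "\<And>h. frame_slack r s h = \<nu> \<bullet> X h - lam h"
proof -
  obtain v where v: "v extreme_point_of \<Delta>" "range r = active v" "inj r" using frame_vertex[OF r] .
  obtain y where "\<forall>i\<in>active v. \<forall>j\<in>active v. y i \<bullet> X j = (if i = j then 1 else 0)"
    using vertex_dual_basis[OF v(1)] by blast
  then have y: "y (r i) \<bullet> X (r k) = (if i = k then 1 else 0)" for i k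
    using inj_eq[OF v(3), of i k] by (simp flip: v(2))
  define \<nu> where "\<nu> = (\<Sum>k\<in>UNIV. (s $ k + lam (r k)) *\<^sub>R y (r k))"
  have "\<nu> \<bullet> X (r k) = (\<Sum>i\<in>UNIV. if i = k then s $ i + lam (r i) else 0)" for k
    unfolding \<nu>_def inner_sum_left by (rule sum.cong) (auto simp: y)
  then have "\<nu> \<bullet> X (r k) - lam (r k) = s $ k" for k by simp
  then show ?thesis using that[of \<nu>] frame_slack_point[OF r] by blast
qed

lemma frame_slack_range: "r \<in> R \<Longrightarrow> frame_slack r s (r k) = s $ k"
  using point_with_frame_slack[of r s] by metis

lemma slack_region_eq_halfspaces:
  "slack_region r =
    (\<Inter>h\<in>- range r. {s. (\<chi> k. frame_coeff X r h k) \<bullet> s > lam h - (\<Sum>k\<in>UNIV. frame_coeff X r h k * lam (r k))})"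
  by (auto simp: slack_region_def frame_slack_def inner_vec_def algebra_simps sum.distrib)

lemma open_slack_region: "open (slack_region r)"
  unfolding slack_region_eq_halfspaces by (intro open_INT ballI finite open_halfspace_gt)

lemma convex_slack_region: "convex (slack_region r)"
  unfolding slack_region_eq_halfspaces by (intro convex_INT convex_halfspace_gt)

lemma slack_region_overlap:
  assumes r: "r \<in> R" and r': "r' \<in> R"
  shows "\<exists>s\<in>slack_region r. \<forall>k. if r k \<notin> range r' then s $ k > 0 else s $ k = 0"
proof -
  obtain v where v: "v extreme_point_of \<Delta>" "range r = active v" using frame_vertex[OF r] .
  obtain v' where v': "v' extreme_point_of \<Delta>" "range r' = active v'" using frame_vertex[OF r'] .
  have slack: "u \<bullet> X j - lam j \<ge> 0" "u \<bullet> X j - lam j = 0 \<longleftrightarrow> j \<in> active u" if "u extreme_point_of \<Delta>" for u j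
    using that by (auto simp: extreme_point_of_def mem_Delta mem_active)
  define m where "m = (1/2) *\<^sub>R (v + v')"
  have m: "m \<bullet> X j - lam j = ((v \<bullet> X j - lam j) + (v' \<bullet> X j - lam j)) / 2" for j
    by (simp add: m_def inner_add_left field_simps)
  have pos: "m \<bullet> X j - lam j > 0" if "j \<notin> active v \<or> j \<notin> active v'" for j
  proof -
    have "(v \<bullet> X j - lam j) + (v' \<bullet> X j - lam j) \<noteq> 0"
      using that by (simp only: add_nonneg_eq_0_iff slack v(1) v'(1)) simp
    then have "(v \<bullet> X j - lam j) + (v' \<bullet> X j - lam j) > 0"
      using add_nonneg_nonneg[OF slack(1)[OF v(1)] slack(1)[OF v'(1)], of j j] by (metis less_le)
    then show ?thesis unfolding m by (rule half_gt_zero)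
  qed
  let ?s = "\<chi> k. m \<bullet> X (r k) - lam (r k)"
  have "frame_slack r ?s h = m \<bullet> X h - lam h" for h by (rule frame_slack_point[OF r]) simp
  then have "?s \<in> slack_region r" using pos v(2) by (simp add: slack_region_def)
  moreover have "if r k \<notin> range r' then ?s $ k > 0 else ?s $ k = 0" for k
  proof -
    have "r k \<in> active v" using v(2) by auto
    then show ?thesis
      using pos[of "r k"] m[of "r k"] slack(2)[OF v(1), of "r k"] slack(2)[OF v'(1), of "r k"] v'(2) by auto
  qed
  ultimately show ?thesis by blast
qed

lemma zero_in_slack_region:
  assumes r: "r \<in> R"
  shows "0 \<in> slack_region r"
proof -
  obtain s where s: "s \<in> slack_region r" "\<And>k. s $ k = 0"
    using slack_region_overlap[OF r r] by auto
  then have "s = 0" by (simp add: vec_eq_iff)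
  then show ?thesis using s(1) by simp
qed

lemma smooth_on_frame_slack:
  assumes S: "open S"
  shows "smooth_on S (\<lambda>w. frame_slack r (sq_moduli w) h)"
proof -
  have parts: "smooth_on S (\<lambda>w::complex^'n. Re (w $ k))" "smooth_on S (\<lambda>w::complex^'n. Im (w $ k))" for k
    by (intro smooth_on_linear_comp[OF S bounded_linear_Re] smooth_on_linear_comp[OF S bounded_linear_Im]
        smooth_on_bounded_linear S bounded_linear_vec_nth)+
  have "smooth_on S (\<lambda>w::complex^'n. sq_moduli w $ k)" for k
    unfolding sq_moduli_def vec_lambda_beta cmod_power2 unfolding power2_eq_square
    by (intro smooth_on_add smooth_on_mult S parts)
  then have "smooth_on S (\<lambda>w. (\<Sum>k\<in>UNIV. frame_coeff X r h k * (sq_moduli w $ k + lam (r k))) + (- lam h))"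
    by (intro smooth_on_add smooth_on_sum smooth_on_linear_comp[OF S bounded_linear_mult_right] smooth_on_const S)
  then show ?thesis by (simp add: frame_slack_def)
qed

lemma smooth_on_slack_heights: "smooth_on (reinhardt (slack_region r)) (\<lambda>w. slack_heights r w $ h)"
proof (cases "h \<in> range r")
  case True
  then show ?thesis by (simp add: slack_heights_def smooth_on_const open_reinhardt open_slack_region)
next
  case False
  then show ?thesis unfolding slack_heights_def vec_lambda_beta if_not_P[OF False]
    by (intro smooth_on_sqrt smooth_on_frame_slack open_reinhardt open_slack_region)
       (auto simp: reinhardt_def slack_region_def)
qed

lemma slice_in_Psi_zero:
  assumes r: "r \<in> R" and w: "w \<in> reinhardt (slack_region r)"
  shows "slice_point r (slack_heights r w) w \<in> Psi_zero X lam"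
proof -
  obtain \<nu> where \<nu>: "\<And>h. frame_slack r (sq_moduli w) h = \<nu> \<bullet> X h - lam h"
    using point_with_frame_slack[OF r, of "sq_moduli w"] by metis
  have "\<nu> \<bullet> X j - lam j = (cmod (slice_point r (slack_heights r w) w $ j))\<^sup>2" for j
  proof (cases "j \<in> range r")
    case True
    then obtain k where k: "j = r k" by blast
    then show ?thesis
      using \<nu>[of j] frame_slack_range[OF r, of "sq_moduli w" k] inj_frame[OF r] by (simp add: sq_moduli_def)
  next
    case False
    then have "frame_slack r (sq_moduli w) j > 0" using w by (simp add: reinhardt_def slack_region_def)
    then show ?thesis using False \<nu>[of j] by (simp add: slack_heights_def)
  qed
  then show ?thesis unfolding mem_Psi_zero by blast
qed

lemma frame_slack_Psi_zero:
  assumes r: "r \<in> R" and z: "z \<in> Psi_zero X lam"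
  shows "frame_slack r (sq_moduli (select_coords r z)) h = (cmod (z $ h))\<^sup>2"
proof -
  obtain \<nu> where "\<And>j. \<nu> \<bullet> X j - lam j = (cmod (z $ j))\<^sup>2" using z mem_Psi_zero by blast
  then show ?thesis
    using frame_slack_point[OF r, of \<nu> "sq_moduli (select_coords r z)" h]
    by (simp add: sq_moduli_def select_coords_def)
qed

lemma positive_coords_in_slack_slice:
  assumes r: "r \<in> R" and z: "z \<in> Psi_zero X lam" and positive: "\<And>h. h \<notin> range r \<Longrightarrow> \<exists>t>0. z $ h = complex_of_real t"
  shows "select_coords r z \<in> reinhardt (slack_region r)"
    and "slice_point r (slack_heights r (select_coords r z)) (select_coords r z) = z"
proof -
  have heights: "frame_slack r (sq_moduli (select_coords r z)) h > 0 \<and>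
      complex_of_real (sqrt (frame_slack r (sq_moduli (select_coords r z)) h)) = z $ h" if h: "h \<notin> range r" for h
    using positive[OF h] frame_slack_Psi_zero[OF r z, of h] by auto
  then show "select_coords r z \<in> reinhardt (slack_region r)" by (simp add: reinhardt_def slack_region_def)
  have "slice_point r (slack_heights r (select_coords r z)) (select_coords r z) $ j = z $ j" for j
  proof (cases "j \<in> range r")
    case True
    then show ?thesis using inj_frame[OF r] by (auto simp: select_coords_def)
  next
    case False
    then show ?thesis using heights by (simp add: slack_heights_def)
  qed
  then show "slice_point r (slack_heights r (select_coords r z)) (select_coords r z) = z" by (simp add: vec_eq_iff)
qed

lemma face_contains_frame_vertex:
  assumes F: "F face_of \<Delta>" "F \<noteq> {}"
  obtains r where "r \<in> R" "face_index X lam F \<subseteq> range r"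
proof -
  obtain v where v: "v \<in> F" "v extreme_point_of \<Delta>" using face_contains_vertex[OF F] .
  obtain r where r: "r \<in> R" "range r = active v" using vertex_frame[OF v(2)] .
  moreover have "face_index X lam F \<subseteq> active v" using v(1) by (auto simp: face_index_def)
  ultimately show ?thesis using that by simp
qed

lemma mem_C_Delta: "z \<in> C_Delta \<Delta> X lam \<longleftrightarrow> (\<exists>r\<in>R. \<forall>h. h \<notin> range r \<longrightarrow> z $ h \<noteq> 0)"
proof
  assume "z \<in> C_Delta \<Delta> X lam"
  then obtain F where F: "F face_of \<Delta>" "F \<noteq> {}" "z \<in> stratum (face_index X lam F)"
    by (auto simp: C_Delta_def)
  obtain r where r: "r \<in> R" "face_index X lam F \<subseteq> range r" using face_contains_frame_vertex[OF F(1,2)] .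
  then show "\<exists>r\<in>R. \<forall>h. h \<notin> range r \<longrightarrow> z $ h \<noteq> 0" using F(3) by (auto simp: stratum_def)
next
  assume "\<exists>r\<in>R. \<forall>h. h \<notin> range r \<longrightarrow> z $ h \<noteq> 0"
  then obtain r where r: "r \<in> R" "\<And>h. h \<notin> range r \<Longrightarrow> z $ h \<noteq> 0" by blast
  obtain v where v: "v extreme_point_of \<Delta>" "range r = active v" using frame_vertex[OF r(1)] .
  have "{h. z $ h = 0} \<subseteq> active v" using r(2) v(2) by blast
  then obtain F where "F face_of \<Delta>" "F \<noteq> {}" "face_index X lam F = {h. z $ h = 0}"
    using face_with_index[OF v(1)] by blast
  then show "z \<in> C_Delta \<Delta> X lam" by (auto simp: C_Delta_def stratum_def)
qed

lemma Psi_zero_subset_C_Delta: "Psi_zero X lam \<subseteq> C_Delta \<Delta> X lam"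
proof
  fix z assume "z \<in> Psi_zero X lam"
  then obtain \<nu> where \<nu>: "\<And>j. \<nu> \<bullet> X j - lam j = (cmod (z $ j))\<^sup>2" using mem_Psi_zero by blast
  then have "\<nu> \<bullet> X j - lam j \<ge> 0" for j by simp
  then have "\<nu> \<in> \<Delta>" by (simp add: mem_Delta)
  then obtain r where r: "r \<in> R" "face_index X lam (facet_intersection (active \<nu>)) \<subseteq> range r"
    using face_contains_frame_vertex[OF facet_intersection_face_of] mem_facet_intersection_active by blast
  have "h \<in> range r" if "z $ h = 0" for h
    using that \<nu>[of h] r(2) by (auto simp: mem_active face_index_def facet_intersection_def)
  then show "z \<in> C_Delta \<Delta> X lam" using r(1) mem_C_Delta by blast
qed

subsection \<open>The atlases of the symplectic and the complex quotient\<close>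

sublocale symp: quasi_slice X Q R 0 "Psi_zero X lam" slack_region slack_heights smooth_on
proof
  show "slack_heights r w $ h > 0" if "r \<in> R" "w \<in> reinhardt (slack_region r)" "h \<notin> range r" for r w h
    using that by (simp add: slack_heights_def reinhardt_def slack_region_def)
  show "select_coords r z \<in> reinhardt (slack_region r) \<and>
      slice_point r (slack_heights r (select_coords r z)) (select_coords r z) = z"
    if "r \<in> R" "z \<in> Psi_zero X lam"
      "\<And>h. h \<notin> range r \<Longrightarrow> \<exists>t>0. z $ h = complex_of_real t \<and> ((0::real) = 1 \<longrightarrow> t = 1)" for r z
    using positive_coords_in_slack_slice[OF that(1,2)] that(3) by blast
  show "\<exists>r\<in>R. \<forall>h. h \<notin> range r \<longrightarrow> z $ h \<noteq> 0" if "z \<in> Psi_zero X lam" for z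
    using that Psi_zero_subset_C_Delta mem_C_Delta by blast
qed (use exp_act_in_Psi_zero slice_in_Psi_zero open_slack_region convex_slack_region zero_in_slack_region
    slack_region_overlap smooth_on_slack_heights in auto)

sublocale cplx: quasi_slice X Q R 1 "C_Delta \<Delta> X lam" "\<lambda>_. UNIV" "\<lambda>_ _. 1" holomorphic_map_on
proof
  show "exp_act \<zeta> z \<in> C_Delta \<Delta> X lam" if "z \<in> C_Delta \<Delta> X lam" for z \<zeta>
    using that by (simp add: mem_C_Delta exp_act_def)
  show "slice_point r 1 w \<in> C_Delta \<Delta> X lam" if "r \<in> R" for r w
    using that by (auto simp: mem_C_Delta intro!: bexI[of _ r])
  show "select_coords r z \<in> reinhardt UNIV \<and> slice_point r 1 (select_coords r z) = z"
    if r: "r \<in> R" and one: "\<And>h. h \<notin> range r \<Longrightarrow> \<exists>t>0. z $ h = complex_of_real t \<and> ((1::real) = 1 \<longrightarrow> t = 1)" for r z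
  proof -
    have "slice_point r 1 (select_coords r z) $ j = z $ j" for j
      using inj_frame[OF r] one[of j] by (cases "j \<in> range r") (auto simp: select_coords_def)
    then show ?thesis by (simp add: vec_eq_iff)
  qed
  show "\<exists>s\<in>(UNIV :: (real^'n) set). \<forall>k. if r k \<notin> range r' then s $ k > 0 else s $ k = 0" for r r' :: "'n \<Rightarrow> 'd"
    by (intro bexI[of _ "\<chi> k. if r k \<notin> range r' then 1 else 0"]) auto
  show "smooth_on (reinhardt UNIV) (\<lambda>w. (1::real^'d) $ h)" for h
    by (simp add: smooth_on_const)
  show "\<exists>r\<in>R. \<forall>h. h \<notin> range r \<longrightarrow> z $ h \<noteq> 0" if "z \<in> C_Delta \<Delta> X lam" for z
    using that mem_C_Delta by blast
qed auto

lemma complex_chart_eq_slice_chart: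
  assumes r: "r \<in> R"
  shows "complex_chart X Q r = cplx.slice_chart r"
proof -
  have "z_vertex (range r) + embed_coords r w = slice_point r 1 w" for w
    by (auto simp: z_vertex_def embed_coords_def slice_point_def vec_eq_iff)
  then show ?thesis
    by (simp add: complex_chart_def cplx.slice_chart_def Gamma_group_eq_transformations[OF r] torus_orbit_NC_group)
qed

lemma slack_eq_frame_slack:
  assumes r: "r \<in> R"
  shows "slack X lam (range r) (embed_coords r w) h = frame_slack r (sq_moduli w) h"
  unfolding slack_def frame_slack_def frame_coeff_def using inj_frame[OF r]
  by (simp add: sum.reindex embed_coords_def sq_moduli_def)

lemma symplectic_chart_eq_slice_chart:
  assumes r: "r \<in> R"
  shows "symplectic_chart X lam Q r = symp.slice_chart r"
proof -
  have "w_vertex X lam (range r) (embed_coords r w) + embed_coords r w = slice_point r (slack_heights r w) w" for w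
    unfolding w_vertex_def slack_eq_frame_slack[OF r] slack_heights_def slice_point_def
    by (simp add: vec_eq_iff embed_coords_def)
  moreover have "U_tilde X lam r = reinhardt (slack_region r)"
    by (simp add: U_tilde_def reinhardt_def slack_region_def slack_eq_frame_slack[OF r])
  ultimately show ?thesis
    by (simp add: symplectic_chart_def symp.slice_chart_def Gamma_group_eq_transformations[OF r] torus_orbit_N_group)
qed

lemma symplectic_charts_eq: "symplectic_charts \<Delta> X lam Q = symp.slice_chart ` R"
  unfolding symplectic_charts_def R_def[symmetric] by (rule image_cong) (auto simp: symplectic_chart_eq_slice_chart)

lemma complex_charts_eq: "complex_charts \<Delta> X lam Q = cplx.slice_chart ` R"
  unfolding complex_charts_def R_def[symmetric] by (rule image_cong) (auto simp: complex_chart_eq_slice_chart)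

lemma symplectic_quotient_eq: "symplectic_quotient X lam Q = symp.orbit_space"
  by (simp add: symplectic_quotient_def torus_orbit_N_group)

lemma complex_quotient_eq: "complex_quotient \<Delta> X lam Q = cplx.orbit_space"
  by (simp add: complex_quotient_def torus_orbit_NC_group)

end

section \<open>The Kempf--Ness argument\<close>

subsection \<open>Minimising a sum of exponentials over a subspace\<close>

text \<open>Both tangent lines of \<open>exp\<close> used here come from \<open>c * (1 + ln (a / c) + 2 * t) \<le> a * exp (2 * t)\<close>,
  once with \<open>c = 2 * b\<close> and once with \<open>c = b / 2\<close>.\<close>

lemma exp_minus_linear_coercive:
  fixes a b :: real
  assumes "a > 0" "b > 0"
  shows "\<exists>M. \<forall>t. b / 2 * \<bar>t\<bar> + M \<le> a * exp (2 * t) / 2 - b * t"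
proof -
  have tangent: "c * (1 + ln (a / c) + 2 * t) \<le> a * exp (2 * t)" if "c > 0" for c t
  proof -
    have "1 + (ln (a / c) + 2 * t) \<le> exp (ln (a / c) + 2 * t)" by (rule exp_ge_add_one_self)
    also have "\<dots> = (a / c) * exp (2 * t)" using assms that by (simp add: exp_add)
    finally have "c * (1 + (ln (a / c) + 2 * t)) \<le> c * ((a / c) * exp (2 * t))"
      using that by (intro mult_left_mono) auto
    then show ?thesis using that by (simp add: add.assoc)
  qed
  define M where "M c = c * (1 + ln (a / c)) / 2" for c
  have bound: "(c - b) * t + M c \<le> a * exp (2 * t) / 2 - b * t" if "c > 0" for c t
    using tangent[OF that, of t] by (simp add: M_def field_simps)
  have "b / 2 * \<bar>t\<bar> + min (M (2 * b)) (M (b / 2)) \<le> a * exp (2 * t) / 2 - b * t" for t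
  proof (cases "t \<ge> 0")
    case True
    then have "b / 2 * \<bar>t\<bar> \<le> (2 * b - b) * t" using assms by (simp add: mult_right_mono)
    then show ?thesis using bound[of "2 * b" t] assms by linarith
  next
    case False
    then have "b / 2 * \<bar>t\<bar> = (b / 2 - b) * t" by (simp add: field_simps)
    then show ?thesis using bound[of "b / 2" t] assms by linarith
  qed
  then show ?thesis by blast
qed

lemma coercive_attains_inf:
  fixes f :: "'e::euclidean_space \<Rightarrow> real"
  assumes "closed V" "V \<noteq> {}" "continuous_on V f" and "c > 0" and coercive: "\<And>y. y \<in> V \<Longrightarrow> c * norm y + M \<le> f y"
  shows "\<exists>y\<in>V. \<forall>x\<in>V. f y \<le> f x"
proof -
  obtain x\<^sub>0 where x\<^sub>0: "x\<^sub>0 \<in> V" using assms(2) by blast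
  let ?S = "{y \<in> V. f y \<le> f x\<^sub>0}"
  have "norm y \<le> (f x\<^sub>0 - M) / c" if "y \<in> ?S" for y
  proof -
    have "c * norm y \<le> f x\<^sub>0 - M" using coercive[of y] that by simp
    then show ?thesis using \<open>c > 0\<close> by (simp add: field_simps)
  qed
  then have "bounded ?S" by (rule boundedI)
  moreover have "closed ?S"
    using continuous_closed_preimage[OF assms(3,1), of "{..f x\<^sub>0}"] by (simp add: vimage_def Int_def)
  ultimately have "compact ?S" by (simp add: compact_eq_bounded_closed)
  moreover have "?S \<noteq> {}" using x\<^sub>0 by blast
  moreover have "continuous_on ?S f" by (rule continuous_on_subset[OF assms(3)]) blast
  ultimately have "\<exists>y\<in>?S. \<forall>x\<in>?S. f y \<le> f x" by (rule continuous_attains_inf)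
  then obtain y where y: "y \<in> ?S" "\<forall>x\<in>?S. f y \<le> f x" by blast
  have "f y \<le> f x" if "x \<in> V" for x
    using y that by (cases "f x \<le> f x\<^sub>0") auto
  then show ?thesis using y(1) by blast
qed

lemma exp_sum_coercive_on_subspace:
  fixes V :: "(real^'d::finite) set" and a b :: "'d \<Rightarrow> real"
  assumes V: "subspace V" and ab: "\<And>j. a j > 0 \<and> b j > 0 \<or> a j = 0 \<and> b j = 0"
    and transversal: "\<And>y. y \<in> V \<Longrightarrow> (\<And>j. b j \<noteq> 0 \<Longrightarrow> y $ j = 0) \<Longrightarrow> y = 0"
  shows "\<exists>c>0. \<exists>M. \<forall>y\<in>V. c * norm y + M \<le> (\<Sum>j\<in>UNIV. a j * exp (2 * y $ j) / 2 - b j * y $ j)"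
proof -
  have "\<exists>M. \<forall>t. b j / 2 * \<bar>t\<bar> + M \<le> a j * exp (2 * t) / 2 - b j * t" for j
    using exp_minus_linear_coercive[of "a j" "b j"] ab[of j] by (auto intro: exI[of _ 0])
  then obtain M where M: "\<And>j t. b j / 2 * \<bar>t\<bar> + M j \<le> a j * exp (2 * t) / 2 - b j * t" by metis
  have b_nonneg: "b j \<ge> 0" for j using ab[of j] by auto
  define L where "L y = (\<chi> j. b j * y $ j)" for y :: "real^'d"
  have "linear L" by (rule linearI) (auto simp: L_def vec_eq_iff algebra_simps)
  then have "bounded_linear L" by (simp add: linear_conv_bounded_linear)
  moreover have "y = 0" if "y \<in> V" "L y = 0" for y
    by (rule transversal[OF that(1)]) (use that(2) in \<open>auto simp: L_def vec_eq_iff\<close>)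
  ultimately obtain e where e: "e > 0" "\<And>y. y \<in> V \<Longrightarrow> norm y * e \<le> norm (L y)"
    using injective_imp_isometric[OF closed_subspace[OF V] V] by (metis mult.commute)
  have "e / 2 * norm y + (\<Sum>j\<in>UNIV. M j) \<le> (\<Sum>j\<in>UNIV. a j * exp (2 * y $ j) / 2 - b j * y $ j)" if y: "y \<in> V" for y
  proof -
    have "e * norm y \<le> norm (L y)" using e(2)[OF y] by (simp add: mult.commute)
    also have "\<dots> \<le> (\<Sum>j\<in>UNIV. \<bar>L y $ j\<bar>)" by (rule norm_le_l1_cart)
    also have "\<dots> = (\<Sum>j\<in>UNIV. b j * \<bar>y $ j\<bar>)"
      by (simp add: L_def abs_mult b_nonneg)
    finally have "e / 2 * norm y + (\<Sum>j\<in>UNIV. M j) \<le> (\<Sum>j\<in>UNIV. b j / 2 * \<bar>y $ j\<bar> + M j)"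
      by (simp add: sum.distrib flip: sum_divide_distrib)
    also have "\<dots> \<le> (\<Sum>j\<in>UNIV. a j * exp (2 * y $ j) / 2 - b j * y $ j)" by (rule sum_mono) (rule M)
    finally show ?thesis .
  qed
  then show ?thesis using e(1) by (intro exI[of _ "e / 2"]) auto
qed

lemma exp_sum_critical_point:
  fixes V :: "(real^'d::finite) set" and a b :: "'d \<Rightarrow> real"
  assumes V: "subspace V" and ab: "\<And>j. a j > 0 \<and> b j > 0 \<or> a j = 0 \<and> b j = 0"
    and transversal: "\<And>y. y \<in> V \<Longrightarrow> (\<And>j. b j \<noteq> 0 \<Longrightarrow> y $ j = 0) \<Longrightarrow> y = 0"
  shows "\<exists>y\<in>V. \<forall>x\<in>V. (\<Sum>j\<in>UNIV. (a j * exp (2 * y $ j) - b j) * x $ j) = 0"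
proof -
  define f where "f y = (\<Sum>j\<in>UNIV. a j * exp (2 * y $ j) / 2 - b j * y $ j)" for y :: "real^'d"
  have "\<exists>c>0. \<exists>M. \<forall>y\<in>V. c * norm y + M \<le> f y"
    unfolding f_def
  proof (rule exp_sum_coercive_on_subspace[OF V ab])
    show "y = 0" if "y \<in> V" "\<And>j. b j \<noteq> 0 \<Longrightarrow> y $ j = 0" for y by (rule transversal[OF that])
  qed
  then obtain c M where "c > 0" "\<And>y. y \<in> V \<Longrightarrow> c * norm y + M \<le> f y" by blast
  moreover have "continuous_on V f" unfolding f_def by (intro continuous_intros) simp
  moreover have "V \<noteq> {}" using subspace_0[OF V] by blast
  ultimately have "\<exists>y\<in>V. \<forall>x\<in>V. f y \<le> f x" using closed_subspace[OF V] by (intro coercive_attains_inf)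
  then obtain y where y: "y \<in> V" "\<And>x. x \<in> V \<Longrightarrow> f y \<le> f x" by blast
  have "(\<Sum>j\<in>UNIV. (a j * exp (2 * y $ j) - b j) * x $ j) = 0" if x: "x \<in> V" for x
  proof (rule DERIV_local_min)
    show "((\<lambda>t. f (y + t *\<^sub>R x)) has_real_derivative (\<Sum>j\<in>UNIV. (a j * exp (2 * y $ j) - b j) * x $ j)) (at 0)"
      unfolding f_def by (auto intro!: derivative_eq_intros sum.cong simp: algebra_simps)
    show "\<forall>t. \<bar>0 - t\<bar> < 1 \<longrightarrow> f (y + 0 *\<^sub>R x) \<le> f (y + t *\<^sub>R x)"
      using y x V by (auto intro!: y(2) subspace_add subspace_scale)
  qed simp
  then show ?thesis using y(1) by blast
qed

subsection \<open>Complex orbits meet the zero level in one compact orbit\<close>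

lemma norm_exp_act_complex_vec: "(cmod (exp_act (complex_vec y) z $ j))\<^sup>2 = exp (2 * y $ j) * (cmod (z $ j))\<^sup>2"
proof -
  have "(exp (y $ j))\<^sup>2 = exp (2 * y $ j)" by (simp add: exp_double)
  then show ?thesis by (simp add: exp_act_def complex_vec_def norm_mult power_mult_distrib norm_exp_eq_Re)
qed

lemma sum_inner_normal_eq_inner_pi_map: "(\<Sum>j\<in>UNIV. (\<nu> \<bullet> X j) * x $ j) = \<nu> \<bullet> pi_map X x"
  unfolding pi_map_def inner_sum_right by (rule sum.cong) auto

lemma subspace_n_space: "subspace (n_space X)"
  unfolding n_space_def by (rule linear_subspace_kernel[OF linear_pi_map])

lemma exp_act_complex_vec_fixed_in_Psi_zero:
  assumes z: "z \<in> Psi_zero X lam" and y: "y \<in> n_space X" and exp_z: "exp_act (complex_vec y) z \<in> Psi_zero X lam"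
  shows "exp_act (complex_vec y) z = z"
proof -
  obtain \<nu> where \<nu>: "\<And>j. \<nu> \<bullet> X j - lam j = (cmod (z $ j))\<^sup>2" using z mem_Psi_zero by blast
  obtain \<nu>' where \<nu>': "\<And>j. \<nu>' \<bullet> X j - lam j = exp (2 * y $ j) * (cmod (z $ j))\<^sup>2"
    using exp_z unfolding mem_Psi_zero norm_exp_act_complex_vec by blast
  have "(cmod (z $ j))\<^sup>2 * (exp (2 * y $ j) - 1) = (\<nu>' - \<nu>) \<bullet> X j" for j
    using \<nu>[of j] \<nu>'[of j] by (simp add: algebra_simps inner_diff_left)
  then have "(\<Sum>j\<in>UNIV. (cmod (z $ j))\<^sup>2 * ((exp (2 * y $ j) - 1) * y $ j)) = (\<nu>' - \<nu>) \<bullet> pi_map X y"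
    by (simp only: mult.assoc[symmetric] sum_inner_normal_eq_inner_pi_map)
  also have "\<dots> = 0" using y by (simp add: n_space_def)
  finally have "(\<Sum>j\<in>UNIV. (cmod (z $ j))\<^sup>2 * ((exp (2 * y $ j) - 1) * y $ j)) = 0" .
  moreover have "(exp (2 * t) - 1) * t \<ge> 0" for t :: real
    by (cases "t \<ge> 0") (auto simp: mult_nonpos_nonpos)
  ultimately have "\<forall>j\<in>UNIV. (cmod (z $ j))\<^sup>2 * ((exp (2 * y $ j) - 1) * y $ j) = 0"
    by (subst (asm) sum_nonneg_eq_0_iff) auto
  then have "y $ j = 0 \<or> z $ j = 0" for j by auto
  then have "exp (complex_vec y $ j) * z $ j = z $ j" for j
    unfolding complex_vec_def vec_lambda_beta by (cases "z $ j = 0") (simp, metis exp_zero mult_1 of_real_0)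
  then show ?thesis by (simp add: exp_act_def vec_eq_iff)
qed

context toric
begin

lemma complex_vec_in_exp_group: "y \<in> n_space X \<Longrightarrow> complex_vec y \<in> exp_group X Q 1"
  by (simp add: exp_group_def complex_vec_def pi_map_def n_space_def Q_zero)

lemma exp_group_mono: "exp_group X Q 0 \<subseteq> exp_group X Q 1"
  by (auto simp: exp_group_def)

lemma n_space_vec_eq_0:
  assumes r: "r \<in> R" and y: "y \<in> n_space X" and outside: "\<And>h. h \<notin> range r \<Longrightarrow> y $ h = 0"
  shows "y = 0"
proof -
  have "complex_vec y = 0"
    by (rule kernel_vec_eq_0[OF r]) (use y outside in \<open>auto simp: complex_vec_def n_space_def pi_map_def\<close>)
  then show ?thesis by (simp add: complex_vec_def vec_eq_iff)
qed

lemma exp_orbit_meets_Psi_zero: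
  assumes z: "z \<in> C_Delta \<Delta> X lam"
  shows "\<exists>y\<in>n_space X. exp_act (complex_vec y) z \<in> Psi_zero X lam"
proof -
  obtain r where r: "r \<in> R" "\<And>h. h \<notin> range r \<Longrightarrow> z $ h \<noteq> 0" using z mem_C_Delta by blast
  obtain v where v: "v extreme_point_of \<Delta>" "range r = active v" using frame_vertex[OF r(1)] .
  have "{j. z $ j = 0} \<subseteq> active v" using r(2) v(2) by blast
  then obtain \<nu> where \<nu>: "\<nu> \<in> \<Delta>" "active \<nu> = {j. z $ j = 0}" using point_with_active_set[OF v(1)] by metis
  define b where "b j = \<nu> \<bullet> X j - lam j" for j
  have b: "b j \<ge> 0" "b j = 0 \<longleftrightarrow> z $ j = 0" for j
    using \<nu> mem_active[of j \<nu>] by (auto simp: b_def mem_Delta)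
  have "\<exists>y\<in>n_space X. \<forall>x\<in>n_space X. (\<Sum>j\<in>UNIV. ((cmod (z $ j))\<^sup>2 * exp (2 * y $ j) - b j) * x $ j) = 0"
  proof (rule exp_sum_critical_point[OF subspace_n_space])
    show "(cmod (z $ j))\<^sup>2 > 0 \<and> b j > 0 \<or> (cmod (z $ j))\<^sup>2 = 0 \<and> b j = 0" for j
      using b[of j] by (cases "z $ j = 0") auto
    show "y = 0" if "y \<in> n_space X" "\<And>j. b j \<noteq> 0 \<Longrightarrow> y $ j = 0" for y
      using n_space_vec_eq_0[OF r(1) that(1)] that(2) r(2) b(2) by blast
  qed
  then obtain y where y: "y \<in> n_space X"
    "\<And>x. x \<in> n_space X \<Longrightarrow> (\<Sum>j\<in>UNIV. ((cmod (z $ j))\<^sup>2 * exp (2 * y $ j) - b j) * x $ j) = 0" by blast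
  have "J_map lam (exp_act (complex_vec y) z) x = 0" if x: "x \<in> n_space X" for x
  proof -
    have "J_map lam (exp_act (complex_vec y) z) x =
        (\<Sum>j\<in>UNIV. ((cmod (z $ j))\<^sup>2 * exp (2 * y $ j) - b j) * x $ j) + (\<Sum>j\<in>UNIV. (\<nu> \<bullet> X j) * x $ j)"
      unfolding J_map_def norm_exp_act_complex_vec sum.distrib[symmetric]
      by (rule sum.cong) (auto simp: b_def algebra_simps)
    then show ?thesis using y(2)[OF x] x by (simp add: sum_inner_normal_eq_inner_pi_map n_space_def)
  qed
  then show ?thesis using y(1) mem_Psi_zero_iff_J_map by blast
qed

lemma imaginary_part_in_exp_group:
  "\<zeta> \<in> exp_group X Q 1 \<Longrightarrow> (\<chi> j. \<i> * complex_of_real (Im (\<zeta> $ j))) \<in> exp_group X Q 0"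
  by (auto simp: exp_group_def im_proj_def complex_eq_iff)

lemma exp_act_in_Psi_zero_eq_phase:
  assumes z: "z \<in> Psi_zero X lam" and \<zeta>: "\<zeta> \<in> exp_group X Q 1" and exp_z: "exp_act \<zeta> z \<in> Psi_zero X lam"
  shows "exp_act \<zeta> z = phase (\<chi> j. Im (\<zeta> $ j)) z"
proof -
  let ?\<xi> = "\<chi> j. \<i> * complex_of_real (Im (\<zeta> $ j))" and ?y = "\<chi> j. Re (\<zeta> $ j)"
  have y: "?y \<in> n_space X" using \<zeta> by (simp add: exp_group_def n_space_def pi_map_def)
  have split: "\<zeta> = complex_vec ?y + ?\<xi>" by (simp add: vec_eq_iff complex_vec_def complex_eq_iff)
  have eq: "exp_act \<zeta> z = exp_act (complex_vec ?y) (exp_act ?\<xi> z)"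
    unfolding exp_act_add[symmetric] by (rule arg_cong[OF split])
  have "exp_act ?\<xi> z \<in> Psi_zero X lam" by (rule exp_act_in_Psi_zero[OF z imaginary_part_in_exp_group[OF \<zeta>]])
  then have "exp_act \<zeta> z = exp_act ?\<xi> z"
    unfolding eq by (rule exp_act_complex_vec_fixed_in_Psi_zero[OF _ y]) (use exp_z eq in simp)
  then show ?thesis by (simp add: exp_act_def phase_def)
qed

subsection \<open>The comparison map\<close>

lemma chi_map_orbit: "chi_map X Q (symp.orbit z) = cplx.orbit z"
proof -
  have "cplx.orbit ` symp.orbit z = {cplx.orbit z}"
    using exp_orbit_act[of _ 1 z] exp_group_mono in_exp_orbit[of z 0] by (auto simp: exp_orbit_def[of X Q 0])
  then show ?thesis by (simp add: chi_map_def torus_orbit_NC_group)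
qed

lemma symp_orbit_eq_if_cplx_orbit_eq:
  assumes "z \<in> Psi_zero X lam" "z' \<in> Psi_zero X lam" "cplx.orbit z = cplx.orbit z'"
  shows "symp.orbit z = symp.orbit z'"
proof -
  obtain \<zeta> where \<zeta>: "\<zeta> \<in> exp_group X Q 1" "z' = exp_act \<zeta> z" using assms(3) unfolding exp_orbit_eq_iff by blast
  then have "z' = phase (\<chi> j. Im (\<zeta> $ j)) z" using exp_act_in_Psi_zero_eq_phase assms(1,2) by simp
  then have "z' = exp_act (\<chi> j. \<i> * complex_of_real (Im (\<zeta> $ j))) z" by (simp add: phase_def exp_act_def)
  then show ?thesis unfolding exp_orbit_eq_iff using imaginary_part_in_exp_group[OF \<zeta>(1)] by blast
qed

lemma bij_betw_chi_map: "bij_betw (chi_map X Q) (topspace symp.orbit_space) (topspace cplx.orbit_space)"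
  unfolding symp.topspace_orbit_space cplx.topspace_orbit_space
proof (rule bij_betw_imageI)
  show "inj_on (chi_map X Q) (symp.orbit ` Psi_zero X lam)"
  proof (rule inj_onI, elim imageE)
    fix p q z z' assume "chi_map X Q p = chi_map X Q q" "p = symp.orbit z" "q = symp.orbit z'"
      "z \<in> Psi_zero X lam" "z' \<in> Psi_zero X lam"
    then show "p = q" using symp_orbit_eq_if_cplx_orbit_eq[of z z'] by (simp add: chi_map_orbit)
  qed
  have "cplx.orbit ` Psi_zero X lam = cplx.orbit ` C_Delta \<Delta> X lam"
  proof (rule subset_antisym[OF image_mono[OF Psi_zero_subset_C_Delta]], rule subsetI)
    fix p assume "p \<in> cplx.orbit ` C_Delta \<Delta> X lam"
    then obtain z where z: "z \<in> C_Delta \<Delta> X lam" "p = cplx.orbit z" by blast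
    obtain y where y: "y \<in> n_space X" "exp_act (complex_vec y) z \<in> Psi_zero X lam"
      using exp_orbit_meets_Psi_zero[OF z(1)] by blast
    have "p = cplx.orbit (exp_act (complex_vec y) z)"
      unfolding z(2) by (rule exp_orbit_act[OF complex_vec_in_exp_group[OF y(1)], symmetric])
    then show "p \<in> cplx.orbit ` Psi_zero X lam" using y(2) by blast
  qed
  then show "chi_map X Q ` symp.orbit ` Psi_zero X lam = cplx.orbit ` C_Delta \<Delta> X lam"
    by (simp add: image_image chi_map_orbit)
qed

lemma continuous_map_chi_map: "continuous_map symp.orbit_space cplx.orbit_space (chi_map X Q)"
proof (rule continuous_map_quotient_topology[where g="cplx.orbit"])
  have "continuous_map (top_of_set (Psi_zero X lam)) (top_of_set (C_Delta \<Delta> X lam)) id"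
    using Psi_zero_subset_C_Delta by (auto simp: continuous_map_in_subtopology)
  from continuous_map_compose[OF this quotient_imp_continuous_map[OF quotient_map_quotient_topology]]
  show "continuous_map (top_of_set (Psi_zero X lam)) cplx.orbit_space cplx.orbit" by simp
qed (simp add: chi_map_orbit)

lemma surj_pi_map: "surj (pi_map X)"
proof -
  have "\<Delta> \<noteq> {}" using full_dim by auto
  then obtain v where v: "v extreme_point_of \<Delta>"
    using extreme_point_exists_convex[OF compact_Delta convex_Delta] by blast
  have "pi_map X (axis j 1) = X j" for j
    by (simp add: pi_map_def axis_def if_distrib[of "\<lambda>c. c *\<^sub>R _"] cong: if_cong)
  then have "X ` active v \<subseteq> range (pi_map X)" by (metis image_subsetI rangeI)
  moreover have "subspace (range (pi_map X))" by (intro linear_subspace_image linear_pi_map subspace_UNIV)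
  ultimately have "span (X ` active v) \<subseteq> range (pi_map X)" by (rule span_minimal)
  then show ?thesis using vertex_normals_span[OF v] by auto
qed

lemma quasitorus_act_orbit:
  assumes t: "t = (\<lambda>q. pi_map X x\<^sub>0 + q) ` Q"
  shows "quasitorus_act X t (symp.orbit z) = symp.orbit (exp_act (torus_exponent (complex_vec x\<^sub>0)) z)"
proof -
  let ?\<zeta> = "torus_exponent (complex_vec x\<^sub>0)"
  have in_coset: "torus_exponent (complex_vec x) - ?\<zeta> \<in> exp_group X Q 0 \<longleftrightarrow> pi_map X x \<in> t" for x
  proof -
    have "torus_exponent (complex_vec x) - ?\<zeta> \<in> exp_group X Q 0 \<longleftrightarrow> pi_map X x - pi_map X x\<^sub>0 \<in> Q"
      by (simp add: torus_exponent_complex_vec_in_exp_group_iff linear_diff[OF linear_pi_map]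
          flip: torus_exponent_diff complex_vec_diff)
    then show ?thesis by (force simp: t image_iff)
  qed
  have "\<exists>x. \<xi> = torus_exponent (complex_vec x)" if \<xi>: "\<xi> - ?\<zeta> \<in> exp_group X Q 0" for \<xi>
  proof -
    obtain Z where Z: "torus_exponent Z = \<xi> - ?\<zeta>" using torus_exponent_surj by blast
    then have "complex_vec (\<chi> j. Re (Z $ j)) = Z" using \<xi> by (intro real_torus_exponent[of Z X Q]) simp
    then have "torus_exponent (complex_vec ((\<chi> j. Re (Z $ j)) + x\<^sub>0)) = \<xi>"
      using Z by (simp add: complex_vec_def torus_exponent_def vec_eq_iff algebra_simps)
    then show ?thesis by blast
  qed
  then have "quasitorus_act X t (symp.orbit z) = {exp_act \<xi> y | \<xi> y. \<xi> - ?\<zeta> \<in> exp_group X Q 0 \<and> y \<in> symp.orbit z}"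
    unfolding quasitorus_act_def torus_act_eq_exp_act in_coset[symmetric] by blast
  then show ?thesis by (simp only: exp_orbit_coset)
qed

lemma complex_quasitorus_act_orbit:
  assumes t: "t = (\<lambda>q. pi_map X x\<^sub>0 + q) ` Q"
  shows "complex_quasitorus_act X (quasitorus_incl t) (cplx.orbit z) =
    cplx.orbit (exp_act (torus_exponent (complex_vec x\<^sub>0)) z)"
proof -
  let ?\<zeta> = "torus_exponent (complex_vec x\<^sub>0)"
  have in_coset: "torus_exponent Z - ?\<zeta> \<in> exp_group X Q 1 \<longleftrightarrow> piC_map X Z \<in> quasitorus_incl t" for Z
  proof -
    have "torus_exponent Z - ?\<zeta> \<in> exp_group X Q 1 \<longleftrightarrow>
        pi_map X (\<chi> j. Re (Z $ j)) - pi_map X x\<^sub>0 \<in> Q \<and> pi_map X (\<chi> j. Im (Z $ j)) = 0"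
      unfolding torus_exponent_diff[symmetric] torus_exponent_in_exp_group_iff
      by (auto simp: piC_map_def QC_def complex_vec_def pi_map_def scaleR_diff_left sum_subtractf)
    then show ?thesis by (force simp: piC_map_def quasitorus_incl_def t image_iff)
  qed
  have "complex_quasitorus_act X (quasitorus_incl t) (cplx.orbit z) =
      {exp_act \<xi> y | \<xi> y. \<xi> - ?\<zeta> \<in> exp_group X Q 1 \<and> y \<in> cplx.orbit z}"
    unfolding complex_quasitorus_act_def torus_act_eq_exp_act in_coset[symmetric]
    by (intro Collect_cong) (metis torus_exponent_surj)
  then show ?thesis by (simp only: exp_orbit_coset)
qed

lemma chi_map_equivariant:
  assumes t: "t \<in> quasitorus Q" and x: "x \<in> topspace symp.orbit_space"
  shows "chi_map X Q (quasitorus_act X t x) = complex_quasitorus_act X (quasitorus_incl t) (chi_map X Q x)"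
proof -
  obtain Y where "t = (\<lambda>q. Y + q) ` Q" using t by (auto simp: quasitorus_def)
  moreover obtain x\<^sub>0 where "Y = pi_map X x\<^sub>0" using surj_pi_map by (metis surjD)
  ultimately have t: "t = (\<lambda>q. pi_map X x\<^sub>0 + q) ` Q" by simp
  obtain z where z: "x = symp.orbit z" using x by (auto simp: symp.topspace_orbit_space)
  show ?thesis
    unfolding z chi_map_orbit quasitorus_act_orbit[OF t] complex_quasitorus_act_orbit[OF t] ..
qed

end

section \<open>The standard form\<close>

lemma standard_form_inner: "standard_form x u v = (u \<bullet> (\<i> *s v)) / pi"
proof -
  have "Re (1 / (2 * complex_of_real pi * \<i>) * (a * cnj b - b * cnj a)) = (a \<bullet> (\<i> * b)) / pi" for a b
    by (simp add: inner_complex_def Re_divide field_simps power2_eq_square)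
  then show ?thesis
    unfolding standard_form_def sum_distrib_left Re_sum by (simp add: inner_vec_def sum_divide_distrib)
qed

lemma linear_imaginary_unit: "linear (\<lambda>v :: complex^'n. \<i> *s v)"
  by (rule linearI) (auto simp: vec_eq_iff algebra_simps)

lemmas imaginary_unit_add = linear_add[OF linear_imaginary_unit]

lemma imaginary_unit_imaginary_unit [simp]: "\<i> *s (\<i> *s u) = - (u :: complex^'n)"
  by (simp add: vec_eq_iff)

lemma inner_imaginary_unit_both: "(\<i> *s u) \<bullet> (\<i> *s v) = u \<bullet> (v :: complex^'n)"
  by (simp add: inner_vec_def inner_complex_def algebra_simps)

lemma inner_imaginary_unit_left: "(\<i> *s u) \<bullet> v = - (u \<bullet> (\<i> *s (v :: complex^'n)))"
  by (simp add: inner_vec_def inner_complex_def sum_negf[symmetric] algebra_simps)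

lemma standard_form_antisym: "standard_form x u v = - standard_form x v u"
  using inner_imaginary_unit_left[of v u] by (simp add: standard_form_inner inner_commute)

lemma bounded_bilinear_standard_form: "bounded_bilinear (standard_form x)"
proof -
  have "bilinear (standard_form x)"
    unfolding bilinear_def standard_form_inner
    by (auto intro!: linearI simp: imaginary_unit_add inner_add_left inner_add_right add_divide_distrib
        linear_cmul[OF linear_imaginary_unit])
  then show ?thesis by (simp add: bilinear_conv_bounded_bilinear)
qed

lemma standard_form_constant: "standard_form x = standard_form y"
  by (simp add: fun_eq_iff standard_form_inner)

lemma standard_form_eq_sum_Im: "standard_form x u v = (\<Sum>k\<in>UNIV. Im (u $ k * cnj (v $ k))) / pi"
  by (simp add: standard_form_inner inner_vec_def inner_complex_def algebra_simps)

lemma standard_form_phase: "standard_form x (phase \<alpha> u) (phase \<alpha> v) = standard_form y u v"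
proof -
  have "exp (\<i> * complex_of_real a) * cnj (exp (\<i> * complex_of_real a)) = 1" for a
    using complex_norm_square[of "exp (\<i> * complex_of_real a)"] by (simp add: norm_exp_i_times)
  then have "phase \<alpha> u $ k * cnj (phase \<alpha> v $ k) = u $ k * cnj (v $ k)" for k
    by (simp add: phase_def)
  then show ?thesis by (simp only: standard_form_eq_sum_Im)
qed

lemma closed_standard_form:
  fixes S :: "(complex^'n) set"
  shows "closed_two_form_on S standard_form"
proof -
  have "frechet_derivative (\<lambda>y. standard_form y u v) (at x) w = 0" for u v w x :: "complex^'n"
    using frechet_derivative_at[OF has_derivative_const[of "standard_form 0 u v" "at x"]]
    by (metis (no_types, lifting) ext standard_form_constant)
  then show ?thesis by (simp add: closed_two_form_on_def)
qed

lemma two_form_standard_form: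
  fixes S :: "(complex^'n) set"
  assumes "open S"
  shows "two_form_on S standard_form"
proof -
  have "bilinear (standard_form x)" for x :: "complex^'n"
    using bounded_bilinear_standard_form by (simp add: bilinear_conv_bounded_bilinear)
  moreover have "standard_form x v v = 0" for x v :: "complex^'n" using standard_form_antisym[of x v v] by simp
  moreover have "smooth_on S (\<lambda>x. standard_form x u v)" for u v :: "complex^'n"
    by (rule smooth_on_cong[OF assms _ smooth_on_const[OF assms, of "standard_form 0 u v"]])
       (simp add: standard_form_inner)
  ultimately show ?thesis by (simp add: two_form_on_def)
qed

lemma symplectic_standard_form:
  fixes S :: "(complex^'n) set"
  assumes "open S"
  shows "symplectic_on S standard_form"
proof -
  have "u = 0" if degenerate: "\<forall>v. standard_form x u v = 0" for x u :: "complex^'n"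
  proof -
    have "\<i> *s (- (\<i> *s u)) = u" using linear_neg[OF linear_imaginary_unit, of "\<i> *s u"] by simp
    then have "u \<bullet> u = 0" using degenerate[rule_format, of "- (\<i> *s u)"] by (simp add: standard_form_inner)
    then show ?thesis by simp
  qed
  then show ?thesis
    using assms by (auto simp: symplectic_on_def closed_standard_form two_form_standard_form)
qed

subsection \<open>Rotations along the zero level\<close>

lemma has_derivative_phase:
  assumes \<theta>: "(\<theta> has_derivative B) (at x)" and z: "(z has_derivative E) (at x)"
  shows "((\<lambda>w. phase (\<theta> w) (z w)) has_derivative
    (\<lambda>u. phase (\<theta> x) (E u + (\<chi> j. \<i> * complex_of_real (B u $ j) * z x $ j)))) (at x)"
proof -
  have "((\<lambda>w. \<chi> j. exp (\<i> * complex_of_real (\<theta> w $ j)) * z w $ j) has_derivative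
      (\<lambda>u. \<chi> j. exp (\<i> * complex_of_real (\<theta> x $ j)) * E u $ j +
        exp (\<i> * complex_of_real (\<theta> x $ j)) * (\<i> * complex_of_real (B u $ j)) * z x $ j)) (at x)"
    by (rule has_derivative_vec)
       (simp, intro has_derivative_mult has_derivative_exp_of_real has_derivative_vec_nth \<theta> z)
  then show ?thesis unfolding phase_def by (simp add: algebra_simps)
qed

lemma standard_form_add_imaginary:
  "standard_form x (a + (\<chi> j. \<i> * complex_of_real (s j) * z $ j)) (b + (\<chi> j. \<i> * complex_of_real (t j) * z $ j)) =
    standard_form x a b +
      ((\<Sum>j\<in>UNIV. Re (cnj (z $ j) * b $ j) * s j) - (\<Sum>j\<in>UNIV. Re (cnj (z $ j) * a $ j) * t j)) / pi"
proof -
  have "Im ((a $ j + \<i> * complex_of_real (s j) * z $ j) * cnj (b $ j + \<i> * complex_of_real (t j) * z $ j)) =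
      Im (a $ j * cnj (b $ j)) + (Re (cnj (z $ j) * b $ j) * s j - Re (cnj (z $ j) * a $ j) * t j)" for j
    by (simp add: algebra_simps)
  then show ?thesis
    by (simp only: standard_form_eq_sum_Im vector_add_component vec_lambda_beta sum.distrib sum_subtractf
        add_divide_distrib)
qed

lemma derivative_in_n_space:
  assumes "open T" "x \<in> T" "\<And>w. w \<in> T \<Longrightarrow> \<theta> w \<in> n_space X" and \<theta>: "(\<theta> has_derivative B) (at x)"
  shows "B u \<in> n_space X"
proof -
  have "bounded_linear (pi_map X)" using linear_pi_map by (simp add: linear_conv_bounded_linear)
  then have "(\<lambda>u. pi_map X (B u)) = (\<lambda>u. 0)"
    using assms(1-3)
    by (intro has_derivative_unique_open[OF bounded_linear.has_derivative[OF _ \<theta>] has_derivative_const])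
       (auto simp: n_space_def)
  then show ?thesis by (simp add: n_space_def fun_eq_iff)
qed

lemma derivative_moduli_annihilates_n_space:
  assumes T: "open T" "x \<in> T" and level: "\<And>w. w \<in> T \<Longrightarrow> z w \<in> Psi_zero X lam"
    and z: "(z has_derivative E) (at x)" and y: "y \<in> n_space X"
  shows "(\<Sum>j\<in>UNIV. Re (cnj (z x $ j) * E u $ j) * y $ j) = 0"
proof -
  have "((\<lambda>w. J_map lam (z w) y) has_derivative (\<lambda>u. \<Sum>j\<in>UNIV. (2 * Re (cnj (z x $ j) * E u $ j) + 0) * y $ j)) (at x)"
    unfolding J_map_def
    by (intro has_derivative_sum has_derivative_mult_left has_derivative_add has_derivative_const
        has_derivative_cmod_squared has_derivative_vec_nth z)
  moreover have "J_map lam (z w) y = 0" if "w \<in> T" for w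
    using level[OF that] y by (simp add: mem_Psi_zero_iff_J_map)
  ultimately have "(\<lambda>u. \<Sum>j\<in>UNIV. (2 * Re (cnj (z x $ j) * E u $ j) + 0) * y $ j) = (\<lambda>u. 0)"
    by (rule has_derivative_unique_open[OF _ has_derivative_const T])
  from fun_cong[OF this, of u] have "2 * (\<Sum>j\<in>UNIV. Re (cnj (z x $ j) * E u $ j) * y $ j) = 0"
    by (simp add: sum_distrib_left algebra_simps)
  then show ?thesis by simp
qed

text \<open>Rotating a map into the zero level by angles with values in \<open>\<nn>\<close> does not change the pulled back form,
  since the differentials of the squared moduli annihilate \<open>\<nn>\<close>.\<close>

lemma standard_form_rotated_level:
  assumes T: "open T" "x \<in> T" and level: "\<And>w. w \<in> T \<Longrightarrow> z w \<in> Psi_zero X lam"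
    and angles: "\<And>w. w \<in> T \<Longrightarrow> \<theta> w \<in> n_space X" and rotated: "\<And>w. w \<in> T \<Longrightarrow> z' w = phase (\<theta> w) (z w)"
    and z: "(z has_derivative E) (at x)" and z': "(z' has_derivative E') (at x)" and \<theta>: "(\<theta> has_derivative B) (at x)"
  shows "standard_form p (E' u) (E' v) = standard_form q (E u) (E v)"
proof -
  have "E' = (\<lambda>u. phase (\<theta> x) (E u + (\<chi> j. \<i> * complex_of_real (B u $ j) * z x $ j)))"
    by (rule has_derivative_unique_open[OF z' has_derivative_phase[OF \<theta> z] T rotated])
  then have "standard_form p (E' u) (E' v) =
      standard_form q (E u + (\<chi> j. \<i> * complex_of_real (B u $ j) * z x $ j))
        (E v + (\<chi> j. \<i> * complex_of_real (B v $ j) * z x $ j))"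
    by (simp only: standard_form_phase[of p _ _ _ q])
  also have "\<dots> = standard_form q (E u) (E v)"
    unfolding standard_form_add_imaginary
    using derivative_moduli_annihilates_n_space[OF T level z derivative_in_n_space[OF T angles \<theta>]] by simp
  finally show ?thesis .
qed

subsection \<open>Perturbations of the identity by a real operator\<close>

text \<open>Writing \<open>A = 1 + T\<close>, the two results say that \<open>(u, v) \<mapsto> \<langle>A\<^sup>-\<^sup>1 u, \<i> A\<^sup>-\<^sup>1 v\<rangle>\<close> is of type (1,1) and positive.\<close>

locale real_psd_operator =
  fixes T :: "complex^'n::finite \<Rightarrow> complex^'n"
  assumes symmetric: "u \<bullet> T v = v \<bullet> T u" and nonneg: "u \<bullet> T u \<ge> 0"
    and null: "u \<bullet> T u = 0 \<Longrightarrow> T u = 0" and imaginary_range_null: "T (\<i> *s T u) = 0"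
begin

lemma range_isotropic: "T u \<bullet> (\<i> *s T v) = 0"
  using symmetric[of "\<i> *s T v" u] imaginary_range_null[of v] by (simp add: inner_commute)

lemma cross_terms_agree:
  assumes p: "q + T q = \<i> *s (p + T p)" and p': "q' + T q' = \<i> *s (p' + T p')"
  shows "p \<bullet> (\<i> *s T p') = T q \<bullet> (\<i> *s q')"
proof -
  have "p \<bullet> (\<i> *s T p') = (p + T p) \<bullet> (\<i> *s T p')" by (simp add: inner_add_left range_isotropic)
  also have "\<dots> = - ((q + T q) \<bullet> T p')" by (simp only: p inner_imaginary_unit_left minus_minus)
  also have "\<dots> = - (T q \<bullet> (p' + T p'))"
    using symmetric[of q p'] by (simp add: inner_add_left inner_add_right inner_commute)
  also have "\<dots> = T q \<bullet> (\<i> *s (q' + T q'))" by (simp only: p' imaginary_unit_imaginary_unit inner_minus_right)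
  also have "\<dots> = T q \<bullet> (\<i> *s q')" by (simp add: imaginary_unit_add inner_add_right range_isotropic)
  finally show ?thesis .
qed

lemma type_one_one:
  assumes p: "q + T q = \<i> *s (p + T p)" and p': "q' + T q' = \<i> *s (p' + T p')"
  shows "q \<bullet> (\<i> *s q') = p \<bullet> (\<i> *s p')"
proof -
  have expand: "(u + T u) \<bullet> (\<i> *s (v + T v)) = u \<bullet> (\<i> *s v) + u \<bullet> (\<i> *s T v) + T u \<bullet> (\<i> *s v)" for u v
    by (simp add: inner_add_left inner_add_right imaginary_unit_add range_isotropic)
  have swap: "u \<bullet> (\<i> *s v) = - (v \<bullet> (\<i> *s u))" for u v :: "complex^'n"
    using inner_imaginary_unit_left[of v u] by (simp add: inner_commute)
  have "(q + T q) \<bullet> (\<i> *s (q' + T q')) = (p + T p) \<bullet> (\<i> *s (p' + T p'))"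
    unfolding p p' by (rule inner_imaginary_unit_both)
  moreover have "p \<bullet> (\<i> *s T p') = T q \<bullet> (\<i> *s q')" by (rule cross_terms_agree[OF p p'])
  moreover have "T p \<bullet> (\<i> *s p') = q \<bullet> (\<i> *s T q')"
    using cross_terms_agree[OF p' p] swap[of "T p" p'] swap[of q "T q'"] by simp
  ultimately show ?thesis unfolding expand by simp
qed

lemma positive:
  assumes q: "q + T q = \<i> *s (p + T p)" and p: "p \<noteq> 0"
  shows "q \<bullet> (\<i> *s p) > 0"
proof -
  let ?s = "p + \<i> *s T q"
  have "q \<bullet> (\<i> *s p) = (q + T q) \<bullet> (\<i> *s p) - T q \<bullet> (\<i> *s p)" by (simp add: inner_add_left)
  also have "\<dots> = p \<bullet> p + p \<bullet> T p + p \<bullet> (\<i> *s T q)"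
    unfolding q
    by (simp add: inner_imaginary_unit_both inner_add_left inner_commute[of "T p"]
        inner_imaginary_unit_left[of "T q" p, symmetric] inner_commute[of "\<i> *s T q"])
  finally have pairing: "q \<bullet> (\<i> *s p) = p \<bullet> p + p \<bullet> T p + p \<bullet> (\<i> *s T q)" .
  have "(q + T q) \<bullet> T q = - ((p + T p) \<bullet> (\<i> *s T q))" unfolding q by (rule inner_imaginary_unit_left)
  then have "q \<bullet> T q + T q \<bullet> T q + p \<bullet> (\<i> *s T q) = 0"
    by (simp add: inner_add_left range_isotropic)
  moreover have "?s \<bullet> ?s = p \<bullet> p + 2 * (p \<bullet> (\<i> *s T q)) + T q \<bullet> T q"
    by (simp add: inner_add_left inner_add_right inner_commute[of "\<i> *s T q" p] inner_imaginary_unit_both)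
  ultimately have eq: "q \<bullet> (\<i> *s p) = ?s \<bullet> ?s + p \<bullet> T p + q \<bullet> T q" using pairing by simp
  have "q \<bullet> (\<i> *s p) \<noteq> 0"
  proof
    assume "q \<bullet> (\<i> *s p) = 0"
    then have "?s \<bullet> ?s = 0" "q \<bullet> T q = 0"
      using eq nonneg[of p] nonneg[of q] inner_ge_zero[of ?s] by linarith+
    then have "?s = 0" "T q = 0" using null by auto
    then show False using p by (simp add: vec_eq_iff)
  qed
  then show ?thesis using eq nonneg[of p] nonneg[of q] inner_ge_zero[of ?s] by linarith
qed

end

section \<open>The lift of the comparison map\<close>

context toric
begin

lemma frame_slack_pos: "w \<in> symp.slice_dom r \<Longrightarrow> h \<notin> range r \<Longrightarrow> frame_slack r (sq_moduli w) h > 0"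
  by (simp add: reinhardt_def slack_region_def)

definition log_scaling :: "('n \<Rightarrow> 'd) \<Rightarrow> complex^'n \<Rightarrow> 'n \<Rightarrow> real" where
  "log_scaling r w k = (\<Sum>h\<in>- range r. frame_coeff X r h k * (ln (frame_slack r (sq_moduli w) h) / 2))"

definition chi_lift :: "('n \<Rightarrow> 'd) \<Rightarrow> complex^'n \<Rightarrow> complex^'n" where
  "chi_lift r w = (\<chi> k. exp (complex_of_real (log_scaling r w k)) * w $ k)"

definition scaling_vec :: "('n \<Rightarrow> 'd) \<Rightarrow> complex^'n \<Rightarrow> real^'d" where
  "scaling_vec r w = (\<chi> j. if j \<in> range r then log_scaling r w (inv_into UNIV r j)
     else - (ln (frame_slack r (sq_moduli w) j) / 2))"

lemma scaling_vec_in_n_space: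
  assumes r: "r \<in> R"
  shows "scaling_vec r w \<in> n_space X"
proof -
  let ?f = "\<lambda>h. complex_of_real (- (ln (frame_slack r (sq_moduli w) h) / 2))"
  have "scaling_vec r w $ j = Re (kernel_extend X r ?f $ j)" for j
    by (cases "j \<in> range r")
       (auto simp: scaling_vec_def kernel_extend_range[OF inj_frame[OF r]] kernel_extend_outside log_scaling_def
          inj_frame[OF r] sum_negf)
  then show ?thesis using sum_Re_kernel_extend[OF r] by (simp add: n_space_def pi_map_def)
qed

lemma exp_scaling_vec_slice:
  assumes r: "r \<in> R" and w: "w \<in> symp.slice_dom r"
  shows "exp_act (complex_vec (scaling_vec r w)) (symp.slice r w) = cplx.slice r (chi_lift r w)"
proof -
  have "exp_act (complex_vec (scaling_vec r w)) (symp.slice r w) $ j = cplx.slice r (chi_lift r w) $ j" for j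
  proof (cases "j \<in> range r")
    case True
    then show ?thesis
      using inj_frame[OF r] by (auto simp: exp_act_def complex_vec_def scaling_vec_def chi_lift_def)
  next
    case False
    let ?s = "frame_slack r (sq_moduli w) j"
    have s: "?s > 0" by (rule frame_slack_pos[OF w False])
    then have "exp (ln ?s / 2) = sqrt ?s" using exp_ln[of "sqrt ?s"] by (simp add: ln_sqrt)
    then have "exp (- (ln ?s / 2)) * sqrt ?s = 1" using s by (simp add: exp_minus field_simps)
    then have "complex_of_real (exp (- (ln ?s / 2)) * sqrt ?s) = 1" by (simp only: of_real_1)
    then show ?thesis using False
      by (simp add: exp_act_def complex_vec_def scaling_vec_def slack_heights_def exp_of_real[symmetric])
  qed
  then show ?thesis by (simp add: vec_eq_iff)
qed

lemma cplx_orbit_chi_lift: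
  "r \<in> R \<Longrightarrow> w \<in> symp.slice_dom r \<Longrightarrow> cplx.orbit (cplx.slice r (chi_lift r w)) = cplx.orbit (symp.slice r w)"
  unfolding exp_scaling_vec_slice[symmetric]
  by (rule exp_orbit_act[OF complex_vec_in_exp_group[OF scaling_vec_in_n_space]])

lemma inj_on_chi_lift:
  assumes r: "r \<in> R"
  shows "inj_on (chi_lift r) (symp.slice_dom r)"
proof (rule inj_onI)
  fix w w' assume w: "w \<in> symp.slice_dom r" "w' \<in> symp.slice_dom r" and eq: "chi_lift r w = chi_lift r w'"
  let ?y = "scaling_vec r w - scaling_vec r w'"
  have "symp.slice r w' = exp_act (- complex_vec (scaling_vec r w')) (cplx.slice r (chi_lift r w'))"
    by (simp flip: exp_scaling_vec_slice[OF r w(2)])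
  also have "\<dots> = exp_act (complex_vec ?y) (symp.slice r w)"
    by (simp flip: eq exp_scaling_vec_slice[OF r w(1)] exp_act_add add: complex_vec_diff)
  finally have slice_eq: "symp.slice r w' = exp_act (complex_vec ?y) (symp.slice r w)" .
  have "?y \<in> n_space X" by (intro subspace_diff subspace_n_space scaling_vec_in_n_space r)
  then have "exp_act (complex_vec ?y) (symp.slice r w) = symp.slice r w"
    using symp.slice_in_level[OF r w(2)] unfolding slice_eq
    by (rule exp_act_complex_vec_fixed_in_Psi_zero[OF symp.slice_in_level[OF r w(1)]])
  then have "select_coords r (symp.slice r w') = select_coords r (symp.slice r w)" using slice_eq by simp
  then show "w = w'" using inj_frame[OF r] by simp
qed

lemma chi_lift_surj:
  assumes r: "r \<in> R"
  shows "\<exists>w\<in>symp.slice_dom r. chi_lift r w = v"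
proof -
  obtain y where y: "y \<in> n_space X" "exp_act (complex_vec y) (cplx.slice r v) \<in> Psi_zero X lam"
    using exp_orbit_meets_Psi_zero[OF cplx.slice_in_level[OF r, of v]] by auto
  let ?z = "exp_act (complex_vec y) (cplx.slice r v)"
  let ?w = "select_coords r ?z"
  have "\<exists>t>0. ?z $ h = complex_of_real t" if "h \<notin> range r" for h
    using that by (intro exI[of _ "exp (y $ h)"]) (simp add: exp_act_def complex_vec_def exp_of_real)
  from positive_coords_in_slack_slice[OF r y(2) this]
  have w: "?w \<in> symp.slice_dom r" and slice_w: "symp.slice r ?w = ?z" by auto
  let ?y = "scaling_vec r ?w + y"
  have "complex_vec ?y = complex_vec (scaling_vec r ?w) + complex_vec y" by (simp add: complex_vec_def vec_eq_iff)
  then have exp_y: "cplx.slice r (chi_lift r ?w) = exp_act (complex_vec ?y) (cplx.slice r v)"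
    by (simp add: slice_w exp_act_add flip: exp_scaling_vec_slice[OF r w])
  have "?y = 0"
  proof (rule n_space_vec_eq_0[OF r])
    show "?y \<in> n_space X" by (intro subspace_add subspace_n_space scaling_vec_in_n_space r y(1))
    fix h assume "h \<notin> range r"
    then have "exp (complex_of_real (?y $ h)) = 1"
      using arg_cong[OF exp_y, of "\<lambda>z. z $ h"] by (simp add: exp_act_def complex_vec_def)
    then have "exp (?y $ h) = 1" by (simp only: exp_of_real of_real_eq_1_iff)
    then show "?y $ h = 0" by (simp only: exp_eq_one_iff)
  qed
  then have "cplx.slice r (chi_lift r ?w) = cplx.slice r v" using exp_y by (simp add: complex_vec_def exp_act_def)
  then have "select_coords r (cplx.slice r (chi_lift r ?w)) = select_coords r (cplx.slice r v)" by simp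
  then show ?thesis using w inj_frame[OF r] by auto
qed

definition chi_lift_inv :: "('n \<Rightarrow> 'd) \<Rightarrow> complex^'n \<Rightarrow> complex^'n" where
  "chi_lift_inv r = inv_into (symp.slice_dom r) (chi_lift r)"

lemma chi_lift_inv:
  assumes r: "r \<in> R"
  shows "chi_lift_inv r v \<in> symp.slice_dom r" "chi_lift r (chi_lift_inv r v) = v"
    "w \<in> symp.slice_dom r \<Longrightarrow> chi_lift_inv r (chi_lift r w) = w"
proof -
  have "v \<in> chi_lift r ` symp.slice_dom r" using chi_lift_surj[OF r, of v] by blast
  then show "chi_lift_inv r v \<in> symp.slice_dom r" "chi_lift r (chi_lift_inv r v) = v"
    unfolding chi_lift_inv_def by (auto intro: inv_into_into f_inv_into_f)
  show "w \<in> symp.slice_dom r \<Longrightarrow> chi_lift_inv r (chi_lift r w) = w"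
    unfolding chi_lift_inv_def by (rule inv_into_f_f[OF inj_on_chi_lift[OF r]])
qed

lemma exp_scaling_vec_slice_chi_lift_inv:
  "r \<in> R \<Longrightarrow>
   exp_act (complex_vec (scaling_vec r (chi_lift_inv r v))) (symp.slice r (chi_lift_inv r v)) = cplx.slice r v"
  by (simp add: exp_scaling_vec_slice chi_lift_inv)

lemma chi_lift_inv_phase:
  assumes r: "r \<in> R"
  shows "chi_lift_inv r (phase \<alpha> v) = phase \<alpha> (chi_lift_inv r v)"
proof -
  have "chi_lift r (phase \<alpha> (chi_lift_inv r v)) = phase \<alpha> (chi_lift r (chi_lift_inv r v))"
    by (simp add: chi_lift_def log_scaling_def phase_def vec_eq_iff sq_moduli_phase[unfolded phase_def])
  then have "chi_lift r (phase \<alpha> (chi_lift_inv r v)) = phase \<alpha> v" by (simp add: chi_lift_inv[OF r])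
  moreover have "phase \<alpha> (chi_lift_inv r v) \<in> symp.slice_dom r"
    by (simp add: phase_in_reinhardt_iff chi_lift_inv[OF r])
  ultimately show ?thesis using chi_lift_inv(3)[OF r] by metis
qed

subsection \<open>The derivative of the lift\<close>

lemma smooth_on_chi_lift:
  assumes r: "r \<in> R"
  shows "smooth_on (symp.slice_dom r) (chi_lift r)"
proof (rule smooth_on_vec[OF symp.open_slice_dom[OF r]])
  fix k
  note opn = symp.open_slice_dom[OF r]
  have "smooth_on (symp.slice_dom r)
      (\<lambda>w. \<Sum>h\<in>- range r. frame_coeff X r h k * (inverse 2 * ln (frame_slack r (sq_moduli w) h)))"
    by (intro smooth_on_sum smooth_on_linear_comp[OF opn bounded_linear_mult_right] smooth_on_ln
        smooth_on_frame_slack opn) (auto intro: frame_slack_pos)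
  then have "smooth_on (symp.slice_dom r) (\<lambda>w. log_scaling r w k)" by (simp add: log_scaling_def)
  then have "smooth_on (symp.slice_dom r) (\<lambda>w. complex_of_real (log_scaling r w k))"
    by (rule smooth_on_linear_comp[OF opn bounded_linear_of_real])
  moreover have "smooth_on (symp.slice_dom r) (\<lambda>w. w $ k)"
    by (rule smooth_on_bounded_linear[OF opn bounded_linear_vec_nth])
  ultimately show "smooth_on (symp.slice_dom r) (\<lambda>w. chi_lift r w $ k)"
    unfolding chi_lift_def vec_lambda_beta by (intro smooth_on_mult smooth_on_exp opn)
qed

definition slack_derivative :: "('n \<Rightarrow> 'd) \<Rightarrow> complex^'n \<Rightarrow> 'd \<Rightarrow> complex^'n \<Rightarrow> real" where
  "slack_derivative r w h u = (\<Sum>k\<in>UNIV. frame_coeff X r h k * Re (cnj (w $ k) * u $ k))"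

definition scaling_operator :: "('n \<Rightarrow> 'd) \<Rightarrow> complex^'n \<Rightarrow> complex^'n \<Rightarrow> complex^'n" where
  "scaling_operator r w u = (\<chi> k. complex_of_real
     (\<Sum>h\<in>- range r. frame_coeff X r h k * (slack_derivative r w h u / frame_slack r (sq_moduli w) h)) * w $ k)"

lemma has_derivative_frame_slack:
  "((\<lambda>w. frame_slack r (sq_moduli w) h) has_derivative (\<lambda>u. 2 * slack_derivative r w h u)) (at w)"
proof -
  have sq: "((\<lambda>w. sq_moduli w $ k) has_derivative (\<lambda>u. 2 * Re (cnj (w $ k) * u $ k))) (at w)" for k
    unfolding sq_moduli_def vec_lambda_beta
    by (rule has_derivative_cmod_squared[OF has_derivative_vec_nth[OF has_derivative_ident]])
  have "((\<lambda>w. frame_slack r (sq_moduli w) h) has_derivative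
      (\<lambda>u. (\<Sum>k\<in>UNIV. frame_coeff X r h k * (2 * Re (cnj (w $ k) * u $ k) + 0)) - 0)) (at w)"
    unfolding frame_slack_def
    by (intro has_derivative_diff has_derivative_sum has_derivative_mult_right has_derivative_add
        has_derivative_const sq)
  then show ?thesis by (simp add: slack_derivative_def sum_distrib_left algebra_simps)
qed

lemma has_derivative_log_scaling:
  assumes w: "w \<in> symp.slice_dom r"
  shows "((\<lambda>w. log_scaling r w k) has_derivative
    (\<lambda>u. \<Sum>h\<in>- range r. frame_coeff X r h k * (slack_derivative r w h u / frame_slack r (sq_moduli w) h))) (at w)"
proof -
  have "((\<lambda>w. ln (frame_slack r (sq_moduli w) h) / 2) has_derivative
      (\<lambda>u. slack_derivative r w h u / frame_slack r (sq_moduli w) h)) (at w)" if "h \<in> - range r" for h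
  proof -
    have "frame_slack r (sq_moduli w) h > 0" using frame_slack_pos[OF w] that by simp
    from bounded_linear.has_derivative[OF bounded_linear_divide has_derivative_ln[OF this has_derivative_frame_slack]]
    show ?thesis by (rule has_derivative_eq_rhs) (auto simp: inverse_eq_divide)
  qed
  then show ?thesis unfolding log_scaling_def by (intro has_derivative_sum has_derivative_mult_right)
qed

lemma has_derivative_chi_lift:
  assumes w: "w \<in> symp.slice_dom r"
  shows "(chi_lift r has_derivative
    (\<lambda>u. \<chi> k. exp (complex_of_real (log_scaling r w k)) * (u + scaling_operator r w u) $ k)) (at w)"
proof (rule has_derivative_vec)
  fix k
  have "((\<lambda>w. exp (1 * complex_of_real (log_scaling r w k)) * w $ k) has_derivative
      (\<lambda>u. exp (complex_of_real (log_scaling r w k)) * (u + scaling_operator r w u) $ k)) (at w)"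
    by (rule has_derivative_eq_rhs[OF has_derivative_mult[OF has_derivative_exp_of_real[OF
            has_derivative_log_scaling[OF w]] has_derivative_vec_nth[OF has_derivative_ident]]])
       (auto simp: scaling_operator_def algebra_simps)
  then show "((\<lambda>w. chi_lift r w $ k) has_derivative
      (\<lambda>u. exp (complex_of_real (log_scaling r w k)) * (u + scaling_operator r w u) $ k)) (at w)"
    by (simp add: chi_lift_def)
qed

lemma inner_scaling_operator:
  "u \<bullet> scaling_operator r w v =
    (\<Sum>h\<in>- range r. slack_derivative r w h u * slack_derivative r w h v / frame_slack r (sq_moduli w) h)"
proof -
  have inner_scaled: "x \<bullet> (complex_of_real t * y) = t * Re (cnj y * x)" for x y t
    by (simp add: inner_complex_def algebra_simps)
  have "u \<bullet> scaling_operator r w v = (\<Sum>k\<in>UNIV. \<Sum>h\<in>- range r. frame_coeff X r h k * Re (cnj (w $ k) * u $ k) *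
      (slack_derivative r w h v / frame_slack r (sq_moduli w) h))"
    unfolding inner_vec_def scaling_operator_def vec_lambda_beta inner_scaled sum_distrib_right
    by (intro sum.cong refl) (simp add: algebra_simps add_divide_distrib)
  also have "\<dots> = (\<Sum>h\<in>- range r. \<Sum>k\<in>UNIV. frame_coeff X r h k * Re (cnj (w $ k) * u $ k) *
      (slack_derivative r w h v / frame_slack r (sq_moduli w) h))"
    by (rule sum.swap)
  also have "\<dots> = (\<Sum>h\<in>- range r. slack_derivative r w h u * slack_derivative r w h v / frame_slack r (sq_moduli w) h)"
    unfolding sum_distrib_right[symmetric] slack_derivative_def[symmetric] by simp
  finally show ?thesis .
qed

lemma real_psd_scaling_operator:
  assumes w: "w \<in> symp.slice_dom r"
  shows "real_psd_operator (scaling_operator r w)"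
proof
  fix u v :: "complex^'n"
  show "u \<bullet> scaling_operator r w v = v \<bullet> scaling_operator r w u"
    by (simp add: inner_scaling_operator mult.commute)
  have terms_nonneg: "slack_derivative r w h u * slack_derivative r w h u / frame_slack r (sq_moduli w) h \<ge> 0"
    if "h \<in> - range r" for h
    using frame_slack_pos[OF w, of h] that by (intro divide_nonneg_pos) auto
  then show "u \<bullet> scaling_operator r w u \<ge> 0" unfolding inner_scaling_operator by (rule sum_nonneg)
  show "scaling_operator r w u = 0" if "u \<bullet> scaling_operator r w u = 0"
  proof -
    have "\<forall>h\<in>- range r. slack_derivative r w h u * slack_derivative r w h u / frame_slack r (sq_moduli w) h = 0"
      using that terms_nonneg unfolding inner_scaling_operator by (subst (asm) sum_nonneg_eq_0_iff) auto
    then have "slack_derivative r w h u = 0" if "h \<in> - range r" for h using frame_slack_pos[OF w, of h] that by auto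
    then show ?thesis by (simp add: scaling_operator_def vec_eq_iff)
  qed
  have "Re (cnj x * (\<i> * (complex_of_real t * x))) = 0" for x t
    by (simp add: algebra_simps)
  then have "slack_derivative r w h (\<i> *s scaling_operator r w u) = 0" for h
    by (simp only: slack_derivative_def scaling_operator_def vector_smult_component vec_lambda_beta) simp
  then show "scaling_operator r w (\<i> *s scaling_operator r w u) = 0"
    unfolding scaling_operator_def[of r w "\<i> *s scaling_operator r w u"] by (simp add: vec_eq_iff)
qed

lemma smooth_on_chi_lift_inv:
  assumes r: "r \<in> R"
  shows "smooth_on UNIV (chi_lift_inv r)"
proof (rule smooth_on_inverse_function[OF symp.open_slice_dom[OF r] open_UNIV smooth_on_chi_lift[OF r]])
  fix w u assume w: "w \<in> symp.slice_dom r" and kernel: "frechet_derivative (chi_lift r) (at w) u = 0"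
  interpret real_psd_operator "scaling_operator r w" by (rule real_psd_scaling_operator[OF w])
  have "(\<chi> k. exp (complex_of_real (log_scaling r w k)) * (u + scaling_operator r w u) $ k) = 0"
    using fun_cong[OF frechet_derivative_at[OF has_derivative_chi_lift[OF w]], of u] unfolding kernel .
  then have "u + scaling_operator r w u = 0" by (simp add: vec_eq_iff)
  then have "u \<bullet> (u + scaling_operator r w u) = 0" by simp
  then have "u \<bullet> u = 0" using nonneg[of u] inner_ge_zero[of u] unfolding inner_add_right by linarith
  then show "u = 0" by simp
qed (use chi_lift_inv[OF r] in auto)

abbreviation chi_lift_inv_derivative :: "('n \<Rightarrow> 'd) \<Rightarrow> complex^'n \<Rightarrow> complex^'n \<Rightarrow> complex^'n" where
  "chi_lift_inv_derivative r v \<equiv> frechet_derivative (chi_lift_inv r) (at v)"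

lemma has_derivative_chi_lift_inv: "r \<in> R \<Longrightarrow> (chi_lift_inv r has_derivative chi_lift_inv_derivative r v) (at v)"
  by (rule smooth_on_has_derivative[OF smooth_on_chi_lift_inv]) auto

lemma chi_lift_inv_derivative_equation:
  assumes r: "r \<in> R"
  shows "chi_lift_inv_derivative r v a + scaling_operator r (chi_lift_inv r v) (chi_lift_inv_derivative r v a) =
    (\<chi> k. exp (- complex_of_real (log_scaling r (chi_lift_inv r v) k)) * a $ k)"
proof -
  let ?w = "chi_lift_inv r v" and ?D = "chi_lift_inv_derivative r v"
  let ?L = "\<lambda>u. \<chi> k. exp (complex_of_real (log_scaling r ?w k)) * (u + scaling_operator r ?w u) $ k"
  have "(chi_lift r \<circ> chi_lift_inv r has_derivative ?L \<circ> ?D) (at v)"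
    by (rule diff_chain_at[OF has_derivative_chi_lift_inv[OF r] has_derivative_chi_lift[OF chi_lift_inv(1)[OF r]]])
  moreover have "chi_lift r \<circ> chi_lift_inv r = id" using chi_lift_inv(2)[OF r] by auto
  ultimately have "?L \<circ> ?D = id" using has_derivative_unique[OF _ has_derivative_id] by simp
  from fun_cong[OF this, of a] have "?L (?D a) = a" by (simp only: comp_apply id_apply)
  then have a: "exp (complex_of_real (log_scaling r ?w k)) * (?D a + scaling_operator r ?w (?D a)) $ k = a $ k" for k
    by (simp only: vec_eq_iff vec_lambda_beta)
  have "exp (- complex_of_real (log_scaling r ?w k)) * a $ k = (?D a + scaling_operator r ?w (?D a)) $ k" for k
    by (simp add: exp_minus flip: a)
  then show ?thesis by (simp add: vec_eq_iff)
qed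

lemma inj_chi_lift_inv_derivative:
  assumes r: "r \<in> R" and "chi_lift_inv_derivative r v a = 0"
  shows "a = 0"
proof -
  have "scaling_operator r (chi_lift_inv r v) 0 = 0"
    by (simp add: scaling_operator_def slack_derivative_def vec_eq_iff)
  then have "(\<chi> k. exp (- complex_of_real (log_scaling r (chi_lift_inv r v) k)) * a $ k) = 0"
    using chi_lift_inv_derivative_equation[OF r, of v a] assms(2) by simp
  then show ?thesis by (simp add: vec_eq_iff)
qed

subsection \<open>The induced form is Kaehler\<close>

definition induced_form :: "('n \<Rightarrow> 'd) \<Rightarrow> (complex^'n) two_form" where
  "induced_form r v a b = standard_form 0 (chi_lift_inv_derivative r v a) (chi_lift_inv_derivative r v b)"

lemma two_form_on_induced_form:
  assumes r: "r \<in> R"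
  shows "two_form_on UNIV (induced_form r)"
  unfolding two_form_on_def
proof (intro conjI ballI allI)
  have "bilinear (standard_form (0::complex^'n))"
    using bounded_bilinear_standard_form by (simp add: bilinear_conv_bounded_bilinear)
  then show "bilinear (induced_form r v)" for v
    using linear_compose[OF has_derivative_linear[OF has_derivative_chi_lift_inv[OF r, of v]]]
    unfolding bilinear_def induced_form_def o_def by auto
  show "induced_form r v a a = 0" for v a
    using standard_form_antisym[of 0 "chi_lift_inv_derivative r v a" "chi_lift_inv_derivative r v a"]
    by (simp add: induced_form_def)
  show "smooth_on UNIV (\<lambda>v. induced_form r v a b)" for a b
    unfolding induced_form_def
    by (rule smooth_on_bilinear[OF open_UNIV bounded_bilinear_standard_form])
       (rule smooth_on_frechet_derivative[OF smooth_on_chi_lift_inv[OF r]])+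
qed

lemma kahler_on_induced_form:
  assumes r: "r \<in> R"
  shows "kahler_on UNIV (induced_form r)"
  unfolding kahler_on_def
proof (intro conjI ballI allI impI two_form_on_induced_form[OF r])
  show "closed_two_form_on UNIV (induced_form r)"
    using closed_pullback_constant_form[OF open_UNIV smooth_on_chi_lift_inv[OF r] bounded_bilinear_standard_form[of 0]
        standard_form_antisym]
    unfolding induced_form_def .
  fix v
  let ?D = "chi_lift_inv_derivative r v"
  interpret real_psd_operator "scaling_operator r (chi_lift_inv r v)"
    by (rule real_psd_scaling_operator[OF chi_lift_inv(1)[OF r]])
  have complex_scaled: "?D (\<i> *s a) + scaling_operator r (chi_lift_inv r v) (?D (\<i> *s a)) =
      \<i> *s (?D a + scaling_operator r (chi_lift_inv r v) (?D a))" for a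
    unfolding chi_lift_inv_derivative_equation[OF r] by (simp add: vec_eq_iff)
  show "induced_form r v (\<i> *s a) (\<i> *s b) = induced_form r v a b" for a b
    unfolding induced_form_def standard_form_inner
    using type_one_one[OF complex_scaled complex_scaled, of a b] by simp
  show "induced_form r v (\<i> *s a) a > 0" if "a \<noteq> 0" for a
    unfolding induced_form_def standard_form_inner
    by (intro divide_pos_pos positive[OF complex_scaled] pi_gt_zero)
       (use inj_chi_lift_inv_derivative[OF r] that in blast)
qed

lemma induced_form_phase:
  assumes r: "r \<in> R"
  shows "induced_form r (phase \<alpha> v) (phase \<alpha> a) (phase \<alpha> b) = induced_form r v a b"
proof -
  note phase_derivative = bounded_linear_imp_has_derivative[OF bounded_linear_phase]
  have "(chi_lift_inv r \<circ> phase \<alpha> has_derivative chi_lift_inv_derivative r (phase \<alpha> v) \<circ> phase \<alpha>) (at v)"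
    by (rule diff_chain_at[OF phase_derivative has_derivative_chi_lift_inv[OF r]])
  moreover have "(phase \<alpha> \<circ> chi_lift_inv r has_derivative phase \<alpha> \<circ> chi_lift_inv_derivative r v) (at v)"
    by (rule diff_chain_at[OF has_derivative_chi_lift_inv[OF r] phase_derivative])
  moreover have "chi_lift_inv r \<circ> phase \<alpha> = phase \<alpha> \<circ> chi_lift_inv r" using chi_lift_inv_phase[OF r] by auto
  ultimately have "chi_lift_inv_derivative r (phase \<alpha> v) \<circ> phase \<alpha> = phase \<alpha> \<circ> chi_lift_inv_derivative r v"
    using has_derivative_unique by metis
  then have "chi_lift_inv_derivative r (phase \<alpha> v) (phase \<alpha> a) = phase \<alpha> (chi_lift_inv_derivative r v a)" for a
    by (metis comp_apply)
  then show ?thesis by (simp add: induced_form_def standard_form_phase[of 0 \<alpha> _ _ 0])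
qed

end

section \<open>Forms on the quotients and the diffeomorphism\<close>

lemma pulls_back_phase:
  assumes C: "open C" and invariant: "\<And>x u v. x \<in> C \<Longrightarrow> \<omega> (phase \<alpha> x) (phase \<alpha> u) (phase \<alpha> v) = \<omega> x u v"
  shows "pulls_back C id id (restrict (phase \<alpha>) C) \<omega> \<omega>"
  unfolding pulls_back_def
proof
  fix x assume x: "x \<in> C"
  have "frechet_derivative (id \<circ> restrict (phase \<alpha>) C \<circ> id) (at (id x)) = frechet_derivative (phase \<alpha>) (at (id x))"
    by (rule frechet_derivative_cong_open[OF C]) (use x in auto)
  also have "\<dots> = phase \<alpha>"
    by (rule frechet_derivative_at[OF bounded_linear_imp_has_derivative[OF bounded_linear_phase], symmetric])
  finally show "\<exists>T s. local_section C id x T s \<and> (\<forall>u v. \<omega> (id x) u v =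
      \<omega> (id (restrict (phase \<alpha>) C x)) (frechet_derivative (id \<circ> restrict (phase \<alpha>) C \<circ> s) (at (id x)) u)
        (frechet_derivative (id \<circ> restrict (phase \<alpha>) C \<circ> s) (at (id x)) v))"
    using local_section_open_id[OF C x] invariant[OF x] x by (intro exI[of _ C] exI[of _ id]) auto
qed

context quasi_slice
begin

lemma quasifold_two_form_slice_charts:
  assumes indexed: "\<And>c. c \<in> slice_chart ` R \<Longrightarrow> \<exists>r\<in>R. c = slice_chart r \<and> \<omega> c = \<omega>' r"
    and two_form: "\<And>r. r \<in> R \<Longrightarrow> two_form_on (slice_dom r) (\<omega>' r)"
    and invariant: "\<And>r \<alpha> x u v. r \<in> R \<Longrightarrow> \<omega>' r (phase \<alpha> x) (phase \<alpha> u) (phase \<alpha> v) = \<omega>' r x u v"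
    and overlaps: "\<And>r r'. r \<in> R \<Longrightarrow> r' \<in> R \<Longrightarrow>
      pulls_back (overlap_cover r r') (overlap_proj r r') (overlap_proj r' r) (cover_change r r') (\<omega>' r') (\<omega>' r)"
  shows "quasifold_two_form reg orbit_space (slice_chart ` R) \<omega>"
  unfolding quasifold_two_form_def
proof (intro conjI ballI impI quasifold_atlas_slice_charts)
  fix c assume "c \<in> slice_chart ` R"
  then obtain r where r: "r \<in> R" "c = slice_chart r" "\<omega> c = \<omega>' r" using indexed by blast
  show "two_form_on (chart_dom c) (\<omega> c)" unfolding r(3) unfolding r(2) using two_form[OF r(1)] by simp
  fix g assume "g \<in> chart_group c"
  then obtain \<alpha> where "g = restrict (phase \<alpha>) (slice_dom r)" by (auto simp: r(2) transformations_def)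
  then show "pulls_back (chart_dom c) id id g (\<omega> c) (\<omega> c)"
    unfolding r(3) unfolding r(2)
    using pulls_back_phase[where \<omega>="\<omega>' r", OF open_slice_dom[OF r(1)] invariant[OF r(1)]] by simp
next
  fix c c' assume charts: "c \<in> slice_chart ` R" "c' \<in> slice_chart ` R"
  obtain r where r: "r \<in> R" "c = slice_chart r" "\<omega> c = \<omega>' r" using indexed[OF charts(1)] by blast
  obtain r' where r': "r' \<in> R" "c' = slice_chart r'" "\<omega> c' = \<omega>' r'" using indexed[OF charts(2)] by blast
  have "chart_change_lift reg c (overlap_cover r r') (overlap_proj r r')
      c' (overlap_cover r' r) (overlap_proj r' r) (cover_change r r')"
    unfolding r(2) r'(2) by (rule chart_change_lift_slice_chart[OF r(1) r'(1)])
  moreover have "pulls_back (overlap_cover r r') (overlap_proj r r') (overlap_proj r' r) (cover_change r r')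
      (\<omega> c') (\<omega> c)"
    unfolding r(3) r'(3) by (rule overlaps[OF r(1) r'(1)])
  ultimately show "\<exists>C \<rho> C' \<rho>' F. chart_change_lift reg c C \<rho> c' C' \<rho>' F \<and> pulls_back C \<rho> \<rho>' F (\<omega> c') (\<omega> c)"
    by blast
qed

definition overlap_angle :: "('n \<Rightarrow> 'd) \<Rightarrow> ('n \<Rightarrow> 'd) \<Rightarrow> complex^'n \<Rightarrow> complex^'n \<Rightarrow> real^'d" where
  "overlap_angle r r' x\<^sub>0 w = (\<chi> j. Im (change_vec r r' (overlap_log r r' x\<^sub>0 w) $ j))"

lemma smooth_on_overlap_angle:
  assumes r: "r \<in> R"
  shows "smooth_on (overlap_slit r r' x\<^sub>0) (overlap_angle r r' x\<^sub>0)"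
proof (rule smooth_on_vec[OF open_overlap_slit[OF r]])
  show "smooth_on (overlap_slit r r' x\<^sub>0) (\<lambda>w. overlap_angle r r' x\<^sub>0 w $ j)" for j
    unfolding overlap_angle_def vec_lambda_beta
    by (rule smooth_on_linear_comp[OF open_overlap_slit[OF r] bounded_linear_Im smooth_on_change_vec[OF r]])
qed

lemma overlap_angle_in_n_space: "r' \<in> R \<Longrightarrow> overlap_angle r r' x\<^sub>0 w \<in> n_space X"
  using sum_Im_change_vec by (simp add: overlap_angle_def n_space_def pi_map_def)

lemma has_derivative_overlap_angle:
  assumes "r \<in> R" "w \<in> overlap_slit r r' x\<^sub>0"
  shows "(overlap_angle r r' x\<^sub>0 has_derivative frechet_derivative (overlap_angle r r' x\<^sub>0) (at w)) (at w)"
  by (rule smooth_on_has_derivative[OF smooth_on_overlap_angle[OF assms(1)] assms(2)])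

lemma has_derivative_local_change:
  assumes "r \<in> R" "w \<in> overlap_slit r r' x\<^sub>0"
  shows "(local_change r r' x\<^sub>0 has_derivative frechet_derivative (local_change r r' x\<^sub>0) (at w)) (at w)"
  by (rule smooth_on_has_derivative[OF smooth_on_local_change[OF assms(1)] assms(2)])

end

context toric
begin

lemma has_derivative_slice_preserving_form:
  assumes r: "r \<in> R" and \<phi>: "(\<phi> has_derivative D) (at x)" "\<phi> x \<in> symp.slice_dom r"
  shows "\<exists>E. ((\<lambda>w. symp.slice r (\<phi> w)) has_derivative E) (at x) \<and>
    (\<forall>u v. standard_form p (E u) (E v) = standard_form q (D u) (D v))"
proof -
  have "(symp.slice r has_derivative frechet_derivative (symp.slice r) (at (\<phi> x))) (at (\<phi> x))"
    by (rule smooth_on_has_derivative[OF symp.smooth_on_slice[OF r] \<phi>(2)])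
  from diff_chain_at[OF \<phi>(1) this] obtain E where E: "((\<lambda>w. symp.slice r (\<phi> w)) has_derivative E) (at x)"
    by (auto simp: o_def)
  have frame_coord: "E u $ r k = D u $ k" for u k
  proof -
    have "((\<lambda>w. \<phi> w $ k) has_derivative (\<lambda>u. E u $ r k)) (at x)"
      using has_derivative_vec_nth[OF E, of "r k"] inj_frame[OF r] by simp
    from fun_cong[OF has_derivative_unique[OF this has_derivative_vec_nth[OF \<phi>(1)]]] show ?thesis .
  qed
  have real_coord: "Im (E u $ h) = 0" if "h \<notin> range r" for u h
  proof -
    have "((\<lambda>w. 0) has_derivative (\<lambda>u. Im (E u $ h))) (at x)"
      using bounded_linear.has_derivative[OF bounded_linear_Im has_derivative_vec_nth[OF E], of h] that by simp
    from fun_cong[OF has_derivative_unique[OF this has_derivative_const]] show ?thesis .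
  qed
  show ?thesis
    by (intro exI[of _ E] conjI E allI)
       (simp add: standard_form_eq_sum_Im sum_UNIV_split_range[OF inj_frame[OF r]] frame_coord real_coord)
qed

lemma standard_form_rotated_slices:
  assumes r: "r \<in> R" and r': "r' \<in> R" and T: "open T" "x \<in> T"
    and \<phi>: "(\<phi> has_derivative D) (at x)" "\<And>w. w \<in> T \<Longrightarrow> \<phi> w \<in> symp.slice_dom r"
    and \<psi>: "(\<psi> has_derivative D') (at x)" "\<And>w. w \<in> T \<Longrightarrow> \<psi> w \<in> symp.slice_dom r'"
    and \<theta>: "(\<theta> has_derivative B) (at x)" "\<And>w. w \<in> T \<Longrightarrow> \<theta> w \<in> n_space X"
    and rotated: "\<And>w. w \<in> T \<Longrightarrow> symp.slice r' (\<psi> w) = phase (\<theta> w) (symp.slice r (\<phi> w))"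
  shows "standard_form p (D' u) (D' v) = standard_form q (D u) (D v)"
proof -
  obtain E where E: "((\<lambda>w. symp.slice r (\<phi> w)) has_derivative E) (at x)"
    "standard_form 0 (E u) (E v) = standard_form q (D u) (D v)"
    using has_derivative_slice_preserving_form[OF r \<phi>(1) \<phi>(2)[OF T(2)]] by blast
  obtain E' where E': "((\<lambda>w. symp.slice r' (\<psi> w)) has_derivative E') (at x)"
    "standard_form 0 (E' u) (E' v) = standard_form p (D' u) (D' v)"
    using has_derivative_slice_preserving_form[OF r' \<psi>(1) \<psi>(2)[OF T(2)]] by blast
  have "symp.slice r (\<phi> w) \<in> Psi_zero X lam" if "w \<in> T" for w by (rule symp.slice_in_level[OF r \<phi>(2)[OF that]])
  from standard_form_rotated_level[OF T this \<theta>(2) rotated E(1) E'(1) \<theta>(1)] E(2) E'(2) show ?thesis by metis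
qed

lemma symp_slice_local_change:
  assumes r: "r \<in> R" and r': "r' \<in> R" and w: "w \<in> symp.overlap_slit r r' x\<^sub>0"
  shows "symp.slice r' (symp.local_change r r' x\<^sub>0 w) = phase (symp.overlap_angle r r' x\<^sub>0 w) (symp.slice r w)"
proof -
  let ?\<zeta> = "symp.change_vec r r' (symp.overlap_log r r' x\<^sub>0 w)"
  have "?\<zeta> $ j = \<i> * complex_of_real (Im (?\<zeta> $ j))" for j
    using symp.im_proj_change_vec[of r r' _ j] by (simp add: im_proj_def complex_eq_iff)
  then show ?thesis
    unfolding symp.local_change(2)[OF r r' w] by (simp add: exp_act_def phase_def symp.overlap_angle_def)
qed

lemma symp_pulls_back_cover_change:
  assumes r: "r \<in> R" and r': "r' \<in> R"
  shows "pulls_back (symp.overlap_cover r r') (symp.overlap_proj r r') (symp.overlap_proj r' r)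
    (symp.cover_change r r') standard_form standard_form"
proof (rule symp.pulls_back_cover_change[OF r r'])
  fix x\<^sub>0 u v assume x\<^sub>0: "x\<^sub>0 \<in> symp.overlap_logs r r'"
  let ?w = "symp.overlap_exp r r' x\<^sub>0" and ?h = "symp.local_change r r' x\<^sub>0"
  have w: "?w \<in> symp.overlap_slit r r' x\<^sub>0" by (rule partial_exp_in_slit_domain[OF x\<^sub>0])
  show "standard_form ?w u v =
      standard_form (?h ?w) (frechet_derivative ?h (at ?w) u) (frechet_derivative ?h (at ?w) v)"
  proof (rule standard_form_rotated_slices[OF r r' symp.open_overlap_slit[OF r] w, symmetric])
    show "((\<lambda>w. w) has_derivative (\<lambda>u. u)) (at ?w)" by (rule has_derivative_ident)
    show "(?h has_derivative frechet_derivative ?h (at ?w)) (at ?w)"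
      by (rule symp.has_derivative_local_change[OF r w])
    show "(symp.overlap_angle r r' x\<^sub>0 has_derivative frechet_derivative (symp.overlap_angle r r' x\<^sub>0) (at ?w)) (at ?w)"
      by (rule symp.has_derivative_overlap_angle[OF r w])
  qed (use symp.overlap_slit_subset_slice_dom symp.local_change(3)[OF r r'] symp.overlap_angle_in_n_space[OF r']
      symp_slice_local_change[OF r r'] in blast)+
qed

lemma symp_slice_cplx_local_change:
  assumes r: "r \<in> R" and r': "r' \<in> R" and w: "w \<in> cplx.overlap_slit r r' x\<^sub>0"
  shows "symp.slice r' (chi_lift_inv r' (cplx.local_change r r' x\<^sub>0 w)) =
    phase (cplx.overlap_angle r r' x\<^sub>0 w) (symp.slice r (chi_lift_inv r w))"
proof -
  let ?v = "chi_lift_inv r w" and ?v' = "chi_lift_inv r' (cplx.local_change r r' x\<^sub>0 w)"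
  let ?y = "complex_vec (scaling_vec r ?v)" and ?y' = "complex_vec (scaling_vec r' ?v')"
  let ?\<zeta> = "cplx.change_vec r r' (cplx.overlap_log r r' x\<^sub>0 w)" and ?z = "symp.slice r ?v"
  let ?\<xi> = "- ?y' + (?\<zeta> + ?y)"
  have level: "?z \<in> Psi_zero X lam" "symp.slice r' ?v' \<in> Psi_zero X lam"
    by (intro symp.slice_in_level chi_lift_inv r r')+
  have "exp_act ?y' (symp.slice r' ?v') = cplx.slice r' (cplx.local_change r r' x\<^sub>0 w)"
    by (rule exp_scaling_vec_slice_chi_lift_inv[OF r'])
  also have "\<dots> = exp_act ?\<zeta> (cplx.slice r w)" by (rule cplx.local_change(2)[OF r r' w])
  also have "\<dots> = exp_act ?\<zeta> (exp_act ?y ?z)" by (simp only: exp_scaling_vec_slice_chi_lift_inv[OF r])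
  finally have "exp_act (- ?y') (exp_act ?y' (symp.slice r' ?v')) = exp_act (- ?y') (exp_act ?\<zeta> (exp_act ?y ?z))"
    by simp
  then have eq: "symp.slice r' ?v' = exp_act ?\<xi> ?z" unfolding exp_act_add by simp
  have "?\<xi> \<in> exp_group X Q 1"
    by (intro exp_group_add exp_group_minus complex_vec_in_exp_group scaling_vec_in_n_space
        cplx.change_vec_in_exp_group r r')
  then have "symp.slice r' ?v' = phase (\<chi> j. Im (?\<xi> $ j)) ?z"
    using exp_act_in_Psi_zero_eq_phase[OF level(1)] level(2) unfolding eq by blast
  moreover have "(\<chi> j. Im (?\<xi> $ j)) = cplx.overlap_angle r r' x\<^sub>0 w"
    by (simp add: cplx.overlap_angle_def complex_vec_def vec_eq_iff)
  ultimately show ?thesis by simp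
qed

lemma cplx_pulls_back_cover_change:
  assumes r: "r \<in> R" and r': "r' \<in> R"
  shows "pulls_back (cplx.overlap_cover r r') (cplx.overlap_proj r r') (cplx.overlap_proj r' r)
    (cplx.cover_change r r') (induced_form r') (induced_form r)"
proof (rule cplx.pulls_back_cover_change[OF r r'])
  fix x\<^sub>0 u v assume x\<^sub>0: "x\<^sub>0 \<in> cplx.overlap_logs r r'"
  let ?w = "cplx.overlap_exp r r' x\<^sub>0" and ?h = "cplx.local_change r r' x\<^sub>0"
  let ?D' = "chi_lift_inv_derivative r' (?h ?w) \<circ> frechet_derivative ?h (at ?w)"
  have w: "?w \<in> cplx.overlap_slit r r' x\<^sub>0" by (rule partial_exp_in_slit_domain[OF x\<^sub>0])
  have "standard_form 0 (?D' u) (?D' v) =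
      standard_form 0 (chi_lift_inv_derivative r ?w u) (chi_lift_inv_derivative r ?w v)"
  proof (rule standard_form_rotated_slices[OF r r' cplx.open_overlap_slit[OF r] w])
    show "(chi_lift_inv r has_derivative chi_lift_inv_derivative r ?w) (at ?w)"
      by (rule has_derivative_chi_lift_inv[OF r])
    show "(chi_lift_inv r' \<circ> ?h has_derivative ?D') (at ?w)"
      by (rule diff_chain_at[OF cplx.has_derivative_local_change[OF r w] has_derivative_chi_lift_inv[OF r']])
    show "(cplx.overlap_angle r r' x\<^sub>0 has_derivative frechet_derivative (cplx.overlap_angle r r' x\<^sub>0) (at ?w)) (at ?w)"
      by (rule cplx.has_derivative_overlap_angle[OF r w])
  qed (simp_all add: chi_lift_inv r r' cplx.overlap_angle_in_n_space symp_slice_cplx_local_change)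
  then show "induced_form r ?w u v =
      induced_form r' (?h ?w) (frechet_derivative ?h (at ?w) u) (frechet_derivative ?h (at ?w) v)"
    by (simp add: induced_form_def)
qed

lemma symplectic_form_standard_form: "symplectic_form symp.orbit_space (symp.slice_chart ` R) (\<lambda>c. standard_form)"
  unfolding symplectic_form_def
proof
  show "quasifold_two_form smooth_on symp.orbit_space (symp.slice_chart ` R) (\<lambda>c. standard_form)"
    by (rule symp.quasifold_two_form_slice_charts[where \<omega>'="\<lambda>r. standard_form"])
       (auto intro: two_form_standard_form symp.open_slice_dom standard_form_phase symp_pulls_back_cover_change)
  show "\<forall>c\<in>symp.slice_chart ` R. symplectic_on (chart_dom c) standard_form"
    by (auto intro: symplectic_standard_form symp.open_slice_dom)
qed

text \<open>Different enumerations of a vertex could in principle define the same chart.\<close>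

definition induced_chart_form :: "(complex^'n, (complex^'d) set) quasi_chart \<Rightarrow> (complex^'n) two_form" where
  "induced_chart_form c = induced_form (SOME r. r \<in> R \<and> c = cplx.slice_chart r)"

lemma induced_chart_form:
  assumes "c \<in> cplx.slice_chart ` R"
  shows "\<exists>r\<in>R. c = cplx.slice_chart r \<and> induced_chart_form c = induced_form r"
proof -
  let ?r = "SOME r. r \<in> R \<and> c = cplx.slice_chart r"
  have "\<exists>r. r \<in> R \<and> c = cplx.slice_chart r" using assms by blast
  then have "?r \<in> R \<and> c = cplx.slice_chart ?r" by (rule someI_ex)
  then show ?thesis unfolding induced_chart_form_def by blast
qed

lemma kahler_form_induced_chart_form: "kahler_form cplx.orbit_space (cplx.slice_chart ` R) induced_chart_form"
  unfolding kahler_form_def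
proof (intro conjI ballI)
  show "quasifold_two_form holomorphic_map_on cplx.orbit_space (cplx.slice_chart ` R) induced_chart_form"
    by (rule cplx.quasifold_two_form_slice_charts[OF induced_chart_form])
       (simp_all add: two_form_on_induced_form induced_form_phase cplx_pulls_back_cover_change)
  show "kahler_on (chart_dom c) (induced_chart_form c)" if c: "c \<in> cplx.slice_chart ` R" for c
  proof -
    obtain r where r: "r \<in> R" "c = cplx.slice_chart r" "induced_chart_form c = induced_form r"
      using induced_chart_form[OF c] by blast
    show ?thesis unfolding r(3) unfolding r(2) using kahler_on_induced_form[OF r(1)] by simp
  qed
qed

end

lemma diffeo_chart_liftI:
  assumes iso: "manifold_iso smooth_on (chart_dom c) id (chart_dom c') id F"
    and comm: "\<And>x. x \<in> chart_dom c \<Longrightarrow>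
      chart_map c' (group_orbit (chart_group c') (F x)) = f (chart_map c (group_orbit (chart_group c) x))"
    and inj: "inj_on (chart_map c) (chart_orbits c)" "inj_on (chart_map c') (chart_orbits c')"
    and inj_f: "inj_on f (chart_image c)"
  shows "diffeo_chart_lift c c' f F"
proof -
  let ?a = "group_orbit (chart_group c)" and ?b = "group_orbit (chart_group c')"
  have bij: "bij_betw F (chart_dom c) (chart_dom c')" using iso by (simp add: manifold_iso_def)
  then have F: "F x \<in> chart_dom c'" if "x \<in> chart_dom c" for x using that by (auto simp: bij_betw_def)
  define h where "h = inv_into (chart_orbits c') (chart_map c') \<circ> (f \<circ> chart_map c)"
  have h: "?b (F x) = h (?a x)" if x: "x \<in> chart_dom c" for x
    using inv_into_f_f[OF inj(2), of "?b (F x)"] F[OF x] comm[OF x] by (simp add: h_def chart_orbits_def)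
  have h_map: "chart_map c' (h w) = f (chart_map c w)" if "w \<in> chart_orbits c" for w
    using that h comm by (auto simp: chart_orbits_def simp flip: h)
  have "inj_on h (?a ` chart_dom c)"
    unfolding chart_orbits_def[symmetric]
  proof (rule inj_onI)
    fix p q assume pq: "p \<in> chart_orbits c" "q \<in> chart_orbits c" and "h p = h q"
    then have "f (chart_map c p) = f (chart_map c q)" using h_map by metis
    then have "chart_map c p = chart_map c q" by (rule inj_onD[OF inj_f]) (simp_all add: chart_image_def pq)
    then show "p = q" by (rule inj_onD[OF inj(1)]) (use pq in auto)
  qed
  then have "bij_betw h (?a ` chart_dom c) (?b ` chart_dom c')"
    by (intro bij_betw_induced_on_images[OF bij] h)
  then show ?thesis
    unfolding diffeo_chart_lift_def model_iso_lift_def using iso h h_map by (intro exI[of _ h]) auto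
qed

lemma manifold_iso_inverse_pair:
  assumes "open U" "open V" "bij_betw F U V" "smooth_on U F" "smooth_on V G" and inverse: "\<And>x. x \<in> U \<Longrightarrow> G (F x) = x"
  shows "manifold_iso smooth_on U id V id F"
proof -
  have "inv_into U F y = G y" if "y \<in> V" for y
    using assms(3) inverse that by (metis bij_betw_def f_inv_into_f inv_into_into)
  then have "smooth_on V (inv_into U F)" using smooth_on_cong[OF assms(2) _ assms(5)] by metis
  then show ?thesis
    unfolding manifold_iso_def
    using assms(1-4) bij_betw_inv_into[OF assms(3)]
    by (auto simp: bij_betw_def intro!: manifold_map_open_id smooth_on_imp_continuous_on)
qed

context toric
begin

lemma bij_betw_chi_lift:
  assumes r: "r \<in> R"
  shows "bij_betw (chi_lift r) (symp.slice_dom r) UNIV" "bij_betw (chi_lift_inv r) UNIV (symp.slice_dom r)"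
  by (rule bij_betwI[where g="chi_lift_inv r"], use chi_lift_inv[OF r] in auto)
     (rule bij_betwI[where g="chi_lift r"], use chi_lift_inv[OF r] in auto)

lemma diffeo_chart_lift_chi_map:
  assumes r: "r \<in> R"
  shows "diffeo_chart_lift (symp.slice_chart r) (cplx.slice_chart r) (chi_map X Q) (chi_lift r)"
proof (rule diffeo_chart_liftI)
  show "manifold_iso smooth_on (chart_dom (symp.slice_chart r)) id (chart_dom (cplx.slice_chart r)) id (chi_lift r)"
    using manifold_iso_inverse_pair[OF symp.open_slice_dom[OF r] open_UNIV bij_betw_chi_lift(1)[OF r]
        smooth_on_chi_lift[OF r] smooth_on_chi_lift_inv[OF r] chi_lift_inv(3)[OF r]]
    by simp
  show "chart_map (cplx.slice_chart r) (group_orbit (chart_group (cplx.slice_chart r)) (chi_lift r w)) =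
     chi_map X Q (chart_map (symp.slice_chart r) (group_orbit (chart_group (symp.slice_chart r)) w))"
    if "w \<in> chart_dom (symp.slice_chart r)" for w
    using that symp.chart_map_slice_chart[OF r, of w] cplx.chart_map_slice_chart[OF r, of "chi_lift r w"]
      cplx_orbit_chi_lift[OF r, of w]
    by (simp add: chi_map_orbit)
  show "inj_on (chi_map X Q) (chart_image (symp.slice_chart r))"
    by (rule inj_on_subset[OF bij_betw_imp_inj_on[OF bij_betw_chi_map] symp.chart_image_subset_topspace[OF r]])
qed (rule symp.inj_on_chart_map[OF r] cplx.inj_on_chart_map[OF r])+

abbreviation "chi_inv \<equiv> inv_into (topspace symp.orbit_space) (chi_map X Q)"

lemma chi_inv_orbit:
  assumes r: "r \<in> R"
  shows "chi_inv (cplx.orbit (cplx.slice r v)) = symp.orbit (symp.slice r (chi_lift_inv r v))"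
proof (rule inv_into_f_eq[OF bij_betw_imp_inj_on[OF bij_betw_chi_map]])
  show "symp.orbit (symp.slice r (chi_lift_inv r v)) \<in> topspace symp.orbit_space"
    unfolding symp.topspace_orbit_space using symp.slice_in_level[OF r chi_lift_inv(1)[OF r]] by blast
  show "chi_map X Q (symp.orbit (symp.slice r (chi_lift_inv r v))) = cplx.orbit (cplx.slice r v)"
    using cplx_orbit_chi_lift[OF r chi_lift_inv(1)[OF r, of v]] chi_lift_inv(2)[OF r] by (simp add: chi_map_orbit)
qed

lemma diffeo_chart_lift_chi_inv:
  assumes r: "r \<in> R"
  shows "diffeo_chart_lift (cplx.slice_chart r) (symp.slice_chart r) chi_inv (chi_lift_inv r)"
proof (rule diffeo_chart_liftI)
  show "manifold_iso smooth_on (chart_dom (cplx.slice_chart r)) id (chart_dom (symp.slice_chart r)) id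
    (chi_lift_inv r)"
    using manifold_iso_inverse_pair[OF open_UNIV symp.open_slice_dom[OF r] bij_betw_chi_lift(2)[OF r]
        smooth_on_chi_lift_inv[OF r] smooth_on_chi_lift[OF r] chi_lift_inv(2)[OF r]]
    by simp
  show "chart_map (symp.slice_chart r) (group_orbit (chart_group (symp.slice_chart r)) (chi_lift_inv r v)) =
     chi_inv (chart_map (cplx.slice_chart r) (group_orbit (chart_group (cplx.slice_chart r)) v))" for v
    using symp.chart_map_slice_chart[OF r chi_lift_inv(1)[OF r]] cplx.chart_map_slice_chart[OF r, of v]
      chi_inv_orbit[OF r]
    by simp
  have "chart_image (cplx.slice_chart r) \<subseteq> chi_map X Q ` topspace symp.orbit_space"
    using cplx.chart_image_subset_topspace[OF r] bij_betw_imp_surj_on[OF bij_betw_chi_map] by simp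
  then show "inj_on chi_inv (chart_image (cplx.slice_chart r))" by (rule inj_on_inv_into)
qed (rule symp.inj_on_chart_map[OF r] cplx.inj_on_chart_map[OF r])+

lemma quasifold_diffeo_chi_map:
  assumes "quasifold smooth_on symp.orbit_space \<A>" "symp.slice_chart ` R \<subseteq> \<A>"
    and "quasifold smooth_on cplx.orbit_space \<B>" "cplx.slice_chart ` R \<subseteq> \<B>"
  shows "quasifold_diffeo symp.orbit_space \<A> cplx.orbit_space \<B> (chi_map X Q)"
  unfolding quasifold_diffeo_def
proof (intro conjI assms(1,3) continuous_map_chi_map bij_betw_chi_map ballI)
  fix m assume "m \<in> topspace symp.orbit_space"
  then obtain z where z: "z \<in> Psi_zero X lam" "m = symp.orbit z" by (auto simp: symp.topspace_orbit_space)
  obtain r where r: "r \<in> R" "\<forall>h. h \<notin> range r \<longrightarrow> z $ h \<noteq> 0" using symp.level_cover[OF z(1)] by blast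
  have "m \<in> chart_image (symp.slice_chart r)" using symp.orbit_in_chart_image_iff[OF r(1) z(1)] r(2) z(2) by simp
  moreover have "chi_map X Q m \<in> chart_image (cplx.slice_chart r)"
    using cplx.orbit_in_chart_image_iff[OF r(1), of z] Psi_zero_subset_C_Delta z r(2) by (auto simp: chi_map_orbit)
  ultimately show "\<exists>c\<in>\<A>. \<exists>c'\<in>\<B>. m \<in> chart_image c \<and> chi_map X Q m \<in> chart_image c' \<and>
      (\<exists>F. diffeo_chart_lift c c' (chi_map X Q) F)"
    using diffeo_chart_lift_chi_map[OF r(1)] assms(2,4) r(1) by blast
qed

lemma pulls_back_chi_lift_inv: "pulls_back UNIV id id (chi_lift_inv r) standard_form (induced_form r)"
  unfolding pulls_back_def
proof
  fix x :: "complex^'n"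
  have "local_section UNIV id x UNIV id" by (rule local_section_open_id) auto
  moreover have "induced_form r (id x) u v = standard_form (id (chi_lift_inv r x))
      (frechet_derivative (id \<circ> chi_lift_inv r \<circ> id) (at (id x)) u)
      (frechet_derivative (id \<circ> chi_lift_inv r \<circ> id) (at (id x)) v)" for u v
    using standard_form_constant[of 0 "chi_lift_inv r x"] by (simp add: induced_form_def)
  ultimately show "\<exists>T s. local_section UNIV id x T s \<and> (\<forall>u v. induced_form r (id x) u v =
      standard_form (id (chi_lift_inv r x)) (frechet_derivative (id \<circ> chi_lift_inv r \<circ> s) (at (id x)) u)
        (frechet_derivative (id \<circ> chi_lift_inv r \<circ> s) (at (id x)) v))"
    by blast
qed

lemma is_pullback_form_induced_chart_form:
  "is_pullback_form (cplx.slice_chart ` R) induced_chart_form (symp.slice_chart ` R) (\<lambda>c. standard_form) chi_inv"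
  unfolding is_pullback_form_def
proof (intro ballI)
  fix c m assume chart: "c \<in> cplx.slice_chart ` R" and m: "m \<in> chart_image c"
  obtain r where r: "r \<in> R" "c = cplx.slice_chart r" "induced_chart_form c = induced_form r"
    using induced_chart_form[OF chart] by blast
  obtain v where v: "m = cplx.orbit (cplx.slice r v)"
    using m by (auto simp: r(2) cplx.chart_image_slice_chart[OF r(1)])
  have "chi_inv m \<in> chart_image (symp.slice_chart r)"
    unfolding v chi_inv_orbit[OF r(1)] symp.chart_image_slice_chart[OF r(1)] using chi_lift_inv(1)[OF r(1)] by blast
  moreover have "diffeo_chart_lift c (symp.slice_chart r) chi_inv (chi_lift_inv r)"
    unfolding r(2) by (rule diffeo_chart_lift_chi_inv[OF r(1)])
  moreover have "pulls_back (chart_dom c) id id (chi_lift_inv r) standard_form (induced_chart_form c)"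
    unfolding r(3) unfolding r(2) using pulls_back_chi_lift_inv by simp
  ultimately show "\<exists>c'\<in>symp.slice_chart ` R. chi_inv m \<in> chart_image c' \<and>
      (\<exists>F. diffeo_chart_lift c c' chi_inv F \<and> pulls_back (chart_dom c) id id F standard_form (induced_chart_form c))"
    using r(1) by blast
qed

end

theorem theorem3p2:
  fixes \<Delta> Q :: "'a::euclidean_space set"
    and X :: "'d::finite \<Rightarrow> 'a"
    and lam :: "'d \<Rightarrow> real"
    and \<G> \<H> :: "(complex^'n::finite, (complex^'d) set) quasi_chart set"
  assumes "CARD('n) = DIM('a)"
    and "simple_polytope \<Delta>"
    and "aff_dim \<Delta> = int DIM('a)"
    and "\<Delta> = (\<Inter>j. {\<mu>. \<mu> \<bullet> X j \<ge> lam j})"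
    and "bij_betw (\<lambda>j. {\<mu> \<in> \<Delta>. \<mu> \<bullet> X j = lam j}) UNIV {F. F facet_of \<Delta>}"
    and "quasilattice Q"
    and "range X \<subseteq> Q"
    and "\<G> = symplectic_charts \<Delta> X lam Q"
    and "\<H> = complex_charts \<Delta> X lam Q"
  shows
    "quasifold_atlas smooth_on (symplectic_quotient X lam Q) \<G> \<and>
     quasifold_atlas holomorphic_map_on (complex_quotient \<Delta> X lam Q) \<H> \<and>
     (\<forall>\<A> \<B>.
        quasifold smooth_on (symplectic_quotient X lam Q) \<A> \<and> \<G> \<subseteq> \<A> \<and>
        quasifold smooth_on (complex_quotient \<Delta> X lam Q) \<B> \<and> \<H> \<subseteq> \<B> \<longrightarrow>
        quasifold_diffeo (symplectic_quotient X lam Q) \<A> (complex_quotient \<Delta> X lam Q) \<B>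
          (chi_map X Q)) \<and>
     (\<forall>t\<in>quasitorus Q. \<forall>x\<in>topspace (symplectic_quotient X lam Q).
        chi_map X Q (quasitorus_act X t x) =
        complex_quasitorus_act X (quasitorus_incl t) (chi_map X Q x)) \<and>
     symplectic_form (symplectic_quotient X lam Q) \<G> (\<lambda>c. standard_form) \<and>
     (\<exists>\<eta>. is_pullback_form \<H> \<eta> \<G> (\<lambda>c. standard_form)
            (inv_into (topspace (symplectic_quotient X lam Q)) (chi_map X Q)) \<and>
          kahler_form (complex_quotient \<Delta> X lam Q) \<H> \<eta>)"
proof -
  interpret toric \<Delta> X lam Q "vertex_enums \<Delta> X lam :: ('n \<Rightarrow> 'd) set"
    by unfold_locales (use assms in auto)
  show ?thesis
    unfolding assms(8,9) symplectic_charts_eq complex_charts_eq symplectic_quotient_eq complex_quotient_eq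
    using symp.quasifold_atlas_slice_charts cplx.quasifold_atlas_slice_charts quasifold_diffeo_chi_map
      chi_map_equivariant symplectic_form_standard_form is_pullback_form_induced_chart_form
      kahler_form_induced_chart_form
    by blast
qed

end
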